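(* Let $G$ be a separable topological group and let $\{K_\alpha\}_{\alpha\in\mathcal A}$, $K_\alpha\subset K\subset G$, be an $\mathcal M$-family of subgroups. Let $\sigma$ be an action of $G$ by nonsingular transformations $\sigma(g)$ of a Lebesgue probability space $(Z,\zeta)$, and suppose that $K$ acts by measure preserving transformations. For $\alpha,\beta\in\mathcal A$ and $g\in G$ define $$\mathcal S_{\alpha,\beta}(g)=\mathfrak l_\alpha^\star\diamond\sigma(g)\diamond\mathfrak l_\beta\in \mathrm{Pol}(Z_\alpha,Z_\beta).$$ Then $\mathcal S$ (with $\alpha\mapsto Z_\alpha$ on objects) is a functor from the train $\mathrm{Tr}(G,\{K_\alpha\}_{\alpha\in\mathcal A})$ to the category of polymorphisms (in which an element of $\mathrm{Pol}(X,Y)$ is regarded as a morphism from the object $Y$ to the object $X$, the composite of $\mathfrak p\in \mathrm{Pol}(X,Y)$ and $\mathfrak q\in\mathrm{Pol}(Y,W)$ being $\mathfrak p\diamond\mathfrak q\in\mathrm{Pol}(X,W)$). Namely, $\mathcal S_{\alpha,\beta}(g)$ depends only on the reduced double coset in $[K_\alpha\backslash G/K_\beta]$ containing $g$, and for all $\alpha,\beta,\gamma\in\mathcal A$ and all $\mathfrak g\in[K_\alpha\backslash G/K_\beta]$, $\mathfrak h\in[K_\beta\backslash G/K_\gamma]$, $$\mathcal S_{\alpha,\beta}(\mathfrak g)\diamond\mathcal S_{\beta,\gamma}(\mathfrak h)=\mathcal S_{\alpha,\gamma}(\mathfrak g\circledcirc\mathfrak h).$$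
   Context: **Polymorphisms.** $\mathbb R^\times$ denotes the multiplicative group of positive reals, with coordinate $t$. All measure spaces are Lebesgue spaces (equivalent to an interval together with at most countably many atoms of nonzero measure). For Lebesgue probability spaces $(X,\xi)$, $(Y,\upsilon)$, a polymorphism from $X$ to $Y$ is a measure $\mathfrak p$ on $X\times Y\times\mathbb R^\times$ such that the pushforward of $\mathfrak p$ to $X$ is $\xi$ and the pushforward of $t\cdot\mathfrak p$ to $Y$ is $\upsilon$. The set of these is $\mathrm{Pol}(X,Y)$. A sequence $\mathfrak p_j$ converges to $\mathfrak p$ in $\mathrm{Pol}(X,Y)$ if for all measurable $A\subset X$, $B\subset Y$ the pushforwards to $\mathbb R^\times$ of the restrictions to $A\times B\times\mathbb R^\times$ of $\mathfrak p_j$ and of $t\cdot\mathfrak p_j$ converge weakly (against bounded continuous functions on $\mathbb R^\times$) to the corresponding pushforwards for $\mathfrak p$ and $t\cdot \mathfrak p$. **Product.** Let $\mathfrak M^\triangledown$ be the set of finite positive Borel measures $s$ on $\mathbb R^\times$ with $\int t\,ds(t)<\infty$; it is a semigroup under the convolution $*$ on the group $\mathbb R^\times$. A polymorphism $\mathfrak s\in\mathrm{Pol}(X,Y)$ is continuous if there is a measurable function $(x,y)\mapsto s_{x,y}\in\mathfrak M^\triangledown$ with $\mathfrak s(A\times B\times C)=\int_{A\times B}s_{x,y}(C)\,d\xi(x)\,d\upsilon(y)$. If continuous $\mathfrak u\in\mathrm{Pol}(X,Y)$, $\mathfrak v\in\mathrm{Pol}(Y,W)$ are given by $u_{x,y}$,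 $v_{y,w}$, their product is the continuous polymorphism in $\mathrm{Pol}(X,W)$ given by $\int_Y u_{x,y}*v_{y,w}\,d\upsilon(y)$. Continuous polymorphisms are dense, and this product extends uniquely to a separately continuous, associative product $\mathrm{Pol}(X,Y)\times\mathrm{Pol}(Y,W)\to\mathrm{Pol}(X,W)$. Here products are written from left to right: $\mathfrak u\diamond\mathfrak v\in\mathrm{Pol}(X,W)$ means "first $\mathfrak u$, then $\mathfrak v$". The category of polymorphisms has Lebesgue probability spaces as objects, polymorphisms as morphisms, and this product as composition. **Nonsingular transformations.** A transformation $q$ of $(Z,\zeta)$ is nonsingular if $q$ and $q^{-1}$ send null sets to null sets; its Radon–Nikodym derivative $q'$ is defined by $\zeta(q(A))=\int_A q'(z)\,d\zeta(z)$. The group $\mathrm{Gms}(Z)$ of nonsingular transformations (up to null sets) has the product $q_1\diamond q_2=q_2(q_1(\cdot))$ and is embedded in $\mathrm{Pol}(Z,Z)$ by sending $q$ to the pushforward of $\zeta$ under $z\mapsto(z,q(z),q'(z))$. An action of $G$ by nonsingular transformations is a continuous homomorphism $\sigma:G\to\mathrm{Gms}(Z)$ (so $\sigma(gh)=\sigma(g)\diamond\sigma(h)$), where $\mathrm{Gms}(Z)$ carries the topology induced from $\mathrm{Pol}(Z,Z)$. **Reduced double cosets, $\mathcal M$-families, trains.** Unitary representations $\rho$ of $G$ are (continuous) representations in separable Hilbert spaces $H$. For a closed subgroup $L\subset G$, $H^L$ is the subspace of $L$-fixed vectors and $P^L$ the orthogonal projection onto it. For closed subgroups $L,M\subset G$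 let $\widehat\rho_{L,M}(g)=P^L\rho(g)|_{H^M}:H^M\to H^L$; it depends only on the double coset $LgM$. The set $[L\backslash G/M]$ of reduced double cosets is the quotient of $G$ by the equivalence: $g\sim g'$ iff $\widehat\rho_{L,M}(g)=\widehat\rho_{L,M}(g')$ for all unitary representations $\rho$ of $G$. Let $K\subset G$ be a closed subgroup and let $\{K_\alpha\}_{\alpha\in\mathcal A}$ be a family of closed subgroups of $K$ such that for any $\alpha,\alpha'$ there is $\alpha''$ with $K_{\alpha''}\subset K_\alpha\cap K_{\alpha'}$; the family includes $K=K_0$. Write $\widehat\rho_{\alpha,\beta}=\widehat\rho_{K_\alpha,K_\beta}$. The family is an $\mathcal M$-family if for all $\alpha,\beta,\gamma\in\mathcal A$, $\mathfrak g\in[K_\alpha\backslash G/K_\beta]$, $\mathfrak h\in[K_\beta\backslash G/K_\gamma]$ there is an element $\mathfrak g\circledcirc\mathfrak h\in[K_\alpha\backslash G/K_\gamma]$ such that $\widehat\rho_{\alpha,\beta}(\mathfrak g)\,\widehat\rho_{\beta,\gamma}(\mathfrak h)=\widehat\rho_{\alpha,\gamma}(\mathfrak g\circledcirc\mathfrak h)$ for every unitary representation $\rho$ of $G$ (this element is unique and $\circledcirc$ is associative). The train $\mathrm{Tr}(G,\{K_\alpha\})$ is the category with objects $\alpha\in\mathcal A$, morphisms $\mathrm{Mor}(\beta,\alpha)=[K_\alpha\backslash G/K_\beta]$, and composition $\circledcirc$. **Quotients $Z_\alpha$ and polymorphisms $\mathfrak l_\alpha$.** A measurable $A\subset Z$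 is $K_\alpha$-invariant if $A\bigtriangleup \sigma(h)(A)$ is null for every $h\in K_\alpha$. Let $\Sigma_\alpha$ be the $\sigma$-algebra of $K_\alpha$-invariant sets. $(Z_\alpha,\zeta_\alpha)$ is the Lebesgue probability space that is the quotient of $(Z,\zeta)$ by the measurable partition corresponding to $\Sigma_\alpha$: there is a canonical measurable map $\pi_\alpha:Z\to Z_\alpha$ pushing $\zeta$ to $\zeta_\alpha$, and the preimages under $\pi_\alpha$ of measurable sets in $Z_\alpha$ form, modulo null sets, exactly $\Sigma_\alpha$. The polymorphism $\mathfrak l_\alpha\in\mathrm{Pol}(Z,Z_\alpha)$ is the pushforward of $\zeta$ under $z\mapsto(z,\pi_\alpha(z),1)$, and $\mathfrak l_\alpha^\star\in\mathrm{Pol}(Z_\alpha,Z)$ is the pushforward of $\zeta$ under $z\mapsto(\pi_\alpha(z),z,1)$. *)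

theory Defs
  imports "HOL-Probability.Probability" "HOL-Algebra.Module"
begin

text \<open>
  Rokhlin's convention: Lebesgue spaces are complete, and up to null sets they consist of
  countably many points of positive mass (the set \<open>S\<close>) and an interval \<open>[0,c]\<close> with Lebesgue measure
  (for \<open>c = 0\<close> the interval is null, and the space is purely atomic).
\<close>

definition lebesgue_prob_space :: "'x measure \<Rightarrow> bool" where
  "lebesgue_prob_space M \<longleftrightarrow> prob_space M \<and> complete_measure M \<and>
     (\<exists>S (c::real) N N' f. countable S \<and> S \<subseteq> space M \<and>
        (\<forall>a\<in>S. {a} \<in> sets M \<and> emeasure M {a} > 0) \<and> 0 \<le> c \<and>
        N \<in> null_sets M \<and> N' \<in> null_sets lebesgue \<and>
        bij_betw f (space M - S - N) ({0..c} - N') \<and>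
        (\<forall>A. A \<subseteq> space M - S - N \<longrightarrow>
           (A \<in> sets M \<longleftrightarrow> f ` A \<in> sets lebesgue) \<and>
           (A \<in> sets M \<longrightarrow> emeasure M A = emeasure lebesgue (f ` A))))"

definition rpos :: "real measure" where
  "rpos = restrict_space borel {0<..}"

definition t_times :: "('x \<times> 'y \<times> real) measure \<Rightarrow> ('x \<times> 'y \<times> real) measure" where
  "t_times p = density p (\<lambda>(x, y, t). ennreal t)"

definition Pol :: "'x measure \<Rightarrow> 'y measure \<Rightarrow> ('x \<times> 'y \<times> real) measure set" where
  "Pol X Y = {p. sets p = sets (X \<Otimes>\<^sub>M (Y \<Otimes>\<^sub>M rpos)) \<and>
                 distr p X (\<lambda>(x, y, t). x) = X \<and>
                 distr (t_times p) Y (\<lambda>(x, y, t). y) = Y}"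

definition rpos_pushforward ::
    "'x set \<Rightarrow> 'y set \<Rightarrow> ('x \<times> 'y \<times> real) measure \<Rightarrow> real measure" where
  "rpos_pushforward A B p =
     distr (density p (indicator (A \<times> B \<times> {0<..}))) rpos (\<lambda>(x, y, t). t)"

definition pol_tests ::
    "'x measure \<Rightarrow> 'y measure \<Rightarrow> (('x \<times> 'y \<times> real) measure \<Rightarrow> real) set" where
  "pol_tests X Y =
     (\<Union>A\<in>sets X. \<Union>B\<in>sets Y. \<Union>\<phi>\<in>{\<phi>::real \<Rightarrow> real. continuous_on {0<..} \<phi> \<and> bounded (\<phi> ` {0<..})}.
        {\<lambda>p. integral\<^sup>L (rpos_pushforward A B p) \<phi>,
         \<lambda>p. integral\<^sup>L (rpos_pushforward A B (t_times p)) \<phi>})"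

text \<open>
  The coarsest topology for which all the test functionals are continuous.  A sequence converges in
  it iff all pushforwards in question converge weakly.
\<close>

definition pol_topology ::
    "'x measure \<Rightarrow> 'y measure \<Rightarrow> ('x \<times> 'y \<times> real) measure topology" where
  "pol_topology X Y =
     topology_generated_by {{p \<in> Pol X Y. F p \<in> U} | F U. F \<in> pol_tests X Y \<and> open U}"

definition pol_id :: "'x measure \<Rightarrow> ('x \<times> 'x \<times> real) measure" where
  "pol_id X = distr X (X \<Otimes>\<^sub>M (X \<Otimes>\<^sub>M rpos)) (\<lambda>x. (x, x, 1))"

definition M_tri :: "real measure set" where
  "M_tri = {s. sets s = sets rpos \<and> finite_measure s \<and> (\<integral>\<^sup>+t. ennreal t \<partial>s) < \<infinity>}"

definition mult_convolution :: "real measure \<Rightarrow> real measure \<Rightarrow> real measure" where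
  "mult_convolution s s' = distr (s \<Otimes>\<^sub>M s') rpos (\<lambda>(t, t'). t * t')"

definition M_tri_kernel ::
    "'x measure \<Rightarrow> 'y measure \<Rightarrow> ('x \<Rightarrow> 'y \<Rightarrow> real measure) \<Rightarrow> bool" where
  "M_tri_kernel X Y s \<longleftrightarrow>
     (\<forall>x\<in>space X. \<forall>y\<in>space Y. s x y \<in> M_tri) \<and>
     (\<forall>C\<in>sets rpos. (\<lambda>(x, y). emeasure (s x y) C) \<in> borel_measurable (X \<Otimes>\<^sub>M Y))"

definition given_by ::
    "'x measure \<Rightarrow> 'y measure \<Rightarrow> ('x \<times> 'y \<times> real) measure \<Rightarrow> ('x \<Rightarrow> 'y \<Rightarrow> real measure) \<Rightarrow> bool"
  where
  "given_by X Y p s \<longleftrightarrow>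
     (\<forall>A\<in>sets X. \<forall>B\<in>sets Y. \<forall>C\<in>sets rpos.
        emeasure p (A \<times> B \<times> C) =
          (\<integral>\<^sup>+(x, y). emeasure (s x y) C * indicator (A \<times> B) (x, y) \<partial>(X \<Otimes>\<^sub>M Y)))"

text \<open>
  The measure \<open>\<integral>\<^sub>Y u\<^sub>x\<^sub>y * v\<^sub>y\<^sub>w d\<upsilon>(y)\<close>; it need only lie in \<^const>\<open>M_tri\<close> for almost all \<open>(x,w)\<close>, so
  the product below is characterised by \<^const>\<open>given_by\<close> without \<^const>\<open>M_tri_kernel\<close>.
\<close>

definition kernel_product ::
    "'y measure \<Rightarrow> ('x \<Rightarrow> 'y \<Rightarrow> real measure) \<Rightarrow> ('y \<Rightarrow> 'w \<Rightarrow> real measure) \<Rightarrow>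
      'x \<Rightarrow> 'w \<Rightarrow> real measure" where
  "kernel_product Y u v x w =
     measure_of (space rpos) (sets rpos)
       (\<lambda>C. \<integral>\<^sup>+y. emeasure (mult_convolution (u x y) (v y w)) C \<partial>Y)"

definition is_pol_product ::
    "'x measure \<Rightarrow> 'y measure \<Rightarrow> 'w measure \<Rightarrow>
      (('x \<times> 'y \<times> real) measure \<Rightarrow> ('y \<times> 'w \<times> real) measure \<Rightarrow> ('x \<times> 'w \<times> real) measure) \<Rightarrow> bool"
  where
  "is_pol_product X Y W P \<longleftrightarrow>
     (\<forall>p\<in>Pol X Y. \<forall>q\<in>Pol Y W. P p q \<in> Pol X W) \<and>
     (\<forall>p\<in>Pol X Y. \<forall>q\<in>Pol Y W. \<forall>u v.
        M_tri_kernel X Y u \<and> given_by X Y p u \<and> M_tri_kernel Y W v \<and> given_by Y W q v \<longrightarrow>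
        given_by X W (P p q) (kernel_product Y u v)) \<and>
     (\<forall>q\<in>Pol Y W. continuous_map (pol_topology X Y) (pol_topology X W) (\<lambda>p. P p q)) \<and>
     (\<forall>p\<in>Pol X Y. continuous_map (pol_topology Y W) (pol_topology X W) (\<lambda>q. P p q))"

text \<open>
  The values of such a \<open>P\<close> on \<open>Pol X Y \<times> Pol Y W\<close> are unique, because the polymorphisms given by
  kernels are dense; outside of this set they are irrelevant.
\<close>

definition pol_product ::
    "'x measure \<Rightarrow> 'y measure \<Rightarrow> 'w measure \<Rightarrow>
      ('x \<times> 'y \<times> real) measure \<Rightarrow> ('y \<times> 'w \<times> real) measure \<Rightarrow> ('x \<times> 'w \<times> real) measure" where
  "pol_product X Y W = (SOME P. is_pol_product X Y W P)"

text \<open>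
  Elements of \<open>Gms(Z)\<close> are represented by bijections of the space; on a Lebesgue space every
  nonsingular bijection between two conull sets agrees almost everywhere with such a bijection.
\<close>

definition nonsingular :: "'z measure \<Rightarrow> ('z \<Rightarrow> 'z) \<Rightarrow> bool" where
  "nonsingular Z q \<longleftrightarrow> bij_betw q (space Z) (space Z) \<and>
     (\<forall>A. A \<subseteq> space Z \<longrightarrow> (q ` A \<in> sets Z \<longleftrightarrow> A \<in> sets Z) \<and>
                           (q ` A \<in> null_sets Z \<longleftrightarrow> A \<in> null_sets Z))"

text \<open>Unlike the library's \<^const>\<open>RN_deriv\<close>, this version is finite and positive everywhere.\<close>

definition ns_deriv :: "'z measure \<Rightarrow> ('z \<Rightarrow> 'z) \<Rightarrow> 'z \<Rightarrow> real" where
  "ns_deriv Z q = (SOME f. f \<in> Z \<rightarrow>\<^sub>M rpos \<and>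
     (\<forall>A\<in>sets Z. emeasure Z (q ` A) = (\<integral>\<^sup>+z. ennreal (f z) * indicator A z \<partial>Z)))"

definition transf_pol :: "'z measure \<Rightarrow> ('z \<Rightarrow> 'z) \<Rightarrow> ('z \<times> 'z \<times> real) measure" where
  "transf_pol Z q = distr Z (Z \<Otimes>\<^sub>M (Z \<Otimes>\<^sub>M rpos)) (\<lambda>z. (z, q z, ns_deriv Z q z))"

definition topological_group :: "('g, 'm) monoid_scheme \<Rightarrow> 'g topology \<Rightarrow> bool" where
  "topological_group G T \<longleftrightarrow> group G \<and> topspace T = carrier G \<and>
     continuous_map (prod_topology T T) T (\<lambda>(g, h). g \<otimes>\<^bsub>G\<^esub> h) \<and>
     continuous_map T T (\<lambda>g. inv\<^bsub>G\<^esub> g)"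

text \<open>The product in \<open>Gms(Z)\<close> is \<open>q\<^sub>1 \<diamondop> q\<^sub>2 = q\<^sub>2 \<circ> q\<^sub>1\<close>, and it is defined up to null sets.\<close>

definition nonsingular_action ::
    "('g, 'm) monoid_scheme \<Rightarrow> 'g topology \<Rightarrow> 'z measure \<Rightarrow> ('g \<Rightarrow> 'z \<Rightarrow> 'z) \<Rightarrow> bool" where
  "nonsingular_action G T Z \<sigma> \<longleftrightarrow>
     (\<forall>g\<in>carrier G. nonsingular Z (\<sigma> g)) \<and>
     (\<forall>g\<in>carrier G. \<forall>h\<in>carrier G. AE z in Z. \<sigma> (g \<otimes>\<^bsub>G\<^esub> h) z = \<sigma> h (\<sigma> g z)) \<and>
     continuous_map T (pol_topology Z Z) (\<lambda>g. transf_pol Z (\<sigma> g))"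

definition measure_preserving_transf :: "'z measure \<Rightarrow> ('z \<Rightarrow> 'z) \<Rightarrow> bool" where
  "measure_preserving_transf Z q \<longleftrightarrow> q \<in> Z \<rightarrow>\<^sub>M Z \<and> distr Z Z q = Z"

definition complex_ring :: "complex ring" where
  "complex_ring = \<lparr>carrier = UNIV, mult = (*), one = 1, zero = 0, add = (+)\<rparr>"

record 'v hilbert = "(complex, 'v) module" +
  inner_prod :: "'v \<Rightarrow> 'v \<Rightarrow> complex"

text \<open>The distance is made total, as required by the locale \<^locale>\<open>Metric_space\<close>.\<close>

definition hdist :: "'v hilbert \<Rightarrow> 'v \<Rightarrow> 'v \<Rightarrow> real" where
  "hdist H x y = (if x \<in> carrier H \<and> y \<in> carrier H
                  then sqrt (Re (inner_prod H (x \<ominus>\<^bsub>H\<^esub> y) (x \<ominus>\<^bsub>H\<^esub> y))) else 0)"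

abbreviation htopology :: "'v hilbert \<Rightarrow> 'v topology" where
  "htopology H \<equiv> Metric_space.mtopology (carrier H) (hdist H)"

definition separable_hilbert_space :: "'v hilbert \<Rightarrow> bool" where
  "separable_hilbert_space H \<longleftrightarrow> module complex_ring H \<and>
     (\<forall>x\<in>carrier H. \<forall>y\<in>carrier H. inner_prod H y x = cnj (inner_prod H x y)) \<and>
     (\<forall>x\<in>carrier H. \<forall>y\<in>carrier H. \<forall>z\<in>carrier H.
        inner_prod H (x \<oplus>\<^bsub>H\<^esub> y) z = inner_prod H x z + inner_prod H y z) \<and>
     (\<forall>c. \<forall>x\<in>carrier H. \<forall>y\<in>carrier H. inner_prod H (c \<odot>\<^bsub>H\<^esub> x) y = c * inner_prod H x y) \<and>
     (\<forall>x\<in>carrier H. x \<noteq> \<zero>\<^bsub>H\<^esub> \<longrightarrow> Re (inner_prod H x x) > 0) \<and>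
     Metric_space.mcomplete (carrier H) (hdist H) \<and>
     separable_space (htopology H)"

definition unitary_operator :: "'v hilbert \<Rightarrow> ('v \<Rightarrow> 'v) \<Rightarrow> bool" where
  "unitary_operator H U \<longleftrightarrow> bij_betw U (carrier H) (carrier H) \<and>
     (\<forall>x\<in>carrier H. \<forall>y\<in>carrier H. U (x \<oplus>\<^bsub>H\<^esub> y) = U x \<oplus>\<^bsub>H\<^esub> U y) \<and>
     (\<forall>c. \<forall>x\<in>carrier H. U (c \<odot>\<^bsub>H\<^esub> x) = c \<odot>\<^bsub>H\<^esub> U x) \<and>
     (\<forall>x\<in>carrier H. \<forall>y\<in>carrier H. inner_prod H (U x) (U y) = inner_prod H x y)"

definition unitary_rep ::
    "('g, 'm) monoid_scheme \<Rightarrow> 'g topology \<Rightarrow> 'v hilbert \<Rightarrow> ('g \<Rightarrow> 'v \<Rightarrow> 'v) \<Rightarrow> bool" where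
  "unitary_rep G T H \<rho> \<longleftrightarrow> separable_hilbert_space H \<and>
     (\<forall>g\<in>carrier G. unitary_operator H (\<rho> g)) \<and>
     (\<forall>g\<in>carrier G. \<forall>h\<in>carrier G. \<forall>v\<in>carrier H. \<rho> (g \<otimes>\<^bsub>G\<^esub> h) v = \<rho> g (\<rho> h v)) \<and>
     (\<forall>v\<in>carrier H. continuous_map T (htopology H) (\<lambda>g. \<rho> g v))"

definition fixed_vectors :: "'v hilbert \<Rightarrow> ('g \<Rightarrow> 'v \<Rightarrow> 'v) \<Rightarrow> 'g set \<Rightarrow> 'v set" where
  "fixed_vectors H \<rho> L = {v \<in> carrier H. \<forall>h\<in>L. \<rho> h v = v}"

definition orth_proj :: "'v hilbert \<Rightarrow> 'v set \<Rightarrow> 'v \<Rightarrow> 'v" where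
  "orth_proj H W v = (THE w. w \<in> W \<and> (\<forall>u\<in>W. inner_prod H (v \<ominus>\<^bsub>H\<^esub> w) u = 0))"

definition rep_hat ::
    "'v hilbert \<Rightarrow> ('g \<Rightarrow> 'v \<Rightarrow> 'v) \<Rightarrow> 'g set \<Rightarrow> 'g set \<Rightarrow> 'g \<Rightarrow> 'v \<Rightarrow> 'v" where
  "rep_hat H \<rho> L M g = (\<lambda>v\<in>fixed_vectors H \<rho> M. orth_proj H (fixed_vectors H \<rho> L) (\<rho> g v))"

text \<open>
  A separable Hilbert space has at most continuum many elements, hence it is isomorphic to one whose
  carrier is a set of sequences of complex numbers.  So quantifying over the Hilbert spaces with
  carrier in \<^typ>\<open>nat \<Rightarrow> complex\<close> (and arbitrary operations) covers all unitary representations.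
\<close>

definition reduced_rel ::
    "('g, 'm) monoid_scheme \<Rightarrow> 'g topology \<Rightarrow> 'g set \<Rightarrow> 'g set \<Rightarrow> ('g \<times> 'g) set" where
  "reduced_rel G T L M = {(g, g'). g \<in> carrier G \<and> g' \<in> carrier G \<and>
     (\<forall>(H :: (nat \<Rightarrow> complex) hilbert) \<rho>. unitary_rep G T H \<rho> \<longrightarrow>
        rep_hat H \<rho> L M g = rep_hat H \<rho> L M g')}"

definition reduced_double_cosets ::
    "('g, 'm) monoid_scheme \<Rightarrow> 'g topology \<Rightarrow> 'g set \<Rightarrow> 'g set \<Rightarrow> 'g set set" where
  "reduced_double_cosets G T L M = carrier G // reduced_rel G T L M"

text \<open>The value on a class of a function that is constant on it.\<close>

definition on_class :: "('g \<Rightarrow> 'b) \<Rightarrow> 'g set \<Rightarrow> 'b" where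
  "on_class f c = the_elem (f ` c)"

definition is_coset_product ::
    "('g, 'm) monoid_scheme \<Rightarrow> 'g topology \<Rightarrow> 'g set \<Rightarrow> 'g set \<Rightarrow> 'g set \<Rightarrow>
      'g set \<Rightarrow> 'g set \<Rightarrow> 'g set \<Rightarrow> bool" where
  "is_coset_product G T L M N a b c \<longleftrightarrow> c \<in> reduced_double_cosets G T L N \<and>
     (\<forall>(H :: (nat \<Rightarrow> complex) hilbert) \<rho>. unitary_rep G T H \<rho> \<longrightarrow>
        compose (fixed_vectors H \<rho> N)
          (on_class (rep_hat H \<rho> L M) a) (on_class (rep_hat H \<rho> M N) b) =
        on_class (rep_hat H \<rho> L N) c)"

definition coset_product ::
    "('g, 'm) monoid_scheme \<Rightarrow> 'g topology \<Rightarrow> 'g set \<Rightarrow> 'g set \<Rightarrow> 'g set \<Rightarrow>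
      'g set \<Rightarrow> 'g set \<Rightarrow> 'g set" where
  "coset_product G T L M N a b = (THE c. is_coset_product G T L M N a b c)"

definition M_family ::
    "('g, 'm) monoid_scheme \<Rightarrow> 'g topology \<Rightarrow> 'g set \<Rightarrow> 'i set \<Rightarrow> ('i \<Rightarrow> 'g set) \<Rightarrow> bool" where
  "M_family G T K I KK \<longleftrightarrow>
     subgroup K G \<and> closedin T K \<and>
     (\<forall>\<alpha>\<in>I. subgroup (KK \<alpha>) G \<and> closedin T (KK \<alpha>) \<and> KK \<alpha> \<subseteq> K) \<and>
     (\<forall>\<alpha>\<in>I. \<forall>\<alpha>'\<in>I. \<exists>\<alpha>''\<in>I. KK \<alpha>'' \<subseteq> KK \<alpha> \<inter> KK \<alpha>') \<and>
     (\<exists>\<alpha>\<^sub>0\<in>I. KK \<alpha>\<^sub>0 = K) \<and>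
     (\<forall>\<alpha>\<in>I. \<forall>\<beta>\<in>I. \<forall>\<gamma>\<in>I.
        \<forall>a\<in>reduced_double_cosets G T (KK \<alpha>) (KK \<beta>).
        \<forall>b\<in>reduced_double_cosets G T (KK \<beta>) (KK \<gamma>).
          \<exists>c. is_coset_product G T (KK \<alpha>) (KK \<beta>) (KK \<gamma>) a b c)"

definition invariant_sets :: "'z measure \<Rightarrow> ('g \<Rightarrow> 'z \<Rightarrow> 'z) \<Rightarrow> 'g set \<Rightarrow> 'z set set" where
  "invariant_sets Z \<sigma> L = {A \<in> sets Z. \<forall>h\<in>L. sym_diff A (\<sigma> h ` A) \<in> null_sets Z}"

text \<open>
  \<open>Y\<close> together with \<open>\<pi>\<close> is the quotient of \<open>Z\<close> corresponding to the \<open>\<sigma>\<close>-algebra \<open>\<Sigma>\<close> of sets (which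
  contains all null sets); these data are unique up to isomorphism modulo null sets.
\<close>

definition is_quotient :: "'z measure \<Rightarrow> 'z set set \<Rightarrow> 'y measure \<Rightarrow> ('z \<Rightarrow> 'y) \<Rightarrow> bool" where
  "is_quotient Z \<Sigma> Y \<pi> \<longleftrightarrow> lebesgue_prob_space Y \<and> \<pi> \<in> Z \<rightarrow>\<^sub>M Y \<and> distr Z Y \<pi> = Y \<and>
     (\<forall>A\<in>sets Z. A \<in> \<Sigma> \<longleftrightarrow>
        (\<exists>B\<in>sets Y. sym_diff A (\<pi> -` B \<inter> space Z) \<in> null_sets Z))"

definition quot_pol :: "'z measure \<Rightarrow> 'y measure \<Rightarrow> ('z \<Rightarrow> 'y) \<Rightarrow> ('z \<times> 'y \<times> real) measure" where
  "quot_pol Z Y \<pi> = distr Z (Z \<Otimes>\<^sub>M (Y \<Otimes>\<^sub>M rpos)) (\<lambda>z. (z, \<pi> z, 1))"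

definition quot_pol_star :: "'z measure \<Rightarrow> 'y measure \<Rightarrow> ('z \<Rightarrow> 'y) \<Rightarrow> ('y \<times> 'z \<times> real) measure"
  where
  "quot_pol_star Z Y \<pi> = distr Z (Y \<Otimes>\<^sub>M (Z \<Otimes>\<^sub>M rpos)) (\<lambda>z. (\<pi> z, z, 1))"

definition train_map ::
    "'z measure \<Rightarrow> ('g \<Rightarrow> 'z \<Rightarrow> 'z) \<Rightarrow> ('i \<Rightarrow> 'y measure) \<Rightarrow> ('i \<Rightarrow> 'z \<Rightarrow> 'y) \<Rightarrow>
      'i \<Rightarrow> 'i \<Rightarrow> 'g \<Rightarrow> ('y \<times> 'y \<times> real) measure" where
  "train_map Z \<sigma> ZZ \<pi> \<alpha> \<beta> g =
     pol_product (ZZ \<alpha>) Z (ZZ \<beta>)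
       (pol_product (ZZ \<alpha>) Z Z (quot_pol_star Z (ZZ \<alpha>) (\<pi> \<alpha>)) (transf_pol Z (\<sigma> g)))
       (quot_pol Z (ZZ \<beta>) (\<pi> \<beta>))"

end

theory Submission
 imports Defs "HOL-Real_Asymp.Real_Asymp"
begin

abbreviation (input) "nnint == nn_integral"
abbreviation (input) "ind == indicator"
abbreviation (input) "BM == borel_measurable"
abbreviation (input) "em == emeasure"
abbreviation (input) "mid z == fst (snd z)"
abbreviation (input) "thd z == snd (snd z)"
abbreviation (input) prodM (infixr "><" 80) where "M >< N == M \<Otimes>\<^sub>M N"

lemmas B_integrable_add = Bochner_Integration.integrable_add
lemmas B_integrable_bound = Bochner_Integration.integrable_bound
lemmas B_integrable_cong = Bochner_Integration.integrable_cong
lemmas B_integrable_diff = Bochner_Integration.integrable_diff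
lemmas B_integrable_sum = Bochner_Integration.integrable_sum
lemmas B_integral_add = Bochner_Integration.integral_add
lemmas B_integral_cnj = Bochner_Integration.integral_cnj
lemmas B_integral_cong = Bochner_Integration.integral_cong
lemmas B_integral_diff = Bochner_Integration.integral_diff
lemmas B_integral_sum = Bochner_Integration.integral_sum

text \<open>
 For every real \<open>th\<close>, the formula \<open>(T(g) f)(z) = f(\<sigma>(g) z) \<sigma>(g)'(z) powr (1/2 + i th)\<close> defines a unitary
 representation of \<open>G\<close> in \<open>L\<^sup>2(Z)\<close>, and its \<open>K\<^sub>\<alpha>\<close>-fixed vectors are exactly the functions lifted from \<open>Z\<^sub>\<alpha>\<close>.
 The matrix elements of \<open>T(g)\<close> between lifted indicator functions are the integrals of
 \<open>1\<^sub>A(x) 1\<^sub>B(y) t powr (1/2 + i th)\<close> over \<open>\<S>\<^sub>\<alpha>\<^sub>\<beta>(g)\<close>, and by the uniqueness theorem for Fourier transforms they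
 determine \<open>\<S>\<^sub>\<alpha>\<^sub>\<beta>(g)\<close>.  So \<open>\<S>\<close> is constant on reduced double cosets, and it is multiplicative because the
 product of polymorphisms corresponds to the product of the compressed operators.

 That product glues \<open>p\<close> and \<open>q\<close> conditionally independently over \<open>Y\<close> (by a disintegration of \<open>q\<close>, for which \<open>W\<close>
 is a Lebesgue space) and multiplies the coordinates in the group of positive reals.  It is
 separately continuous, and it is the only such extension of the formula for kernels, because
 averaging over finite partitions does not change the mass of the rectangles built from them.
\<close>

text \<open>The exponent 1/2 is what unitarity asks for, and it fits the two marginal conditions: a
  polymorphism between probability spaces integrates both 1 and t to 1, and the square root of t is
  dominated by 1 + t, with tails that are small uniformly in the polymorphism. The phase i th runs
  through the characters of the real line in the variable ln t, so the family of all th recovers a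
  law of t. The obstacle is that the multiplicative group is not compact. The product involves ph(t
  s), which is not compactly supported in (t, s) even if ph is, and mass could run off to 0 or
  infinity. Conservation of the masses of p and of t p prevents this. The two factors enter
  unequally, because only the weighted second marginal of p is the measure of Y. Two further
  constraints shape the constructions. Reduced double cosets test representations on sequences of
  complex numbers, so an L2 function is coded by its integrals over a countable family of sets.
  Densities are taken of nonnegative functions, so signed and complex functions are shifted or split
  before they are projected to Y.\<close>

lemma space_rpos [simp]: "space rpos = {0<..}"
 by (simp add: rpos_def space_restrict_space)

lemma measurable_rpos_id [measurable]: "(%t. t) : BM rpos"
 unfolding rpos_def by (rule measurable_restrict_space1) simp

lemma borel_measurable_rpos: "f : BM borel ==> f : BM rpos"
 unfolding rpos_def by (rule measurable_restrict_space1)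

lemma sets_rpos_borel: "A : sets rpos \<longleftrightarrow> A : sets borel \<and> A \<subseteq> {0<..}"
 unfolding rpos_def by (subst sets_restrict_space_iff) auto

lemma continuous_on_rpos_measurable:
 "continuous_on {0<..} (f :: real => 'b::topological_space) ==> f : BM rpos"
 unfolding rpos_def by (rule borel_measurable_continuous_on_restrict)

lemma measurable_into_rpos:
 assumes "f : BM M" "!!x. x : space M ==> 0 < f x"
 shows "f : M \<rightarrow>\<^sub>M rpos"
 unfolding rpos_def by (rule measurable_restrict_space2) (use assms in auto)

lemma rpos_mult_measurable [measurable (raw)]:
 assumes "f : M \<rightarrow>\<^sub>M rpos" "g : M \<rightarrow>\<^sub>M rpos"
 shows "(%x. f x * g x) : M \<rightarrow>\<^sub>M rpos"
proof (rule measurable_into_rpos)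
 have [measurable]: "f : BM M" "g : BM M"
  using measurable_compose[OF assms(1) measurable_rpos_id]
   measurable_compose[OF assms(2) measurable_rpos_id] by simp_all
 show "(%x. f x * g x) : BM M" by simp
 show "!!x. x : space M ==> 0 < f x * g x"
  using measurable_space[OF assms(1)] measurable_space[OF assms(2)] by simp
qed

lemma rpos_ennreal_times [measurable]: "(%t. ennreal t) : BM rpos"
 by measurable

lemma rpos_one [simp, measurable]: "(%x. 1) : M \<rightarrow>\<^sub>M rpos"
 by (rule measurable_into_rpos) auto

section \<open>Marginals, integrability and test functionals of polymorphisms\<close>

lemma PolI:
 assumes s [measurable_cong]: "sets p = sets (X >< (Y >< rpos))"
  and a: "!!A. A : sets X ==> (nnint p (%z. ind A (fst z))) = em X A"
  and b: "!!B. B : sets Y ==> (nnint p (%z. ennreal (thd z) * ind B (mid z))) = em Y B"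
 shows "p : Pol X Y"
proof -
 let ?D = "distr p X (%z. fst z)" and ?E = "distr (density p (%z. ennreal (thd z))) Y (%z. mid z)"
 have "?D = X"
 proof (rule measure_eqI)
  fix A assume "A : sets ?D"
  then have A [measurable]: "A : sets X" by simp
  have "em ?D A = (nnint ?D (%x. ind A x))" by simp
  also have "... = (nnint p (%z. ind A (fst z)))" by (rule nn_integral_distr) auto
  finally show "em ?D A = em X A" by (simp only: a[OF A])
 qed simp
 moreover have "?E = Y"
 proof (rule measure_eqI)
  fix B assume "B : sets ?E"
  then have B [measurable]: "B : sets Y" by simp
  have "em ?E B = (nnint ?E (%y. ind B y))" by simp
  also have "... = (nnint p (%z. ennreal (thd z) * ind B (mid z)))"
   by (subst nn_integral_distr) (simp_all add: nn_integral_density)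
  finally show "em ?E B = em Y B" by (simp only: b[OF B])
 qed simp
 ultimately show ?thesis using s by (simp add: Pol_def t_times_def split_beta')
qed

context
 fixes X :: "'x measure" and Y :: "'y measure" and p
 assumes p: "p : Pol X Y"
begin

lemma sets_Pol: "sets p = sets (X >< (Y >< rpos))"
 using p by (simp add: Pol_def)

lemma space_Pol: "space p = space X \<times> space Y \<times> {0<..}"
 using sets_eq_imp_space_eq[OF sets_Pol] by (simp add: space_pair_measure)

lemma distr_Pol_fst: "distr p X (%z. fst z) = X"
 using p by (simp add: Pol_def split_beta')

lemma Pol_nn_integral_fst:
 assumes [measurable]: "f : BM X"
 shows "(nnint p (%z. f (fst z))) = (nnint X (%x. f x))"
proof -
 note sets_Pol [measurable_cong]
 have "(nnint X (%x. f x)) = (nnint (distr p X (%z. fst z)) (%x. f x))"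
  by (simp add: distr_Pol_fst)
 also have "... = (nnint p (%z. f (fst z)))"
  by (rule nn_integral_distr) auto
 finally show ?thesis by simp
qed

lemma Pol_nn_integral_snd:
 assumes [measurable]: "f : BM Y"
 shows "(nnint p (%z. ennreal (thd z) * f (mid z))) = (nnint Y (%y. f y))"
proof -
 note sets_Pol [measurable_cong]
 have "distr (density p (%z. ennreal (thd z))) Y (%z. mid z) = Y"
  using p by (simp add: Pol_def split_beta' t_times_def)
 then have "(nnint Y (%y. f y)) =
   (nnint (distr (density p (%z. ennreal (thd z))) Y (%z. mid z)) (%y. f y))"
  by simp
 also have "... = (nnint (density p (%z. ennreal (thd z))) (%z. f (mid z)))"
  by (rule nn_integral_distr) auto
 also have "... = (nnint p (%z. ennreal (thd z) * f (mid z)))"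
  by (rule nn_integral_density) auto
 finally show ?thesis by simp
qed

lemma Pol_AE_fst:
 assumes "AE x in X. P x" shows "AE z in p. P (fst z)"
proof -
 note sets_Pol [measurable_cong]
 have "AE x in distr p X (%z. fst z). P x"
  unfolding distr_Pol_fst by fact
 then show ?thesis
  by (rule AE_distrD[rotated]) auto
qed

text \<open>Only the measure weighted by t projects onto Y. Since t is positive on the whole space,
  a set that is null for the weighted measure is null for p as well.\<close>

lemma Pol_AE_snd:
 assumes "AE y in Y. P y" shows "AE z in p. P (mid z)"
proof -
 note sets_Pol [measurable_cong]
 obtain N where N: "N : null_sets Y" "{y\<in>space Y. \<not> P y} \<subseteq> N"
  using assms by (auto simp: eventually_ae_filter)
 then have [measurable]: "N : sets Y" by auto
 have "(nnint p (%z. ennreal (thd z) * ind N (mid z))) = (nnint Y (%y. ind N y))"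
  by (rule Pol_nn_integral_snd) auto
 also have "... = 0" using N by auto
 finally have "AE z in p. ennreal (thd z) * ind N (mid z) = 0"
  by (subst (asm) nn_integral_0_iff_AE) auto
 then show ?thesis
 proof (rule AE_mp, intro AE_I2 impI)
  fix z assume z: "z : space p" and *: "ennreal (thd z) * ind N (mid z) = (0::ennreal)"
  from z have "thd z > 0" "mid z : space Y" by (auto simp: space_Pol)
  with * have "mid z \<notin> N" by (auto simp: indicator_def ennreal_eq_0_iff)
  with N \<open>fst (snd z) \<in> space Y\<close> show "P (mid z)" by auto
 qed
qed

lemma Pol_prob_space: assumes "prob_space X" shows "prob_space p"
proof
 interpret prob_space X by fact
 have "em p (space p) = (nnint p (%z. 1))" by simp
 also have "... = (nnint X (%x. 1))" using Pol_nn_integral_fst[of "%_. 1"] by simp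
 finally show "em p (space p) = 1" by (simp add: emeasure_space_1)
qed

text \<open>With the total mass 1 this gives 1 + t the integral 2 against every polymorphism. It is
  the majorant behind the later integrability claims.\<close>

lemma Pol_nn_integral_t: assumes "prob_space Y" shows "(nnint p (%z. ennreal (thd z))) = 1"
proof -
 interpret prob_space Y by fact
 show ?thesis using Pol_nn_integral_snd[of "%_. 1"] by (simp add: emeasure_space_1)
qed

lemma Pol_AE_pos: "AE z in p. thd z > 0"
 by (rule AE_I2) (auto simp: space_Pol)

lemma Pol_integrable_t: assumes "prob_space Y" shows "integrable p (%z. thd z)"
proof (rule integrableI_nonneg)
 note sets_Pol [measurable_cong]
 show "(%z. thd z) : BM p" by measurable
 show "AE z in p. 0 <= thd z" using Pol_AE_pos by eventually_elim simp
qed (simp add: Pol_nn_integral_t[OF assms])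

end

lemma Pol_integral_t:
 assumes "p : Pol X Y" "prob_space Y" shows "(LINT z|p. thd z) = 1"
proof -
 note sets_Pol [OF assms(1), measurable_cong]
 have "(LINT z|p. thd z) = enn2real (nnint p (%z. ennreal (thd z)))"
  by (rule integral_eq_nn_integral) (use Pol_AE_pos[OF assms(1)] in \<open>auto elim: eventually_mono\<close>)
 then show ?thesis by (simp add: Pol_nn_integral_t[OF assms])
qed

text \<open>A single integral against p instead of an integral against the pushforward of a
  restricted measure. The tests of \<open>t_times p\<close> become tests of p with t * ph in place
  of ph.\<close>

definition pol_test :: "'x set => 'y set => (real => real) => ('x \<times> 'y \<times> real) measure => real" where
 "pol_test A B ph p = (LINT z|p. ind A (fst z) * ind B (mid z) * ph (thd z))"

lemma integral_rpos_pushforward: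
 assumes s: "sets p = sets (X >< (Y >< rpos))"
  and [measurable]: "A : sets X" "B : sets Y" "ph : BM rpos"
 shows "integral\<^sup>L (rpos_pushforward A B p) ph = pol_test A B ph p"
proof -
 note s [measurable_cong]
 have sp: "space p = space X \<times> space Y \<times> {0<..}"
  using sets_eq_imp_space_eq[OF s] by (simp add: space_pair_measure)
 have "A \<times> B \<times> {0<..} : sets (X >< (Y >< rpos))"
  by (intro pair_measureI) (auto simp: sets_rpos_borel)
 then have [measurable]: "A \<times> B \<times> {0<..} : sets p" by (simp add: s)
 have "integral\<^sup>L (rpos_pushforward A B p) ph =
   (LINT z|(density p (%z. ennreal (ind (A \<times> B \<times> {0<..}) z))). ph (thd z))"
  unfolding rpos_pushforward_def
  by (subst integral_distr) (auto simp: split_beta' ennreal_indicator)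
 also have "... = (LINT z|p. ind (A \<times> B \<times> {0<..}) z *\<^sub>R ph (thd z))"
  by (rule integral_density) auto
 also have "... = pol_test A B ph p"
  unfolding pol_test_def
  by (rule B_integral_cong) (auto simp: sp indicator_def)
 finally show ?thesis .
qed

lemma sets_t_times [simp]: "sets (t_times p) = sets p" by (simp add: t_times_def)

lemma pol_test_t_times:
 assumes s: "sets p = sets (X >< (Y >< rpos))"
  and [measurable]: "A : sets X" "B : sets Y" "ph : BM rpos"
 shows "pol_test A B ph (t_times p) = pol_test A B (%t. t * ph t) p"
proof -
 note s [measurable_cong]
 have sp: "space p = space X \<times> space Y \<times> {0<..}"
  using sets_eq_imp_space_eq[OF s] by (simp add: space_pair_measure)
 have "pol_test A B ph (t_times p) =
   (LINT z|p. thd z *\<^sub>R (ind A (fst z) * ind B (mid z) * ph (thd z)))"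
  unfolding pol_test_def t_times_def split_beta'
  by (rule integral_density) (auto intro!: AE_I2 simp: sp)
 then show ?thesis by (simp add: pol_test_def ac_simps)
qed

section \<open>Uniqueness on rectangles, and densities\<close>

lemma measure_eqI_rectangles:
 assumes M: "sets M = sets (A >< B)" and N: "sets N = sets (A >< B)"
  and fin: "em M (space A \<times> space B) ~= \<infinity>"
  and eq: "!!a b. a : sets A ==> b : sets B ==> em M (a \<times> b) = em N (a \<times> b)"
 shows "M = N"
proof (rule measure_eqI_generator_eq[OF Int_stable_pair_measure_generator[of A B], where \<Omega> = "space A \<times> space B" and A = "%_. space A \<times> space B"])
 show "{a \<times> b |a b. a : sets A \<and> b : sets B} \<subseteq> Pow (space A \<times> space B)"
  by (auto dest: sets.sets_into_space)
 show "sets M = sigma_sets (space A \<times> space B) {a \<times> b |a b. a : sets A \<and> b : sets B}"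
  "sets N = sigma_sets (space A \<times> space B) {a \<times> b |a b. a : sets A \<and> b : sets B}"
  unfolding M N by (rule sets_pair_measure)+
 show "range (%_. space A \<times> space B) \<subseteq> {a \<times> b |a b. a : sets A \<and> b : sets B}" by auto
qed (use fin eq in auto)

lemma density_exists:
 assumes "prob_space Y" and [simp]: "sets N = sets Y" and "!!B. B : null_sets Y ==> em N B = 0"
 obtains k where "k : BM Y" "!!B. B : sets Y ==> em N B = (nnint Y (%y. k y * ind B y))"
proof -
 interpret prob_space Y by fact
 have "absolutely_continuous Y N"
  unfolding absolutely_continuous_def using assms(3) by (auto simp: null_sets_def)
 then obtain k where "k : BM Y" "density Y k = N"
  using Radon_Nikodym[of N] by auto
 then show ?thesis using emeasure_density[of k Y] by (intro that[of k]) auto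
qed

text \<open>What makes the image of F Z absolutely continuous is that null sets of Y pull back to
  null sets. It is this, and not that Z is mapped to Y, which holds for the second coordinate of a
  polymorphism.\<close>

lemma pushforward_density:
 assumes Y: "prob_space Y" and \<pi> [measurable]: "\<pi> : Z \<rightarrow>\<^sub>M Y" and null: "!!P. AE y in Y. P y ==> AE z in Z. P (\<pi> z)"
  and F [measurable]: "F : BM Z"
 obtains k :: "_ => ennreal" where "k : BM Y"
  "!!B. B : sets Y ==> (nnint Z (%z. F z * ind B (\<pi> z))) = (nnint Y (%y. k y * ind B y))"
proof -
 define N where "N = distr (density Z F) Y \<pi>"
 have NB: "em N B = (nnint Z (%z. F z * ind B (\<pi> z)))" if [measurable]: "B : sets Y" for B
 proof -
  have "em N B = (nnint N (%y. ind B y))" using that by (simp add: N_def)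
  also have "... = (nnint Z (%z. F z * ind B (\<pi> z)))"
   unfolding N_def by (subst nn_integral_distr) (auto simp: nn_integral_density)
  finally show ?thesis .
 qed
 have N0: "em N B = 0" if B: "B : null_sets Y" for B
 proof -
  from null[OF AE_not_in[OF B]] have "AE z in Z. F z * ind B (\<pi> z) = 0"
   by eventually_elim simp
  then have "(nnint Z (%z. F z * ind B (\<pi> z))) = (nnint Z (%z. 0))" by (rule nn_integral_cong_AE)
  then show ?thesis using B by (subst NB) auto
 qed
 have sN: "sets N = sets Y" by (simp add: N_def)
 obtain k where "k : BM Y" "!!B. B : sets Y ==> em N B = (nnint Y (%y. k y * ind B y))"
  by (rule density_exists[OF Y sN N0], assumption, rule that)
 with NB show ?thesis by (intro that[of k]) auto
qed

text \<open>On the set A where g < f the difference f - g is positive, yet its integral vanishes.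
  Finiteness of the integral of f permits the subtraction in \<open>ennreal\<close>.\<close>

lemma AE_le_of_set_nn_integral_le:
 fixes f g :: "'a => ennreal"
 assumes [measurable]: "f : BM M" "g : BM M"
  and le: "!!B. B : sets M ==> (nnint M (%x. f x * ind B x)) <= (nnint M (%x. g x * ind B x))"
  and fin: "(nnint M (%x. f x)) < \<infinity>"
 shows "AE x in M. f x <= g x"
proof -
 define A where "A = {x : space M. g x < f x}"
 have [measurable]: "A : sets M" unfolding A_def by measurable
 have gf: "g x * ind A x <= f x * ind A x" for x
  by (auto simp: A_def indicator_def)
 have "(nnint M (%x. f x * ind A x)) <= (nnint M (%x. f x))"
  by (intro nn_integral_mono) (auto simp: indicator_def)
 with fin have finA: "(nnint M (%x. f x * ind A x)) < \<infinity>" by (simp add: le_less_trans)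
 have "(nnint M (%x. g x * ind A x)) <= (nnint M (%x. f x * ind A x))"
  by (intro nn_integral_mono gf)
 with finA have ging: "(nnint M (%x. g x * ind A x)) ~= \<infinity>" by auto
 have "(nnint M (%x. f x * ind A x - g x * ind A x)) =
  (nnint M (%x. f x * ind A x)) - (nnint M (%x. g x * ind A x))"
  by (rule nn_integral_diff) (use ging gf in auto)
 also have "... = 0"
  using le[of A] finA by (simp add: diff_eq_0_iff_ennreal)
 finally have "AE x in M. f x * ind A x - g x * ind A x = 0"
  by (subst (asm) nn_integral_0_iff_AE) auto
 moreover have "AE x in M. f x * ind A x ~= \<infinity>"
  by (rule nn_integral_noteq_infinite) (use finA in auto)
 ultimately show ?thesis
  using AE_space
 proof eventually_elim
  case (elim x)
  show ?case
  proof (rule ccontr)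
   assume "\<not> f x <= g x"
   with elim have "x : A" by (simp add: A_def)
   with elim \<open>\<not> f x <= g x\<close> show False by (auto simp: diff_eq_0_iff_ennreal less_top)
  qed
 qed
qed

section \<open>Kernels of finite measures and disintegration over the real line\<close>

text \<open>Finite rather than subprobability measures, since the kernels with values in
  \<open>M_tri\<close> may have any finite mass.\<close>

definition fin_kernel :: "'a measure => 'b measure => ('a => 'b measure) => bool" where
 "fin_kernel M N kp \<longleftrightarrow> (\<forall>z\<in>space M. sets (kp z) = sets N \<and> finite_measure (kp z)) \<and>
   (\<forall>C\<in>sets N. (%z. em (kp z) C) : BM M)"

lemma nn_integral_fin_kernel:
 assumes kp: "fin_kernel M N kp" and ne: "space N ~= {}"
  and f: "(%(z, s). f z s) : BM (M >< N)"
 shows "(%z. nnint (kp z) (%s. f z s)) : BM M"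
proof -
 have s: "sets (kp z) = sets N" "finite_measure (kp z)" "space (kp z) = space N" if "z : space M" for z
  using kp that sets_eq_imp_space_eq[of "kp z" N] by (auto simp: fin_kernel_def)
 have m [measurable]: "(%z. em (kp z) C) : BM M" if "C : sets N" for C
  using kp that by (auto simp: fin_kernel_def)
 define c where "c z = em (kp z) (space N)" for z
 have [measurable]: "c : BM M" unfolding c_def by (rule m) simp
 have cfin: "c z ~= \<infinity>" if "z : space M" for z
  using finite_measure.emeasure_finite[OF s(2)[OF that]] by (simp add: c_def)
 have inv1: "inverse x * x <= 1" if "x ~= \<infinity>" for x :: ennreal
 proof (cases "x = 0")
  case False
  then have "x * inverse x = 1" using that
   by (simp add: ennreal_divide_self less_top flip: divide_ennreal_def)
  then show ?thesis by (simp add: mult.commute)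
 qed simp
 \<comment> \<open>Normalising reduces the claim to subprobability kernels. Where c z = 0 the scale
   is infinite, but it multiplies the zero measure.\<close>
 define L where "L z = scale_measure (inverse (c z)) (kp z)" for z
 have L: "L : M \<rightarrow>\<^sub>M subprob_algebra N"
 proof (rule measurable_subprob_algebra)
  fix z assume z: "z : space M"
  show "subprob_space (L z)"
  proof
   show "em (L z) (space (L z)) <= 1"
    using inv1[OF cfin[OF z]] s[OF z] unfolding L_def
    by (simp add: space_scale_measure c_def)
   show "space (L z) ~= {}" using ne s[OF z] by (simp add: L_def space_scale_measure)
  qed
  show "sets (L z) = sets N" using s[OF z] by (simp add: L_def)
 next
  show "(%z. em (L z) A) : BM M" if "A : sets N" for A
   unfolding L_def using that by simp
 qed
 have "(%z. c z * (nnint (L z) (%s. f z s))) : BM M"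
  by (intro borel_measurable_times_ennreal nn_integral_measurable_subprob_algebra2[OF f L]) auto
 moreover have "c z * (nnint (L z) (%s. f z s)) = (nnint (kp z) (%s. f z s))" if z: "z : space M" for z
 proof -
  have "(%s. f z s) : BM N"
   using measurable_Pair2[OF f z] by simp
  then have fm: "(%s. f z s) : BM (kp z)"
   using s[OF z] by (simp cong: measurable_cong_sets)
  have e: "(nnint (L z) (%s. f z s)) = inverse (c z) * (nnint (kp z) (%s. f z s))"
   unfolding L_def by (rule nn_integral_scale_measure[OF fm])
  show ?thesis
  proof (cases "c z = 0")
   case True
   then have "em (kp z) (space (kp z)) = 0" using s[OF z] by (simp add: c_def)
   then have "AE s in kp z. f z s = 0"
    by (intro AE_I[of _ _ "space (kp z)"]) auto
   then have "(nnint (kp z) (%s. f z s)) = 0"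
    using fm by (simp add: nn_integral_0_iff_AE)
   then show ?thesis by (simp add: True)
  next
   case False
   then have "c z * inverse (c z) = 1" using cfin[OF z]
    by (simp add: ennreal_divide_self less_top flip: divide_ennreal_def)
   then show ?thesis unfolding e by (simp add: mult.assoc[symmetric])
  qed
 qed
 ultimately show ?thesis by (simp cong: measurable_cong)
qed

definition semidirect :: "'a measure => 'b measure => ('a => 'b measure) => ('a \<times> 'b) measure" where
 "semidirect M N kp = measure_of (space M \<times> space N) (sets (M >< N))
   (%E. nnint M (%z. nnint (kp z) (%s. ind E (z, s))))"

lemma sets_semidirect [simp, measurable_cong]: "sets (semidirect M N kp) = sets (M >< N)"
 unfolding semidirect_def space_pair_measure[symmetric] by (rule sets.sets_measure_of_eq)

lemma space_semidirect [simp]: "space (semidirect M N kp) = space M \<times> space N"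
 using sets_eq_imp_space_eq[OF sets_semidirect[of M N kp]] by (simp add: space_pair_measure)

lemma emeasure_semidirect:
 assumes kp: "fin_kernel M N kp" and ne: "space N ~= {}" and E: "E : sets (M >< N)"
 shows "em (semidirect M N kp) E = (nnint M (%z. nnint (kp z) (%s. ind E (z, s))))"
proof (rule emeasure_measure_of[OF semidirect_def])
 let ?\<mu> = "%E. nnint M (%z. nnint (kp z) (%s. ind E (z, s)))"
 have s: "sets (kp z) = sets N" if "z : space M" for z
  using kp that by (auto simp: fin_kernel_def)
 show "sets (M >< N) \<subseteq> Pow (space M \<times> space N)"
  using sets.space_closed[of "M >< N"] by (simp add: space_pair_measure)
 show "positive (sets (semidirect M N kp)) ?\<mu>" by (simp add: positive_def)
 show "E : sets (semidirect M N kp)" using E by simp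
 show "countably_additive (sets (semidirect M N kp)) ?\<mu>"
 proof (rule countably_additiveI)
  fix A :: "nat => ('a \<times> 'b) set"
  assume A: "range A \<subseteq> sets (semidirect M N kp)" "disjoint_family A"
  then have [measurable]: "A i : sets (M >< N)" for i by auto
  have "(\<Sum>i. ?\<mu> (A i)) = (nnint M (%z. (\<Sum>i. nnint (kp z) (%s. ind (A i) (z, s)))))"
   by (rule nn_integral_suminf[symmetric]) (intro nn_integral_fin_kernel[OF kp ne], measurable)
  also have "... = (nnint M (%z. nnint (kp z) (%s. (\<Sum>i. ind (A i) (z, s)))))"
  proof (rule nn_integral_cong)
   fix z assume z: "z : space M"
   note s[OF z, measurable_cong]
   have [measurable]: "(%s. ind (A i) (z, s) :: ennreal) : BM (kp z)" for i
    using z by measurable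
   show "(\<Sum>i. nnint (kp z) (%s. ind (A i) (z, s))) = (nnint (kp z) (%s. (\<Sum>i. ind (A i) (z, s))))"
    by (rule nn_integral_suminf[symmetric]) measurable
  qed
  also have "... = ?\<mu> (\<Union>i. A i)"
   by (simp add: suminf_indicator[OF A(2)])
  finally show "(\<Sum>i. ?\<mu> (A i)) = ?\<mu> (\<Union>i. A i)" .
 qed
qed

lemma nn_integral_semidirect:
 assumes kp: "fin_kernel M N kp" and ne: "space N ~= {}"
  and f: "f : BM (M >< N)"
 shows "(nnint (semidirect M N kp) (%e. f e)) = (nnint M (%z. nnint (kp z) (%s. f (z, s))))"
 using f
proof (induction f rule: borel_measurable_induct)
 have s: "sets (kp z) = sets N" if "z : space M" for z
  using kp that by (auto simp: fin_kernel_def)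
 have meas: "(%s. u (z, s)) : BM (kp z)" if "z : space M" "u : BM (M >< N)" for z and u :: "_ => ennreal"
  using measurable_Pair2[OF that(2,1)] s[OF that(1)] by (simp cong: measurable_cong_sets)
 have meas2: "(%z. nnint (kp z) (%s. u (z, s))) : BM M" if "u : BM (M >< N)" for u :: "_ => ennreal"
  by (rule nn_integral_fin_kernel[OF kp ne]) (use that in simp)
 {
  case (cong f g)
  have "(nnint (semidirect M N kp) (%e. f e)) = (nnint (semidirect M N kp) (%e. g e))"
   by (intro nn_integral_cong) (use cong in \<open>auto simp: space_pair_measure\<close>)
  moreover have "(nnint M (%z. nnint (kp z) (%s. f (z, s)))) = (nnint M (%z. nnint (kp z) (%s. g (z, s))))"
   by (intro nn_integral_cong) (use cong sets_eq_imp_space_eq[OF s] in \<open>auto simp: space_pair_measure\<close>)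
  ultimately show ?case using cong by simp
 next
  case (set E)
  then show ?case using emeasure_semidirect[OF kp ne, of E] by (subst nn_integral_indicator) auto
 next
  case (mult u c)
  have "(nnint M (%z. nnint (kp z) (%s. c * u (z, s)))) = (nnint M (%z. c * (nnint (kp z) (%s. u (z, s)))))"
   by (intro nn_integral_cong nn_integral_cmult meas mult)
  also have "... = c * (nnint M (%z. (nnint (kp z) (%s. u (z, s)))))"
   by (intro nn_integral_cmult meas2 mult)
  finally show ?case using mult by (simp add: nn_integral_cmult cong: measurable_cong_sets)
 next
  case (add u v)
  have "(nnint M (%z. nnint (kp z) (%s. v (z, s) + u (z, s)))) = (nnint M (%z. (nnint (kp z) (%s. v (z, s))) + (nnint (kp z) (%s. u (z, s)))))"
   by (intro nn_integral_cong nn_integral_add meas add)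
  also have "... = (nnint M (%z. (nnint (kp z) (%s. v (z, s))))) + (nnint M (%z. (nnint (kp z) (%s. u (z, s)))))"
   by (intro nn_integral_add meas2 add)
  finally show ?case using add by (simp add: nn_integral_add cong: measurable_cong_sets)
 next
  case (seq U)
  have "(nnint M (%z. nnint (kp z) (%s. (SUP i. U i) (z, s)))) = (nnint M (%z. nnint (kp z) (%s. (SUP i. U i (z, s)))))"
   by (simp only: SUP_apply)
  also have "... = (nnint M (%z. (SUP i. nnint (kp z) (%s. U i (z, s)))))"
   using \<open>incseq U\<close> by (intro nn_integral_cong nn_integral_monotone_convergence_SUP meas seq) (auto simp: incseq_def le_fun_def)
  also have "... = (SUP i. nnint M (%z. nnint (kp z) (%s. U i (z, s))))"
   using \<open>incseq U\<close> by (intro nn_integral_monotone_convergence_SUP meas2 seq) (auto simp: incseq_def le_fun_def intro!: nn_integral_mono)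
  also have "... = (SUP i. nnint (semidirect M N kp) (%e. U i e))" using seq by simp
  also have "... = (nnint (semidirect M N kp) (%e. (SUP i. U i e)))"
   using seq by (intro nn_integral_monotone_convergence_SUP[symmetric]) (auto cong: measurable_cong_sets)
  finally show ?case by (simp only: SUP_apply)
 }
qed

text \<open>Rationals chosen from (x, x + 1/(n+1)) converge but need not decrease; their running
  minima do both. Such sequences carry identities from rational to real end points by continuity
  from above.\<close>

lemma rational_sequence_from_above:
 fixes x :: real
 obtains Q :: "nat => rat" where "!!n. x < of_rat (Q n)" "decseq Q" "(%n. real_of_rat (Q n)) \<longlonglongrightarrow> x"
proof -
 have "\<exists>q. x < of_rat q \<and> of_rat q < x + 1 / real (Suc n)" for n
  by (rule of_rat_dense) simp
 then obtain g where g: "!!n. x < of_rat (g n)" "!!n. of_rat (g n) < x + 1 / real (Suc n)" by metis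
 define Q where "Q n = Min (g ` {..n})" for n
 have 1: "x < of_rat (Q n)" for n
 proof -
  have "Q n : g ` {..n}" unfolding Q_def by (rule Min_in) auto
  then show ?thesis using g(1) by auto
 qed
 have 2: "decseq Q" unfolding decseq_def Q_def by (auto intro!: Min_antimono)
 have 3: "(%n. real_of_rat (Q n)) \<longlonglongrightarrow> x"
 proof (rule tendsto_sandwich)
  show "\<forall>\<^sub>F n in sequentially. x <= of_rat (Q n)" using 1 by (auto intro!: always_eventually less_imp_le)
  show "\<forall>\<^sub>F n in sequentially. of_rat (Q n) <= x + 1 / real (Suc n)"
  proof (intro always_eventually allI)
   fix n have "Q n <= g n" unfolding Q_def by (rule Min_le) auto
   then show "of_rat (Q n) <= x + 1 / real (Suc n)"
    using g(2)[of n] by (meson less_imp_le of_rat_less_eq order.trans)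
  qed
  have "(%n. 1 / real (Suc n)) \<longlonglongrightarrow> 0" by (rule LIMSEQ_Suc[OF lim_1_over_n])
  from tendsto_add[OF tendsto_const this] show "(%n. x + 1 / real (Suc n)) \<longlonglongrightarrow> x" by simp
 qed auto
 show ?thesis using 1 2 3 by (rule that)
qed

text \<open>Regular conditional laws by way of distribution functions. The densities in y of the
  half-lines with rational end points satisfy the laws of a distribution function outside one null
  set, and right continuous regularisation turns them into honest ones.\<close>

lemma disintegration_real:
 fixes M :: "('y \<times> real) measure"
 assumes sM: "sets M = sets (Y >< borel)" and Y: "prob_space Y" and marg: "distr M Y fst = Y"
 obtains kp where "fin_kernel Y borel kp" "M = semidirect Y borel kp"
proof -
 interpret Y: prob_space Y by fact
 note sM [measurable_cong]
 have spM: "space M = space Y \<times> UNIV" using sets_eq_imp_space_eq[OF sM] by (simp add: space_pair_measure)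
 have margB: "em M (B \<times> UNIV) = em Y B" if B: "B : sets Y" for B
 proof -
  have "em Y B = em (distr M Y fst) B" by (simp add: marg)
  also have "... = em M (fst -` B \<inter> space M)" by (rule emeasure_distr) (use B in auto)
  also have "fst -` B \<inter> space M = B \<times> UNIV" using sets.sets_into_space[OF B] by (auto simp: spM)
  finally show ?thesis ..
 qed
 interpret M: prob_space M
  by standard (simp add: spM margB Y.emeasure_space_1)
 have rect [measurable]: "B \<times> C : sets M" if "B : sets Y" "C : sets borel" for B and C :: "real set"
  using that by (simp add: sM)
 have "\<exists>f. f : BM Y \<and> (\<forall>B\<in>sets Y. em M (B \<times> {..r}) = (nnint Y (%y. f y * ind B y)))" for r :: real
 proof -
  define N where "N = distr (density M (ind (space Y \<times> {..r}))) Y fst"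
  have N: "em N B = em M (B \<times> {..r})" if B: "B : sets Y" for B
  proof -
   have "em N B = (nnint M (%z. ind (space Y \<times> {..r}) z * ind (fst -` B \<inter> space M) z))"
    unfolding N_def using B by (subst emeasure_distr) (auto simp: emeasure_density)
   also have "... = (nnint M (%z. ind (B \<times> {..r}) z))"
    using sets.sets_into_space[OF B] by (intro nn_integral_cong) (auto simp: spM indicator_def)
   finally show ?thesis using B by simp
  qed
  have "em N B = 0" if B: "B : null_sets Y" for B
  proof -
   have "em M (B \<times> {..r}) <= em M (B \<times> UNIV)"
    using B by (intro emeasure_mono) auto
   with B show ?thesis by (simp add: N margB null_setsD1 null_setsD2)
  qed
  moreover have "sets N = sets Y" by (simp add: N_def)
  ultimately obtain k where "k : BM Y" "!!B. B : sets Y ==> em N B = (nnint Y (%y. k y * ind B y))"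
   using density_exists[OF Y] by metis
  with N show ?thesis by auto
 qed
 then obtain f' where f' [measurable]: "!!r. f' r : BM Y"
  and f'eq: "!!r B. B : sets Y ==> em M (B \<times> {..r}) = (nnint Y (%y. f' r y * ind B y))"
  by metis
 define f where "f q = f' (real_of_rat q)" for q
 have f [measurable]: "f q : BM Y" for q by (simp add: f_def)
 have feq: "em M (B \<times> {..real_of_rat q}) = (nnint Y (%y. f q y * ind B y))" if "B : sets Y" for q B
  by (simp add: f_def f'eq that)
 have fint: "(nnint Y (%y. f q y)) = em M (space Y \<times> {..real_of_rat q})" for q
  by (subst feq) (auto intro!: nn_integral_cong)
 have ffin: "(nnint Y (%y. f q y)) < \<infinity>" for q
  by (simp add: fint less_top[symmetric])
 have mono: "AE y in Y. f q y <= f r y" if "q <= r" for q r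
 proof (rule AE_le_of_set_nn_integral_le[OF f f _ ffin])
  fix B assume B: "B : sets Y"
  show "(nnint Y (%y. f q y * ind B y)) <= (nnint Y (%y. f r y * ind B y))"
   unfolding feq[OF B, symmetric] using B that
   by (intro emeasure_mono) (auto simp: of_rat_less_eq intro: order.trans)
 qed
 have le1: "AE y in Y. f q y <= 1" for q
 proof (rule AE_le_of_set_nn_integral_le[OF f _ _ ffin])
  fix B assume B: "B : sets Y"
  have "em M (B \<times> {..real_of_rat q}) <= em M (B \<times> UNIV)"
   using B by (intro emeasure_mono) auto
  then show "(nnint Y (%y. f q y * ind B y)) <= (nnint Y (%y. 1 * ind B y))"
   unfolding feq[OF B, symmetric] using B by (simp add: margB)
 qed simp
 have bot: "AE y in Y. (INF n::nat. f (- of_nat n) y) = 0"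
 proof -
  have "(nnint Y (%y. (INF n::nat. f (- of_nat n) y))) <= (INF n::nat. nnint Y (%y. f (- of_nat n) y))"
   by (intro INF_greatest nn_integral_mono INF_lower) auto
  also have "... = (INF n::nat. em M (space Y \<times> {..- real n}))"
   by (simp add: fint of_rat_minus)
  also have "... = em M (\<Inter>n. space Y \<times> {..- real n})"
   by (rule INF_emeasure_decseq) (auto simp: decseq_def)
  also have "(\<Inter>n. space Y \<times> {..- real n}) = {}"
  proof -
   have "\<exists>n. \<not> x <= - real n" for x :: real
    using reals_Archimedean2[of "- x"] by (metis minus_less_iff not_le)
   then show ?thesis by auto
  qed
  finally have "(nnint Y (%y. (INF n::nat. f (- of_nat n) y))) = 0" by simp
  then show ?thesis by (subst (asm) nn_integral_0_iff_AE) auto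
 qed
 \<comment> \<open>Written with 1 - f so that both limits are infima, whose integrals are bounded by
   monotonicity alone.\<close>
 have top: "AE y in Y. (INF n::nat. 1 - f (of_nat n) y) = 0"
 proof -
  have d: "(nnint Y (%y. 1 - f (of_nat n) y)) = em M (space Y \<times> {real n<..})" for n :: nat
  proof -
   have "(nnint Y (%y. 1 - f (of_nat n) y)) = (nnint Y (%y. 1)) - (nnint Y (%y. f (of_nat n) y))"
    by (rule nn_integral_diff) (use ffin[of "of_nat n"] le1[of "of_nat n"] in auto)
   also have "... = em M (space M) - em M (space Y \<times> {..real n})"
    by (simp add: fint Y.emeasure_space_1 M.emeasure_space_1)
   also have "... = em M (space M - space Y \<times> {..real n})"
    by (rule emeasure_compl[symmetric]) auto
   also have "space M - space Y \<times> {..real n} = space Y \<times> {real n<..}"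
    by (auto simp: spM)
   finally show ?thesis .
  qed
  have "(nnint Y (%y. (INF n::nat. 1 - f (of_nat n) y))) <= (INF n::nat. nnint Y (%y. 1 - f (of_nat n) y))"
   by (intro INF_greatest nn_integral_mono INF_lower) auto
  also have "... = (INF n::nat. em M (space Y \<times> {real n<..}))"
   by (simp add: d)
  also have "... = em M (\<Inter>n. space Y \<times> {real n<..})"
   by (rule INF_emeasure_decseq) (auto simp: decseq_def)
  also have "(\<Inter>n. space Y \<times> {real n<..}) = {}"
  proof -
   have "\<exists>n. \<not> real n < x" for x :: real using reals_Archimedean2[of x] by (metis less_asym)
   then show ?thesis by auto
  qed
  finally have "(nnint Y (%y. (INF n::nat. 1 - f (of_nat n) y))) = 0" by simp
  then show ?thesis by (subst (asm) nn_integral_0_iff_AE) auto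
 qed
 have "AE y in Y. (\<forall>q r. q <= r --> f q y <= f r y) \<and> (\<forall>q. f q y <= 1) \<and>
   (INF n::nat. f (- of_nat n) y) = 0 \<and> (INF n::nat. 1 - f (of_nat n) y) = 0"
  using mono le1 bot top by (auto simp: AE_all_countable intro!: AE_conjI AE_impI)
 moreover define \<Omega> where "\<Omega> = {y : space Y. (\<forall>q r. q <= r --> f q y <= f r y) \<and> (\<forall>q. f q y <= 1) \<and>
   (INF n::nat. f (- of_nat n) y) = 0 \<and> (INF n::nat. 1 - f (of_nat n) y) = 0}"
 moreover have \<Omega>m [measurable]: "\<Omega> : sets Y" unfolding \<Omega>_def by measurable
 ultimately have \<Omega>ae: "AE y in Y. y : \<Omega>" by (auto simp: \<Omega>_def)
 \<comment> \<open>The strict inequality x < q makes the infimum right continuous. Outside the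
   conull set \<Omega> the default in F is the distribution function of the point mass at 0.\<close>
 define Fe where "Fe y x = (INF q\<in>{q. x < real_of_rat q}. f q y)" for y x
 define F where "F y x = (if y : \<Omega> then enn2real (Fe y x) else ind {0..} x)" for y x
 have Fe1: "Fe y x <= 1" if y: "y : \<Omega>" for y x
 proof -
  obtain q where q: "x < real_of_rat q" using of_rat_dense[of x "x+1"] by auto
  then have "Fe y x <= f q y" unfolding Fe_def by (intro INF_lower) auto
  also have "... <= 1" using y by (auto simp: \<Omega>_def)
  finally show ?thesis .
 qed
 have Feq: "ennreal (F y x) = Fe y x" if "y : \<Omega>" for y x
  using that le_less_trans[OF Fe1[OF that] ennreal_one_less_top] by (simp add: F_def)
 have Fmono: "F y a <= F y b" if "a <= b" for y a b
 proof (cases "y : \<Omega>")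
  case True
  have "Fe y a <= Fe y b" unfolding Fe_def using that by (intro INF_superset_mono) auto
  then show ?thesis using True le_less_trans[OF Fe1[OF True] ennreal_one_less_top] by (auto simp: F_def intro!: enn2real_mono)
 next
  case False then show ?thesis using that by (auto simp: F_def indicator_def)
 qed
 have F0: "0 <= F y x" and F1: "F y x <= 1" for y x
  using enn2real_mono[OF Fe1, of y x] by (auto simp: F_def indicator_def)
 have Fle: "F y x <= enn2real (f q y)" if "y : \<Omega>" "x < real_of_rat q" for y x q
 proof -
  have "Fe y x <= f q y" unfolding Fe_def using that by (intro INF_lower) auto
  moreover have "f q y <= 1" using that by (auto simp: \<Omega>_def)
  ultimately show ?thesis using that le_less_trans[OF _ ennreal_one_less_top, of "f q y"]
   by (auto simp: F_def intro!: enn2real_mono)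
 qed
 have rcont: "continuous (at_right a) (F y)" for y a
 proof (cases "y : \<Omega>")
  case True
  have "(F y \<longlongrightarrow> F y a) (at_right a)"
  proof (rule order_tendstoI)
   fix l assume "l < F y a"
   then show "\<forall>\<^sub>F x in at_right a. l < F y x"
    unfolding eventually_at_right_field using Fmono[of a _ y] by (intro exI[of _ "a+1"]) (auto intro: less_le_trans)
  next
   fix u assume u: "F y a < u"
   then have "Fe y a < ennreal u"
    using Feq[OF True, of a] F0[of y a] by (metis ennreal_lessI le_less_trans)
   then obtain q where q: "a < real_of_rat q" "f q y < ennreal u"
    unfolding Fe_def by (auto simp: INF_less_iff)
   have "u > 0" using u F0[of y a] by linarith
   then have "enn2real (f q y) < u"
    using q(2) by (cases "f q y") (auto simp: ennreal_less_iff)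
   then show "\<forall>\<^sub>F x in at_right a. F y x < u"
    unfolding eventually_at_right_field using q(1) Fle[OF True] by (intro exI[of _ "real_of_rat q"]) (auto intro: le_less_trans)
  qed
  then show ?thesis by (simp add: continuous_within)
 next
  case False
  show ?thesis
  proof (cases "a < 0")
   case True
   have "\<forall>\<^sub>F x in at_right a. F y x = F y a"
    unfolding eventually_at_right_field using True False by (intro exI[of _ 0]) (auto simp: F_def)
   then show ?thesis by (simp add: continuous_within tendsto_eventually)
  next
   case a: False
   have "\<forall>\<^sub>F x in at_right a. F y x = F y a"
    unfolding eventually_at_right_field using a False by (intro exI[of _ "a+1"]) (auto simp: F_def)
   then show ?thesis by (simp add: continuous_within tendsto_eventually)
  qed
 qed
 have fn_le: "enn2real (f (of_nat n) y) <= F y (real n)" if y: "y : \<Omega>" for y and n :: nat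
 proof -
  have "f (of_nat n) y <= Fe y (real n)"
   unfolding Fe_def
  proof (rule INF_greatest)
   fix q assume "q : {q. real n < real_of_rat q}"
   then have "real_of_rat (of_nat n) <= real_of_rat q" by simp
   then have "of_nat n <= q" by (simp only: of_rat_less_eq)
   then show "f (of_nat n) y <= f q y" using y by (auto simp: \<Omega>_def)
  qed
  then show ?thesis using y le_less_trans[OF Fe1[OF y] ennreal_one_less_top]
   by (auto simp: F_def intro!: enn2real_mono)
 qed
 have Fbot: "(F y \<longlongrightarrow> 0) at_bot" for y
 proof (rule order_tendstoI)
  fix l :: real assume "l < 0" then have "l < F y x" for x using F0[of y x] by linarith
  then show "\<forall>\<^sub>F x in at_bot. l < F y x" by simp
 next
  fix u :: real assume u: "0 < u"
  show "\<forall>\<^sub>F x in at_bot. F y x < u"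
  proof (cases "y : \<Omega>")
   case True
   then have "(INF n::nat. f (- of_nat n) y) < ennreal u" using u by (auto simp: \<Omega>_def)
   then obtain n :: nat where n: "f (- of_nat n) y < ennreal u" by (auto simp: INF_less_iff)
   then have "enn2real (f (- of_nat n) y) < u" using u
    by (cases "f (- of_nat n) y") (auto simp: ennreal_less_iff)
   moreover have "F y x <= enn2real (f (- of_nat n) y)" if "x <= - real n - 1" for x
    by (rule Fle[OF True]) (use that in \<open>simp add: of_rat_minus\<close>)
   ultimately show ?thesis
    unfolding eventually_at_bot_linorder by (meson le_less_trans)
  next
   case False then show ?thesis unfolding eventually_at_bot_linorder using u by (intro exI[of _ "-1"]) (auto simp: F_def)
  qed
 qed
 have Ftop: "(F y \<longlongrightarrow> 1) at_top" for y
 proof (rule order_tendstoI)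
  fix l :: real assume "1 < l" then have "F y x < l" for x using F1[of y x] by linarith
  then show "\<forall>\<^sub>F x in at_top. F y x < l" by simp
 next
  fix u :: real assume u: "u < 1"
  show "\<forall>\<^sub>F x in at_top. u < F y x"
  proof (cases "y : \<Omega>")
   case True
   then have "(INF n::nat. 1 - f (of_nat n) y) < ennreal (1 - u)" using u by (auto simp: \<Omega>_def)
   then obtain n :: nat where n: "1 - f (of_nat n) y < ennreal (1 - u)" by (auto simp: INF_less_iff)
   have f1: "f (of_nat n) y <= 1" using True by (auto simp: \<Omega>_def)
   have "u < enn2real (f (of_nat n) y)"
   proof (cases "f (of_nat n) y")
    case (real r)
    then have "1 - f (of_nat n) y = ennreal (1 - r)" by (metis ennreal_1 ennreal_minus)
    with n have "ennreal (1 - r) < ennreal (1 - u)" by simp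
    then have "1 - r < 1 - u" using u by (meson ennreal_leI not_le)
    with real show ?thesis by simp
   next
    case top with f1 show ?thesis by (simp add: top_unique)
   qed
   then have "u < F y (real n)" using fn_le[OF True, of n] by simp
   then show ?thesis
    unfolding eventually_at_top_linorder using Fmono[of "real n" _ y]
    by (intro exI[of _ "real n"]) (auto intro: less_le_trans)
  next
   case False then show ?thesis unfolding eventually_at_top_linorder using u by (intro exI[of _ 0]) (auto simp: F_def)
  qed
 qed
 have Fm [measurable]: "(%y. F y x) : BM Y" for x
  unfolding F_def Fe_def by measurable
 define kp where "kp y = interval_measure (F y)" for y
 have rd: "real_distribution (kp y)" for y
  unfolding kp_def by (intro real_distribution_interval_measure Fmono rcont Fbot Ftop)
 have Iic: "em (kp y) {..x} = ennreal (F y x)" for y x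
  unfolding kp_def by (intro emeasure_interval_measure_Iic Fmono rcont Fbot)
 have "kp : Y \<rightarrow>\<^sub>M prob_algebra borel"
 proof (rule measurable_prob_algebra_generated[where \<Omega> = UNIV and G = "range (%x::real. {..x})"])
  show "sets (borel :: real measure) = sigma_sets UNIV (range (%x::real. {..x}))"
   unfolding borel_eq_atMost by (simp add: sets_measure_of)
  show "Int_stable (range (%x::real. {..x}))" by (auto simp: Int_stable_def)
  show "prob_space (kp a)" "sets (kp a) = sets borel" for a
   using rd[of a] by (auto simp: real_distribution_def real_distribution_axioms_def)
  show "(%a. em (kp a) A) : BM Y" if "A : range (%x::real. {..x})" for A
   using that by (auto simp: Iic)
 qed auto
 then have [measurable]: "kp : Y \<rightarrow>\<^sub>M subprob_algebra borel" by (rule measurable_prob_algebraD)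
 have fk: "fin_kernel Y borel kp"
  unfolding fin_kernel_def using rd
  by (auto simp: real_distribution_def real_distribution_axioms_def prob_space_def)
 \<comment> \<open>Both sides are continuous from above along rationals decreasing to x, so the
   defining identity of the densities passes from rational to real end points.\<close>
 have key: "em M (B \<times> {..x}) = (nnint Y (%y. em (kp y) {..x} * ind B y))" if B: "B : sets Y" for B x
 proof -
  obtain Q :: "nat => rat" where Q: "!!n. x < of_rat (Q n)" "decseq Q" "(%n. real_of_rat (Q n)) \<longlonglongrightarrow> x"
   using rational_sequence_from_above[of x] by metis
  have "(nnint Y (%y. em (kp y) {..x} * ind B y)) = (nnint Y (%y. (INF n. f (Q n) y * ind B y)))"
  proof (rule nn_integral_cong_AE, use \<Omega>ae in eventually_elim)
   case (elim y)
   have "Fe y x = (INF n. f (Q n) y)"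
   proof (rule antisym)
    show "Fe y x <= (INF n. f (Q n) y)" unfolding Fe_def using Q(1) by (intro INF_greatest INF_lower) auto
    show "(INF n. f (Q n) y) <= Fe y x"
    unfolding Fe_def
    proof (rule INF_greatest)
    fix q assume "q : {q. x < real_of_rat q}"
    then have "\<forall>\<^sub>F n in sequentially. real_of_rat (Q n) < real_of_rat q" using Q(3) by (auto dest: order_tendstoD)
    then obtain n where "Q n < q" by (auto simp: eventually_sequentially of_rat_less)
    then have "f (Q n) y <= f q y" using elim by (auto simp: \<Omega>_def)
    then show "(INF n. f (Q n) y) <= f q y" by (rule INF_lower2[OF UNIV_I])
    qed
   qed
   then show ?case using elim by (cases "y : B") (auto simp: Iic Feq)
  qed
  also have "... = (INF n. nnint Y (%y. f (Q n) y * ind B y))"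
  proof (rule nn_integral_monotone_convergence_INF_AE')
   show "AE y in Y. f (Q (Suc n)) y * ind B y <= f (Q n) y * ind B y" for n
    using \<Omega>ae
   proof eventually_elim
    case (elim y)
    then have "f (Q (Suc n)) y <= f (Q n) y" using decseq_SucD[OF Q(2)] by (auto simp: \<Omega>_def)
    then show ?case by (intro mult_right_mono) auto
   qed
   show "(%y. f (Q n) y * ind B y) : BM Y" for n using B by measurable
   show "(nnint Y (%y. f (Q 0) y * ind B y)) < \<infinity>"
    using B by (simp add: feq[symmetric] less_top[symmetric])
  qed
  also have "... = (INF n. em M (B \<times> {..real_of_rat (Q n)}))" using B by (simp add: feq)
  also have "... = em M (\<Inter>n. B \<times> {..real_of_rat (Q n)})"
   using B Q(2) by (intro INF_emeasure_decseq) (auto simp: decseq_def of_rat_less_eq intro: order.trans)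
  also have "(\<Inter>n. B \<times> {..real_of_rat (Q n)}) = B \<times> {..x}"
  proof -
   have "z <= x" if "!!n. z <= real_of_rat (Q n)" for z
    by (rule LIMSEQ_le_const[OF Q(3)]) (use that in auto)
   moreover have "b <= real_of_rat (Q n)" if "b <= x" for b n
    using that Q(1)[of n] by linarith
   ultimately show ?thesis by auto
  qed
  finally show ?thesis ..
 qed
 have "M = semidirect Y borel kp"
 proof (rule measure_eqI_rectangles[OF sM])
  show "em M (space Y \<times> space borel) ~= \<infinity>" by simp
  fix B and C :: "real set" assume B: "B : sets Y" and C: "C : sets borel"
  define M1 where "M1 = distr (density M (ind (B \<times> UNIV))) borel snd"
  define M2 where "M2 = distr (density (semidirect Y borel kp) (ind (B \<times> UNIV))) borel snd"
  have M1: "em M1 C = em M (B \<times> C)" if "C : sets borel" for C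
  proof -
   have "em M1 C = (nnint M (%z. ind (B \<times> UNIV) z * ind (snd -` C \<inter> space M) z))"
    unfolding M1_def using B that by (subst emeasure_distr) (auto simp: emeasure_density)
   also have "... = (nnint M (%z. ind (B \<times> C) z))"
    using sets.sets_into_space[OF B] by (intro nn_integral_cong) (auto simp: spM indicator_def)
   finally show ?thesis using B that by simp
  qed
  have M2: "em M2 C = em (semidirect Y borel kp) (B \<times> C)" if "C : sets borel" for C
  proof -
   have "em M2 C = (nnint (semidirect Y borel kp) (%z. ind (B \<times> UNIV) z * ind (snd -` C \<inter> (space Y \<times> UNIV)) z))"
    unfolding M2_def using B that
    by (subst emeasure_distr) (auto simp: emeasure_density measurable_sets[OF measurable_snd] space_pair_measure[symmetric, of Y "borel :: real measure", simplified])
   also have "... = (nnint (semidirect Y borel kp) (%z. ind (B \<times> C) z))"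
    using sets.sets_into_space[OF B] by (intro nn_integral_cong) (auto simp: indicator_def)
   finally show ?thesis using B that by simp
  qed
  have semi: "em (semidirect Y borel kp) (B \<times> C) = (nnint Y (%y. em (kp y) C * ind B y))" if C: "C : sets borel" for C
  proof -
   have "(nnint (kp y) (%s. ind (B \<times> C) (y, s))) = em (kp y) C * ind B y" if "y : space Y" for y
   proof -
    have "sets (kp y) = sets borel" using fk that by (auto simp: fin_kernel_def)
    then have "(nnint (kp y) (%s. ind C s)) = em (kp y) C" using C by simp
    then show ?thesis by (cases "y : B") (auto simp: indicator_def[of "B \<times> C"] indicator_def[of C] cong: nn_integral_cong)
   qed
   then show ?thesis using B C by (subst emeasure_semidirect[OF fk]) (auto intro!: nn_integral_cong)
  qed
  have "M1 = M2"
  proof (rule measure_eqI_generator_eq[where \<Omega> = UNIV and E = "range (%x::real. {..x})" and A = "%n. {..real n}"])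
   show "Int_stable (range (%x::real. {..x}))" by (auto simp: Int_stable_def)
   show "sets M1 = sigma_sets UNIV (range (%x::real. {..x}))" "sets M2 = sigma_sets UNIV (range (%x::real. {..x}))"
    unfolding M1_def M2_def borel_eq_atMost by (simp_all add: sets_measure_of)
   show "em M1 X = em M2 X" if "X : range (%x::real. {..x})" for X
    using that B by (auto simp: M1 M2 semi key)
   show "(\<Union>i. {..real i}) = UNIV" using real_arch_simple by (auto simp: UN_iff) 
   show "em M1 {..real i} ~= \<infinity>" for i by (simp add: M1)
  qed auto
  then show "em M (B \<times> C) = em (semidirect Y borel kp) (B \<times> C)" using M1[OF C] M2[OF C] by simp
 qed simp
 with fk show ?thesis by (rule that)
qed

section \<open>Coding a Lebesgue space by real numbers\<close>

lemma lebesgue_prob_space_real_code: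
 assumes "lebesgue_prob_space W"
 obtains j :: "'w => real" and i where "j : BM W" "AE w in W. i (j w) = w"
  "!!x. i x : space W"
  "!!D. D : sets W ==> \<exists>E1\<in>sets borel. \<exists>E2\<in>sets borel. E1 \<subseteq> i -` D \<and> i -` D \<subseteq> E2 \<and> j -` (E2 - E1) \<inter> space W : null_sets W"
proof -
 from assms[unfolded lebesgue_prob_space_def]
 obtain S :: "'w set" and c :: real and N N' f where W: "prob_space W" and cm: "complete_measure W"
  and S: "countable S" "S \<subseteq> space W" and S3: "\<forall>a\<in>S. {a} : sets W \<and> em W {a} > 0"
  and N: "N : null_sets W" "N' : null_sets lebesgue"
  and bij: "bij_betw f (space W - S - N) ({0..c} - N')"
  and iso: "\<forall>A. A \<subseteq> space W - S - N --> (A : sets W \<longleftrightarrow> f ` A : sets lebesgue) \<and>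
    (A : sets W --> em W A = em lebesgue (f ` A))"
  by (elim conjE exE) (rule that)
 note iso = iso[rule_format]
 interpret W: prob_space W by fact
 interpret W: complete_measure W by fact
 have NL: "N' : sets lebesgue" using N(2) by (rule null_setsD2)
 define U where "U = space W - S - N"
 \<comment> \<open>A point of S in N would give the null set N positive mass.\<close>
 have SN: "S \<inter> N = {}"
 proof -
  have False if "a : S" "a : N" for a
  proof -
   have "em W {a} <= em W N" using that N by (intro emeasure_mono) auto
   with N S3 that(1) show False by (auto simp: null_sets_def)
  qed
  then show ?thesis by auto
 qed
 have countable_sets: "A : sets W" if "A \<subseteq> S" for A
 proof -
  have "countable A" using that S(1) by (rule countable_subset)
  then have "(\<Union>a\<in>A. {a}) : sets W" using S3 that by (intro sets.countable_UN') auto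
  then show ?thesis by simp
 qed
 have Nsub: "A : sets W" if "A \<subseteq> N" for A
  using W.complete[OF that N(1)] by (auto simp: null_sets_def)
 \<comment> \<open>The atoms receive numbers at most -1, the points of N the number -1/2, and the
   rest numbers at least 0. These ranges are disjoint, so j is injective off N.\<close>
 define j where "j w = (if w : S then - 1 - real (to_nat_on S w) else if w : N then -1/2 else f w)" for w
 have jU: "j w = f w" if "w : U" for w using that by (auto simp: j_def U_def)
 have fU: "f w : {0..c} - N'" if "w : U" for w
  using that bij by (auto simp: U_def bij_betw_def)
 have finj: "inj_on f U" using bij by (auto simp: U_def bij_betw_def)
 have fimg: "f ` U = {0..c} - N'" using bij by (auto simp: U_def bij_betw_def)
 have jS: "j w <= - 1" if "w : S" for w using that by (auto simp: j_def)
 have split: "space W - N = S \<union> U" using S(2) SN by (auto simp: U_def)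
 have jinj: "inj_on j (space W - N)"
  unfolding split
 proof (rule inj_onI)
  fix x y assume x: "x : S \<union> U" and y: "y : S \<union> U" and eq: "j x = j y"
  have d: "x : S \<longleftrightarrow> y : S"
   using x y eq jS[of x] jS[of y] jU[of x] jU[of y] fU[of x] fU[of y] by auto
  show "x = y"
  proof (cases "x : S")
   case True
   with d have "to_nat_on S x = to_nat_on S y" "y : S" using eq by (auto simp: j_def)
   then show ?thesis using True S(1) by (simp add: to_nat_on_inj)
  next
   case False
   with x y d eq jU finj show ?thesis by (auto simp: inj_on_def)
  qed
 qed
 define w0 where "w0 = (SOME w. w : space W)"
 have w0: "w0 : space W" unfolding w0_def using W.not_empty by (auto intro: someI_ex)
 define i where "i x = (if x : j ` (space W - N) then the_inv_into (space W - N) j x else w0)" for x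
 have ij: "i (j w) = w" if "w : space W - N" for w
  using that by (simp add: i_def the_inv_into_f_f[OF jinj])
 have "j -` E \<inter> space W : sets W" if E: "E : sets borel" for E
 proof -
  have "f ` {w : U. f w : E} = E \<inter> ({0..c} - N')" using fimg by auto
  also have "... : sets lebesgue"
   by (intro sets.Int sets.Diff NL) (simp_all add: sets_completionI_sets E)
  finally have "{w : U. f w : E} : sets W" using iso[of "{w : U. f w : E}"] by (auto simp: U_def)
  moreover have "{w : S. j w : E} : sets W" by (rule countable_sets) auto
  moreover have "{w : N. j w : E} : sets W" by (rule Nsub) auto
  ultimately have "{w : U. f w : E} \<union> {w : S. j w : E} \<union> {w : N. j w : E} : sets W" by auto
  also have "{w : U. f w : E} \<union> {w : S. j w : E} \<union> {w : N. j w : E} = j -` E \<inter> space W"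
   using S(2) N(1) sets.sets_into_space[of N W] by (auto simp: U_def jU)
  finally show ?thesis .
 qed
 then have jm: "j : BM W" by (intro measurableI) auto
 have iae: "AE w in W. i (j w) = w"
  by (rule AE_I'[OF N(1)]) (use ij in auto)
 have isp: "i x : space W" for x
  using the_inv_into_into[OF jinj, of x "space W - N"] w0 by (auto simp: i_def)
 have sand: "\<exists>E1\<in>sets borel. \<exists>E2\<in>sets borel. E1 \<subseteq> j ` (D - N) \<and> j ` (D - N) \<subseteq> E2 \<and> j -` (E2 - E1) \<inter> space W : null_sets W"
  if D: "D : sets W" for D
 proof -
  have DU: "D \<inter> U : sets W" using D countable_sets[of S] N(1) by (auto simp: U_def null_sets_def)
  then have "f ` (D \<inter> U) : sets lebesgue" using iso[of "D \<inter> U"] by (auto simp: U_def)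
  then obtain E1 E0 Nn where E: "f ` (D \<inter> U) = E1 \<union> E0" "E0 \<subseteq> Nn" "Nn : null_sets lborel" "E1 : sets lborel"
   by (rule sets_completionE)
  \<comment> \<open>Nn covers what the image of D has beyond the Borel set E1. Cutting it to [0,c]
    keeps the atoms out of the error set and makes the preimage of V under f correspond to V -
    N'.\<close>
  define V where "V = (Nn \<inter> {0..c}) - E1"
  define C where "C = j ` (D \<inter> S)"
  have [measurable]: "E1 : sets borel" "Nn : sets borel" using E by (auto simp: null_sets_def)
  have "countable C" unfolding C_def using S(1) by (auto intro: countable_subset)
  then have [measurable]: "C : sets borel" by (rule sets.countable[rotated]) auto 
  have Vm: "V : sets borel" unfolding V_def by auto
  have fDU: "f ` (D \<inter> U) \<subseteq> {0..c}" using fU by auto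
  have jD: "j ` (D - N) = C \<union> f ` (D \<inter> U)"
  proof -
   have "D - N = (D \<inter> S) \<union> (D \<inter> U)" using split sets.sets_into_space[OF D] by auto
   then show ?thesis unfolding C_def using jU by (auto simp: image_Un cong: image_cong_simp)
  qed
  have null: "j -` ((C \<union> E1 \<union> V) - (C \<union> E1)) \<inter> space W : null_sets W"
  proof -
   define V' where "V' = {w : U. f w : V}"
   have Vn: "V : null_sets lebesgue"
    using E(3) Vm by (intro null_sets_subset[OF null_sets_completionI[of Nn lborel]]) (auto simp: V_def)
   have "f ` V' = f ` U \<inter> V" by (auto simp: V'_def)
   also have "... = V - N'" unfolding fimg by (auto simp: V_def)
   finally have "f ` V' : null_sets lebesgue" using null_set_Diff[OF Vn NL] by simp
   then have "V' : null_sets W" using iso[of V'] by (auto simp: V'_def U_def null_sets_def)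
   then have "V' \<union> N : null_sets W" using N(1) by (rule null_sets.Un)
   moreover have "j -` ((C \<union> E1 \<union> V) - (C \<union> E1)) \<inter> space W \<subseteq> V' \<union> N"
   proof
    fix w assume w: "w : j -` ((C \<union> E1 \<union> V) - (C \<union> E1)) \<inter> space W"
    then have jV: "j w : V" by auto
    then have "0 <= j w" by (auto simp: V_def)
    then have "w \<notin> S" using jS[of w] by auto
    with w split have "w : N \<or> w : U" by auto
    then show "w : V' \<union> N" using jV jU by (auto simp: V'_def)
   qed
   ultimately show ?thesis by (metis W.complete2)
  qed
  have low: "C \<union> E1 \<subseteq> j ` (D - N)" unfolding jD E(1) by auto
  have "f ` (D \<inter> U) \<subseteq> E1 \<union> V" using E(1,2) fDU unfolding V_def by blast
  then have up: "j ` (D - N) \<subseteq> C \<union> E1 \<union> V" unfolding jD by blast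
  show ?thesis
   by (intro bexI[of _ "C \<union> E1"] bexI[of _ "C \<union> E1 \<union> V"] conjI low up null) (use Vm in auto)
 qed
 have "\<exists>E1\<in>sets borel. \<exists>E2\<in>sets borel. E1 \<subseteq> i -` D \<and> i -` D \<subseteq> E2 \<and> j -` (E2 - E1) \<inter> space W : null_sets W"
  if D: "D : sets W" for D
 proof -
  obtain E1 E2 where E: "E1 : sets borel" "E2 : sets borel" "E1 \<subseteq> j ` (D - N)" "j ` (D - N) \<subseteq> E2" "j -` (E2 - E1) \<inter> space W : null_sets W"
   using sand[OF D] by auto
  obtain F1 F2 where F: "F1 : sets borel" "F2 : sets borel" "F1 \<subseteq> j ` (space W - N)" "j ` (space W - N) \<subseteq> F2" "j -` (F2 - F1) \<inter> space W : null_sets W"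
   using sand[OF sets.top] by auto
  define P Q where "P = j ` (space W - N)" and "Q = j ` (D - N)"
  have in1: "i x : D \<longleftrightarrow> x : Q" if "x : P" for x
  proof -
   from that obtain w where w: "w : space W - N" "x = j w" by (auto simp: P_def)
   have "x : Q \<longleftrightarrow> w : D - N"
    using w jinj sets.sets_into_space[OF D] unfolding w(2) Q_def by (intro inj_on_image_mem_iff) auto
   then show ?thesis using w by (simp add: ij)
  qed
  have in2: "i x = w0" if "x \<notin> P" for x
   using that by (simp add: i_def P_def)
  have sub: "Q \<subseteq> P" unfolding P_def Q_def using sets.sets_into_space[OF D] by auto
  note E = E[folded Q_def] and F = F[folded P_def]
  show ?thesis
  \<comment> \<open>Off the range P of j the map i is constantly w0, so the preimage of D contains
    the complement of P or misses it, according to whether w0 lies in D.\<close>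
  proof (cases "w0 : D")
   case True
   have eq: "i -` D = Q \<union> - P" using in1 in2 True sub by auto
   have "j -` ((E2 \<union> - F1) - (E1 \<union> - F2)) \<inter> space W \<subseteq> (j -` (E2 - E1) \<inter> space W) \<union> (j -` (F2 - F1) \<inter> space W)"
    by blast
   then have "j -` ((E2 \<union> - F1) - (E1 \<union> - F2)) \<inter> space W : null_sets W"
    using null_sets.Un[OF E(5) F(5)] W.complete2 by metis
   moreover have "E1 \<union> - F2 : sets borel" "E2 \<union> - F1 : sets borel" using E(1,2) F(1,2) by auto
   moreover have "E1 \<union> - F2 \<subseteq> i -` D" "i -` D \<subseteq> E2 \<union> - F1" unfolding eq using E(3,4) F(3,4) by blast+
   ultimately show ?thesis by blast
  next
   case False
   have "i -` D = Q" using in1 in2 False sub by auto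
   then show ?thesis using E by auto
  qed
 qed
 with jm iae isp show ?thesis by (rule that)
qed

section \<open>The conditionally independent gluing of two polymorphisms\<close>

text \<open>Independence given y, phrased without conditional measures: if k is the density in y of
  the image of F p, then F may be replaced by k and R by q. The form is asymmetric because the first
  marginal of q is Y, whereas p projects onto Y only after weighting by t. Functions F of finite
  integral already determine R.\<close>

definition is_joint ::
  "'x measure => 'y measure => 'w measure => ('x \<times> 'y \<times> real) measure => ('y \<times> 'w \<times> real) measure =>
   (('x \<times> 'y \<times> real) \<times> ('w \<times> real)) measure => bool" where
 "is_joint X Y W p q R \<longleftrightarrow> sets R = sets ((X >< (Y >< rpos)) >< (W >< rpos)) \<and>
  (\<forall>F k H. F : BM (X >< (Y >< rpos)) --> k : BM Y -->
   H : BM (W >< rpos) --> (nnint p (%z. F z)) < \<infinity> -->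
   (\<forall>B\<in>sets Y. (nnint p (%z. F z * ind B (mid z))) = (nnint Y (%y. k y * ind B y))) -->
   (nnint R (%e. F (fst e) * H (snd e))) = (nnint q (%z. (k (fst z) :: ennreal) * H (snd z))))"

lemma nn_integral_eq_of_sets:
 assumes "(!!B. B : sets Y ==> (nnint p (%z. F z * ind B (g z))) = (nnint Y (%y. k y * ind B y)))"
  and [measurable]: "F : BM p" "g : p \<rightarrow>\<^sub>M Y" "k : BM Y" "h : BM Y"
 shows "(nnint p (%z. F z * h (g z))) = (nnint Y (%y. k y * h y))"
proof -
 have "distr (density p F) Y g = density Y k"
 proof (rule measure_eqI)
  fix B assume "B : sets (distr (density p F) Y g)"
  then have B [measurable]: "B : sets Y" by simp
  have "em (distr (density p F) Y g) B = (nnint p (%z. F z * ind (g -` B \<inter> space p) z))"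
   by (subst emeasure_distr) (auto simp: emeasure_density)
  also have "... = (nnint p (%z. F z * ind B (g z)))"
   by (intro nn_integral_cong) (auto simp: indicator_def)
  also have "... = em (density Y k) B" using assms(1)[OF B] by (simp add: emeasure_density)
  finally show "em (distr (density p F) Y g) B = em (density Y k) B" .
 qed simp
 then have "(nnint (distr (density p F) Y g) (%y. h y)) = (nnint (density Y k) (%y. h y))" by simp
 then show ?thesis by (simp add: nn_integral_distr nn_integral_density)
qed

lemma Pol_snd_density_exists:
 assumes Y: "prob_space Y" and p: "p : Pol X Y" and F [measurable]: "F : BM (X >< (Y >< rpos))"
 obtains k :: "_ => ennreal" where "k : BM Y"
  "!!B. B : sets Y ==> (nnint p (%z. F z * ind B (mid z))) = (nnint Y (%y. k y * ind B y))"
proof -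
 note sets_Pol[OF p, measurable_cong]
 have m: "(%z. mid z) : p \<rightarrow>\<^sub>M Y" "F : BM p" by measurable
 show ?thesis by (rule pushforward_density[OF Y m(1) Pol_AE_snd[OF p] m(2)], assumption, rule that)
qed

lemma Pol_fst_density_exists:
 assumes Y: "prob_space Y" and q: "q : Pol Y W" and H [measurable]: "H : BM (W >< rpos)"
 obtains h :: "_ => ennreal" where "h : BM Y"
  "!!B. B : sets Y ==> (nnint q (%z. H (snd z) * ind B (fst z))) = (nnint Y (%y. h y * ind B y))"
proof -
 note sets_Pol[OF q, measurable_cong]
 have m: "fst : q \<rightarrow>\<^sub>M Y" "(%z. H (snd z)) : BM q" by measurable
 show ?thesis by (rule pushforward_density[OF Y m(1) Pol_AE_fst[OF q] m(2)], assumption, rule that)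
qed

text \<open>Only q is disintegrated. Its W-coordinate is coded by a real number; \<open>kp1\<close>
  is the law of the code given y, and \<open>kp2\<close> the law of the multiplier given y and the
  code. Attaching both kernels to p gives R' with real coordinates, and decoding these gives
  R.\<close>

lemma is_joint_exists:
 fixes p :: "('x \<times> 'y \<times> real) measure" and q :: "('y \<times> 'w \<times> real) measure"
 assumes X: "prob_space X" and Y: "prob_space Y" and W: "lebesgue_prob_space W"
  and p: "p : Pol X Y" and q: "q : Pol Y W"
 obtains R where "is_joint X Y W p q R"
proof -
 let ?PP = "X >< (Y >< rpos)"
 interpret p: prob_space p by (rule Pol_prob_space[OF p X])
 interpret q: prob_space q by (rule Pol_prob_space[OF q Y])
 interpret Y: prob_space Y by fact
 note sets_Pol[OF p, measurable_cong] and sets_Pol[OF q, measurable_cong]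
 obtain j :: "'w => real" and i where j [measurable]: "j : BM W" and ij: "AE w in W. i (j w) = w"
  and isp: "!!x. i x : space W"
  and sand: "!!D. D : sets W ==> \<exists>E1\<in>sets borel. \<exists>E2\<in>sets borel. E1 \<subseteq> i -` D \<and> i -` D \<subseteq> E2 \<and> j -` (E2 - E1) \<inter> space W : null_sets W"
  by (rule lebesgue_prob_space_real_code[OF W], rule that)
 define q1 where "q1 = distr q (Y >< borel) (%z. (fst z, j (mid z)))"
 define q2 where "q2 = distr q ((Y >< borel) >< borel) (%z. ((fst z, j (mid z)), thd z))"
 have "distr q1 Y fst = Y"
  unfolding q1_def by (subst distr_distr) (auto simp: comp_def distr_Pol_fst[OF q])
 then obtain kp1 where k1: "fin_kernel Y borel kp1" "q1 = semidirect Y borel kp1"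
  using disintegration_real[of q1 Y] Y by (auto simp: q1_def)
 interpret q1: prob_space q1 unfolding q1_def by (rule q.prob_space_distr) simp
 have "distr q2 q1 fst = q1"
 proof -
  have "distr q2 q1 fst = distr q2 (Y >< borel) fst" by (rule distr_cong) (auto simp: q1_def)
  also have "... = q1" unfolding q2_def q1_def by (subst distr_distr) (auto simp: comp_def)
  finally show ?thesis .
 qed
 moreover have "sets q2 = sets (q1 >< borel)"
  unfolding q2_def by (simp add: q1_def cong: sets_pair_measure_cong)
 ultimately obtain kp2 where k2': "fin_kernel q1 borel kp2" "q2 = semidirect q1 borel kp2"
  using disintegration_real[of q2 q1] q1.prob_space_axioms by metis
 have k2: "fin_kernel (Y >< borel) borel kp2"
  using k2'(1) unfolding fin_kernel_def q1_def by simp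
 have nb: "space (borel :: real measure) ~= {}" by simp
 have Y2: "space (Y >< borel) = space Y \<times> (UNIV :: real set)" by (simp add: space_pair_measure)
 have fk1: "fin_kernel p borel (%e. kp1 (mid e))"
  unfolding fin_kernel_def
 proof (intro conjI ballI)
  fix z assume "z : space p"
  then have "mid z : space Y" by (auto simp: space_Pol[OF p])
  then show "sets (kp1 (mid z)) = sets borel" "finite_measure (kp1 (mid z))"
   using k1(1) by (auto simp: fin_kernel_def)
 next
  fix C :: "real set" assume "C : sets borel"
  then have [measurable]: "(%y. em (kp1 y) C) : BM Y" using k1(1) by (auto simp: fin_kernel_def)
  show "(%z. em (kp1 (mid z)) C) : BM p" by measurable
 qed
 have fk2: "fin_kernel (p >< borel) borel (%e. kp2 (mid (fst e), snd e))"
  unfolding fin_kernel_def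
 proof (intro conjI ballI)
  fix z assume "z : space (p >< (borel :: real measure))"
  then have "(mid (fst z), snd z) : space (Y >< borel)"
   by (auto simp: space_Pol[OF p] space_pair_measure)
  then show "sets (kp2 (mid (fst z), snd z)) = sets borel" "finite_measure (kp2 (mid (fst z), snd z))"
   using k2 by (auto simp: fin_kernel_def)
 next
  fix C :: "real set" assume "C : sets borel"
  then have [measurable]: "(%y. em (kp2 y) C) : BM (Y >< borel)" using k2 by (auto simp: fin_kernel_def)
  show "(%z. em (kp2 (mid (fst z), snd z)) C) : BM (p >< borel)" by measurable
 qed
 define R' where "R' = semidirect (semidirect p borel (%e. kp1 (mid e))) borel (%e. kp2 (mid (fst e), snd e))"
 have sR': "sets R' = sets ((?PP >< borel) >< borel)"
  unfolding R'_def by (simp add: sets_Pol[OF p] cong: sets_pair_measure_cong)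
 note sR' [measurable_cong]
 have spR': "space R' = (space p \<times> UNIV) \<times> UNIV" unfolding R'_def by simp
 have fk2s: "fin_kernel (semidirect p borel (%e. kp1 (mid e))) borel (%e. kp2 (mid (fst e), snd e))"
  using fk2 unfolding fin_kernel_def by (simp add: space_pair_measure cong: measurable_cong_sets)
 have intR': "(nnint R' (%a. \<Phi> a)) = (nnint p (%e. nnint (kp1 (mid e)) (%r. nnint (kp2 (mid e, r)) (%s. \<Phi> ((e, r), s)))))"
  if m [measurable]: "\<Phi> : BM ((?PP >< borel) >< borel)" for \<Phi> :: "_ => ennreal"
 proof -
  have m': "\<Phi> : BM ((p >< borel) >< borel)" by measurable
  have m2: "(%e. nnint (kp2 (mid (fst e), snd e)) (%s. \<Phi> (e, s))) : BM (p >< borel)"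
   by (rule nn_integral_fin_kernel[OF fk2 nb]) (use m' in simp)
  have "(nnint R' (%a. \<Phi> a)) = (nnint (semidirect p borel (%e. kp1 (mid e))) (%e. nnint (kp2 (mid (fst e), snd e)) (%s. \<Phi> (e, s))))"
   unfolding R'_def by (rule nn_integral_semidirect[OF fk2s nb]) measurable
  also have "... = (nnint p (%e. nnint (kp1 (mid e)) (%r. nnint (kp2 (mid e, r)) (%s. \<Phi> ((e, r), s)))))"
   by (subst nn_integral_semidirect[OF fk1 nb m2]) simp
  finally show ?thesis .
 qed
 define L where "L G y = (nnint (kp1 y) (%r. nnint (kp2 (y, r)) (%s. G r s)))" for G :: "real => real => ennreal" and y
 have inner: "(%e. nnint (kp2 e) (%s. G (snd e) s)) : BM (Y >< borel)"
  if m [measurable]: "(%(r, s). G r s) : BM (borel >< borel)" for G :: "real => real => ennreal"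
 proof (rule nn_integral_fin_kernel[OF k2 nb])
  have "(%x. (%(r, s). G r s) (snd (fst x), snd x)) : BM ((Y >< borel) >< borel)"
   by (rule measurable_compose[OF _ m]) measurable
  then show "(%(z, s). G (snd z) s) : BM ((Y >< borel) >< borel)"
   by (simp add: split_beta')
 qed
 have Lm: "L G : BM Y"
  if m: "(%(r, s). G r s) : BM (borel >< borel)" for G :: "real => real => ennreal"
  unfolding L_def by (rule nn_integral_fin_kernel[OF k1(1) nb]) (use inner[OF m] in \<open>simp add: split_beta'\<close>)
 have split_m: "(%(r, s). u r * c s :: ennreal) : BM (borel >< borel)"
  if [measurable]: "u : BM borel" "c : BM borel" for u c :: "real => ennreal"
  by measurable
 have L_q: "(nnint Y (%y. k y * L (%r s. u r * c s) y)) = (nnint q (%z. k (fst z) * (u (j (mid z)) * c (thd z))))"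
  if [measurable]: "u : BM borel" "c : BM borel" "k : BM Y"
  for u c :: "real => ennreal" and k
 proof -
  have [measurable]: "(%a. k (fst (fst a)) * (u (snd (fst a)) * c (snd a))) : BM ((Y >< borel) >< borel)" by measurable
  have sk1: "sets (kp1 y) = sets borel" if "y : space Y" for y using that k1(1) by (auto simp: fin_kernel_def)
  have sk2: "sets (kp2 (y, r)) = sets borel" if "y : space Y" for y r using that k2 by (auto simp: fin_kernel_def Y2)
  have "(nnint q (%z. k (fst z) * (u (j (mid z)) * c (thd z)))) =
   (nnint q2 (%a. k (fst (fst a)) * (u (snd (fst a)) * c (snd a))))"
   unfolding q2_def by (subst nn_integral_distr) auto
  also have "... = (nnint q1 (%e. nnint (kp2 e) (%s. k (fst e) * (u (snd e) * c s))))"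
   unfolding k2'(2) by (subst nn_integral_semidirect[OF k2'(1) nb]) (simp_all add: q1_def)
  also have "... = (nnint q1 (%e. k (fst e) * (nnint (kp2 e) (%s. u (snd e) * c s))))"
  proof (rule nn_integral_cong)
   fix e assume "e : space q1"
   then have "fst e : space Y" by (auto simp: q1_def Y2)
   from sk2[OF this, of "snd e"] have "sets (kp2 e) = sets borel" by simp
   then have "(%s. u (snd e) * c s) : BM (kp2 e)" by (simp cong: measurable_cong_sets)
   then show "(nnint (kp2 e) (%s. k (fst e) * (u (snd e) * c s))) = k (fst e) * (nnint (kp2 e) (%s. u (snd e) * c s))"
    by (rule nn_integral_cmult)
  qed
  also have "... = (nnint Y (%y. nnint (kp1 y) (%r. k y * (nnint (kp2 (y, r)) (%s. u r * c s)))))"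
  proof -
   have "(%e. k (fst e) * (nnint (kp2 e) (%s. u (snd e) * c s))) : BM (Y >< borel)"
    by (intro borel_measurable_times_ennreal inner split_m) measurable
   then show ?thesis unfolding k1(2) by (subst nn_integral_semidirect[OF k1(1) nb]) simp_all
  qed
  also have "... = (nnint Y (%y. k y * L (%r s. u r * c s) y))"
  proof (rule nn_integral_cong)
   fix y assume y: "y : space Y"
   note sk1[OF y, measurable_cong]
   have "(%r. nnint (kp2 (y, r)) (%s. u r * c s)) : BM borel"
    using measurable_Pair2[OF inner[OF split_m, of u c] y] by simp
   then show "(nnint (kp1 y) (%r. k y * (nnint (kp2 (y, r)) (%s. u r * c s)))) = k y * L (%r s. u r * c s) y"
    unfolding L_def by (intro nn_integral_cmult) measurable
  qed
  finally show ?thesis ..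
 qed
 \<comment> \<open>Integrating out both kernels leaves a function of y alone, against which F may be
   replaced by its density k. By \<open>L_q\<close> the result is the same expression over
   q.\<close>
 have L_p: "(nnint R' (%a. F (fst (fst a)) * (u (snd (fst a)) * c (snd a)))) = (nnint q (%z. k (fst z) * (u (j (mid z)) * c (thd z))))"
  if [measurable]: "u : BM borel" "c : BM borel" "k : BM Y" "F : BM ?PP"
   and Fk: "!!B. B : sets Y ==> (nnint p (%z. F z * ind B (mid z))) = (nnint Y (%y. k y * ind B y))"
  for u c :: "real => ennreal" and k F
 proof -
  have sk1: "sets (kp1 y) = sets borel" if "y : space Y" for y using that k1(1) by (auto simp: fin_kernel_def)
  have sk2: "sets (kp2 (y, r)) = sets borel" if "y : space Y" for y r using that k2 by (auto simp: fin_kernel_def Y2)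
  have "(nnint R' (%a. F (fst (fst a)) * (u (snd (fst a)) * c (snd a)))) =
   (nnint p (%e. nnint (kp1 (mid e)) (%r. nnint (kp2 (mid e, r)) (%s. F e * (u r * c s)))))"
   by (subst intR') simp_all
  also have "... = (nnint p (%e. F e * L (%r s. u r * c s) (mid e)))"
  proof (rule nn_integral_cong)
   fix e assume "e : space p"
   then have y: "mid e : space Y" (is "?y : _") by (auto simp: space_Pol[OF p])
   have "(nnint (kp1 ?y) (%r. nnint (kp2 (?y, r)) (%s. F e * (u r * c s)))) = (nnint (kp1 ?y) (%r. F e * (nnint (kp2 (?y, r)) (%s. u r * c s))))"
   proof (rule nn_integral_cong)
    fix r
    have "(%s. u r * c s) : BM (kp2 (?y, r))"
    using sk2[OF y, of r] by (simp cong: measurable_cong_sets)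
    then show "(nnint (kp2 (?y, r)) (%s. F e * (u r * c s))) = F e * (nnint (kp2 (?y, r)) (%s. u r * c s))"
    by (rule nn_integral_cmult)
   qed
   also have "... = F e * L (%r s. u r * c s) ?y"
   proof -
    note sk1[OF y, measurable_cong]
    have "(%r. nnint (kp2 (?y, r)) (%s. u r * c s)) : BM borel"
    using measurable_Pair2[OF inner[OF split_m, of u c] y] by simp
    then show ?thesis
    unfolding L_def by (intro nn_integral_cmult) measurable
   qed
   finally show "(nnint (kp1 ?y) (%r. nnint (kp2 (?y, r)) (%s. F e * (u r * c s)))) = F e * L (%r s. u r * c s) ?y" .
  qed
  also have "... = (nnint Y (%y. k y * L (%r s. u r * c s) y))"
   by (rule nn_integral_eq_of_sets[OF Fk]) (simp_all add: Lm split_m)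
  also have "... = (nnint q (%z. k (fst z) * (u (j (mid z)) * c (thd z))))"
   by (rule L_q) auto
  finally show ?thesis .
 qed
 \<comment> \<open>Taking F = 1 shows that the law of the code under R' has a density with respect
   to q, so the errors of the Borel sandwich have mass 0 under R'.\<close>
 have nullR': "AE a in R'. snd (fst a) \<notin> E" if E [measurable]: "E : sets borel" and nE: "j -` E \<inter> space W : null_sets W" for E
 proof -
  obtain k where k: "k : BM Y" "!!B. B : sets Y ==> (nnint p (%z. 1 * ind B (mid z))) = (nnint Y (%y. k y * ind B y))"
   by (rule Pol_snd_density_exists[OF Y p, of "%_. 1"]) (simp, rule that)
  have "(nnint R' (%a. (%_. 1) (fst (fst a)) * (ind E (snd (fst a)) * (%_. 1) (snd a)))) =
   (nnint q (%z. k (fst z) * (ind E (j (mid z)) * (%_. 1) (thd z))))"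
   by (rule L_p) (use k in auto)
  also have "... = 0"
  proof -
   have "AE w in W. j w \<notin> E" by (rule AE_I'[OF nE]) auto
   from Pol_AE_snd[OF q this] have "AE z in q. k (fst z) * (ind E (j (mid z)) * (1::ennreal)) = 0"
    by eventually_elim simp
   then have "(nnint q (%z. k (fst z) * (ind E (j (mid z)) * 1))) = (nnint q (%z. 0))"
    by (rule nn_integral_cong_AE)
   then show ?thesis by simp
  qed
  finally have "(nnint R' (%a. ind E (snd (fst a)))) = 0" by simp
  then have "AE a in R'. ind E (snd (fst a)) = (0::ennreal)"
   by (subst (asm) nn_integral_0_iff_AE) auto
  then show ?thesis by eventually_elim (auto simp: indicator_def split: if_splits)
 qed
 \<comment> \<open>The kernel \<open>kp2\<close> lives on all of the real line. Nonpositive values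
   carry no mass under R', and the default 1 sends them into the multiplicative group.\<close>
 define pos where "pos s = (if 0 < s then s else 1)" for s :: real
 have pos [measurable]: "pos : borel \<rightarrow>\<^sub>M rpos"
  by (rule measurable_into_rpos) (auto simp: pos_def[abs_def])
 define \<tau> where "\<tau> a = (fst (fst a), (i (snd (fst a)), pos (snd a)))" for a :: "(('x \<times> 'y \<times> real) \<times> real) \<times> real"
 \<comment> \<open>The preimage of D differs from a measurable set by a subset of a null set, which
   is why the completion of R' appears.\<close>
 have im: "(%a. i (snd (fst a))) : completion R' \<rightarrow>\<^sub>M W"
 proof (rule measurableI)
  fix D assume D: "D : sets W"
  obtain E1 E2 where E: "E1 : sets borel" "E2 : sets borel" "E1 \<subseteq> i -` D" "i -` D \<subseteq> E2" "j -` (E2 - E1) \<inter> space W : null_sets W"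
   using sand[OF D] by auto
  note E(1,2) [measurable]
  have "AE a in R'. snd (fst a) \<notin> E2 - E1" by (rule nullR') (use E in auto)
  moreover have meas: "{a : space R'. snd (fst a) : E2 - E1} : sets R'" by measurable
  ultimately have n: "{a : space R'. snd (fst a) : E2 - E1} : null_sets R'"
   by (subst (asm) AE_iff_null) auto
  have eq: "(%a. i (snd (fst a))) -` D \<inter> space (completion R') = {a : space R'. snd (fst a) : E1} \<union> {a : space R'. i (snd (fst a)) : D \<and> snd (fst a) \<notin> E1}"
   using E(3) by auto
  have m: "{a : space R'. snd (fst a) : E1} : sets R'" by measurable
  have sub: "{a : space R'. i (snd (fst a)) : D \<and> snd (fst a) \<notin> E1} \<subseteq> {a : space R'. snd (fst a) : E2 - E1}"
   using E(4) by auto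
  show "(%a. i (snd (fst a))) -` D \<inter> space (completion R') : sets (completion R')"
   by (rule sets_completionI[OF eq sub n m])
 qed (simp add: isp)
 have \<tau>m: "\<tau> : completion R' \<rightarrow>\<^sub>M ?PP >< (W >< rpos)"
  unfolding \<tau>_def by (intro measurable_Pair im measurable_completion) measurable
 define R where "R = distr (completion R') (?PP >< (W >< rpos)) \<tau>"
 have sR: "sets R = sets (?PP >< (W >< rpos))" by (simp add: R_def)
 note sR [measurable_cong]
 have rect: "(nnint R (%e. F (fst e) * (ind D (mid e) * ind C (thd e)))) =
   (nnint q (%z. k (fst z) * (ind D (mid z) * ind C (thd z))))"
  if [measurable]: "k : BM Y" "F : BM ?PP"
   and Fk: "!!B. B : sets Y ==> (nnint p (%z. F z * ind B (mid z))) = (nnint Y (%y. k y * ind B y))"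
   and D [measurable]: "D : sets W" and C [measurable]: "C : sets rpos"
  for k F D C
 proof -
  obtain E1 E2 where E: "E1 : sets borel" "E2 : sets borel" "E1 \<subseteq> i -` D" "i -` D \<subseteq> E2" "j -` (E2 - E1) \<inter> space W : null_sets W"
   using sand[OF D] by auto
  note E(1,2) [measurable]
  define c0 where "c0 s = (ind C (pos s) :: ennreal)" for s
  have [measurable]: "c0 : BM borel" unfolding c0_def[abs_def] by measurable
  have eqv: "i r : D \<longleftrightarrow> r : E1" if "r \<notin> E2 - E1" for r using that E(3,4) by auto
  have "(nnint R (%e. F (fst e) * (ind D (mid e) * ind C (thd e)))) =
   (nnint (completion R') (%a. F (fst (fst a)) * (ind D (i (snd (fst a))) * ind C (pos (snd a)))))"
   unfolding R_def by (subst nn_integral_distr[OF \<tau>m]) (simp_all add: \<tau>_def)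
  also have "... = (nnint (completion R') (%a. F (fst (fst a)) * (ind E1 (snd (fst a)) * ind C (pos (snd a)))))"
  proof (rule nn_integral_cong_AE)
   have "AE a in R'. snd (fst a) \<notin> E2 - E1" by (rule nullR') (use E in auto)
   then have "AE a in completion R'. snd (fst a) \<notin> E2 - E1" by (rule AE_completion)
   then show "AE a in completion R'. F (fst (fst a)) * (ind D (i (snd (fst a))) * ind C (pos (snd a)))
    = F (fst (fst a)) * (ind E1 (snd (fst a)) * ind C (pos (snd a)))"
    by eventually_elim (simp add: eqv indicator_def)
  qed
  also have "... = (nnint R' (%a. F (fst (fst a)) * (ind E1 (snd (fst a)) * ind C (pos (snd a)))))"
   by (rule nn_integral_completion)
  also have "... = (nnint R' (%a. F (fst (fst a)) * (ind E1 (snd (fst a)) * c0 (snd a))))"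
   by (simp add: c0_def)
  also have "... = (nnint q (%z. k (fst z) * (ind E1 (j (mid z)) * c0 (thd z))))"
   by (rule L_p[OF _ _ _ _ Fk]) measurable
  also have "... = (nnint q (%z. k (fst z) * (ind D (mid z) * ind C (thd z))))"
  proof (rule nn_integral_cong_AE)
   have "AE w in W. j w \<notin> E2 - E1" by (rule AE_I'[OF E(5)]) auto
   from Pol_AE_snd[OF q this] Pol_AE_snd[OF q ij] Pol_AE_pos[OF q]
   show "AE z in q. k (fst z) * (ind E1 (j (mid z)) * c0 (thd z))
    = k (fst z) * (ind D (mid z) * ind C (thd z))"
   proof eventually_elim
    case (elim z)
    then have "j (mid z) : E1 \<longleftrightarrow> mid z : D" using eqv[of "j (mid z)"] by simp
    with elim show ?case by (simp add: c0_def pos_def indicator_def)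
   qed
  qed
  finally show ?thesis .
 qed
 have "is_joint X Y W p q R"
  unfolding is_joint_def
 proof (intro conjI allI impI sR)
  fix F k and H :: "_ => ennreal"
  assume F [measurable]: "F : BM ?PP" and k [measurable]: "k : BM Y"
   and H [measurable]: "H : BM (W >< rpos)" and fin: "(nnint p (%z. F z)) < \<infinity>"
   and Fk: "\<forall>B\<in>sets Y. (nnint p (%z. F z * ind B (mid z))) = (nnint Y (%y. k y * ind B y))"
  define M1 where "M1 = distr (density R (%e. F (fst e))) (W >< rpos) snd"
  define M2 where "M2 = distr (density q (%z. k (fst z))) (W >< rpos) snd"
  have i1: "(nnint M1 (%v. h v)) = (nnint R (%e. F (fst e) * h (snd e)))" if [measurable]: "h : BM (W >< rpos)" for h
   unfolding M1_def by (subst nn_integral_distr) (auto simp: nn_integral_density)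
  have i2: "(nnint M2 (%v. h v)) = (nnint q (%z. k (fst z) * h (snd z)))" if [measurable]: "h : BM (W >< rpos)" for h
   unfolding M2_def by (subst nn_integral_distr) (auto simp: nn_integral_density)
  \<comment> \<open>Finiteness of the integral of F makes these finite measures, for which
    rectangles suffice.\<close>
  have "M2 = M1"
  proof (rule measure_eqI_rectangles[of M2 W rpos M1])
   show "sets M2 = sets (W >< rpos)" "sets M1 = sets (W >< rpos)" by (simp_all add: M1_def M2_def)
   have "em M2 (space W \<times> space rpos) = (nnint M2 (%v. 1))"
    by (simp add: M2_def space_pair_measure)
   also have "... = (nnint q (%z. k (fst z)))" by (subst i2) auto
   also have "... = (nnint Y (%y. k y))" by (rule Pol_nn_integral_fst[OF q k])
   also have "... = (nnint p (%z. F z))"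
   proof -
    have "(nnint Y (%y. k y)) = (nnint Y (%y. k y * ind (space Y) y))" by (rule nn_integral_cong) simp
    also have "... = (nnint p (%z. F z * ind (space Y) (mid z)))" using Fk by simp
    also have "... = (nnint p (%z. F z))" by (rule nn_integral_cong) (auto simp: space_Pol[OF p])
    finally show ?thesis .
   qed
   finally show "em M2 (space W \<times> space rpos) ~= \<infinity>" using fin by simp
   fix D C assume D [measurable]: "D : sets W" and C [measurable]: "C : sets rpos"
   have ind: "ind (D \<times> C) v = (ind D (fst v) * ind C (snd v) :: ennreal)" for v
    by (cases v) (auto simp: indicator_def)
   have DC: "D \<times> C : sets (W >< rpos)" by simp
   have "em M2 (D \<times> C) = (nnint M2 (%v. ind (D \<times> C) v))"
    using DC by (simp add: M2_def)
   also have "... = (nnint R (%e. F (fst e) * (ind D (mid e) * ind C (thd e))))"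
    using rect[OF k F _ D C] Fk by (subst i2) (simp_all add: ind)
   also have "... = (nnint M1 (%v. ind (D \<times> C) v))"
    by (subst i1) (simp_all add: ind)
   also have "... = em M1 (D \<times> C)" using DC by (simp add: M1_def)
   finally show "em M2 (D \<times> C) = em M1 (D \<times> C)" .
  qed
  then show "(nnint R (%e. F (fst e) * H (snd e))) = (nnint q (%z. k (fst z) * H (snd z)))"
   using i1[OF H] i2[OF H] by simp
 qed
 then show ?thesis by (rule that)
qed

section \<open>Continuity of functionals on the space of polymorphisms\<close>

lemma abs_integral_le:
 fixes f g :: "'a => real"
 assumes "integrable M f" "integrable M g" "!!x. x : space M ==> \<bar>f x\<bar> <= g x"
 shows "\<bar>\<integral>x. f x \<partial>M\<bar> <= (LINT x|M. g x)"
proof -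
 have "\<bar>\<integral>x. f x \<partial>M\<bar> <= (LINT x|M. \<bar>f x\<bar>)" by (rule integral_abs_bound)
 also have "... <= (LINT x|M. g x)"
  by (rule integral_mono) (use assms in auto)
 finally show ?thesis .
qed

text \<open>The preimage of the whole line under any single test is already \<open>Pol X Y\<close>;
  the test with empty sets and the function 0 is at hand.\<close>

lemma topspace_pol_topology [simp]: "topspace (pol_topology X Y) = Pol X Y"
proof -
 define F :: "('a \<times> 'b \<times> real) measure => real"
  where "F = (%p. integral\<^sup>L (rpos_pushforward {} {} p) (%_. 0))"
 have "F : pol_tests X Y"
  unfolding pol_tests_def F_def
  by (rule UN_I[of "{}"], simp, rule UN_I[of "{}"], simp, rule UN_I[of "%_. 0"])
   (auto simp: image_constant_conv)
 then have "Pol X Y : {{p : Pol X Y. F p : U} | F U. F : pol_tests X Y \<and> open U}"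
  by (auto intro!: exI[of _ F] exI[of _ UNIV])
 then show ?thesis
  unfolding pol_topology_def topology_generated_by_topspace by blast
qed

lemma continuous_map_pol_tests:
 assumes "F : pol_tests X Y"
 shows "continuous_map (pol_topology X Y) euclideanreal F"
proof (clarsimp simp: continuous_map_def)
 fix U :: "real set" assume "open U"
 with assms show "openin (pol_topology X Y) {p : Pol X Y. F p : U}"
  unfolding pol_topology_def by (intro topology_generated_by_Basis) blast
qed

lemma continuous_map_pol_test:
 assumes "A : sets X" "B : sets Y" "continuous_on {0<..} ph" "bounded (ph ` {0<..})"
 shows "continuous_map (pol_topology X Y) euclideanreal (pol_test A B ph)"
proof (rule continuous_map_eq)
 show "continuous_map (pol_topology X Y) euclideanreal (%p. integral\<^sup>L (rpos_pushforward A B p) ph)"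
  by (rule continuous_map_pol_tests) (use assms in \<open>auto simp: pol_tests_def\<close>)
 show "integral\<^sup>L (rpos_pushforward A B p) ph = pol_test A B ph p"
  if "p : topspace (pol_topology X Y)" for p
  using that assms
  by (intro integral_rpos_pushforward[of p X Y])
   (auto simp: sets_Pol continuous_on_rpos_measurable)
qed

text \<open>A weaker demand than uniform approximation: the error bound H may vary with the point,
  provided that it is continuous and small at x0. Tails of measures are controlled in just this way,
  near each polymorphism but not uniformly.\<close>

lemma continuous_map_local_approx:
 fixes F :: "'a => real"
 assumes approx: "!!x0 e. x0 : topspace T ==> 0 < e ==>
   \<exists>G H. continuous_map T euclideanreal G \<and> continuous_map T euclideanreal H \<and>
    (\<forall>x\<in>topspace T. \<bar>F x - G x\<bar> <= H x) \<and> H x0 < e"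
 shows "continuous_map T euclideanreal F"
proof (clarsimp simp: continuous_map_def)
 fix U :: "real set" assume U: "open U"
 show "openin T {x : topspace T. F x : U}"
 proof (subst openin_subopen, intro ballI)
  fix x0 assume "x0 : {x : topspace T. F x : U}"
  then have x0: "x0 : topspace T" "F x0 : U" by auto
  with U obtain e where e: "e > 0" "!!y. \<bar>y - F x0\<bar> < e ==> y : U"
   unfolding open_dist by (metis dist_real_def)
  obtain G H where G: "continuous_map T euclideanreal G" and H: "continuous_map T euclideanreal H"
   and GH: "\<forall>x\<in>topspace T. \<bar>F x - G x\<bar> <= H x" "H x0 < e / 4"
   using approx[OF x0(1), of "e/4"] e by auto
  define V where "V = {x : topspace T. G x : {G x0 - e/4<..<G x0 + e/4}} \<inter> {x : topspace T. H x : {..<e/4}}"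
  have "openin T V"
   unfolding V_def
   by (intro openin_Int openin_continuous_map_preimage[OF G] openin_continuous_map_preimage[OF H])
    auto
  moreover have "x0 : V" using x0 e GH by (auto simp: V_def)
  moreover have "V \<subseteq> {x : topspace T. F x : U}"
  proof
   fix x assume x: "x : V"
   then have "\<bar>F x - F x0\<bar> < e"
    using GH(1)[rule_format, of x] GH(1)[rule_format, of x0] GH(2) x0 by (auto simp: V_def)
   with e x show "x : {x : topspace T. F x : U}" by (auto simp: V_def)
  qed
  ultimately show "\<exists>V. openin T V \<and> x0 : V \<and> V \<subseteq> {x : topspace T. F x : U}" by blast
 qed
qed

lemma continuous_map_uniform_approx:
 fixes F :: "'a => real"
 assumes "!!e. 0 < e ==> \<exists>G. continuous_map T euclideanreal G \<and> (\<forall>x\<in>topspace T. \<bar>F x - G x\<bar> <= e)"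
 shows "continuous_map T euclideanreal F"
proof (rule continuous_map_local_approx)
 fix x0 and e :: real assume "e > 0"
 with assms[of "e/2"] obtain G where "continuous_map T euclideanreal G" "\<forall>x\<in>topspace T. \<bar>F x - G x\<bar> <= e/2"
  by auto
 with \<open>e > 0\<close> show "\<exists>G H. continuous_map T euclideanreal G \<and> continuous_map T euclideanreal H \<and>
    (\<forall>x\<in>topspace T. \<bar>F x - G x\<bar> <= H x) \<and> H x0 < e"
  by (intro exI[of _ G] exI[of _ "%_. e/2"]) auto
qed

text \<open>Continuous functions of compact support on the multiplicative group of positive reals,
  whose compact sets are bounded in ln t.\<close>

definition cc :: "(real => real) => bool" where
 "cc ph \<longleftrightarrow> continuous_on {0<..} ph \<and> (\<exists>n::nat. \<forall>t>0. real n <= \<bar>ln t\<bar> --> ph t = 0)"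

text \<open>A tent that is piecewise linear in ln t: it equals 1 for |ln t| up to n and vanishes
  from n + 1 on.\<close>

definition cutoff :: "nat => real => real" where
 "cutoff n t = max 0 (min 1 (real n + 1 - \<bar>ln t\<bar>))"

lemma cutoff_bounds: "0 <= cutoff n t" "cutoff n t <= 1" "\<bar>cutoff n t\<bar> <= 1" "\<bar>1 - cutoff n t\<bar> <= 1"
 by (auto simp: cutoff_def)

lemma abs_mult_cutoff: "\<bar>a * cutoff n t\<bar> <= \<bar>a\<bar>"
 using mult_left_le[of "\<bar>cutoff n t\<bar>" "\<bar>a\<bar>"] cutoff_bounds(3)[of n t] by (simp only: abs_mult abs_ge_zero)

lemma cutoff_eq_1: "\<bar>ln t\<bar> <= real n ==> cutoff n t = 1"
 by (auto simp: cutoff_def)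

lemma continuous_on_cutoff [continuous_intros]: "continuous_on {0<..} (cutoff n)"
 unfolding cutoff_def[abs_def] by (intro continuous_intros) auto

lemma cutoff_measurable [measurable]: "cutoff n : BM rpos"
 by (rule continuous_on_rpos_measurable) (rule continuous_on_cutoff)

lemma tendsto_cutoff: "(%n. cutoff n t) \<longlonglongrightarrow> 1"
proof (rule tendsto_eventually, rule eventually_sequentiallyI)
 fix n assume "nat \<lceil>\<bar>ln t\<bar>\<rceil> <= n"
 then show "cutoff n t = 1" by (intro cutoff_eq_1) linarith
qed

lemma indicator_cutoff_bound:
 assumes "\<bar>c\<bar> <= d"
 shows "\<bar>ind A x * ind B y * c - ind A x * ind B y * c * cutoff n t\<bar> <= d * (1 - cutoff n t)"
proof -
 have "ind A x * ind B y * c - ind A x * ind B y * c * cutoff n t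
   = ind A x * ind B y * c * (1 - cutoff n t)"
  by (simp add: right_diff_distrib)
 then have "\<bar>ind A x * ind B y * c - ind A x * ind B y * c * cutoff n t\<bar>
  = \<bar>ind A x * ind B y * c\<bar> * \<bar>1 - cutoff n t\<bar>"
  by (simp only: abs_mult)
 also have "\<bar>1 - cutoff n t\<bar> = 1 - cutoff n t"
  using cutoff_bounds[of n t] by simp
 also have "\<bar>ind A x * ind B y * c\<bar> * (1 - cutoff n t) <= d * (1 - cutoff n t)"
  using assms cutoff_bounds[of n t] by (intro mult_right_mono) (auto simp: indicator_def)
 finally show ?thesis .
qed

lemma cc_cutoff_mult:
 assumes "continuous_on {0<..} ph" shows "cc (%t. ph t * cutoff n t)"
 unfolding cc_def
proof (intro conjI exI allI impI)
 show "continuous_on {0<..} (%t. ph t * cutoff n t)"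
  by (intro continuous_intros assms)
 show "real (Suc n) <= \<bar>ln t\<bar> ==> ph t * cutoff n t = 0" for t
  by (auto simp: cutoff_def)
qed

lemma cc_continuous: "cc ph ==> continuous_on {0<..} ph" by (simp add: cc_def)

lemma cc_measurable: "cc ph ==> ph : BM rpos"
 by (intro continuous_on_rpos_measurable cc_continuous)

lemma cc_bounded:
 assumes "cc ph" obtains M where "M > 0" "!!t. t > 0 ==> \<bar>ph t\<bar> <= M"
proof -
 from assms obtain n :: nat where n: "!!t. t > 0 ==> real n <= \<bar>ln t\<bar> ==> ph t = 0"
  and c: "continuous_on {0<..} ph" by (auto simp: cc_def)
 have "compact (ph ` {exp (- real n)..exp (real n)})"
  by (intro compact_continuous_image continuous_on_subset[OF c] compact_Icc)
   (auto intro: less_le_trans[OF exp_gt_zero])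
 then obtain M where M: "M > 0" "!!t. t : {exp (- real n)..exp (real n)} ==> \<bar>ph t\<bar> <= M"
  by (fastforce dest!: compact_imp_bounded simp: bounded_pos)
 have "\<bar>ph t\<bar> <= M" if t: "t > 0" for t
 proof (cases "real n <= \<bar>ln t\<bar>")
  case True then show ?thesis using n[OF t] M by auto
 next
  case False
  then have "exp (- real n) <= exp (ln t)" "exp (ln t) <= exp (real n)"
   unfolding exp_le_cancel_iff by linarith+
  then have "t : {exp (- real n)..exp (real n)}" using t by simp
  then show ?thesis by (rule M)
 qed
 with M that show ?thesis by blast
qed

lemma cc_bounded_image: assumes "cc ph" shows "bounded (ph ` {0<..})"
proof -
 obtain M where "!!t. t > 0 ==> \<bar>ph t\<bar> <= M" using cc_bounded[OF assms] by metis
 then show ?thesis by (auto simp: bounded_iff intro!: exI[of _ M])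
qed

lemma pol_integrable_dominated:
 fixes f :: "_ => 'b::{banach, second_countable_topology}"
 assumes p: "p : Pol X Y" and [simp]: "prob_space X" "prob_space Y"
  and [measurable]: "f : BM (X >< (Y >< rpos))"
  and le: "!!z. z : space p ==> norm (f z) <= c * (1 + thd z)"
 shows "integrable p f"
proof (rule B_integrable_bound)
 interpret prob_space p using Pol_prob_space[OF p] by simp
 note sets_Pol [OF p, measurable_cong]
 show "integrable p (%z. c * (1 + thd z))"
  by (intro B_integrable_add integrable_mult_right integrable_const
    Pol_integrable_t[OF p]) simp
 show "f : BM p" by measurable
 show "AE z in p. norm (f z) <= norm (c * (1 + thd z))"
  by (rule AE_I2) (use le in force)
qed

lemma pol_integrable_bounded:
 fixes f :: "_ => 'b::{banach, second_countable_topology}"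
 assumes p: "p : Pol X Y" and "prob_space X" "prob_space Y"
  and "f : BM (X >< (Y >< rpos))"
  and le: "!!z. z : space p ==> norm (f z) <= c"
 shows "integrable p f"
proof (rule pol_integrable_dominated[OF assms(1-4)])
 fix z assume z: "z : space p"
 then have "thd z > 0" by (auto simp: space_Pol[OF p])
 moreover have "0 <= c" by (rule order.trans[OF norm_ge_zero le[OF z]])
 ultimately have "c * 1 <= c * (1 + thd z)" by (intro mult_left_mono) auto
 with le[OF z] show "norm (f z) <= c * (1 + thd z)" by simp
qed

text \<open>Compactly supported tests suffice because p and t p always have mass 1. If a cutoff
  captures almost all of this mass at x0, then by continuity it does so nearby, and the part of a
  bounded test beyond the cutoff is small there.\<close>

lemma continuous_map_into_pol_topology:
 assumes X: "prob_space X" and Y: "prob_space Y"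
  and F: "!!x. x : topspace T ==> F x : Pol X Y"
  and test: "!!A B ph. A : sets X ==> B : sets Y ==> cc ph ==>
   continuous_map T euclideanreal (%x. pol_test A B ph (F x))"
 shows "continuous_map T (pol_topology X Y) F"
proof -
 \<comment> \<open>The weights w = 1 and w = t produce the two families of tests of the topology;
   \<open>w1\<close> is the conservation of mass.\<close>
 have weighted: "continuous_map T euclideanreal (%x. pol_test A B (%t. w t * ph t) (F x))"
  if A [measurable]: "A : sets X" and B [measurable]: "B : sets Y" and ph: "continuous_on {0<..} ph" "bounded (ph ` {0<..})"
   and w: "continuous_on {0<..} w" "!!t. t > 0 ==> 0 < w t \<and> w t <= 1 + t"
   and w1: "!!p. p : Pol X Y ==> (LINT z|p. w (thd z)) = 1"
  for A B ph w
 proof (rule continuous_map_local_approx)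
  fix x0 and e :: real assume x0: "x0 : topspace T" and e: "0 < e"
  have [measurable]: "w : BM rpos" "ph : BM rpos"
   using w ph by (auto intro: continuous_on_rpos_measurable)
  obtain M where M: "M > 0" "!!t. t > 0 ==> \<bar>ph t\<bar> <= M"
   using ph(2) by (auto simp: bounded_pos)
  have wint: "integrable p (%z. w (thd z))" if p: "p : Pol X Y" for p
  proof (rule pol_integrable_dominated[OF p X Y, where c = 1])
   fix z assume "z : space p"
   then have "thd z > 0" by (auto simp: space_Pol[OF p])
   then show "norm (w (thd z)) <= 1 * (1 + thd z)"
    using w(2)[of "thd z"] by simp
  qed measurable
  have "(%n. LINT z|(F x0). w (thd z) * cutoff n (thd z)) \<longlonglongrightarrow> (LINT z|(F x0). w (thd z) * 1)"
  proof (rule integral_dominated_convergence[where w = "%z. w (thd z)"])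
   note sets_Pol [OF F[OF x0], measurable_cong]
   show "(%z. w (thd z) * 1) : BM (F x0)" by measurable
   show "(%z. w (thd z) * cutoff n (thd z)) : BM (F x0)" for n by measurable
   show "integrable (F x0) (%z. w (thd z))" by (rule wint[OF F[OF x0]])
   show "AE z in F x0. (%n. w (thd z) * cutoff n (thd z)) \<longlonglongrightarrow> w (thd z) * 1"
    by (intro AE_I2 tendsto_intros tendsto_cutoff)
   show "AE z in F x0. norm (w (thd z) * cutoff n (thd z)) <= w (thd z)" for n
   proof (rule AE_I2)
    fix z assume "z : space (F x0)"
    then have "thd z > 0" by (auto simp: space_Pol[OF F[OF x0]])
    then have "\<bar>w (thd z)\<bar> = w (thd z)" using w(2) by (intro abs_of_pos) blast
    then show "norm (w (thd z) * cutoff n (thd z)) <= w (thd z)"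
    using abs_mult_cutoff[of "w (thd z)" n "thd z"] by simp
   qed
  qed
  then have "(%n. LINT z|(F x0). w (thd z) * cutoff n (thd z)) \<longlonglongrightarrow> 1"
   by (simp add: w1[OF F[OF x0]])
  then have "\<forall>\<^sub>F n in sequentially. 1 - e / M < (LINT z|(F x0). w (thd z) * cutoff n (thd z))"
   by (rule order_tendstoD) (use e M in auto)
  then obtain n where n: "1 - e / M < (LINT z|(F x0). w (thd z) * cutoff n (thd z))"
   by (auto simp: eventually_sequentially)
  define G where "G x = pol_test A B (%t. (w t * ph t) * cutoff n t) (F x)" for x
  \<comment> \<open>M times the w-mass beyond the cutoff, expressed by a compactly supported test so
    that it is continuous in x.\<close>
  define H where "H x = M * (1 - pol_test (space X) (space Y) (%t. w t * cutoff n t) (F x))" for x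
  have top: "pol_test (space X) (space Y) (%t. w t * cutoff n t) p = (LINT z|p. w (thd z) * cutoff n (thd z))"
   if p: "p : Pol X Y" for p
   unfolding pol_test_def
   by (rule B_integral_cong) (auto simp: space_Pol[OF p])
  have "\<bar>pol_test A B (%t. w t * ph t) (F x) - G x\<bar> <= H x" if x: "x : topspace T" for x
  proof -
   define p where "p = F x"
   have p: "p : Pol X Y" using F[OF x] by (simp add: p_def)
   note sets_Pol [OF p, measurable_cong]
   let ?f = "%z. ind A (fst z) * ind B (mid z) * (w (thd z) * ph (thd z))"
   have le1: "\<bar>w t * ph t\<bar> <= M * (1 + t)" if "t > 0" for t
    using w(2)[OF that] M(2)[OF that] M(1)
    by (subst abs_mult, subst mult.commute) (intro mult_mono, auto)
   have i1: "integrable p ?f"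
    by (rule pol_integrable_dominated[OF p X Y, where c = M])
    (use le1 M in \<open>auto simp: space_Pol[OF p] indicator_def mult_nonneg_nonneg\<close>)
   have i2: "integrable p (%z. ?f z * cutoff n (thd z))"
   proof (rule B_integrable_bound[OF i1])
    show "AE z in p. norm (?f z * cutoff n (thd z)) <= norm (?f z)"
    by (intro AE_I2) (simp only: real_norm_def abs_mult_cutoff)
   qed measurable
   have i3: "integrable p (%z. w (thd z) * cutoff n (thd z))"
   proof (rule B_integrable_bound[OF wint[OF p]])
    show "AE z in p. norm (w (thd z) * cutoff n (thd z)) <= norm (w (thd z))"
    by (intro AE_I2) (simp only: real_norm_def abs_mult_cutoff)
   qed measurable
   have "pol_test A B (%t. w t * ph t) p - pol_test A B (%t. (w t * ph t) * cutoff n t) p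
    = (LINT z|p. ?f z - ?f z * cutoff n (thd z))"
    unfolding pol_test_def by (subst B_integral_diff[OF i1 i2]) (simp add: ac_simps)
   also have "\<bar>...\<bar> <= (LINT z|p. M * (w (thd z) - w (thd z) * cutoff n (thd z)))"
   proof (rule abs_integral_le)
    fix z assume "z : space p"
    then have t: "thd z > 0" by (auto simp: space_Pol[OF p])
    have "\<bar>?f z - ?f z * cutoff n (thd z)\<bar> <= 1 * (w (thd z) * M) * (1 - cutoff n (thd z))"
    using w(2)[OF t] M(2)[OF t] M(1)
    by (simp only: mult_1, intro indicator_cutoff_bound, subst abs_mult) (intro mult_mono, auto)
    then show "\<bar>?f z - ?f z * cutoff n (thd z)\<bar> <= M * (w (thd z) - w (thd z) * cutoff n (thd z))"
    by (simp add: algebra_simps)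
   qed (use i1 i2 i3 wint[OF p] in auto)
   also have "... = M * (1 - (LINT z|p. w (thd z) * cutoff n (thd z)))"
    by (subst integral_mult_right_zero, subst B_integral_diff[OF wint[OF p] i3]) (simp add: w1[OF p])
   also have "... = H x" by (simp add: H_def top[OF p] flip: p_def)
   finally show ?thesis by (simp add: G_def p_def)
  qed
  moreover have "continuous_map T euclideanreal G"
   unfolding G_def
   by (intro test A B cc_cutoff_mult continuous_intros w ph)
  moreover have "continuous_map T euclideanreal H"
   unfolding H_def
   by (intro continuous_map_real_mult continuous_map_diff continuous_map_const[THEN iffD2] test cc_cutoff_mult w) auto
  moreover have "H x0 < e"
   using n M(1) by (simp add: H_def top[OF F[OF x0]] field_simps)
  ultimately show "\<exists>G H. continuous_map T euclideanreal G \<and> continuous_map T euclideanreal H \<and>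
    (\<forall>x\<in>topspace T. \<bar>pol_test A B (%t. w t * ph t) (F x) - G x\<bar> <= H x) \<and> H x0 < e"
   by blast
 qed
 have "continuous_map T euclideanreal (%x. Q (F x))" if Q: "Q : pol_tests X Y" for Q
 proof -
  from Q obtain A B ph where *: "A : sets X" "B : sets Y" "continuous_on {0<..} ph" "bounded (ph ` {0<..})"
   and Q': "Q = (%p. integral\<^sup>L (rpos_pushforward A B p) ph) \<or> Q = (%p. integral\<^sup>L (rpos_pushforward A B (t_times p)) ph)"
   unfolding pol_tests_def by auto
  have [measurable]: "ph : BM rpos" by (intro continuous_on_rpos_measurable *)
  from Q' show ?thesis
  proof
   assume Q: "Q = (%p. integral\<^sup>L (rpos_pushforward A B p) ph)"
   have "continuous_map T euclideanreal (%x. pol_test A B (%t. 1 * ph t) (F x))"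
    by (rule weighted) (use * prob_space.prob_space[OF Pol_prob_space[OF _ X]] in auto)
   then show ?thesis
    by (rule continuous_map_eq) (simp add: Q integral_rpos_pushforward[OF sets_Pol[OF F]] *)
  next
   assume Q: "Q = (%p. integral\<^sup>L (rpos_pushforward A B (t_times p)) ph)"
   have "continuous_map T euclideanreal (%x. pol_test A B (%t. t * ph t) (F x))"
    by (rule weighted) (use * Pol_integral_t[OF _ Y] in \<open>auto intro: continuous_intros\<close>)
   then show ?thesis
    by (rule continuous_map_eq)
    (simp add: Q integral_rpos_pushforward[of _ X Y] sets_Pol[OF F] pol_test_t_times[OF sets_Pol[OF F]] *)
  qed
 qed
 note cont = this
 show ?thesis
  unfolding pol_topology_def
 proof (rule continuous_on_generated_topo)
  fix U assume "U : {{p : Pol X Y. Q p : V} |Q V. Q : pol_tests X Y \<and> open V}"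
  then obtain Q V where U: "U = {p : Pol X Y. Q p : V}" "Q : pol_tests X Y" "open V" by blast
  have "F -` U \<inter> topspace T = {x : topspace T. Q (F x) : V}" using F by (auto simp: U)
  then show "openin T (F -` U \<inter> topspace T)"
   using cont[OF U(2)] U(3) by (simp add: continuous_map_def)
 next
  show "F ` topspace T \<subseteq> \<Union>{{p : Pol X Y. F p : U} |F U. F : pol_tests X Y \<and> open U}"
   using F topspace_pol_topology[of X Y] unfolding pol_topology_def topology_generated_by_topspace by blast
 qed
qed

text \<open>g is rounded down to multiples of e; since g is bounded, finitely many multiples
  occur.\<close>

lemma bounded_measurable_approx:
 fixes g :: "'y => real"
 assumes [measurable]: "g : BM Y" and g: "!!y. y : space Y ==> \<bar>g y\<bar> <= M" and e: "e > 0"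
 shows "\<exists>(I::int set) c B. finite I \<and> (\<forall>i\<in>I. B i : sets Y) \<and>
  (\<forall>y\<in>space Y. \<bar>g y - (\<Sum>i\<in>I. c i * ind (B i) y)\<bar> <= e)"
proof (intro exI conjI ballI)
 let ?I = "{- \<lceil>M / e\<rceil> - 1 .. \<lceil>M / e\<rceil> + 1}"
 let ?B = "%i. {y : space Y. \<lfloor>g y / e\<rfloor> = i}"
 show "finite ?I" by simp
 show "?B i : sets Y" for i by measurable
 fix y assume y: "y : space Y"
 have "\<bar>g y / e\<bar> <= M / e" using g[OF y] e by (simp add: abs_divide divide_right_mono)
 then have "g y / e <= M / e" "- (M / e) <= g y / e" by linarith+
 then have "\<lfloor>g y / e\<rfloor> : ?I" unfolding atLeastAtMost_iff by linarith
 then have "(\<Sum>i\<in>?I. (e * of_int i) * ind (?B i) y) = e * of_int \<lfloor>g y / e\<rfloor>"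
  using y by (subst sum.remove[where x = "\<lfloor>g y / e\<rfloor>"]) (auto intro!: sum.neutral simp: indicator_def)
 moreover have "\<bar>g y - e * of_int \<lfloor>g y / e\<rfloor>\<bar> <= e"
 proof -
  have "\<bar>g y / e - of_int \<lfloor>g y / e\<rfloor>\<bar> <= 1" by linarith
  then have "e * \<bar>g y / e - of_int \<lfloor>g y / e\<rfloor>\<bar> <= e * 1" using e by (intro mult_left_mono) auto
  also have "e * \<bar>g y / e - of_int \<lfloor>g y / e\<rfloor>\<bar> = \<bar>e * (g y / e - of_int \<lfloor>g y / e\<rfloor>)\<bar>"
   using e by (simp add: abs_mult)
  finally show ?thesis using e by (simp add: right_diff_distrib)
 qed
 ultimately show "\<bar>g y - (\<Sum>i\<in>?I. (e * of_int i) * ind (?B i) y)\<bar> <= e" by simp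
qed

text \<open>Here g will be the density in y contributed by the other, fixed factor of a product.
  Step functions approximate g uniformly, and ph is bounded, so the error is uniform in p.\<close>

lemma continuous_map_pol_snd:
 assumes X: "prob_space X" and Y: "prob_space Y"
  and A [measurable]: "A : sets X" and g [measurable]: "g : BM Y"
  and gM: "!!y. y : space Y ==> \<bar>g y\<bar> <= M" and ph: "cc ph"
 shows "continuous_map (pol_topology X Y) euclideanreal
   (%p. LINT z|p. ind A (fst z) * g (mid z) * ph (thd z))"
proof (rule continuous_map_uniform_approx)
 fix e :: real assume e: "e > 0"
 have [measurable]: "ph : BM rpos" using cc_measurable[OF ph] .
 obtain K where K: "K > 0" "!!t. t > 0 ==> \<bar>ph t\<bar> <= K" using cc_bounded[OF ph] by metis
 have "e / K > 0" using e K by simp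
 from bounded_measurable_approx[where Y = Y, OF g _ this, of M] gM
 obtain I :: "int set" and c B where I: "finite I" and "\<forall>i\<in>I. B i : sets Y"
  and "\<forall>y\<in>space Y. \<bar>g y - (\<Sum>i\<in>I. c i * ind (B i) y)\<bar> <= e / K"
  by blast
 then have B: "!!i. i : I ==> B i : sets Y"
  and app: "!!y. y : space Y ==> \<bar>g y - (\<Sum>i\<in>I. c i * ind (B i) y)\<bar> <= e / K"
  by blast+
 define G where "G p = (\<Sum>i\<in>I. c i * pol_test A (B i) ph p)" for p
 have "continuous_map (pol_topology X Y) euclideanreal G"
  unfolding G_def using I B
  by (intro continuous_map_sum continuous_map_real_mult continuous_map_const[THEN iffD2] continuous_map_pol_test A
   cc_continuous[OF ph] cc_bounded_image[OF ph]) auto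
 moreover have "\<bar>(LINT z|p. ind A (fst z) * g (mid z) * ph (thd z)) - G p\<bar> <= e"
  if p: "p : Pol X Y" for p
 proof -
  interpret p: prob_space p using Pol_prob_space[OF p X] .
  note sets_Pol [OF p, measurable_cong]
  note B [measurable]
  obtain y0 where "y0 : space Y" using prob_space.not_empty[OF Y] by auto
  then have M0: "0 <= M" using order.trans[OF abs_ge_zero gM] by blast
  have i1: "integrable p (%z. ind A (fst z) * g (mid z) * ph (thd z))"
   by (rule pol_integrable_bounded[OF p X Y, where c = "M * K"])
    (use K gM M0 in \<open>auto simp: space_Pol[OF p] abs_mult indicator_def intro!: mult_mono\<close>)
  have i2: "integrable p (%z. ind A (fst z) * ind (B i) (mid z) * ph (thd z))"
   if "i : I" for i
  proof -
   have [measurable]: "B i : sets Y" using B that by auto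
   show ?thesis
   by (rule pol_integrable_bounded[OF p X Y, where c = "K"])
    (use K in \<open>auto simp: space_Pol[OF p] abs_mult indicator_def\<close>)
  qed
  have G: "G p = (LINT z|p. (\<Sum>i\<in>I. c i * (ind A (fst z) * ind (B i) (mid z) * ph (thd z))))"
   unfolding G_def pol_test_def by (subst B_integral_sum) (use i2 in auto)
  have i3: "integrable p (%z. \<Sum>i\<in>I. c i * (ind A (fst z) * ind (B i) (mid z) * ph (thd z)))"
   by (intro B_integrable_sum integrable_mult_right i2)
  have "\<bar>(LINT z|p. ind A (fst z) * g (mid z) * ph (thd z)) - G p\<bar> =
   \<bar>(LINT z|p. ind A (fst z) * g (mid z) * ph (thd z) -
    (\<Sum>i\<in>I. c i * (ind A (fst z) * ind (B i) (mid z) * ph (thd z))))\<bar>"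
   unfolding G by (subst B_integral_diff[OF i1 i3]) simp
  also have "... <= (LINT z|p. e)"
  proof (rule abs_integral_le)
   fix z assume "z : space p"
   then have z: "mid z : space Y" "thd z > 0" by (auto simp: space_Pol[OF p])
   have "ind A (fst z) * g (mid z) * ph (thd z) -
    (\<Sum>i\<in>I. c i * (ind A (fst z) * ind (B i) (mid z) * ph (thd z)))
    = ind A (fst z) * ((g (mid z) - (\<Sum>i\<in>I. c i * ind (B i) (mid z))) * ph (thd z))"
    by (simp add: algebra_simps sum_distrib_left)
   also have "\<bar>...\<bar> <= 1 * (e / K * K)"
    unfolding abs_mult
    by (intro mult_mono app z K(2)) (use K e in \<open>auto simp: indicator_def\<close>)
   finally show "\<bar>ind A (fst z) * g (mid z) * ph (thd z) -
    (\<Sum>i\<in>I. c i * (ind A (fst z) * ind (B i) (mid z) * ph (thd z)))\<bar> <= e"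
    using K by simp
  qed (use i1 i3 in auto)
  finally show ?thesis by (simp add: p.prob_space)
 qed
 ultimately show "\<exists>G. continuous_map (pol_topology X Y) euclideanreal G \<and>
   (\<forall>p\<in>topspace (pol_topology X Y). \<bar>(LINT z|p. ind A (fst z) * g (mid z) * ph (thd z)) - G p\<bar> <= e)"
  by auto
qed

lemma continuous_map_pol_fst:
 assumes X: "prob_space X" and Y: "prob_space Y"
  and B [measurable]: "B : sets Y" and g [measurable]: "g : BM X"
  and gM: "!!y. y : space X ==> \<bar>g y\<bar> <= M" and ph: "cc ph"
 shows "continuous_map (pol_topology X Y) euclideanreal
   (%p. LINT z|p. g (fst z) * ind B (mid z) * ph (thd z))"
proof (rule continuous_map_uniform_approx)
 fix e :: real assume e: "e > 0"
 have [measurable]: "ph : BM rpos" using cc_measurable[OF ph] .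
 obtain K where K: "K > 0" "!!t. t > 0 ==> \<bar>ph t\<bar> <= K" using cc_bounded[OF ph] by metis
 have "e / K > 0" using e K by simp
 from bounded_measurable_approx[where Y = X, OF g _ this, of M] gM
 obtain I :: "int set" and c A where I: "finite I" and "\<forall>i\<in>I. A i : sets X"
  and "\<forall>y\<in>space X. \<bar>g y - (\<Sum>i\<in>I. c i * ind (A i) y)\<bar> <= e / K"
  by blast
 then have A: "!!i. i : I ==> A i : sets X"
  and app: "!!y. y : space X ==> \<bar>g y - (\<Sum>i\<in>I. c i * ind (A i) y)\<bar> <= e / K"
  by blast+
 define G where "G p = (\<Sum>i\<in>I. c i * pol_test (A i) B ph p)" for p
 have "continuous_map (pol_topology X Y) euclideanreal G"
  unfolding G_def using I A
  by (intro continuous_map_sum continuous_map_real_mult continuous_map_const[THEN iffD2] continuous_map_pol_test B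
   cc_continuous[OF ph] cc_bounded_image[OF ph]) auto
 moreover have "\<bar>(LINT z|p. g (fst z) * ind B (mid z) * ph (thd z)) - G p\<bar> <= e"
  if p: "p : Pol X Y" for p
 proof -
  interpret p: prob_space p using Pol_prob_space[OF p X] .
  note sets_Pol [OF p, measurable_cong]
  obtain y0 where "y0 : space X" using prob_space.not_empty[OF X] by auto
  then have M0: "0 <= M" using order.trans[OF abs_ge_zero gM] by blast
  have i1: "integrable p (%z. g (fst z) * ind B (mid z) * ph (thd z))"
   by (rule pol_integrable_bounded[OF p X Y, where c = "M * K"])
    (use K gM M0 in \<open>auto simp: space_Pol[OF p] abs_mult indicator_def intro!: mult_mono\<close>)
  have i2: "integrable p (%z. ind (A i) (fst z) * ind B (mid z) * ph (thd z))"
   if "i : I" for i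
  proof -
   have [measurable]: "A i : sets X" using A that by auto
   show ?thesis
   by (rule pol_integrable_bounded[OF p X Y, where c = "K"])
    (use K in \<open>auto simp: space_Pol[OF p] abs_mult indicator_def\<close>)
  qed
  have G: "G p = (LINT z|p. (\<Sum>i\<in>I. c i * (ind (A i) (fst z) * ind B (mid z) * ph (thd z))))"
   unfolding G_def pol_test_def by (subst B_integral_sum) (use i2 in auto)
  have i3: "integrable p (%z. \<Sum>i\<in>I. c i * (ind (A i) (fst z) * ind B (mid z) * ph (thd z)))"
   by (intro B_integrable_sum integrable_mult_right i2)
  have "\<bar>(LINT z|p. g (fst z) * ind B (mid z) * ph (thd z)) - G p\<bar> =
   \<bar>(LINT z|p. g (fst z) * ind B (mid z) * ph (thd z) -
    (\<Sum>i\<in>I. c i * (ind (A i) (fst z) * ind B (mid z) * ph (thd z))))\<bar>"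
   unfolding G by (subst B_integral_diff[OF i1 i3]) simp
  also have "... <= (LINT z|p. e)"
  proof (rule abs_integral_le)
   fix z assume "z : space p"
   then have z: "fst z : space X" "thd z > 0" by (auto simp: space_Pol[OF p])
   have "g (fst z) * ind B (mid z) * ph (thd z) -
    (\<Sum>i\<in>I. c i * (ind (A i) (fst z) * ind B (mid z) * ph (thd z)))
    = ind B (mid z) * ((g (fst z) - (\<Sum>i\<in>I. c i * ind (A i) (fst z))) * ph (thd z))"
    by (simp add: algebra_simps sum_distrib_left)
   also have "\<bar>...\<bar> <= 1 * (e / K * K)"
    unfolding abs_mult
    by (intro mult_mono app z K(2)) (use K e in \<open>auto simp: indicator_def\<close>)
   finally show "\<bar>g (fst z) * ind B (mid z) * ph (thd z) -
    (\<Sum>i\<in>I. c i * (ind (A i) (fst z) * ind B (mid z) * ph (thd z)))\<bar> <= e"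
    using K by simp
  qed (use i1 i3 in auto)
  finally show ?thesis by (simp add: p.prob_space)
 qed
 ultimately show "\<exists>G. continuous_map (pol_topology X Y) euclideanreal G \<and>
   (\<forall>p\<in>topspace (pol_topology X Y). \<bar>(LINT z|p. g (fst z) * ind B (mid z) * ph (thd z)) - G p\<bar> <= e)"
  by auto
qed

text \<open>The square root of t is the geometric mean of 1 and t. Where the cutoff acts, one of the
  two exceeds it by the factor exp (n/2): the number 1 if t <= exp (-n), and t if t >= exp
  n.\<close>

lemma sqrt_cutoff_bound:
 assumes t: "t > 0" shows "sqrt t * (1 - cutoff n t) <= exp (- real n / 2) * (1 + t)"
proof (cases "\<bar>ln t\<bar> <= real n")
 case True then show ?thesis using t by (simp add: cutoff_eq_1)
next
 case False
 have "exp (ln t / 2) = exp (ln (sqrt t))" using t by (simp add: ln_sqrt)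
 also have "... = sqrt t" by (rule exp_ln) (rule real_sqrt_gt_zero[OF t])
 finally have s: "sqrt t = exp (ln t / 2)" ..
 have "sqrt t * (1 - cutoff n t) <= sqrt t * 1"
  by (rule mult_left_mono) (use t cutoff_bounds(1)[of n t] in simp_all)
 then have 1: "sqrt t * (1 - cutoff n t) <= sqrt t" by simp
 from False consider "ln t <= - real n" | "ln t \<ge> real n" by linarith
 then have "sqrt t <= exp (- real n / 2) * (1 + t)"
 proof cases
  case 1
  have "sqrt t <= exp (- real n / 2)" unfolding s using 1 by simp
  also have "... <= exp (- real n / 2) * (1 + t)" using t by simp
  finally show ?thesis .
 next
  case 2
  have "exp (ln t / 2) = exp (- ln t / 2) * exp (ln t)"
   unfolding exp_add[symmetric] by simp
  then have "sqrt t = exp (- ln t / 2) * t"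
   using t unfolding s by simp
  also have "... <= exp (- real n / 2) * t" using 2 t by (intro mult_right_mono) auto
  also have "... <= exp (- real n / 2) * (1 + t)" using t by simp
  finally show ?thesis .
 qed
 with 1 show ?thesis by linarith
qed

lemma sqrt_le_1_plus: "0 <= t ==> sqrt t <= 1 + t"
proof (rule real_le_lsqrt)
 assume "0 <= t"
 then show "t <= (1 + t)\<^sup>2" using zero_le_square[of t]
  by (simp only: power2_eq_square distrib_left distrib_right mult_1_left mult_1_right)
qed auto

text \<open>The tests of the topology are bounded or bounded by a multiple of t; those of size sqrt
  t are uniform limits of compactly supported ones. They occur as matrix elements of the
  representation.\<close>

lemma continuous_map_pol_sqrt:
 assumes X: "prob_space X" and Y: "prob_space Y"
  and A [measurable]: "A : sets X" and B [measurable]: "B : sets Y"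
  and \<psi>: "continuous_on {0<..} \<psi>" "!!t. t > 0 ==> \<bar>\<psi> t\<bar> <= sqrt t"
 shows "continuous_map (pol_topology X Y) euclideanreal (pol_test A B \<psi>)"
proof (rule continuous_map_uniform_approx)
 fix e :: real assume e: "e > 0"
 have [measurable]: "\<psi> : BM rpos" using \<psi> by (intro continuous_on_rpos_measurable)
 \<comment> \<open>The 2 is the integral of 1 + t against any polymorphism.\<close>
 have "((%n. exp (- real n / 2) * 2) \<longlongrightarrow> 0) sequentially" by real_asymp
 then have "\<forall>\<^sub>F n in sequentially. exp (- real n / 2) * 2 < e" by (rule order_tendstoD) (rule e)
 then obtain n where n: "exp (- real n / 2) * 2 < e" by (auto simp: eventually_sequentially)
 let ?G = "pol_test A B (%t. \<psi> t * cutoff n t)"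
 have "cc (%t. \<psi> t * cutoff n t)" by (intro cc_cutoff_mult \<psi>)
 then have "continuous_map (pol_topology X Y) euclideanreal ?G"
  by (intro continuous_map_pol_test A B cc_continuous cc_bounded_image)
 moreover have "\<bar>pol_test A B \<psi> p - ?G p\<bar> <= e" if p: "p : Pol X Y" for p
 proof -
  interpret p: prob_space p using Pol_prob_space[OF p X] .
  note sets_Pol [OF p, measurable_cong]
  let ?f = "%z. ind A (fst z) * ind B (mid z) * \<psi> (thd z)"
  have le: "norm (?f z) <= 1 + thd z" if "z : space p" for z
   using that \<psi>(2)[of "thd z"] sqrt_le_1_plus[of "thd z"]
   by (auto simp: space_Pol[OF p] indicator_def)
  have i1: "integrable p ?f"
   by (rule pol_integrable_dominated[OF p X Y, where c = 1]) (use le in auto)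
  have i2: "integrable p (%z. ?f z * cutoff n (thd z))"
  proof (rule B_integrable_bound[OF i1])
   show "AE z in p. norm (?f z * cutoff n (thd z)) <= norm (?f z)"
    by (intro AE_I2) (simp only: real_norm_def abs_mult_cutoff)
  qed measurable
  have "pol_test A B \<psi> p - ?G p = (LINT z|p. ?f z - ?f z * cutoff n (thd z))"
   unfolding pol_test_def by (subst B_integral_diff[OF i1 i2]) (simp add: ac_simps)
  also have "\<bar>...\<bar> <= (LINT z|p. exp (- real n / 2) * (1 + thd z))"
  proof (rule abs_integral_le)
   fix z assume "z : space p"
   then have t: "thd z > 0" by (auto simp: space_Pol[OF p])
   have "\<bar>?f z - ?f z * cutoff n (thd z)\<bar> <= 1 * sqrt (thd z) * (1 - cutoff n (thd z))"
    using indicator_cutoff_bound[OF \<psi>(2)[OF t]] by simp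
   also have "... <= exp (- real n / 2) * (1 + thd z)" using sqrt_cutoff_bound[OF t] by simp
   finally show "\<bar>?f z - ?f z * cutoff n (thd z)\<bar> <= exp (- real n / 2) * (1 + thd z)" .
  qed (use i1 i2 Pol_integrable_t[OF p Y] in auto)
  also have "... = exp (- real n / 2) * 2"
   using Pol_integrable_t[OF p Y] by (simp add: Pol_integral_t[OF p Y] p.prob_space)
  finally show ?thesis using n by simp
 qed
 ultimately show "\<exists>G. continuous_map (pol_topology X Y) euclideanreal G \<and>
   (\<forall>p\<in>topspace (pol_topology X Y). \<bar>pol_test A B \<psi> p - G p\<bar> <= e)"
  by auto
qed

section \<open>Calculus with the joint measure\<close>

text \<open>Truncation at c alters the density only on a null set, and it makes the bounds hold at
  every point.\<close>

lemma density_bounded_version: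
 fixes c :: real
 assumes Y: "prob_space Y" and k [measurable]: "k : BM Y" and c: "0 <= c"
  and le: "!!B. B : sets Y ==> (nnint Y (%y. k y * ind B y)) <= ennreal c * em Y B"
 obtains k' :: "_ => real" where "k' : BM Y" "!!y. 0 <= k' y \<and> k' y <= c"
  "!!B. B : sets Y ==> (nnint Y (%y. k y * ind B y)) = (nnint Y (%y. ennreal (k' y) * ind B y))"
proof -
 interpret Y: prob_space Y by fact
 have fin: "(nnint Y (%y. k y)) < \<infinity>"
 proof -
  have "(nnint Y (%y. k y)) = (nnint Y (%y. k y * ind (space Y) y))" by (rule nn_integral_cong) simp
  also have "... <= ennreal c" using le[OF sets.top] by (simp add: Y.emeasure_space_1)
  also have "... < \<infinity>" by simp
  finally show ?thesis .
 qed
 have ae: "AE y in Y. k y <= ennreal c"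
  by (rule AE_le_of_set_nn_integral_le[OF k _ _ fin]) (use le in \<open>auto simp: nn_integral_cmult_indicator\<close>)
 define k' where "k' y = enn2real (min (k y) (ennreal c))" for y
 have eq: "ennreal (k' y) = min (k y) (ennreal c)" for y
  unfolding k'_def by (rule ennreal_enn2real) (simp add: min_less_iff_disj)
 show ?thesis
 proof (rule that)
  show "k' : BM Y" unfolding k'_def by measurable
  show "0 <= k' y \<and> k' y <= c" for y
  proof
   show "0 <= k' y" by (simp add: k'_def)
   have "ennreal (k' y) <= ennreal c" unfolding eq by simp
   then show "k' y <= c" using c by (simp add: ennreal_le_iff)
  qed
  show "(nnint Y (%y. k y * ind B y)) = (nnint Y (%y. ennreal (k' y) * ind B y))" for B
   by (rule nn_integral_cong_AE, use ae in eventually_elim) (simp add: eq min_absorb1)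
 qed
qed

lemma sets_joint: "is_joint X Y W p q R ==> sets R = sets ((X >< (Y >< rpos)) >< (W >< rpos))"
 by (simp add: is_joint_def)

lemma space_joint: "is_joint X Y W p q R ==> space R = (space X \<times> space Y \<times> {0<..}) \<times> (space W \<times> {0<..})"
 by (drule sets_joint[THEN sets_eq_imp_space_eq]) (simp add: space_pair_measure)

context
 fixes X :: "'x measure" and Y :: "'y measure" and W :: "'w measure" and p q R
 assumes X: "prob_space X" and Y: "prob_space Y"
  and p: "p : Pol X Y" and q: "q : Pol Y W" and R: "is_joint X Y W p q R"
begin

lemma joint_eq_snd:
 assumes "F : BM (X >< (Y >< rpos))" "k : BM Y"
  "H : BM (W >< rpos)" "(nnint p (%z. F z)) < \<infinity>"
  "!!B. B : sets Y ==> (nnint p (%z. F z * ind B (mid z))) = (nnint Y (%y. k y * ind B y))"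
 shows "(nnint R (%e. F (fst e) * H (snd e))) = (nnint q (%z. k (fst z) * H (snd z)))"
 using R assms unfolding is_joint_def by blast

text \<open>The defining identity read from the side of q. Both integrals equal the integral of k h
  over Y, where k and h are the densities in y of F p and H q.\<close>

lemma joint_eq_fst:
 assumes F [measurable]: "F : BM (X >< (Y >< rpos))" and h [measurable]: "h : BM Y"
  and H [measurable]: "H : BM (W >< rpos)" and fin: "(nnint p (%z. F z)) < \<infinity>"
  and Hh: "!!B. B : sets Y ==> (nnint q (%z. H (snd z) * ind B (fst z))) = (nnint Y (%y. h y * ind B y))"
 shows "(nnint R (%e. F (fst e) * H (snd e))) = (nnint p (%z. F z * h (mid z)))"
proof -
 note sets_Pol[OF p, measurable_cong] and sets_Pol[OF q, measurable_cong]
 obtain k :: "_ => ennreal" where k [measurable]: "k : BM Y"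
  and Fk: "!!B. B : sets Y ==> (nnint p (%z. F z * ind B (mid z))) = (nnint Y (%y. k y * ind B y))"
  using Pol_snd_density_exists[OF Y p F] by metis
 have "(nnint R (%e. F (fst e) * H (snd e))) = (nnint q (%z. k (fst z) * H (snd z)))"
  by (rule joint_eq_snd[OF F k H fin Fk])
 also have "... = (nnint q (%z. H (snd z) * k (fst z)))" by (simp add: mult.commute)
 also have "... = (nnint Y (%y. h y * k y))"
  by (rule nn_integral_eq_of_sets[OF Hh]) simp_all
 also have "... = (nnint Y (%y. k y * h y))" by (simp add: mult.commute)
 also have "... = (nnint p (%z. F z * h (mid z)))"
  by (rule nn_integral_eq_of_sets[OF Fk, symmetric]) simp_all
 finally show ?thesis .
qed

lemma joint_density_fst:
 assumes H [measurable]: "H : BM (W >< rpos)" and h [measurable]: "h : BM Y"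
  and Hh: "!!B. B : sets Y ==> (nnint q (%z. H (snd z) * ind B (fst z))) = (nnint Y (%y. h y * ind B y))"
 shows "distr (density R (%e. H (snd e))) (X >< (Y >< rpos)) fst = density p (%z. h (mid z))"
proof (rule measure_eqI)
 interpret p: prob_space p by (rule Pol_prob_space[OF p X])
 note sets_joint[OF R, measurable_cong] and sets_Pol[OF p, measurable_cong]
 show "sets (distr (density R (%e. H (snd e))) (X >< (Y >< rpos)) fst) = sets (density p (%z. h (mid z)))"
  by (simp add: sets_Pol[OF p])
 fix E assume "E : sets (distr (density R (%e. H (snd e))) (X >< (Y >< rpos)) fst)"
 then have E [measurable]: "E : sets (X >< (Y >< rpos))" by simp
 have "em (distr (density R (%e. H (snd e))) (X >< (Y >< rpos)) fst) E
   = (nnint (distr (density R (%e. H (snd e))) (X >< (Y >< rpos)) fst) (%z. ind E z))" by simp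
 also have "... = (nnint R (%e. ind E (fst e) * H (snd e)))"
  by (subst nn_integral_distr) (auto simp: nn_integral_density mult.commute)
 also have "... = (nnint p (%z. ind E z * h (mid z)))"
  by (rule joint_eq_fst[OF _ h H _ Hh]) (use p.emeasure_finite in \<open>auto simp: sets_Pol[OF p] less_top[symmetric]\<close>)
 also have "... = em (density p (%z. h (mid z))) E"
  by (subst emeasure_density) (auto simp: sets_Pol[OF p] mult.commute)
 finally show "em (distr (density R (%e. H (snd e))) (X >< (Y >< rpos)) fst) E = em (density p (%z. h (mid z))) E" .
qed

lemma joint_density_snd:
 assumes F [measurable]: "F : BM (X >< (Y >< rpos))" and k [measurable]: "k : BM Y"
  and fin: "(nnint p (%z. F z)) < \<infinity>"
  and Fk: "!!B. B : sets Y ==> (nnint p (%z. F z * ind B (mid z))) = (nnint Y (%y. k y * ind B y))"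
 shows "distr (density R (%e. F (fst e))) (W >< rpos) snd = distr (density q (%z. k (fst z))) (W >< rpos) snd"
proof (rule measure_eqI)
 note sets_joint[OF R, measurable_cong] and sets_Pol[OF q, measurable_cong]
 fix D assume "D : sets (distr (density R (%e. F (fst e))) (W >< rpos) snd)"
 then have D [measurable]: "D : sets (W >< rpos)" by simp
 have "em (distr (density R (%e. F (fst e))) (W >< rpos) snd) D
   = (nnint (distr (density R (%e. F (fst e))) (W >< rpos) snd) (%z. ind D z))" by simp
 also have "... = (nnint R (%e. F (fst e) * ind D (snd e)))"
  by (subst nn_integral_distr) (auto simp: nn_integral_density)
 also have "... = (nnint q (%z. k (fst z) * ind D (snd z)))"
  by (rule joint_eq_snd[OF F k _ fin Fk]) auto
 also have "... = (nnint (distr (density q (%z. k (fst z))) (W >< rpos) snd) (%z. ind D z))"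
  by (subst nn_integral_distr) (auto simp: nn_integral_density)
 also have "... = em (distr (density q (%z. k (fst z))) (W >< rpos) snd) D" by simp
 finally show "em (distr (density R (%e. F (fst e))) (W >< rpos) snd) D = em (distr (density q (%z. k (fst z))) (W >< rpos) snd) D" .
qed simp

lemma joint_nn_integral_fst:
 assumes F [measurable]: "F : BM (X >< (Y >< rpos))"
 shows "(nnint R (%e. F (fst e))) = (nnint p (%z. F z))"
proof -
 note sets_joint[OF R, measurable_cong] and sets_Pol[OF p, measurable_cong]
 have "distr (density R (%e. 1)) (X >< (Y >< rpos)) fst = density p (%z. 1)"
  by (rule joint_density_fst[of "%_. 1" "%_. 1"])
   (use Pol_nn_integral_fst[OF q] in auto)
 then have "distr R (X >< (Y >< rpos)) fst = p" by (simp add: density_1)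
 then have "(nnint p (%z. F z)) = (nnint (distr R (X >< (Y >< rpos)) fst) (%z. F z))" by simp
 also have "... = (nnint R (%e. F (fst e)))" by (rule nn_integral_distr) auto
 finally show ?thesis ..
qed

text \<open>The density in y of the function t under p is 1, since t p projects onto Y. This yields
  the second marginal of the product.\<close>

lemma joint_nn_integral_t_snd:
 assumes H [measurable]: "H : BM (W >< rpos)"
 shows "(nnint R (%e. ennreal (thd (fst e)) * H (snd e))) = (nnint q (%z. H (snd z)))"
 using joint_eq_snd[of "%z. ennreal (thd z)" "%_. 1" H] Pol_nn_integral_snd[OF p] Pol_nn_integral_t[OF p Y] by simp

lemma prob_space_joint: "prob_space R"
proof
 have "em R (space R) = (nnint R (%e. 1))" by simp
 also have "... = (nnint p (%z. 1))" by (rule joint_nn_integral_fst) simp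
 also have "... = 1" using prob_space.emeasure_space_1[OF Pol_prob_space[OF p X]] by simp
 finally show "em R (space R) = 1" .
qed

lemma joint_unique: assumes R': "is_joint X Y W p q R'" shows "R' = R"
proof (rule measure_eqI_rectangles[of R' "X >< (Y >< rpos)" "W >< rpos" R, symmetric, THEN sym])
 let ?PP = "X >< (Y >< rpos)" and ?Q = "W >< rpos"
 interpret p: prob_space p by (rule Pol_prob_space[OF p X])
 show s': "sets R' = sets (?PP >< ?Q)" using R' by (simp add: is_joint_def)
 show s: "sets R = sets (?PP >< ?Q)" by (rule sets_joint[OF R])
 have eq: "em R' (E \<times> D) = em R (E \<times> D)" if E [measurable]: "E : sets ?PP" and D [measurable]: "D : sets ?Q" for E D
 proof -
  have Em: "(ind E :: _ => ennreal) : BM ?PP" and Dm: "(ind D :: _ => ennreal) : BM ?Q" by auto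
  have fin: "(nnint p (%z. ind E z)) < \<infinity>"
   using E p.emeasure_finite by (auto simp: sets_Pol[OF p] less_top[symmetric])
  obtain k :: "_ => ennreal" where k [measurable]: "k : BM Y"
   and Fk: "!!B. B : sets Y ==> (nnint p (%z. ind E z * ind B (mid z))) = (nnint Y (%y. k y * ind B y))"
   using Pol_snd_density_exists[OF Y p Em] by metis
  have ind: "ind (E \<times> D) e = (ind E (fst e) * ind D (snd e) :: ennreal)" for e
   by (cases e) (auto simp: indicator_def)
  have *: "em Q (E \<times> D) = (nnint Q (%e. ind E (fst e) * ind D (snd e)))" if "sets Q = sets (?PP >< ?Q)" for Q
   using that by (simp flip: ind)
  have "(nnint R' (%e. ind E (fst e) * ind D (snd e))) = (nnint q (%z. k (fst z) * ind D (snd z)))"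
   using R' Em k Dm fin Fk unfolding is_joint_def by blast
  also have "... = (nnint R (%e. ind E (fst e) * ind D (snd e)))"
   by (rule joint_eq_snd[OF Em k Dm fin Fk, symmetric])
  finally show ?thesis by (simp add: *[OF s] *[OF s'])
 qed
 then show "!!a b. a : sets ?PP ==> b : sets ?Q ==> em R' (a \<times> b) = em R (a \<times> b)" .
 have "em R' (space ?PP \<times> space ?Q) = em R (space R)"
  unfolding eq[OF sets.top sets.top] by (simp add: space_joint[OF R] space_pair_measure)
 also have "... = 1" by (rule prob_space.emeasure_space_1[OF prob_space_joint])
 finally show "em R' (space ?PP \<times> space ?Q) ~= \<infinity>" by simp
qed

end

definition joint_push :: "'x measure => 'w measure => (('x \<times> 'y \<times> real) \<times> ('w \<times> real)) measure => ('x \<times> 'w \<times> real) measure" where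
 "joint_push X W R = distr R (X >< (W >< rpos))
   (%e. (fst (fst e), mid e, thd (fst e) * thd e))"

text \<open>The joint measure is unique, and it exists when W is a Lebesgue space, so on
  polymorphisms the choice by \<open>SOME\<close> is determined.\<close>

definition joint_product ::
  "'x measure => 'y measure => 'w measure => ('x \<times> 'y \<times> real) measure => ('y \<times> 'w \<times> real) measure => ('x \<times> 'w \<times> real) measure" where
 "joint_product X Y W p q = joint_push X W (SOME R. is_joint X Y W p q R)"

lemma joint_push_measurable [measurable]:
 "(%e. (fst (fst e), mid e, thd (fst e) * thd e))
   : (X >< (Y >< rpos)) >< (W >< rpos) \<rightarrow>\<^sub>M X >< (W >< rpos)"
 by measurable

lemma joint_product_eq:
 assumes "prob_space X" "prob_space Y" "p : Pol X Y" "q : Pol Y W" "is_joint X Y W p q R"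
 shows "joint_product X Y W p q = joint_push X W R"
 unfolding joint_product_def
 using joint_unique[OF assms(1,2,3,4,5)] someI[of "is_joint X Y W p q", OF assms(5)] by simp

lemma joint_push_Pol:
 assumes X: "prob_space X" and Y: "prob_space Y" and p: "p : Pol X Y" and q: "q : Pol Y W" and R: "is_joint X Y W p q R"
 shows "joint_push X W R : Pol X W"
proof -
 note sR = sets_joint[OF R, measurable_cong]
 let ?P = "joint_push X W R"
 have [measurable_cong]: "sets ?P = sets (X >< (W >< rpos))" by (simp add: joint_push_def)
 have int: "(nnint ?P (%z. f z)) = (nnint R (%e. f (fst (fst e), mid e, thd (fst e) * thd e)))"
  if [measurable]: "f : BM (X >< (W >< rpos))" for f
  unfolding joint_push_def by (rule nn_integral_distr) measurable
 show ?thesis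
 proof (rule PolI)
  show "sets ?P = sets (X >< (W >< rpos))" by (simp add: joint_push_def)
  fix A assume A [measurable]: "A : sets X"
  have "(nnint ?P (%z. ind A (fst z))) = (nnint R (%e. ind A (fst (fst e))))" by (subst int) auto
  also have "... = (nnint p (%z. ind A (fst z)))"
   by (rule joint_nn_integral_fst[OF X Y p q R]) measurable
  also have "... = em X A" using Pol_nn_integral_fst[OF p, of "ind A"] by simp
  finally show "(nnint ?P (%z. ind A (fst z))) = em X A" .
 next
  fix A assume A [measurable]: "A : sets W"
  have "(nnint ?P (%z. ennreal (thd z) * ind A (mid z))) = (nnint R (%e. ennreal (thd (fst e) * thd e) * ind A (mid e)))"
   by (subst int) auto
  also have "... = (nnint R (%e. ennreal (thd (fst e)) * (ennreal (thd e) * ind A (mid e))))"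
   by (rule nn_integral_cong) (auto simp: space_joint[OF R] ennreal_mult mult.assoc)
  also have "... = (nnint q (%z. ennreal (thd z) * ind A (mid z)))"
   by (rule joint_nn_integral_t_snd[OF X Y p q R, of "%v. ennreal (snd v) * ind A (fst v)"]) measurable
  also have "... = em W A" using Pol_nn_integral_snd[OF q, of "ind A"] by simp
  finally show "(nnint ?P (%z. ennreal (thd z) * ind A (mid z))) = em W A" .
 qed
qed

lemma pol_test_joint_push:
 assumes R: "is_joint X Y W p q R" and [measurable]: "A : sets X" "D : sets W" "ph : BM rpos"
 shows "pol_test A D ph (joint_push X W R) =
  (LINT e|R. ind A (fst (fst e)) * ind D (mid e) * ph (thd (fst e) * thd e))"
proof -
 note sR = sets_joint[OF R, measurable_cong]
 show ?thesis unfolding pol_test_def joint_push_def by (subst integral_distr) simp_all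
qed

context
 fixes X :: "'x measure" and Y :: "'y measure" and W :: "'w measure" and p q R
 assumes X: "prob_space X" and Y: "prob_space Y"
  and p: "p : Pol X Y" and q: "q : Pol Y W" and R: "is_joint X Y W p q R"
begin

lemma joint_integral_fst:
 fixes f :: "_ => 'b::{banach, second_countable_topology}"
 assumes H [measurable]: "H : BM (W >< rpos)" and h [measurable]: "h : BM Y"
  and H0: "!!v. v : space (W >< rpos) ==> 0 <= H v" and h0: "!!y. y : space Y ==> (0::real) <= h y"
  and Hh: "!!B. B : sets Y ==> (nnint q (%z. ennreal (H (snd z)) * ind B (fst z))) = (nnint Y (%y. ennreal (h y) * ind B y))"
  and f [measurable]: "f : BM (X >< (Y >< rpos))"
 shows "(LINT e|R. H (snd e) *\<^sub>R f (fst e)) = (LINT z|p. h (mid z) *\<^sub>R f z)"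
proof -
 note sets_joint[OF R, measurable_cong] and sets_Pol[OF p, measurable_cong]
 have "(LINT e|R. H (snd e) *\<^sub>R f (fst e)) = (LINT e|(density R (%e. ennreal (H (snd e)))). f (fst e))"
  by (rule integral_density[symmetric]) (use H0 in \<open>auto simp: space_joint[OF R] space_pair_measure\<close>)
 also have "... = (LINT z|(distr (density R (%e. ennreal (H (snd e)))) (X >< (Y >< rpos)) fst). f z)"
  by (rule integral_distr[symmetric]) auto
 also have "... = (LINT z|(density p (%z. ennreal (h (mid z)))). f z)"
  by (subst joint_density_fst[OF X Y p q R _ _ Hh]) auto
 also have "... = (LINT z|p. h (mid z) *\<^sub>R f z)"
  by (rule integral_density) (use h0 in \<open>auto simp: space_Pol[OF p]\<close>)
 finally show ?thesis .
qed

lemma joint_integral_snd: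
 fixes f :: "_ => 'b::{banach, second_countable_topology}"
 assumes F [measurable]: "F : BM (X >< (Y >< rpos))" and k [measurable]: "k : BM Y"
  and fin: "(nnint p (%z. ennreal (F z))) < \<infinity>"
  and F0: "!!v. v : space (X >< (Y >< rpos)) ==> 0 <= F v" and k0: "!!y. y : space Y ==> (0::real) <= k y"
  and Fk: "!!B. B : sets Y ==> (nnint p (%z. ennreal (F z) * ind B (mid z))) = (nnint Y (%y. ennreal (k y) * ind B y))"
  and f [measurable]: "f : BM (W >< rpos)"
 shows "(LINT e|R. F (fst e) *\<^sub>R f (snd e)) = (LINT z|q. k (fst z) *\<^sub>R f (snd z))"
proof -
 note sets_joint[OF R, measurable_cong] and sets_Pol[OF q, measurable_cong]
 have "(LINT e|R. F (fst e) *\<^sub>R f (snd e)) = (LINT e|(density R (%e. ennreal (F (fst e)))). f (snd e))"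
  by (rule integral_density[symmetric]) (use F0 in \<open>auto simp: space_joint[OF R] space_pair_measure\<close>)
 also have "... = (LINT v|(distr (density R (%e. ennreal (F (fst e)))) (W >< rpos) snd). f v)"
  by (rule integral_distr[symmetric]) auto
 also have "... = (LINT v|(distr (density q (%z. ennreal (k (fst z)))) (W >< rpos) snd). f v)"
  by (subst joint_density_snd[OF X Y p q R _ _ fin Fk]) auto
 also have "... = (LINT z|(density q (%z. ennreal (k (fst z)))). f (snd z))"
  by (rule integral_distr) auto
 also have "... = (LINT z|q. k (fst z) *\<^sub>R f (snd z))"
  by (rule integral_density) (use k0 in \<open>auto simp: space_Pol[OF q]\<close>)
 finally show ?thesis .
qed

end

section \<open>Integrals of functions of both multipliers against the joint measure\<close>

text \<open>Inductive, so that a claim stable under sums has to be checked only for products a(t)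
  b(s). Polynomials in two variables belong to it, which connects it with Stone-Weierstrass.\<close>

inductive sepfun :: "(real \<times> real => real) => bool" where
 base: "continuous_on UNIV a ==> continuous_on UNIV b ==> sepfun (%z. a (fst z) * b (snd z))"
| add: "sepfun f ==> sepfun g ==> sepfun (%z. f z + g z)"

lemma sepfun_mult:
 assumes "sepfun f" "sepfun g" shows "sepfun (%z. f z * g z)"
 using assms(1)
proof induction
 case (base a b)
 note ab = base
 from assms(2) show ?case
 proof induction
  case (base c d)
  have "sepfun (%z. (a (fst z) * c (fst z)) * (b (snd z) * d (snd z)))"
   by (rule sepfun.base[of "%t. a t * c t" "%s. b s * d s"]) (intro continuous_intros ab base)+
  then show ?case by (simp add: ac_simps)
 next
  case (add f g)
  then show ?case using sepfun.add[OF add.IH] by (simp add: distrib_left)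
 qed
next
 case (add f1 f2)
 then show ?case using sepfun.add[OF add.IH] by (simp add: distrib_right)
qed

lemma real_polynomial_sepfun:
 assumes "real_polynomial_function (g :: real \<times> real => real)" shows "sepfun g"
 using assms
proof induction
 case (linear f)
 interpret bounded_linear f by fact
 have "f z = f (1, 0) * fst z * 1 + 1 * (f (0, 1) * snd z)" for z
 proof -
  have "f z = f (fst z *\<^sub>R (1, 0) + snd z *\<^sub>R (0, 1))" by simp
  also have "... = fst z *\<^sub>R f (1, 0) + snd z *\<^sub>R f (0, 1)" by (simp only: add scaleR)
  finally show ?thesis by simp
 qed
 moreover have "sepfun (%z. f (1, 0) * fst z * 1 + 1 * (f (0, 1) * snd z))"
  by (rule sepfun.add[OF sepfun.base[of "%t. f (1, 0) * t" "%_. 1"] sepfun.base[of "%_. 1" "%s. f (0, 1) * s"]])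
   (intro continuous_intros)+
 ultimately show ?case by (subst ext[of f "%z. f (1, 0) * fst z * 1 + 1 * (f (0, 1) * snd z)"])
next
 case (const c)
 show ?case using sepfun.base[of "%_. c" "%_. 1"] by simp
next
 case (add f g)
 show ?case by (rule sepfun.add[OF add.IH])
next
 case (mult f g)
 show ?case by (rule sepfun_mult[OF mult.IH])
qed

lemma sepfun_measurable: "sepfun f ==> f : BM (borel >< borel)"
proof (induction rule: sepfun.induct)
 case (base a b)
 then have [measurable]: "a : BM borel" "b : BM borel"
  by (auto intro: borel_measurable_continuous_onI)
 show ?case by measurable
next
 case (add f g)
 then show ?case by (intro borel_measurable_add)
qed

lemma cutoff_zero: "\<bar>ln t\<bar> \<ge> real n + 1 ==> cutoff n t = 0"
 by (auto simp: cutoff_def)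

text \<open>Stone-Weierstrass on the box \<open>|ln t|, |ln s| <= m + 1\<close> reduces to functions \<open>a(t) b(s)\<close>.\<close>

lemma continuous_map_joint_compact:
 fixes R :: "'a => (('x \<times> 'y \<times> real) \<times> ('w \<times> real)) measure"
 assumes R: "!!x. x : topspace T ==> prob_space (R x) \<and> sets (R x) = sets ((X >< (Y >< rpos)) >< (W >< rpos))"
  and A [measurable]: "A : sets X" and D [measurable]: "D : sets W"
  and base: "!!a b. cc a ==> cc b ==> continuous_map T euclideanreal
    (%x. LINT e|(R x). ind A (fst (fst e)) * ind D (mid e) * (a (thd (fst e)) * b (thd e)))"
  and \<psi>: "continuous_on ({0<..} \<times> {0<..}) \<psi>" and [measurable]: "\<psi> : BM (rpos >< rpos)"
  and supp: "!!t s. 0 < t ==> 0 < s ==> \<bar>ln t\<bar> > real m \<or> \<bar>ln s\<bar> > real m ==> \<psi> (t, s) = 0"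
  and bdd: "!!t s. 0 < t ==> 0 < s ==> \<bar>\<psi> (t, s)\<bar> <= M"
 shows "continuous_map T euclideanreal
    (%x. LINT e|(R x). ind A (fst (fst e)) * ind D (mid e) * \<psi> (thd (fst e), thd e))"
proof (rule continuous_map_uniform_approx)
 fix \<epsilon> :: real assume \<epsilon>: "0 < \<epsilon>"
 \<comment> \<open>One unit beyond the support of \<psi>: the cutoff with index m is 1 on that
   support and 0 outside the box, so Q times the cutoffs approximates \<psi> on all of the
   quadrant.\<close>
 let ?I = "{exp (- real (m + 1))..exp (real (m + 1))}"
 have Ipos: "t > 0" if "t : ?I" for t
  using that less_le_trans[OF exp_gt_zero] by auto
 have inI: "t : ?I" if "t > 0" "\<bar>ln t\<bar> <= real m + 1" for t
 proof -
  from that(2) have "exp (- real (m + 1)) <= exp (ln t)" "exp (ln t) <= exp (real (m + 1))"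
   unfolding exp_le_cancel_iff by auto
  then show ?thesis using that(1) by simp
 qed
 have "compact (?I \<times> ?I)" by (intro compact_Times compact_Icc)
 moreover have "continuous_on (?I \<times> ?I) \<psi>"
  by (rule continuous_on_subset[OF \<psi>]) (use Ipos in auto)
 ultimately obtain Q where Q: "real_polynomial_function Q" and Qe: "!!z. z : ?I \<times> ?I ==> \<bar>\<psi> z - Q z\<bar> < \<epsilon>"
  using Stone_Weierstrass_real_polynomial_function[of "?I \<times> ?I" \<psi> \<epsilon>] \<epsilon> by blast
 have Qm [measurable]: "Q : BM (borel >< borel)"
  by (intro sepfun_measurable real_polynomial_sepfun Q)
 have Rx: "prob_space (R x)" "sets (R x) = sets ((X >< (Y >< rpos)) >< (W >< rpos))"
  "space (R x) = (space X \<times> space Y \<times> {0<..}) \<times> (space W \<times> {0<..})" if "x : topspace T" for x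
  using R[OF that] sets_eq_imp_space_eq[of "R x" "(X >< (Y >< rpos)) >< (W >< rpos)"] by (auto simp: space_pair_measure)
 have integrable_sep: "integrable (R x) (%e. ind A (fst (fst e)) * ind D (mid e) *
   (f (thd (fst e), thd e) * (cutoff m (thd (fst e)) * cutoff m (thd e))))"
  if x: "x : topspace T" and f: "sepfun f" for x f
 proof -
  interpret prob_space "R x" by (rule Rx[OF x])
  note Rx(2)[OF x, measurable_cong]
  have [measurable]: "f : BM (borel >< borel)" by (rule sepfun_measurable[OF f])
  have "continuous_on UNIV f" using f
   by induction (auto intro!: continuous_intros intro: continuous_on_compose2)
  then have "compact (f ` (?I \<times> ?I))"
   by (intro compact_continuous_image compact_Times compact_Icc) (auto intro: continuous_on_subset)
  then obtain B where B: "B > 0" "!!z. z : ?I \<times> ?I ==> \<bar>f z\<bar> <= B"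
   by (auto dest!: compact_imp_bounded simp: bounded_pos)
  show ?thesis
  proof (rule integrable_const_bound[where B = B], rule AE_I2)
   fix e assume "e : space (R x)"
   then have t: "thd (fst e) > 0" (is "?t > 0") "thd e > 0" (is "?s > 0") by (auto simp: Rx(3)[OF x])
   have "\<bar>f (?t, ?s) * (cutoff m ?t * cutoff m ?s)\<bar> <= B"
   proof (cases "\<bar>ln ?t\<bar> <= real m + 1 \<and> \<bar>ln ?s\<bar> <= real m + 1")
    case True
    then have "\<bar>f (?t, ?s)\<bar> <= B" using inI t by (intro B) auto
    moreover have "\<bar>cutoff m ?t * cutoff m ?s\<bar> <= 1"
    unfolding abs_mult by (intro mult_le_one cutoff_bounds abs_ge_zero)
    ultimately have "\<bar>f (?t, ?s)\<bar> * \<bar>cutoff m ?t * cutoff m ?s\<bar> <= B * 1" using B(1) by (intro mult_mono) auto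
    then show ?thesis by (simp add: abs_mult)
   next
    case False
    then have "cutoff m ?t = 0 \<or> cutoff m ?s = 0" using cutoff_zero[of m ?t] cutoff_zero[of m ?s] by linarith
    then show ?thesis using B(1) by auto
   qed
   then show "norm (ind A (fst (fst e)) * ind D (mid e) * (f (?t, ?s) * (cutoff m ?t * cutoff m ?s))) <= B"
    using B(1) by (auto simp: indicator_def)
  qed measurable
 qed
 have sep: "continuous_map T euclideanreal (%x. LINT e|(R x). ind A (fst (fst e)) * ind D (mid e) *
   (f (thd (fst e), thd e) * (cutoff m (thd (fst e)) * cutoff m (thd e))))"
  if "sepfun f" for f
  using that
 proof induction
  case (base a b)
  have "cc (%t. a t * cutoff m t)" "cc (%t. b t * cutoff m t)"
   using base by (auto intro!: cc_cutoff_mult intro: continuous_on_subset)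
  from assms(4)[OF this] show ?case by (simp add: ac_simps)
 next
  case (add f g)
  show ?case
  proof (rule continuous_map_eq[OF continuous_map_add[OF add.IH]])
   fix x assume x: "x : topspace T"
   show "(LINT e|(R x). ind A (fst (fst e)) * ind D (mid e) *
    (f (thd (fst e), thd e) * (cutoff m (thd (fst e)) * cutoff m (thd e)))) +
    (LINT e|(R x). ind A (fst (fst e)) * ind D (mid e) *
    (g (thd (fst e), thd e) * (cutoff m (thd (fst e)) * cutoff m (thd e)))) =
    (LINT e|(R x). ind A (fst (fst e)) * ind D (mid e) *
    ((f (thd (fst e), thd e) + g (thd (fst e), thd e)) * (cutoff m (thd (fst e)) * cutoff m (thd e))))"
    by (subst B_integral_add[symmetric, OF integrable_sep[OF x add.hyps(1)] integrable_sep[OF x add.hyps(2)]])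
    (simp add: distrib_left distrib_right)
  qed
 qed
 define G where "G x = (LINT e|(R x). ind A (fst (fst e)) * ind D (mid e) *
   (Q (thd (fst e), thd e) * (cutoff m (thd (fst e)) * cutoff m (thd e))))" for x
 have "continuous_map T euclideanreal G"
  unfolding G_def by (intro sep real_polynomial_sepfun Q)
 moreover have "\<bar>(LINT e|(R x). ind A (fst (fst e)) * ind D (mid e) * \<psi> (thd (fst e), thd e)) - G x\<bar> <= \<epsilon>"
  if x: "x : topspace T" for x
 proof -
  interpret prob_space "R x" by (rule Rx[OF x])
  note Rx(2)[OF x, measurable_cong]
  obtain x0 where "x0 : space (R x)" using not_empty by auto
  then have M0: "0 <= M" using bdd[of "thd (fst x0)" "thd x0"] by (auto simp: Rx(3)[OF x])
  have i1: "integrable (R x) (%e. ind A (fst (fst e)) * ind D (mid e) * \<psi> (thd (fst e), thd e))"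
  proof (rule integrable_const_bound[where B = M], rule AE_I2)
   fix e assume "e : space (R x)"
   then have "thd (fst e) > 0" "thd e > 0" by (auto simp: Rx(3)[OF x])
   then show "norm (ind A (fst (fst e)) * ind D (mid e) * \<psi> (thd (fst e), thd e)) <= M"
    using bdd M0 by (auto simp: indicator_def)
  qed measurable
  note i2 = integrable_sep[OF x real_polynomial_sepfun[OF Q]]
  have "(LINT e|(R x). ind A (fst (fst e)) * ind D (mid e) * \<psi> (thd (fst e), thd e)) - G x
   = (LINT e|(R x). ind A (fst (fst e)) * ind D (mid e) * \<psi> (thd (fst e), thd e) -
    ind A (fst (fst e)) * ind D (mid e) *
    (Q (thd (fst e), thd e) * (cutoff m (thd (fst e)) * cutoff m (thd e))))"
   unfolding G_def by (rule B_integral_diff[OF i1 i2, symmetric])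
  also have "\<bar>...\<bar> <= (LINT e|(R x). \<epsilon>)"
  proof (rule abs_integral_le)
   fix e assume "e : space (R x)"
   then have t: "thd (fst e) > 0" (is "?t > 0") "thd e > 0" (is "?s > 0") by (auto simp: Rx(3)[OF x])
   have "\<bar>\<psi> (?t, ?s) - Q (?t, ?s) * (cutoff m ?t * cutoff m ?s)\<bar> <= \<epsilon>"
   proof (cases "\<bar>ln ?t\<bar> <= real m + 1 \<and> \<bar>ln ?s\<bar> <= real m + 1")
    case True
    have eq: "\<psi> (?t, ?s) = \<psi> (?t, ?s) * (cutoff m ?t * cutoff m ?s)"
    proof (cases "\<bar>ln ?t\<bar> > real m \<or> \<bar>ln ?s\<bar> > real m")
    case True then show ?thesis using supp[OF t] by simp
    next
    case False then show ?thesis by (simp add: cutoff_eq_1)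
    qed
    have "\<psi> (?t, ?s) - Q (?t, ?s) * (cutoff m ?t * cutoff m ?s) = (\<psi> (?t, ?s) - Q (?t, ?s)) * (cutoff m ?t * cutoff m ?s)"
    by (subst eq) (simp add: left_diff_distrib)
    also have "\<bar>...\<bar> <= \<epsilon> * 1"
    unfolding abs_mult[of "\<psi> (?t, ?s) - Q (?t, ?s)"]
    proof (intro mult_mono)
    show "\<bar>\<psi> (?t, ?s) - Q (?t, ?s)\<bar> <= \<epsilon>" using Qe[of "(?t, ?s)"] inI t True by auto
    show "\<bar>cutoff m ?t * cutoff m ?s\<bar> <= 1"
    unfolding abs_mult by (intro mult_le_one cutoff_bounds abs_ge_zero)
    qed (use \<epsilon> in auto)
    finally show ?thesis by simp
   next
    case False
    then have "\<psi> (?t, ?s) = 0" using supp[OF t] by linarith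
    moreover have "cutoff m ?t = 0 \<or> cutoff m ?s = 0" using False cutoff_zero[of m ?t] cutoff_zero[of m ?s] by linarith
    ultimately show ?thesis using \<epsilon> by auto
   qed
   then show "\<bar>ind A (fst (fst e)) * ind D (mid e) * \<psi> (?t, ?s) -
    ind A (fst (fst e)) * ind D (mid e) * (Q (?t, ?s) * (cutoff m ?t * cutoff m ?s))\<bar> <= \<epsilon>"
    using \<epsilon> by (auto simp: indicator_def)
  qed (use i1 i2 in auto)
  finally show ?thesis by (simp add: prob_space)
 qed
 ultimately show "\<exists>G. continuous_map T euclideanreal G \<and> (\<forall>x\<in>topspace T.
   \<bar>(LINT e|(R x). ind A (fst (fst e)) * ind D (mid e) * \<psi> (thd (fst e), thd e)) - G x\<bar> <= \<epsilon>)"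
  by blast
qed

text \<open>On its support t exceeds exp (-n), so M <= M exp n t. A bound by a multiple of t is what
  the weighted second marginal of a polymorphism can absorb.\<close>

lemma cc_bound_linear:
 assumes "cc ph" obtains C where "C > 0" "!!t. t > 0 ==> \<bar>ph t\<bar> <= C * t" "!!t. t > 0 ==> \<bar>ph t\<bar> <= C"
proof -
 from assms obtain n :: nat where n: "!!t. t > 0 ==> real n <= \<bar>ln t\<bar> ==> ph t = 0"
  by (auto simp: cc_def)
 obtain M where M: "M > 0" "!!t. t > 0 ==> \<bar>ph t\<bar> <= M" using cc_bounded[OF assms] by metis
 show ?thesis
 proof (rule that[of "M * exp (real n)"])
  show "M * exp (real n) > 0" using M by simp
  fix t :: real assume t: "t > 0"
  have "M * 1 <= M * exp (real n)" using M by (intro mult_left_mono) auto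
  then show "\<bar>ph t\<bar> <= M * exp (real n)" using M(2)[OF t] by simp
  show "\<bar>ph t\<bar> <= M * exp (real n) * t"
  proof (cases "real n <= \<bar>ln t\<bar>")
   case True then show ?thesis using n[OF t] M t by simp
  next
   case False
   then have "exp 0 <= exp (real n + ln t)" unfolding exp_le_cancel_iff by linarith
   then have "1 <= exp (real n) * t" using t by (simp add: exp_add)
   then have "M * 1 <= M * (exp (real n) * t)" using M by (intro mult_left_mono) auto
   then show ?thesis using M(2)[OF t] by (simp add: mult.assoc)
  qed
 qed
qed

lemma cc_abs_bound_measurable:
 assumes "cc a" obtains K where "K > 0" "!!t. t > 0 ==> \<bar>a t\<bar> <= K" "!!t. t > 0 ==> \<bar>a t\<bar> <= K * t" "a : BM rpos"
 using cc_bound_linear[OF assms] cc_measurable[OF assms] by metis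

lemma Pol_fst_bounded_density:
 assumes Y: "prob_space Y" and q: "q : Pol Y W" and H [measurable]: "H : BM (W >< rpos)"
  and c: "0 <= c" "!!v. v : space (W >< rpos) ==> 0 <= H v \<and> H v <= c"
 obtains h :: "_ => real" where "h : BM Y" "!!y. 0 <= h y \<and> h y <= c"
  "!!B. B : sets Y ==> (nnint q (%z. ennreal (H (snd z)) * ind B (fst z))) = (nnint Y (%y. ennreal (h y) * ind B y))"
proof -
 note sets_Pol[OF q, measurable_cong]
 have Hm: "(%v. ennreal (H v)) : BM (W >< rpos)" by measurable
 obtain k :: "_ => ennreal" where k: "k : BM Y"
  and eq: "!!B. B : sets Y ==> (nnint q (%z. ennreal (H (snd z)) * ind B (fst z))) = (nnint Y (%y. k y * ind B y))"
  by (rule Pol_fst_density_exists[OF Y q Hm], rule that)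
 have "(nnint Y (%y. k y * ind B y)) <= ennreal c * em Y B" if B [measurable]: "B : sets Y" for B
 proof -
  have "(nnint Y (%y. k y * ind B y)) = (nnint q (%z. ennreal (H (snd z)) * ind B (fst z)))" by (rule eq[OF B, symmetric])
  also have "... <= (nnint q (%z. ennreal c * ind B (fst z)))"
  proof (rule nn_integral_mono)
   fix z assume "z : space q"
   then have "snd z : space (W >< rpos)" by (auto simp: space_Pol[OF q] space_pair_measure)
   from c(2)[OF this] show "ennreal (H (snd z)) * ind B (fst z) <= ennreal c * ind B (fst z)"
    by (intro mult_right_mono ennreal_leI) auto
  qed
  also have "... = ennreal c * (nnint q (%z. ind B (fst z)))" by (rule nn_integral_cmult) measurable
  also have "... = ennreal c * em Y B" using Pol_nn_integral_fst[OF q, of "ind B"] by simp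
  finally show ?thesis .
 qed
 from density_bounded_version[OF Y k c(1) this] obtain h :: "_ => real" where "h : BM Y" "!!y. 0 <= h y \<and> h y <= c"
  "!!B. B : sets Y ==> (nnint Y (%y. k y * ind B y)) = (nnint Y (%y. ennreal (h y) * ind B y))" by blast
 with eq show ?thesis by (intro that[of h]) auto
qed

text \<open>The bound on F is a multiple of t and not a constant, because it is t p that projects
  onto Y.\<close>

lemma Pol_snd_bounded_density:
 assumes Y: "prob_space Y" and p: "p : Pol X Y" and F [measurable]: "F : BM (X >< (Y >< rpos))"
  and c: "0 <= c" "!!z. z : space p ==> 0 <= F z \<and> F z <= c * thd z"
 obtains k :: "_ => real" where "k : BM Y" "!!y. 0 <= k y \<and> k y <= c"
  "!!B. B : sets Y ==> (nnint p (%z. ennreal (F z) * ind B (mid z))) = (nnint Y (%y. ennreal (k y) * ind B y))"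
proof -
 note sets_Pol[OF p, measurable_cong]
 have Fm: "(%v. ennreal (F v)) : BM (X >< (Y >< rpos))" by measurable
 obtain k :: "_ => ennreal" where k: "k : BM Y"
  and eq: "!!B. B : sets Y ==> (nnint p (%z. ennreal (F z) * ind B (mid z))) = (nnint Y (%y. k y * ind B y))"
  by (rule Pol_snd_density_exists[OF Y p Fm], rule that)
 have "(nnint Y (%y. k y * ind B y)) <= ennreal c * em Y B" if B [measurable]: "B : sets Y" for B
 proof -
  have "(nnint Y (%y. k y * ind B y)) = (nnint p (%z. ennreal (F z) * ind B (mid z)))" by (rule eq[OF B, symmetric])
  also have "... <= (nnint p (%z. ennreal c * (ennreal (thd z) * ind B (mid z))))"
  proof (rule nn_integral_mono)
   fix z assume z: "z : space p"
   have "ennreal (F z) <= ennreal (c * thd z)" using c(2)[OF z] by (intro ennreal_leI) auto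
   also have "... = ennreal c * ennreal (thd z)" by (rule ennreal_mult) (use z c(1) in \<open>auto simp: space_Pol[OF p]\<close>)
   finally show "ennreal (F z) * ind B (mid z) <= ennreal c * (ennreal (thd z) * ind B (mid z))"
    unfolding mult.assoc[symmetric] by (rule mult_right_mono) simp
  qed
  also have "... = ennreal c * (nnint p (%z. ennreal (thd z) * ind B (mid z)))" by (rule nn_integral_cmult) measurable
  also have "... = ennreal c * em Y B" using Pol_nn_integral_snd[OF p, of "ind B"] by simp
  finally show ?thesis .
 qed
 from density_bounded_version[OF Y k c(1) this] obtain h :: "_ => real" where "h : BM Y" "!!y. 0 <= h y \<and> h y <= c"
  "!!B. B : sets Y ==> (nnint Y (%y. k y * ind B y)) = (nnint Y (%y. ennreal (h y) * ind B y))" by blast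
 with eq show ?thesis by (intro that[of h]) auto
qed

lemma joint_integrable_bounded:
 fixes f :: "_ => real"
 assumes "prob_space X" "prob_space Y" "p : Pol X Y" "q : Pol Y W" and R: "is_joint X Y W p q R"
  and f: "f : BM ((X >< (Y >< rpos)) >< (W >< rpos))"
  and c: "!!e. e : space R ==> \<bar>f e\<bar> <= c"
 shows "integrable R f"
proof -
 interpret prob_space R using assms(1-5) by (rule prob_space_joint)
 note sets_joint[OF R, measurable_cong]
 show ?thesis
  by (rule integrable_const_bound[where B = c]) (use f c in auto)
qed

text \<open>With q fixed, conditional independence replaces the part of the integrand in (w, s) by a
  bounded function g of y that depends on q alone. What remains is a functional of p already known
  to be continuous.\<close>

lemma joint_base_fst:
 fixes X :: "'x measure" and Y :: "'y measure" and W :: "'w measure"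
 assumes Y: "prob_space Y" and q: "q : Pol Y W"
  and A [measurable]: "A : sets X" and D [measurable]: "D : sets W" and a: "cc a" and b: "cc b"
 obtains g C where "g : BM Y" "!!y. y : space Y ==> \<bar>g y\<bar> <= (C :: real)"
  "!!p R. prob_space X ==> p : Pol X Y ==> is_joint X Y W p q R ==>
   (LINT e|R. ind A (fst (fst e)) * ind D (mid e) * (a (thd (fst e)) * b (thd e))) =
   (LINT z|p. ind A (fst z) * g (mid z) * a (thd z))"
proof -
 obtain L where L: "L > 0" "!!t. t > 0 ==> \<bar>a t\<bar> <= L" and am [measurable]: "a : BM rpos"
  using cc_abs_bound_measurable[OF a] by metis
 obtain K where K: "K > 0" "!!t. t > 0 ==> \<bar>b t\<bar> <= K" and bm [measurable]: "b : BM rpos"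
  using cc_abs_bound_measurable[OF b] by metis
 \<comment> \<open>The shift by K makes b nonnegative, as densities require; \<open>H0\<close>
   serves to subtract it again.\<close>
 define H where "H v = ind D (fst v) * (b (snd v) + K)" for v
 define H0 where "H0 v = (ind D (fst v) :: real)" for v :: "_ \<times> real"
 have Hm [measurable]: "H : BM (W >< rpos)" "H0 : BM (W >< rpos)"
  unfolding H_def H0_def by measurable
 have Hb: "0 <= H v \<and> H v <= 2 * K" "0 <= H0 v \<and> H0 v <= 1" if "v : space (W >< rpos)" for v
 proof -
  have "snd v > 0" using that by (auto simp: space_pair_measure)
  from K(2)[OF this] K(1) show "0 <= H v \<and> H v <= 2 * K" "0 <= H0 v \<and> H0 v <= 1" by (auto simp: H_def H0_def indicator_def)
 qed
 obtain h :: "_ => real" where h: "h : BM Y" "!!y. 0 <= h y \<and> h y <= 2 * K"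
  and hH: "!!B. B : sets Y ==> (nnint q (%z. ennreal (H (snd z)) * ind B (fst z))) = (nnint Y (%y. ennreal (h y) * ind B y))"
  by (rule Pol_fst_bounded_density[OF Y q Hm(1), of "2 * K"]) (use Hb K in auto)
 obtain h0 :: "_ => real" where h0: "h0 : BM Y" "!!y. 0 <= h0 y \<and> h0 y <= 1"
  and hH0: "!!B. B : sets Y ==> (nnint q (%z. ennreal (H0 (snd z)) * ind B (fst z))) = (nnint Y (%y. ennreal (h0 y) * ind B y))"
  by (rule Pol_fst_bounded_density[OF Y q Hm(2), of 1]) (use Hb in auto)
 note h(1) [measurable] and h0(1) [measurable]
 show ?thesis
 proof (rule that[of "%y. h y - K * h0 y" "3 * K"])
  show "(%y. h y - K * h0 y) : BM Y" by measurable
  show "\<bar>h y - K * h0 y\<bar> <= 3 * K" for y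
  proof -
   have "0 <= K * h0 y" "K * h0 y <= K" using h0(2)[of y] K(1) by (auto intro: mult_left_le)
   then show ?thesis using h(2)[of y] K(1) unfolding abs_le_iff by linarith
  qed
  fix p R assume X: "prob_space X" and p: "p : Pol X Y" and R: "is_joint X Y W p q R"
  note sets_joint[OF R, measurable_cong] and sets_Pol[OF p, measurable_cong]
  define f where "f z = ind A (fst z) * a (thd z)" for z :: "_ \<times> 'y \<times> real"
  have fm [measurable]: "f : BM (X >< (Y >< rpos))" unfolding f_def by measurable
  have fL: "\<bar>f z\<bar> <= L" if "z : space p" for z
  proof -
   have "thd z > 0" using that by (auto simp: space_Pol[OF p])
   from L(2)[OF this] L(1) show ?thesis by (auto simp: f_def indicator_def)
  qed
  have bnd: "\<bar>H' (snd e) * f (fst e)\<bar> <= c * L" if "e : space R" "0 <= H' (snd e) \<and> H' (snd e) <= c" for e c and H' :: "_ => real"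
   unfolding abs_mult using that fL[of "fst e"] by (intro mult_mono) (auto simp: space_joint[OF R] space_Pol[OF p])
  have Rs: "snd e : space (W >< rpos)" if "e : space R" for e using that by (auto simp: space_joint[OF R] space_pair_measure)
  have iH: "integrable R (%e. H (snd e) * f (fst e))"
   by (rule joint_integrable_bounded[OF X Y p q R, of _ "2 * K * L"]) (use bnd Hb(1) Rs in auto)
  have iH0: "integrable R (%e. H0 (snd e) * f (fst e))"
   by (rule joint_integrable_bounded[OF X Y p q R, of _ "1 * L"]) (use bnd[where c = 1] Hb(2) Rs in auto)
  have pint: "integrable p (%z. k (mid z) * f z)" if [measurable]: "k : BM Y" and "!!y. 0 <= k y \<and> k y <= c" for k c
  proof (rule pol_integrable_bounded[OF p X Y, of _ "c * L"])
   fix z assume "z : space p"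
   then show "norm (k (mid z) * f z) <= c * L"
    unfolding real_norm_def abs_mult using fL[of z] that(2)[of "mid z"] by (intro mult_mono) auto
  qed measurable
  have "(LINT e|R. ind A (fst (fst e)) * ind D (mid e) * (a (thd (fst e)) * b (thd e)))
   = (LINT e|R. H (snd e) * f (fst e) - K * (H0 (snd e) * f (fst e)))"
   by (rule B_integral_cong) (auto simp: H_def H0_def f_def algebra_simps)
  also have "... = (LINT e|R. H (snd e) * f (fst e)) - K * (LINT e|R. H0 (snd e) * f (fst e))"
   using iH iH0 by simp
  also have "(LINT e|R. H (snd e) * f (fst e)) = (LINT z|p. h (mid z) * f z)"
   using joint_integral_fst[OF X Y p q R Hm(1) h(1) _ _ hH fm] Hb(1) h(2) by simp
  also have "(LINT e|R. H0 (snd e) * f (fst e)) = (LINT z|p. h0 (mid z) * f z)"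
   using joint_integral_fst[OF X Y p q R Hm(2) h0(1) _ _ hH0 fm] Hb(2) h0(2) by simp
  also have "(LINT z|p. h (mid z) * f z) - K * (LINT z|p. h0 (mid z) * f z) =
   (LINT z|p. h (mid z) * f z - K * (h0 (mid z) * f z))"
   using pint[OF h] pint[OF h0] by simp
  also have "... = (LINT z|p. ind A (fst z) * (h (mid z) - K * h0 (mid z)) * a (thd z))"
   by (rule B_integral_cong) (auto simp: f_def algebra_simps)
  finally show "(LINT e|R. ind A (fst (fst e)) * ind D (mid e) * (a (thd (fst e)) * b (thd e))) =
   (LINT z|p. ind A (fst z) * (h (mid z) - K * h0 (mid z)) * a (thd z))" .
 qed
qed

text \<open>The counterpart with p fixed. The part of the integrand in (x, t) becomes a bounded
  function of y, thanks to the linear bound on a.\<close>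

lemma joint_base_snd:
 fixes X :: "'x measure" and Y :: "'y measure" and W :: "'w measure"
 assumes X: "prob_space X" and Y: "prob_space Y" and p: "p : Pol X Y"
  and A [measurable]: "A : sets X" and D [measurable]: "D : sets W" and a: "cc a" and b: "cc b"
 obtains g C where "g : BM Y" "!!y. y : space Y ==> \<bar>g y\<bar> <= (C :: real)"
  "!!q R. prob_space W ==> q : Pol Y W ==> is_joint X Y W p q R ==>
   (LINT e|R. ind A (fst (fst e)) * ind D (mid e) * (a (thd (fst e)) * b (thd e))) =
   (LINT z|q. g (fst z) * ind D (mid z) * b (thd z))"
proof -
 note sets_Pol[OF p, measurable_cong]
 obtain L where L: "L > 0" "!!t. t > 0 ==> \<bar>b t\<bar> <= L" and bm [measurable]: "b : BM rpos"
  using cc_abs_bound_measurable[OF b] by metis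
 obtain K where K: "K > 0" "!!t. t > 0 ==> \<bar>a t\<bar> <= K * t" and am [measurable]: "a : BM rpos"
  using cc_abs_bound_measurable[OF a] by metis
 \<comment> \<open>The shift is K t instead of a constant, so that F is still dominated by a
   multiple of t and has a bounded density in y.\<close>
 define F where "F z = ind A (fst z) * (a (thd z) + K * thd z)" for z :: "_ \<times> 'y \<times> real"
 define F0 where "F0 z = ind A (fst z) * thd z" for z :: "_ \<times> 'y \<times> real"
 have Fm [measurable]: "F : BM (X >< (Y >< rpos))" "F0 : BM (X >< (Y >< rpos))"
  unfolding F_def F0_def by measurable
 have Fb: "0 <= F z \<and> F z <= 2 * K * thd z" "0 <= F0 z \<and> F0 z <= 1 * thd z" if "z : space p" for z
 proof -
  have t: "thd z > 0" using that by (auto simp: space_Pol[OF p])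
  from K(2)[OF this] K(1) t show "0 <= F z \<and> F z <= 2 * K * thd z" "0 <= F0 z \<and> F0 z <= 1 * thd z" by (auto simp: F_def F0_def indicator_def)
 qed
 have Ffin: "integrable p F" "integrable p F0"
 proof -
  have "norm (F z) <= 2 * K * (1 + thd z)" if "z : space p" for z
   using Fb(1)[OF that] K(1) by (simp add: algebra_simps)
  then show "integrable p F" by (rule pol_integrable_dominated[OF p X Y Fm(1)])
  have "norm (F0 z) <= 1 * (1 + thd z)" if "z : space p" for z
   using Fb(2)[OF that] by simp
  then show "integrable p F0" by (rule pol_integrable_dominated[OF p X Y Fm(2)])
 qed
 have nfin: "(nnint p (%z. ennreal (F' z))) < \<infinity>" if "integrable p F'" "!!z. z : space p ==> 0 <= F' z" for F'
  using that by (subst nn_integral_eq_integral) auto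
 obtain k :: "_ => real" where k: "k : BM Y" "!!y. 0 <= k y \<and> k y <= 2 * K"
  and kF: "!!B. B : sets Y ==> (nnint p (%z. ennreal (F z) * ind B (mid z))) = (nnint Y (%y. ennreal (k y) * ind B y))"
  by (rule Pol_snd_bounded_density[OF Y p Fm(1), of "2 * K"]) (use Fb K in auto)
 obtain k0 :: "_ => real" where k0: "k0 : BM Y" "!!y. 0 <= k0 y \<and> k0 y <= 1"
  and kF0: "!!B. B : sets Y ==> (nnint p (%z. ennreal (F0 z) * ind B (mid z))) = (nnint Y (%y. ennreal (k0 y) * ind B y))"
  by (rule Pol_snd_bounded_density[OF Y p Fm(2), of 1]) (use Fb in auto)
 note k(1) [measurable] and k0(1) [measurable]
 show ?thesis
 proof (rule that[of "%y. k y - K * k0 y" "3 * K"])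
  show "(%y. k y - K * k0 y) : BM Y" by measurable
  show "\<bar>k y - K * k0 y\<bar> <= 3 * K" for y
  proof -
   have "0 <= K * k0 y" "K * k0 y <= K" using k0(2)[of y] K(1) by (auto intro: mult_left_le)
   then show ?thesis using k(2)[of y] K(1) unfolding abs_le_iff by linarith
  qed
  fix q R assume W: "prob_space W" and q: "q : Pol Y W" and R: "is_joint X Y W p q R"
  interpret R: prob_space R by (rule prob_space_joint[OF X Y p q R])
  note sets_joint[OF R, measurable_cong] and sets_Pol[OF q, measurable_cong]
  define f where "f v = ind D (fst v) * b (snd v)" for v
  have fm [measurable]: "f : BM (W >< rpos)" unfolding f_def by measurable
  have fL: "\<bar>f v\<bar> <= L" if "v : space (W >< rpos)" for v
  proof -
   have "snd v > 0" using that by (auto simp: space_pair_measure)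
   from L(2)[OF this] L(1) show ?thesis by (auto simp: f_def indicator_def)
  qed
  have Rs: "snd e : space (W >< rpos)" "fst e : space p" if "e : space R" for e
   using that by (auto simp: space_joint[OF R] space_pair_measure space_Pol[OF p])
  have Rint: "integrable R (%e. F' (fst e) * f (snd e))" if i: "integrable p F'" and F'm [measurable]: "F' : BM (X >< (Y >< rpos))"
   and F'0: "!!z. z : space p ==> 0 <= F' z" for F' :: "_ => real"
  proof (rule B_integrable_bound[of R "%e. L * F' (fst e)"])
   have "(nnint R (%e. ennreal (F' (fst e)))) = (nnint p (%z. ennreal (F' z)))"
    by (rule joint_nn_integral_fst[OF X Y p q R]) measurable
   then have "integrable R (%e. F' (fst e))"
    using nfin[OF i F'0] Rs(2) F'0 by (intro integrableI_nonneg) (auto simp: less_top)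
   then show "integrable R (%e. L * F' (fst e))" by simp
   show "AE e in R. norm (F' (fst e) * f (snd e)) <= norm (L * F' (fst e))"
   proof (rule AE_I2)
    fix e assume "e : space R"
    then show "norm (F' (fst e) * f (snd e)) <= norm (L * F' (fst e))"
    using fL[OF Rs(1)] L(1) by (simp add: abs_mult) (subst mult.commute, intro mult_right_mono, auto)
   qed
  qed measurable
  have qint: "integrable q (%z. k (fst z) * f (snd z))" if [measurable]: "k : BM Y" and "!!y. 0 <= k y \<and> k y <= c" for k c
  proof (rule pol_integrable_bounded[OF q Y W, of _ "c * L"])
   fix z assume "z : space q"
   then show "norm (k (fst z) * f (snd z)) <= c * L"
    unfolding real_norm_def abs_mult using fL[of "snd z"] that(2)[of "fst z"] by (intro mult_mono) (auto simp: space_Pol[OF q] space_pair_measure)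
  qed measurable
  have Fs: "0 <= F v" "0 <= F0 v" if "v : space (X >< (Y >< rpos))" for v
   using that Fb[of v] by (auto simp: space_Pol[OF p] space_pair_measure)
  have Fp: "0 <= F v" "0 <= F0 v" if "v : space p" for v
   using that Fb[of v] by auto
  have iF: "integrable R (%e. F (fst e) * f (snd e))" by (rule Rint[OF Ffin(1) Fm(1) Fp(1)])
  have iF0: "integrable R (%e. F0 (fst e) * f (snd e))" by (rule Rint[OF Ffin(2) Fm(2) Fp(2)])
  have "(LINT e|R. ind A (fst (fst e)) * ind D (mid e) * (a (thd (fst e)) * b (thd e)))
   = (LINT e|R. F (fst e) * f (snd e) - K * (F0 (fst e) * f (snd e)))"
   by (rule B_integral_cong) (auto simp: F_def F0_def f_def algebra_simps)
  also have "... = (LINT e|R. F (fst e) * f (snd e)) - K * (LINT e|R. F0 (fst e) * f (snd e))"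
   using iF iF0 by simp
  also have "(LINT e|R. F (fst e) * f (snd e)) = (LINT z|q. k (fst z) * f (snd z))"
   using joint_integral_snd[OF X Y p q R Fm(1) k(1) nfin[OF Ffin(1) Fp(1)] Fs(1) _ kF fm] k(2) by simp
  also have "(LINT e|R. F0 (fst e) * f (snd e)) = (LINT z|q. k0 (fst z) * f (snd z))"
   using joint_integral_snd[OF X Y p q R Fm(2) k0(1) nfin[OF Ffin(2) Fp(2)] Fs(2) _ kF0 fm] k0(2) by simp
  also have "(LINT z|q. k (fst z) * f (snd z)) - K * (LINT z|q. k0 (fst z) * f (snd z)) =
   (LINT z|q. k (fst z) * f (snd z) - K * (k0 (fst z) * f (snd z)))"
   using qint[OF k] qint[OF k0] by simp
  also have "... = (LINT z|q. (k (fst z) - K * k0 (fst z)) * ind D (mid z) * b (thd z))"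
   by (rule B_integral_cong) (auto simp: f_def algebra_simps)
  finally show "(LINT e|R. ind A (fst (fst e)) * ind D (mid e) * (a (thd (fst e)) * b (thd e))) =
   (LINT z|q. (k (fst z) - K * k0 (fst z)) * ind D (mid z) * b (thd z))" .
 qed
qed

text \<open>The tail of the fixed factor is a single number for each n, so one cutoff serves for all
  values of the variable factor.\<close>

lemma Pol_cutoff_tail:
 assumes X: "prob_space X" and Y: "prob_space Y" and p: "p : Pol X Y" and e: "e > 0"
  and w: "continuous_on {0<..} w" "!!t. t > 0 ==> 0 <= w t \<and> w t <= 1 + t"
 obtains n where "(nnint p (%z. ennreal (w (thd z) * (1 - cutoff n (thd z))))) <= ennreal e"
proof -
 note sets_Pol[OF p, measurable_cong]
 have [measurable]: "w : BM rpos" by (rule continuous_on_rpos_measurable[OF w(1)])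
 have pos: "thd z > 0" if "z : space p" for z using that by (auto simp: space_Pol[OF p])
 have wpos: "0 <= w (thd z)" "w (thd z) <= 1 + thd z" if "z : space p" for z
  using w(2)[OF pos[OF that]] by auto
 have wint: "integrable p (%z. w (thd z))"
 proof (rule pol_integrable_dominated[OF p X Y])
  fix z assume "z : space p"
  then show "norm (w (thd z)) <= 1 * (1 + thd z)" using wpos[of z] by simp
 qed measurable
 have nab: "norm (w (thd z) * (1 - cutoff n (thd z))) <= w (thd z)" if "z : space p" for z n
 proof -
  have "\<bar>w (thd z)\<bar> * \<bar>1 - cutoff n (thd z)\<bar> <= w (thd z) * 1"
   using wpos[OF that] cutoff_bounds(4)[of n "thd z"] by (intro mult_mono) auto
  then show ?thesis by (simp add: abs_mult)
 qed
 have nn: "0 <= w (thd z) * (1 - cutoff n (thd z))" if "z : space p" for z n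
  using wpos(1)[OF that] cutoff_bounds(2)[of n "thd z"] by (intro mult_nonneg_nonneg) auto
 have int: "integrable p (%z. w (thd z) * (1 - cutoff n (thd z)))" for n
 proof (rule B_integrable_bound[OF wint])
  show "AE z in p. norm (w (thd z) * (1 - cutoff n (thd z))) <= norm (w (thd z))"
   by (rule AE_I2) (metis nab abs_ge_self order.trans real_norm_def)
 qed measurable
 have "(%n. LINT z|p. w (thd z) * (1 - cutoff n (thd z))) \<longlonglongrightarrow> (LINT z|p. w (thd z) * (1 - 1))"
 proof (rule integral_dominated_convergence[where w = "%z. w (thd z)"])
  show "AE z in p. (%n. w (thd z) * (1 - cutoff n (thd z))) \<longlonglongrightarrow> w (thd z) * (1 - 1)"
   by (intro AE_I2 tendsto_intros tendsto_cutoff)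
  show "AE z in p. norm (w (thd z) * (1 - cutoff n (thd z))) <= w (thd z)" for n
   by (rule AE_I2) (rule nab)
 qed (use wint in auto)
 then have "\<forall>\<^sub>F n in sequentially. (LINT z|p. w (thd z) * (1 - cutoff n (thd z))) < e"
  using e by (intro order_tendstoD) auto
 then obtain n where n: "(LINT z|p. w (thd z) * (1 - cutoff n (thd z))) < e"
  by (auto simp: eventually_sequentially)
 show ?thesis
 proof (rule that[of n])
  have "(nnint p (%z. ennreal (w (thd z) * (1 - cutoff n (thd z)))))
    = ennreal (LINT z|p. w (thd z) * (1 - cutoff n (thd z)))"
   by (rule nn_integral_eq_integral[OF int]) (rule AE_I2, rule nn)
  also have "... <= ennreal e" using n by (intro ennreal_leI) simp
  finally show "(nnint p (%z. ennreal (w (thd z) * (1 - cutoff n (thd z))))) <= ennreal e" .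
 qed
qed

section \<open>Separate continuity of the product\<close>

lemma some_joint:
 assumes "prob_space X" "prob_space Y" "lebesgue_prob_space W" "p : Pol X Y" "q : Pol Y W"
 shows "is_joint X Y W p q (SOME R. is_joint X Y W p q R)"
proof (rule someI_ex)
 show "\<exists>R. is_joint X Y W p q R"
  by (rule is_joint_exists[OF assms]) (rule exI)
qed

lemma lebesgue_prob_spaceD: "lebesgue_prob_space W ==> prob_space W"
 by (simp add: lebesgue_prob_space_def)

lemma joint_product_Pol:
 assumes "prob_space X" "prob_space Y" "lebesgue_prob_space W" "p : Pol X Y" "q : Pol Y W"
 shows "joint_product X Y W p q : Pol X W"
 unfolding joint_product_def
 by (rule joint_push_Pol[OF assms(1,2,4,5) some_joint[OF assms]])

text \<open>The cutoff in one of the variables \<open>t, s\<close> makes \<open>ph(t s)\<close> compactly supported in both.\<close>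

lemma cc_product_support:
 assumes ph: "cc ph"
 obtains m :: nat where
  "!!t s. 0 < t ==> 0 < s ==> \<bar>ln t\<bar> > real m \<or> \<bar>ln s\<bar> > real m ==> ph (t * s) * cutoff n s = 0"
  "!!t s. 0 < t ==> 0 < s ==> \<bar>ln t\<bar> > real m \<or> \<bar>ln s\<bar> > real m ==> ph (t * s) * cutoff n t = 0"
proof -
 from ph obtain k :: nat where k: "!!t. t > 0 ==> real k <= \<bar>ln t\<bar> ==> ph t = 0" by (auto simp: cc_def)
 \<comment> \<open>If ph(t s) does not vanish, then ln t and -ln s differ by less than k. So if one
   of the logarithms exceeds k + n + 1 in modulus, both exceed n + 1, and either cutoff
   vanishes.\<close>
 have *: "ph (t * s) * cutoff n s = 0 \<and> ph (t * s) * cutoff n t = 0"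
  if t: "0 < t" "0 < s" and b: "\<bar>ln t\<bar> > real (k + n + 1) \<or> \<bar>ln s\<bar> > real (k + n + 1)" for t s
 proof (cases "real k <= \<bar>ln (t * s)\<bar>")
  case True then show ?thesis using k[of "t * s"] t by simp
 next
  case False
  have "ln (t * s) = ln t + ln s" using t by (rule ln_mult_pos)
  with False b have "\<bar>ln s\<bar> \<ge> real n + 1" "\<bar>ln t\<bar> \<ge> real n + 1" by (auto simp: abs_if split: if_splits)
  then show ?thesis by (simp add: cutoff_zero)
 qed
 show ?thesis by (rule that[of "k + n + 1"]) (use * in blast)+
qed

lemma joint_continuous_product:
 assumes ph: "cc ph"
 shows "continuous_on ({0<..} \<times> {0<..}) (%z. ph (fst z * snd z) * cutoff n (snd z))"
  and "continuous_on ({0<..} \<times> {0<..}) (%z. ph (fst z * snd z) * cutoff n (fst z))"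
  and "(%z. ph (fst z * snd z) * cutoff n (snd z)) : BM (rpos >< rpos)"
  and "(%z. ph (fst z * snd z) * cutoff n (fst z)) : BM (rpos >< rpos)"
proof -
 note c = continuous_on_compose2[OF cc_continuous[OF ph]] and d = continuous_on_compose2[OF continuous_on_cutoff]
 show "continuous_on ({0<..} \<times> {0<..}) (%z. ph (fst z * snd z) * cutoff n (snd z))"
  by (intro continuous_on_mult c d continuous_on_fst continuous_on_snd continuous_on_id) auto
 show "continuous_on ({0<..} \<times> {0<..}) (%z. ph (fst z * snd z) * cutoff n (fst z))"
  by (intro continuous_on_mult c d continuous_on_fst continuous_on_snd continuous_on_id) auto
 have [measurable]: "ph : BM rpos" by (rule cc_measurable[OF ph])
 show "(%z. ph (fst z * snd z) * cutoff n (snd z)) : BM (rpos >< rpos)"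
  "(%z. ph (fst z * snd z) * cutoff n (fst z)) : BM (rpos >< rpos)" by measurable
qed

lemma nn_abs_integral_le:
 fixes f :: "'a => real"
 assumes "integrable M f" "(nnint M (%x. ennreal \<bar>f x\<bar>)) <= ennreal e" "0 <= e"
 shows "\<bar>\<integral>x. f x \<partial>M\<bar> <= e"
proof -
 have "\<bar>\<integral>x. f x \<partial>M\<bar> <= (LINT x|M. \<bar>f x\<bar>)" by (rule integral_abs_bound)
 also have "... <= e"
 proof -
  have "ennreal (LINT x|M. \<bar>f x\<bar>) = (nnint M (%x. ennreal \<bar>f x\<bar>))"
   using assms(1) by (intro nn_integral_eq_integral[symmetric]) auto
  also note assms(2)
  finally show ?thesis using assms(3) by (simp only: ennreal_le_iff)
 qed
 finally show ?thesis .
qed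

lemma joint_tail:
 assumes X: "prob_space X" and Y: "prob_space Y" and p: "p : Pol X Y" and q: "q : Pol Y W" and R: "is_joint X Y W p q R"
  and A [measurable]: "A : sets X" and D [measurable]: "D : sets W" and ph: "cc ph"
  and v [measurable]: "v : BM ((X >< (Y >< rpos)) >< (W >< rpos))"
  and v01: "!!e. e : space R ==> 0 <= v e \<and> v e <= 1"
  and e: "(nnint R (%e. ennreal (\<bar>ph (thd (fst e) * thd e)\<bar> * (1 - v e)))) <= ennreal \<epsilon>" "0 <= \<epsilon>"
 shows "\<bar>(LINT e|R. ind A (fst (fst e)) * ind D (mid e) * ph (thd (fst e) * thd e)) -
  (LINT e|R. ind A (fst (fst e)) * ind D (mid e) * (ph (thd (fst e) * thd e) * v e))\<bar> <= \<epsilon>"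
proof -
 have [measurable]: "ph : BM rpos" by (rule cc_measurable[OF ph])
 note sets_joint[OF R, measurable_cong]
 obtain M where M: "M > 0" "!!t. t > 0 ==> \<bar>ph t\<bar> <= M" using cc_bounded[OF ph] by metis
 let ?f = "%e. ind A (fst (fst e)) * ind D (mid e) * ph (thd (fst e) * thd e)"
 let ?g = "%e. ind A (fst (fst e)) * ind D (mid e) * (ph (thd (fst e) * thd e) * v e)"
 have fb: "\<bar>?f e\<bar> <= M" if "e : space R" for e
 proof -
  have "thd (fst e) * thd e > 0" using that by (auto simp: space_joint[OF R])
  from M(2)[OF this] M(1) show ?thesis by (auto simp: indicator_def)
 qed
 have gb: "\<bar>?g e\<bar> <= M" if "e : space R" for e
 proof -
  have "\<bar>?f e\<bar> * \<bar>v e\<bar> <= M * 1" using fb[OF that] v01[OF that] M(1) by (intro mult_mono) auto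
  then show ?thesis by (simp add: abs_mult mult.assoc)
 qed
 have i1: "integrable R ?f" by (rule joint_integrable_bounded[OF X Y p q R _ fb]) measurable
 have i2: "integrable R ?g" by (rule joint_integrable_bounded[OF X Y p q R _ gb]) measurable
 have "(LINT e|R. ?f e) - (LINT e|R. ?g e) = (LINT e|R. ?f e - ?g e)"
  by (rule B_integral_diff[OF i1 i2, symmetric])
 also have "\<bar>...\<bar> <= \<epsilon>"
 proof (rule nn_abs_integral_le)
  show "integrable R (%e. ?f e - ?g e)" using i1 i2 by simp
  have "(nnint R (%e. ennreal \<bar>?f e - ?g e\<bar>)) <= (nnint R (%e. ennreal (\<bar>ph (thd (fst e) * thd e)\<bar> * (1 - v e))))"
  proof (rule nn_integral_mono)
   fix e assume "e : space R"
   then have v: "0 <= 1 - v e" using v01 by auto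
   have "?f e - ?g e = ind A (fst (fst e)) * ind D (mid e) * (ph (thd (fst e) * thd e) * (1 - v e))"
    by (simp add: algebra_simps)
   also have "\<bar>...\<bar> <= \<bar>ph (thd (fst e) * thd e)\<bar> * (1 - v e)"
    using v by (auto simp: indicator_def abs_mult)
   finally show "ennreal \<bar>?f e - ?g e\<bar> <= ennreal (\<bar>ph (thd (fst e) * thd e)\<bar> * (1 - v e))"
    by (rule ennreal_leI)
  qed
  also note e(1)
  finally show "(nnint R (%e. ennreal \<bar>?f e - ?g e\<bar>)) <= ennreal \<epsilon>" .
 qed (rule e)
 finally show ?thesis .
qed

text \<open>The cutoff is placed on the multiplier s of the fixed q. Its error is uniform in p:
  |ph(t s)| <= C t s, and the weight t turns an integral over R into one over q, where s has a small
  tail.\<close>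

lemma joint_product_continuous_fst:
 fixes X :: "'x measure" and Y :: "'y measure" and W :: "'w measure"
 assumes X: "prob_space X" and Y: "prob_space Y" and W: "lebesgue_prob_space W" and q: "q : Pol Y W"
 shows "continuous_map (pol_topology X Y) (pol_topology X W) (%p. joint_product X Y W p q)"
proof (rule continuous_map_into_pol_topology[OF X lebesgue_prob_spaceD[OF W]])
 have W': "prob_space W" by (rule lebesgue_prob_spaceD[OF W])
 show "joint_product X Y W p q : Pol X W" if "p : topspace (pol_topology X Y)" for p
  using that by (intro joint_product_Pol X Y W q) simp
 fix A D ph assume A [measurable]: "A : sets X" and D [measurable]: "D : sets W" and ph: "cc ph"
 have [measurable]: "ph : BM rpos" by (rule cc_measurable[OF ph])
 define R where "R p = (SOME R. is_joint X Y W p q R)" for p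
 have R: "is_joint X Y W p q (R p)" if "p : Pol X Y" for p
  unfolding R_def by (rule some_joint[OF X Y W that q])
 let ?F = "%p. LINT e|(R p). ind A (fst (fst e)) * ind D (mid e) * ph (thd (fst e) * thd e)"
 have "continuous_map (pol_topology X Y) euclideanreal ?F"
 proof (rule continuous_map_uniform_approx)
  fix \<epsilon> :: real assume \<epsilon>: "0 < \<epsilon>"
  obtain C where C: "C > 0" "!!t. t > 0 ==> \<bar>ph t\<bar> <= C * t" "!!t. t > 0 ==> \<bar>ph t\<bar> <= C"
   using cc_bound_linear[OF ph] by metis
  obtain n where n: "(nnint q (%z. ennreal (thd z * (1 - cutoff n (thd z))))) <= ennreal (\<epsilon> / C)"
   by (rule Pol_cutoff_tail[OF Y W' q, of "\<epsilon> / C" "%t. t"]) (use \<epsilon> C(1) in \<open>auto intro: continuous_on_id\<close>)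
  define G where "G p = (LINT e|(R p). ind A (fst (fst e)) * ind D (mid e) *
   (ph (thd (fst e) * thd e) * cutoff n (thd e)))" for p
  have "continuous_map (pol_topology X Y) euclideanreal G"
  proof -
   obtain m :: nat where m: "!!t s. 0 < t ==> 0 < s ==> \<bar>ln t\<bar> > real m \<or> \<bar>ln s\<bar> > real m ==> ph (t * s) * cutoff n s = 0"
    using cc_product_support[OF ph] by metis
   have "continuous_map (pol_topology X Y) euclideanreal (%p. LINT e|(R p). ind A (fst (fst e)) * ind D (mid e) *
    (%z. ph (fst z * snd z) * cutoff n (snd z)) (thd (fst e), thd e))"
   proof (rule continuous_map_joint_compact[OF _ A D _ joint_continuous_product(1)[OF ph] joint_continuous_product(3)[OF ph], where m = m and M = C])
    show "prob_space (R p) \<and> sets (R p) = sets ((X >< (Y >< rpos)) >< (W >< rpos))" if "p : topspace (pol_topology X Y)" for p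
    using that R[of p] prob_space_joint[OF X Y _ q R[of p]] by (simp add: sets_joint)
    show "(%z. ph (fst z * snd z) * cutoff n (snd z)) (t, s) = 0" if "0 < t" "0 < s" "real m < \<bar>ln t\<bar> \<or> real m < \<bar>ln s\<bar>" for t s
    using m[OF that] by simp
    show "\<bar>(%z. ph (fst z * snd z) * cutoff n (snd z)) (t, s)\<bar> <= C" if "0 < t" "0 < s" for t s
    using order.trans[OF abs_mult_cutoff C(3)[of "t * s"]] that by simp
    fix a b assume a: "cc a" and b: "cc b"
    obtain g B where g: "g : BM Y" "!!y. y : space Y ==> \<bar>g y\<bar> <= (B :: real)"
    and eq: "!!p R. prob_space X ==> p : Pol X Y ==> is_joint X Y W p q R ==>
    (LINT e|R. ind A (fst (fst e)) * ind D (mid e) * (a (thd (fst e)) * b (thd e))) =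
    (LINT z|p. ind A (fst z) * g (mid z) * a (thd z))"
    by (rule joint_base_fst[OF Y q A D a b], rule that)
    show "continuous_map (pol_topology X Y) euclideanreal
    (%p. LINT e|(R p). ind A (fst (fst e)) * ind D (mid e) * (a (thd (fst e)) * b (thd e)))"
    proof (rule continuous_map_eq[OF continuous_map_pol_snd[OF X Y A g a]])
    fix p assume "p : topspace (pol_topology X Y)"
    then have p: "p : Pol X Y" by simp
    show "(LINT z|p. ind A (fst z) * g (mid z) * a (thd z)) =
    (LINT e|(R p). ind A (fst (fst e)) * ind D (mid e) * (a (thd (fst e)) * b (thd e)))"
    by (rule eq[OF X p R[OF p], symmetric])
    qed
   qed
   then show ?thesis by (simp add: G_def[abs_def])
  qed
  moreover have "\<bar>?F p - G p\<bar> <= \<epsilon>" if p: "p : Pol X Y" for p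
   unfolding G_def
  proof (rule joint_tail[OF X Y p q R[OF p] A D ph])
   show "0 <= cutoff n (thd e) \<and> cutoff n (thd e) <= 1" for e :: "('x \<times> 'y \<times> real) \<times> ('w \<times> real)"
    by (simp add: cutoff_bounds)
   show "0 <= \<epsilon>" using \<epsilon> by simp
   have "(nnint (R p) (%e. ennreal (\<bar>ph (thd (fst e) * thd e)\<bar> * (1 - cutoff n (thd e)))))
    <= (nnint (R p) (%e. ennreal (thd (fst e)) * (ennreal C * ennreal (thd e * (1 - cutoff n (thd e))))))"
   proof (rule nn_integral_mono)
    fix e assume "e : space (R p)"
    then have t: "thd (fst e) > 0" (is "?t > 0") "thd e > 0" (is "?s > 0") by (auto simp: space_joint[OF R[OF p]])
    have "\<bar>ph (?t * ?s)\<bar> * (1 - cutoff n ?s) <= (C * (?t * ?s)) * (1 - cutoff n ?s)"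
    using C(2)[of "?t * ?s"] t cutoff_bounds(2)[of n ?s] by (intro mult_right_mono) auto
    also have "... = ?t * (C * (?s * (1 - cutoff n ?s)))" by (simp add: mult_ac)
    finally have "ennreal (\<bar>ph (?t * ?s)\<bar> * (1 - cutoff n ?s)) <= ennreal (?t * (C * (?s * (1 - cutoff n ?s))))"
    by (rule ennreal_leI)
    also have "... = ennreal ?t * (ennreal C * ennreal (?s * (1 - cutoff n ?s)))"
    using t C(1) cutoff_bounds(2)[of n ?s] by (simp add: ennreal_mult)
    finally show "ennreal (\<bar>ph (?t * ?s)\<bar> * (1 - cutoff n ?s)) <= ennreal ?t * (ennreal C * ennreal (?s * (1 - cutoff n ?s)))" .
   qed
   also have "... = (nnint q (%z. ennreal C * ennreal (thd z * (1 - cutoff n (thd z)))))"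
    by (rule joint_nn_integral_t_snd[OF X Y p q R[OF p], of "%v. ennreal C * ennreal (snd v * (1 - cutoff n (snd v)))"]) measurable
   also have "... = ennreal C * (nnint q (%z. ennreal (thd z * (1 - cutoff n (thd z)))))"
   proof (rule nn_integral_cmult)
    note sets_Pol[OF q, measurable_cong]
    show "(%z. ennreal (thd z * (1 - cutoff n (thd z)))) : BM q" by measurable
   qed
   also have "... <= ennreal C * ennreal (\<epsilon> / C)" by (intro mult_left_mono n) simp
   also have "... = ennreal \<epsilon>" using C(1) \<epsilon> by (simp add: ennreal_mult[symmetric])
   finally show "(nnint (R p) (%e. ennreal (\<bar>ph (thd (fst e) * thd e)\<bar> * (1 - cutoff n (thd e))))) <= ennreal \<epsilon>" .
  qed measurable
  ultimately show "\<exists>G. continuous_map (pol_topology X Y) euclideanreal G \<and> (\<forall>p\<in>topspace (pol_topology X Y). \<bar>?F p - G p\<bar> <= \<epsilon>)"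
   by auto
 qed
 then show "continuous_map (pol_topology X Y) euclideanreal (%p. pol_test A D ph (joint_product X Y W p q))"
 proof (rule continuous_map_eq)
  fix p assume "p : topspace (pol_topology X Y)"
  then have "p : Pol X Y" by simp
  then show "?F p = pol_test A D ph (joint_product X Y W p q)"
   unfolding joint_product_def R_def[symmetric] by (subst pol_test_joint_push[OF R]) auto
 qed
qed

text \<open>Now the cutoff acts on the multiplier t of the fixed p. The constant bound |ph| <= C is
  enough here, because R projects onto p without a weight.\<close>

lemma joint_product_continuous_snd:
 fixes X :: "'x measure" and Y :: "'y measure" and W :: "'w measure"
 assumes X: "prob_space X" and Y: "prob_space Y" and W: "lebesgue_prob_space W" and p: "p : Pol X Y"
 shows "continuous_map (pol_topology Y W) (pol_topology X W) (%q. joint_product X Y W p q)"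
proof (rule continuous_map_into_pol_topology[OF X lebesgue_prob_spaceD[OF W]])
 have W': "prob_space W" by (rule lebesgue_prob_spaceD[OF W])
 show "joint_product X Y W p q : Pol X W" if "q : topspace (pol_topology Y W)" for q
  using that by (intro joint_product_Pol X Y W p) simp
 fix A D ph assume A [measurable]: "A : sets X" and D [measurable]: "D : sets W" and ph: "cc ph"
 have [measurable]: "ph : BM rpos" by (rule cc_measurable[OF ph])
 define R where "R q = (SOME R. is_joint X Y W p q R)" for q
 have R: "is_joint X Y W p q (R q)" if "q : Pol Y W" for q
  unfolding R_def by (rule some_joint[OF X Y W p that])
 let ?F = "%q. LINT e|(R q). ind A (fst (fst e)) * ind D (mid e) * ph (thd (fst e) * thd e)"
 have "continuous_map (pol_topology Y W) euclideanreal ?F"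
 proof (rule continuous_map_uniform_approx)
  fix \<epsilon> :: real assume \<epsilon>: "0 < \<epsilon>"
  obtain C where C: "C > 0" "!!t. t > 0 ==> \<bar>ph t\<bar> <= C * t" "!!t. t > 0 ==> \<bar>ph t\<bar> <= C"
   using cc_bound_linear[OF ph] by metis
  obtain n where n: "(nnint p (%z. ennreal (1 * (1 - cutoff n (thd z))))) <= ennreal (\<epsilon> / C)"
   by (rule Pol_cutoff_tail[OF X Y p, of "\<epsilon> / C" "%t. 1"]) (use \<epsilon> C(1) in auto)
  define G where "G q = (LINT e|(R q). ind A (fst (fst e)) * ind D (mid e) *
   (ph (thd (fst e) * thd e) * cutoff n (thd (fst e))))" for q
  have "continuous_map (pol_topology Y W) euclideanreal G"
  proof -
   obtain m :: nat where m: "!!t s. 0 < t ==> 0 < s ==> \<bar>ln t\<bar> > real m \<or> \<bar>ln s\<bar> > real m ==> ph (t * s) * cutoff n t = 0"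
    using cc_product_support[OF ph] by metis
   have "continuous_map (pol_topology Y W) euclideanreal (%q. LINT e|(R q). ind A (fst (fst e)) * ind D (mid e) *
    (%z. ph (fst z * snd z) * cutoff n (fst z)) (thd (fst e), thd e))"
   proof (rule continuous_map_joint_compact[OF _ A D _ joint_continuous_product(2)[OF ph] joint_continuous_product(4)[OF ph], where m = m and M = C])
    show "prob_space (R q) \<and> sets (R q) = sets ((X >< (Y >< rpos)) >< (W >< rpos))" if "q : topspace (pol_topology Y W)" for q
    using that R[of q] prob_space_joint[OF X Y p _ R[of q]] by (simp add: sets_joint)
    show "(%z. ph (fst z * snd z) * cutoff n (fst z)) (t, s) = 0" if "0 < t" "0 < s" "real m < \<bar>ln t\<bar> \<or> real m < \<bar>ln s\<bar>" for t s
    using m[OF that] by simp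
    show "\<bar>(%z. ph (fst z * snd z) * cutoff n (fst z)) (t, s)\<bar> <= C" if "0 < t" "0 < s" for t s
    using order.trans[OF abs_mult_cutoff C(3)[of "t * s"]] that by simp
    fix a b assume a: "cc a" and b: "cc b"
    obtain g B where g: "g : BM Y" "!!y. y : space Y ==> \<bar>g y\<bar> <= (B :: real)"
    and eq: "!!q R. prob_space W ==> q : Pol Y W ==> is_joint X Y W p q R ==>
    (LINT e|R. ind A (fst (fst e)) * ind D (mid e) * (a (thd (fst e)) * b (thd e))) =
    (LINT z|q. g (fst z) * ind D (mid z) * b (thd z))"
    by (rule joint_base_snd[OF X Y p A D a b], rule that)
    show "continuous_map (pol_topology Y W) euclideanreal
    (%q. LINT e|(R q). ind A (fst (fst e)) * ind D (mid e) * (a (thd (fst e)) * b (thd e)))"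
    proof (rule continuous_map_eq[OF continuous_map_pol_fst[OF Y W' D g b]])
    fix q assume "q : topspace (pol_topology Y W)"
    then have q: "q : Pol Y W" by simp
    show "(LINT z|q. g (fst z) * ind D (mid z) * b (thd z)) =
    (LINT e|(R q). ind A (fst (fst e)) * ind D (mid e) * (a (thd (fst e)) * b (thd e)))"
    by (rule eq[OF W' q R[OF q], symmetric])
    qed
   qed
   then show ?thesis by (simp add: G_def[abs_def])
  qed
  moreover have "\<bar>?F q - G q\<bar> <= \<epsilon>" if q: "q : Pol Y W" for q
   unfolding G_def
  proof (rule joint_tail[OF X Y p q R[OF q] A D ph])
   show "0 <= cutoff n (thd (fst e)) \<and> cutoff n (thd (fst e)) <= 1" for e :: "('x \<times> 'y \<times> real) \<times> ('w \<times> real)"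
    by (simp add: cutoff_bounds)
   show "0 <= \<epsilon>" using \<epsilon> by simp
   have "(nnint (R q) (%e. ennreal (\<bar>ph (thd (fst e) * thd e)\<bar> * (1 - cutoff n (thd (fst e))))))
    <= (nnint (R q) (%e. ennreal C * ennreal (1 * (1 - cutoff n (thd (fst e))))))"
   proof (rule nn_integral_mono)
    fix e assume "e : space (R q)"
    then have t: "thd (fst e) > 0" (is "?t > 0") "thd e > 0" (is "?s > 0") by (auto simp: space_joint[OF R[OF q]])
    have "\<bar>ph (?t * ?s)\<bar> * (1 - cutoff n ?t) <= C * (1 * (1 - cutoff n ?t))"
    using C(3)[of "?t * ?s"] t cutoff_bounds(2)[of n ?t] by (simp only: mult_1_left, intro mult_right_mono) auto
    then have "ennreal (\<bar>ph (?t * ?s)\<bar> * (1 - cutoff n ?t)) <= ennreal (C * (1 * (1 - cutoff n ?t)))"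
    by (rule ennreal_leI)
    also have "... = ennreal C * ennreal (1 * (1 - cutoff n ?t))"
    using C(1) cutoff_bounds(2)[of n ?t] by (simp add: ennreal_mult)
    finally show "ennreal (\<bar>ph (?t * ?s)\<bar> * (1 - cutoff n ?t)) <= ennreal C * ennreal (1 * (1 - cutoff n ?t))" .
   qed
   also have "... = (nnint p (%z. ennreal C * ennreal (1 * (1 - cutoff n (thd z)))))"
    by (rule joint_nn_integral_fst[OF X Y p q R[OF q], of "%z. ennreal C * ennreal (1 * (1 - cutoff n (thd z)))"]) measurable
   also have "... = ennreal C * (nnint p (%z. ennreal (1 * (1 - cutoff n (thd z)))))"
   proof (rule nn_integral_cmult)
    note sets_Pol[OF p, measurable_cong]
    show "(%z. ennreal (1 * (1 - cutoff n (thd z)))) : BM p" by measurable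
   qed
   also have "... <= ennreal C * ennreal (\<epsilon> / C)" by (intro mult_left_mono n) simp
   also have "... = ennreal \<epsilon>" using C(1) \<epsilon> by (simp add: ennreal_mult[symmetric])
   finally show "(nnint (R q) (%e. ennreal (\<bar>ph (thd (fst e) * thd e)\<bar> * (1 - cutoff n (thd (fst e)))))) <= ennreal \<epsilon>" .
  qed measurable
  ultimately show "\<exists>G. continuous_map (pol_topology Y W) euclideanreal G \<and> (\<forall>q\<in>topspace (pol_topology Y W). \<bar>?F q - G q\<bar> <= \<epsilon>)"
   by auto
 qed
 then show "continuous_map (pol_topology Y W) euclideanreal (%q. pol_test A D ph (joint_product X Y W p q))"
 proof (rule continuous_map_eq)
  fix q assume "q : topspace (pol_topology Y W)"
  then have "q : Pol Y W" by simp
  then show "?F q = pol_test A D ph (joint_product X Y W p q)"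
   unfolding joint_product_def R_def[symmetric] by (subst pol_test_joint_push[OF R]) auto
 qed
qed

section \<open>Products of polymorphisms given by kernels\<close>

lemma M_tri_kernel_fin_kernel:
 assumes "M_tri_kernel X Y s"
 shows "fin_kernel (X >< Y) rpos (%z. s (fst z) (snd z))"
 using assms unfolding M_tri_kernel_def M_tri_def fin_kernel_def
 by (auto simp: space_pair_measure split_beta')

lemma fin_kernel_compose:
 assumes "fin_kernel M N kp" and [measurable]: "f : L \<rightarrow>\<^sub>M M"
 shows "fin_kernel L N (%z. kp (f z))"
 unfolding fin_kernel_def
proof (intro conjI ballI)
 fix z assume "z : space L"
 then have "f z : space M" by (rule measurable_space[OF assms(2)])
 then show "sets (kp (f z)) = sets N" "finite_measure (kp (f z))" using assms(1) by (auto simp: fin_kernel_def)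
next
 fix C assume "C : sets N"
 then have [measurable]: "(%z. em (kp z) C) : BM M" using assms(1) by (auto simp: fin_kernel_def)
 show "(%z. em (kp (f z)) C) : BM L" by measurable
qed

lemma fin_kernel_pair:
 assumes u: "fin_kernel L M u" and v: "fin_kernel L N v" and ne: "space M ~= {}" "space N ~= {}"
 shows "fin_kernel L (M >< N) (%z. u z >< v z)"
 unfolding fin_kernel_def
proof (intro conjI ballI)
 fix z assume z: "z : space L"
 then show "sets (u z >< v z) = sets (M >< N)"
  using u v by (intro sets_pair_measure_cong) (auto simp: fin_kernel_def)
 interpret U: finite_measure "u z" using z u by (auto simp: fin_kernel_def)
 interpret V: finite_measure "v z" using z v by (auto simp: fin_kernel_def)
 show "finite_measure (u z >< v z)"
  by (rule finite_measureI)
   (simp add: space_pair_measure V.emeasure_pair_measure_Times ennreal_mult_eq_top_iff)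
next
 fix C assume C [measurable]: "C : sets (M >< N)"
 have v': "fin_kernel (L >< M) N (%a. v (fst a))" by (rule fin_kernel_compose[OF v]) measurable
 have "(%a. nnint (v (fst a)) (%s. ind C (snd a, s))) : BM (L >< M)"
  by (rule nn_integral_fin_kernel[OF v' ne(2)]) measurable
 then have "(%z. nnint (u z) (%t. nnint (v z) (%s. ind C (t, s)))) : BM L"
  by (intro nn_integral_fin_kernel[OF u ne(1)]) (simp add: split_beta')
 moreover have "em (u z >< v z) C = (nnint (u z) (%t. nnint (v z) (%s. ind C (t, s))))" if z: "z : space L" for z
 proof -
  have s: "sets (u z >< v z) = sets (M >< N)"
   using u v z by (intro sets_pair_measure_cong) (auto simp: fin_kernel_def)
  interpret finite_measure "v z" using z v by (auto simp: fin_kernel_def)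
  show ?thesis by (rule emeasure_pair_measure) (simp add: s)
 qed
 ultimately show "(%z. em (u z >< v z) C) : BM L" by (simp cong: measurable_cong)
qed

lemma emeasure_pair_rectangle:
 assumes "finite_measure v" "A : sets u" "B : sets v"
 shows "em (u >< v) (A \<times> B) = em u A * em v B"
proof -
 interpret finite_measure v by fact
 show ?thesis using assms(2,3) by (rule emeasure_pair_measure_Times)
qed

lemma rpos_prod_measurable: "(%z. fst z * snd z) : rpos >< rpos \<rightarrow>\<^sub>M rpos"
 by measurable

lemma emeasure_mult_convolution:
 assumes "sets u = sets rpos" "sets v = sets rpos" "C : sets rpos"
 shows "em (mult_convolution u v) C = em (u >< v) {z : space (rpos >< rpos). fst z * snd z : C}"
proof -
 have s: "sets (u >< v) = sets (rpos >< rpos)" using assms by (intro sets_pair_measure_cong)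
 have "(%z. fst z * snd z) : u >< v \<rightarrow>\<^sub>M rpos"
  using rpos_prod_measurable by (simp add: measurable_cong_sets[OF s refl])
 then show ?thesis
  unfolding mult_convolution_def split_beta' using assms(3) sets_eq_imp_space_eq[OF s]
  by (subst emeasure_distr) (auto intro!: arg_cong2[where f = emeasure])
qed

text \<open>\<open>measure_of\<close> takes the prescribed values only for a set function that is a
  measure. Here it is one, being the image under multiplication of the semidirect product of Y with
  the kernel of product measures.\<close>

lemma kernel_product_emeasure:
 assumes u: "M_tri_kernel X Y u" and v: "M_tri_kernel Y W v" and x: "x : space X" and w: "w : space W"
  and C: "C : sets rpos"
 shows "em (kernel_product Y u v x w) C = (nnint Y (%y. em (mult_convolution (u x y) (v y w)) C))"
proof -
 have ne: "space rpos ~= {}" by (auto intro: exI[of _ 1])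
 have fu: "fin_kernel Y rpos (%y. u x y)"
  using fin_kernel_compose[OF M_tri_kernel_fin_kernel[OF u], of "%y. (x, y)" Y] x by simp
 have fv: "fin_kernel Y rpos (%y. v y w)"
  using fin_kernel_compose[OF M_tri_kernel_fin_kernel[OF v], of "%y. (y, w)" Y] w by simp
 note k = fin_kernel_pair[OF fu fv ne ne]
 have ne2: "space (rpos >< rpos) ~= {}" using ne by (simp add: space_pair_measure)
 define M where "M = distr (semidirect Y (rpos >< rpos) (%y. u x y >< v y w)) rpos (%a. mid a * thd a)"
 have eM: "em M C = (nnint Y (%y. em (mult_convolution (u x y) (v y w)) C))" if C [measurable]: "C : sets rpos" for C
 proof -
  let ?S = "semidirect Y (rpos >< rpos) (%y. u x y >< v y w)"
  have "em M C = (nnint M (%a. ind C a))" using C by (simp add: M_def)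
  also have "... = (nnint ?S (%a. ind C (mid a * thd a)))"
   unfolding M_def by (rule nn_integral_distr) measurable
  also have "... = (nnint Y (%y. nnint (u x y >< v y w) (%z. ind C (fst z * snd z))))"
   by (subst nn_integral_semidirect[OF k ne2]) simp_all
  also have "... = (nnint Y (%y. em (mult_convolution (u x y) (v y w)) C))"
  proof (rule nn_integral_cong)
   fix y assume y: "y : space Y"
   have su: "sets (u x y) = sets rpos" "sets (v y w) = sets rpos" using fu fv y by (auto simp: fin_kernel_def)
   have s: "sets (u x y >< v y w) = sets (rpos >< rpos)" using su by (intro sets_pair_measure_cong)
   have m: "{z : space (rpos >< rpos). fst z * snd z : C} : sets (u x y >< v y w)"
    unfolding s by measurable
   have "(nnint (u x y >< v y w) (%z. ind C (fst z * snd z))) =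
    (nnint (u x y >< v y w) (%z. ind {z : space (rpos >< rpos). fst z * snd z : C} z))"
    by (rule nn_integral_cong) (auto simp: sets_eq_imp_space_eq[OF s] indicator_def)
   also have "... = em (mult_convolution (u x y) (v y w)) C"
    using m emeasure_mult_convolution[OF su C] by simp
   finally show "(nnint (u x y >< v y w) (%z. ind C (fst z * snd z))) = em (mult_convolution (u x y) (v y w)) C" .
  qed
  finally show ?thesis .
 qed
 have "kernel_product Y u v x w = measure_of (space M) (sets M) (em M)"
  unfolding kernel_product_def
  by (rule trans[OF measure_of_eq[of _ _ _ "em M"]])
   (use eM sets.sets_into_space[of _ rpos] in \<open>auto simp: M_def sets.sigma_sets_eq[of rpos, simplified]\<close>)
 also have "... = M" by (rule measure_of_of_measure)
 finally show ?thesis using eM[OF C] by simp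
qed

text \<open>Given x, y and w the multipliers t and s are independent with the laws u and v, so over
  (x, w) their product has the convolution integrated in y as its law. The identity is proved first
  for the pair (t, s).\<close>

lemma joint_push_given_by:
 fixes X :: "'x measure" and Y :: "'y measure" and W :: "'w measure"
 assumes X: "prob_space X" and Y: "prob_space Y" and W: "prob_space W"
  and p: "p : Pol X Y" and q: "q : Pol Y W" and R: "is_joint X Y W p q R"
  and u: "M_tri_kernel X Y u" "given_by X Y p u" and v: "M_tri_kernel Y W v" "given_by Y W q v"
 shows "given_by X W (joint_push X W R) (kernel_product Y u v)"
 unfolding given_by_def
proof (intro ballI)
 interpret X: prob_space X by fact
 interpret Y: prob_space Y by fact
 interpret W: prob_space W by fact
 interpret XY: pair_prob_space X Y ..
 interpret YW: pair_prob_space Y W ..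
 interpret p: prob_space p by (rule Pol_prob_space[OF p X])
 interpret R: prob_space R by (rule prob_space_joint[OF X Y p q R])
 note sets_joint[OF R, measurable_cong] and sets_Pol[OF p, measurable_cong] and sets_Pol[OF q, measurable_cong]
 fix A D C assume A [measurable]: "A : sets X" and D [measurable]: "D : sets W" and C [measurable]: "C : sets rpos"
 have ne: "space rpos ~= {}" by (auto intro: exI[of _ 1])
 have ne2: "space (rpos >< rpos) ~= {}" using ne by (simp add: space_pair_measure)
 have um [measurable]: "(%z. em (u (fst z) (snd z)) C) : BM (X >< Y)" if "C : sets rpos" for C
  using u(1) that by (auto simp: M_tri_kernel_def split_beta')
 have vm [measurable]: "(%z. em (v (fst z) (snd z)) C) : BM (Y >< W)" if "C : sets rpos" for C
  using v(1) that by (auto simp: M_tri_kernel_def split_beta')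
 have su: "sets (u x y) = sets rpos" "finite_measure (u x y)" if "x : space X" "y : space Y" for x y
  using u(1) that by (auto simp: M_tri_kernel_def M_tri_def)
 have sv: "sets (v y w) = sets rpos" "finite_measure (v y w)" if "y : space Y" "w : space W" for y w
  using v(1) that by (auto simp: M_tri_kernel_def M_tri_def)
 let ?Z = "(X >< Y) >< W"
 let ?kp = "%z. u (fst (fst z)) (snd (fst z)) >< v (snd (fst z)) (snd z)"
 have fu: "fin_kernel ?Z rpos (%z. u (fst (fst z)) (snd (fst z)))"
  using fin_kernel_compose[OF M_tri_kernel_fin_kernel[OF u(1)], of fst ?Z] by simp
 have fv: "fin_kernel ?Z rpos (%z. v (snd (fst z)) (snd z))"
  using fin_kernel_compose[OF M_tri_kernel_fin_kernel[OF v(1)], of "%z. (snd (fst z), snd z)" ?Z] by simp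
 note fk = fin_kernel_pair[OF fu fv ne ne]
 have kS: "(%z. em (?kp z) S) : BM ?Z" if "S : sets (rpos >< rpos)" for S
  using fk that by (auto simp: fin_kernel_def)
 \<comment> \<open>N1 and N2 are the laws of the pair (t, s) over A and D, computed from the joint
   measure and from the kernels.\<close>
 define N1 where "N1 = distr (density R (%e. ind A (fst (fst e)) * ind D (mid e))) (rpos >< rpos)
  (%e. (thd (fst e), thd e))"
 define N2 where "N2 = distr (density (semidirect ?Z (rpos >< rpos) ?kp) (%a. ind A (fst (fst (fst a))) * ind D (snd (fst a)))) (rpos >< rpos) snd"
 have N1: "em N1 S = (nnint R (%e. ind A (fst (fst e)) * ind D (mid e) * ind S (thd (fst e), thd e)))"
  if [measurable]: "S : sets (rpos >< rpos)" for S
 proof -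
  have "em N1 S = (nnint N1 (%s. ind S s))" using that by (simp add: N1_def)
  also have "... = (nnint R (%e. ind A (fst (fst e)) * ind D (mid e) * ind S (thd (fst e), thd e)))"
   unfolding N1_def by (subst nn_integral_distr) (simp_all add: nn_integral_density)
  finally show ?thesis .
 qed
 have N2: "em N2 S = (nnint ?Z (%z. ind A (fst (fst z)) * ind D (snd z) * em (?kp z) S))"
  if S [measurable]: "S : sets (rpos >< rpos)" for S
 proof -
  have "em N2 S = (nnint N2 (%s. ind S s))" using that by (simp add: N2_def)
  also have "... = (nnint (semidirect ?Z (rpos >< rpos) ?kp) (%a. ind A (fst (fst (fst a))) * ind D (snd (fst a)) * ind S (snd a)))"
   unfolding N2_def by (subst nn_integral_distr) (simp_all add: nn_integral_density)
  also have "... = (nnint ?Z (%z. nnint (?kp z) (%s. ind A (fst (fst z)) * ind D (snd z) * ind S s)))"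
   by (subst nn_integral_semidirect[OF fk ne2]) simp_all
  also have "... = (nnint ?Z (%z. ind A (fst (fst z)) * ind D (snd z) * em (?kp z) S))"
  proof (rule nn_integral_cong)
   fix z assume "z : space ?Z"
   then have "sets (?kp z) = sets (rpos >< rpos)" using fk by (auto simp: fin_kernel_def)
   then have "S : sets (?kp z)" using S by simp
   then show "(nnint (?kp z) (%s. ind A (fst (fst z)) * ind D (snd z) * ind S s)) = ind A (fst (fst z)) * ind D (snd z) * em (?kp z) S"
    by (rule nn_integral_cmult_indicator)
  qed
  finally show ?thesis .
 qed
 have "N1 = N2"
 proof (rule measure_eqI_rectangles)
  show "sets N1 = sets (rpos >< rpos)" "sets N2 = sets (rpos >< rpos)" by (simp_all add: N1_def N2_def)
  have "em N1 (space rpos \<times> space rpos) <= (nnint R (%e. 1))"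
  proof -
   have "space rpos \<times> space rpos : sets (rpos >< rpos)" by (intro pair_measureI sets.top)
   note N1[OF this]
   also have "(nnint R (%e. ind A (fst (fst e)) * ind D (mid e) *
    ind (space rpos \<times> space rpos) (thd (fst e), thd e))) <= (nnint R (%e. 1))"
    by (rule nn_integral_mono) (auto split: split_indicator)
   finally show ?thesis .
  qed
  also have "... = 1" by (simp add: R.emeasure_space_1)
  finally show "em N1 (space rpos \<times> space rpos) ~= \<infinity>" by (auto simp: top_unique)
  fix C C' assume C [measurable]: "C : sets rpos" and C' [measurable]: "C' : sets rpos"
  have ind: "ind (C \<times> C') (t, s) = (ind C t * ind C' s :: ennreal)" for t s by (auto simp: indicator_def)
  \<comment> \<open>h and k are the densities in y of q restricted to D and C', and of p restricted
    to A and C. On a rectangle both laws have the mass given by the integral of k h.\<close>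
  define h where "h y = (nnint W (%w. ind D w * em (v y w) C'))" for y
  define k where "k y = (nnint X (%x. ind A x * em (u x y) C))" for y
  have vm2 [measurable]: "(%(y, w). ind D w * em (v y w) C') : BM (Y >< W)"
   using vm[OF C'] by (simp add: split_beta')
  have um2 [measurable]: "(%(y, x). ind A x * em (u x y) C) : BM (Y >< X)"
   using measurable_compose[OF measurable_pair_swap' um[OF C]] by (simp add: split_beta')
  have hm [measurable]: "h : BM Y" unfolding h_def by measurable
  have km [measurable]: "k : BM Y" unfolding k_def by measurable
  have hH: "(nnint q (%z. (ind D (mid z) * ind C' (thd z)) * ind B (fst z))) = (nnint Y (%y. h y * ind B y))"
   if B [measurable]: "B : sets Y" for B
  proof -
   have "(nnint q (%z. (ind D (mid z) * ind C' (thd z)) * ind B (fst z))) = (nnint q (%z. ind (B \<times> D \<times> C') z))"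
    by (rule nn_integral_cong) (auto simp: indicator_def)
   also have "... = em q (B \<times> D \<times> C')" by (rule nn_integral_indicator) (simp add: sets_Pol[OF q])
   also have "... = (nnint (Y >< W) (%(y, w). em (v y w) C' * ind (B \<times> D) (y, w)))"
    using v(2) B D C' unfolding given_by_def by blast
   also have "... = (nnint (Y >< W) (%z. (%z. ind B (fst z) * (ind D (snd z) * em (v (fst z) (snd z)) C')) z))"
    by (rule nn_integral_cong) (auto simp: indicator_def split_beta')
   also have "... = (nnint Y (%y. nnint W (%w. ind B y * (ind D w * em (v y w) C'))))"
    by (subst W.nn_integral_fst[symmetric]) (use vm[OF C'] in simp_all)
   also have "... = (nnint Y (%y. h y * ind B y))"
   proof (rule nn_integral_cong)
    fix y assume y: "y : space Y"
    have "(%w. ind D w * em (v y w) C') : BM W"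
    using measurable_Pair2[OF vm2 y] by simp
    then show "(nnint W (%w. ind B y * (ind D w * em (v y w) C'))) = h y * ind B y"
    unfolding h_def by (simp add: nn_integral_cmult mult.commute)
   qed
   finally show ?thesis .
  qed
  have kF: "(nnint p (%z. (ind A (fst z) * ind C (thd z)) * ind B (mid z))) = (nnint Y (%y. k y * ind B y))"
   if B [measurable]: "B : sets Y" for B
  proof -
   have "(nnint p (%z. (ind A (fst z) * ind C (thd z)) * ind B (mid z))) = (nnint p (%z. ind (A \<times> B \<times> C) z))"
    by (rule nn_integral_cong) (auto simp: indicator_def)
   also have "... = em p (A \<times> B \<times> C)" by (rule nn_integral_indicator) (simp add: sets_Pol[OF p])
   also have "... = (nnint (X >< Y) (%(x, y). em (u x y) C * ind (A \<times> B) (x, y)))"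
    using u(2) A B C unfolding given_by_def by blast
   also have "... = (nnint (X >< Y) (%(x, y). ind B y * (ind A x * em (u x y) C)))"
    by (rule nn_integral_cong) (auto simp: indicator_def split_beta')
   also have "... = (nnint Y (%y. nnint X (%x. ind B y * (ind A x * em (u x y) C))))"
    by (subst XY.nn_integral_snd[symmetric]) (use um[OF C] in \<open>simp_all add: split_beta'\<close>)
   also have "... = (nnint Y (%y. k y * ind B y))"
   proof (rule nn_integral_cong)
    fix y assume y: "y : space Y"
    have "(%x. ind A x * em (u x y) C) : BM X"
    using measurable_Pair2[OF um2 y] by simp
    then show "(nnint X (%x. ind B y * (ind A x * em (u x y) C))) = k y * ind B y"
    unfolding k_def by (simp add: nn_integral_cmult mult.commute)
   qed
   finally show ?thesis .
  qed
  have fin: "(nnint p (%z. ind A (fst z) * ind C (thd z))) < \<infinity>"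
  proof -
   have "(nnint p (%z. ind A (fst z) * ind C (thd z))) <= (nnint p (%z. 1))"
    by (intro nn_integral_mono) (auto simp: indicator_def)
   also have "... < \<infinity>" by (simp add: p.emeasure_space_1)
   finally show ?thesis .
  qed
  have "em N1 (C \<times> C') = (nnint R (%e. (ind A (fst (fst e)) * ind C (thd (fst e))) * (ind D (mid e) * ind C' (thd e))))"
   by (subst N1) (simp_all add: ind mult_ac)
  also have "... = (nnint p (%z. (ind A (fst z) * ind C (thd z)) * h (mid z)))"
   by (rule joint_eq_fst[where H = "%v. ind D (fst v) * ind C' (snd v)", OF X Y p q R _ hm _ fin hH]) simp_all
  also have "... = (nnint Y (%y. k y * h y))"
   by (rule nn_integral_eq_of_sets[OF kF]) simp_all
  also have "... = em N2 (C \<times> C')"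
  proof -
   have gm [measurable]: "(%z. ind A (fst (fst z)) * ind D (snd z) * (em (u (fst (fst z)) (snd (fst z))) C * em (v (snd (fst z)) (snd z)) C')) : BM ?Z"
   proof -
    have [measurable]: "(%z. em (u (fst (fst z)) (snd (fst z))) C) : BM ?Z"
    by (rule measurable_compose[OF measurable_fst um[OF C]])
    have [measurable]: "(%z. em (v (snd (fst z)) (snd z)) C') : BM ?Z"
    using measurable_compose[OF _ vm[OF C'], of "%z. (snd (fst z), snd z)" ?Z] by simp
    show ?thesis by measurable
   qed
   have "em N2 (C \<times> C') = (nnint ?Z (%z. ind A (fst (fst z)) * ind D (snd z) * (em (u (fst (fst z)) (snd (fst z))) C * em (v (snd (fst z)) (snd z)) C')))"
   proof (subst N2)
    show "(nnint ?Z (%z. ind A (fst (fst z)) * ind D (snd z) * em (?kp z) (C \<times> C'))) =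
    (nnint ?Z (%z. ind A (fst (fst z)) * ind D (snd z) * (em (u (fst (fst z)) (snd (fst z))) C * em (v (snd (fst z)) (snd z)) C')))"
    proof (rule nn_integral_cong)
    fix z assume "z : space ?Z"
    then have z: "fst (fst z) : space X" "snd (fst z) : space Y" "snd z : space W" by (auto simp: space_pair_measure)
    show "ind A (fst (fst z)) * ind D (snd z) * em (?kp z) (C \<times> C') =
    ind A (fst (fst z)) * ind D (snd z) * (em (u (fst (fst z)) (snd (fst z))) C * em (v (snd (fst z)) (snd z)) C')"
    using su[OF z(1) z(2)] sv[OF z(2) z(3)] C C' by (subst emeasure_pair_rectangle) auto
    qed
   qed simp
   also have "... = (nnint (X >< Y) (%a. nnint W (%w. ind A (fst a) * ind D w * (em (u (fst a) (snd a)) C * em (v (snd a) w) C'))))"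
    by (subst W.nn_integral_fst[symmetric, OF gm]) simp
   also have "... = (nnint (X >< Y) (%(x, y). h y * (ind A x * em (u x y) C)))"
   proof (rule nn_integral_cong)
    fix a assume "a : space (X >< Y)"
    then have y: "snd a : space Y" by (auto simp: space_pair_measure)
    have m: "(%w. ind D w * em (v (snd a) w) C') : BM W"
    using measurable_Pair2[OF vm2 y] by simp
    have "(nnint W (%w. ind A (fst a) * ind D w * (em (u (fst a) (snd a)) C * em (v (snd a) w) C'))) =
    (nnint W (%w. (ind A (fst a) * em (u (fst a) (snd a)) C) * (ind D w * em (v (snd a) w) C')))"
    by (simp add: mult_ac)
    also have "... = (ind A (fst a) * em (u (fst a) (snd a)) C) * h (snd a)"
    unfolding h_def by (rule nn_integral_cmult[OF m])
    finally show "(nnint W (%w. ind A (fst a) * ind D w * (em (u (fst a) (snd a)) C * em (v (snd a) w) C'))) =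
    (case a of (x, y) => h y * (ind A x * em (u x y) C))" by (simp add: split_beta' mult.commute)
   qed
   also have "... = (nnint Y (%y. nnint X (%x. h y * (ind A x * em (u x y) C))))"
    by (subst XY.nn_integral_snd[symmetric]) (use um[OF C] in \<open>simp_all add: split_beta'\<close>)
   also have "... = (nnint Y (%y. k y * h y))"
   proof (rule nn_integral_cong)
    fix y assume y: "y : space Y"
    have "(%x. ind A x * em (u x y) C) : BM X"
    using measurable_Pair2[OF um2 y] by simp
    then show "(nnint X (%x. h y * (ind A x * em (u x y) C))) = k y * h y"
    unfolding k_def by (simp add: nn_integral_cmult mult.commute)
   qed
   finally show ?thesis ..
  qed
  finally show "em N1 (C \<times> C') = em N2 (C \<times> C')" .
 qed
 define S where "S = {z : space (rpos >< rpos). fst z * snd z : C}"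
 have S [measurable]: "S : sets (rpos >< rpos)" unfolding S_def by measurable
 have [measurable_cong]: "sets (joint_push X W R) = sets (X >< (W >< rpos))" by (simp add: joint_push_def)
 have "em (joint_push X W R) (A \<times> D \<times> C) = (nnint (joint_push X W R) (%z. ind (A \<times> D \<times> C) z))"
  by simp
 also have "... = (nnint R (%e. ind (A \<times> D \<times> C) (fst (fst e), mid e, thd (fst e) * thd e)))"
  unfolding joint_push_def by (rule nn_integral_distr) measurable
 also have "... = (nnint R (%e. ind A (fst (fst e)) * ind D (mid e) * ind S (thd (fst e), thd e)))"
  by (rule nn_integral_cong) (auto simp: indicator_def S_def space_joint[OF R] space_pair_measure)
 also have "... = em N2 S" using N1[OF S] \<open>N1 = N2\<close> by simp
 also have "... = (nnint ?Z (%z. ind A (fst (fst z)) * ind D (snd z) * em (?kp z) S))" by (rule N2[OF S])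
 also have "... = (nnint (X >< Y) (%a. nnint W (%w. ind A (fst a) * ind D w * em (u (fst a) (snd a) >< v (snd a) w) S)))"
 proof -
  have "(%z. ind A (fst (fst z)) * ind D (snd z) * em (?kp z) S) : BM ?Z"
   by (intro borel_measurable_times_ennreal kS S) measurable
  then show ?thesis by (subst W.nn_integral_fst[symmetric]) simp_all
 qed
 also have "... = (nnint X (%x. nnint Y (%y. nnint W (%w. ind A x * ind D w * em (u x y >< v y w) S))))"
 proof -
  have "(%(a, w). ind A (fst a) * ind D w * em (u (fst a) (snd a) >< v (snd a) w) S) : BM ?Z"
   unfolding split_beta' by (intro borel_measurable_times_ennreal kS S) measurable
  from W.borel_measurable_nn_integral[OF this]
  show ?thesis by (subst Y.nn_integral_fst[symmetric]) simp_all
 qed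
 \<comment> \<open>Exchanging y and w brings y innermost, as in
   \<open>kernel_product\<close>.\<close>
 also have "... = (nnint X (%x. nnint W (%w. nnint Y (%y. ind A x * ind D w * em (u x y >< v y w) S))))"
 proof (rule nn_integral_cong)
  fix x assume x: "x : space X"
  have "(%z. ind A (fst (fst z)) * ind D (snd z) * em (?kp z) S) : BM ?Z"
   by (intro borel_measurable_times_ennreal kS S) measurable
  from measurable_compose[OF _ this, of "%a. ((x, fst a), snd a)" "Y >< W"]
  have "(%(y, w). ind A x * ind D w * em (u x y >< v y w) S) : BM (Y >< W)"
   using x by (simp add: split_beta')
  from YW.Fubini'[OF this]
  show "(nnint Y (%y. nnint W (%w. ind A x * ind D w * em (u x y >< v y w) S))) =
   (nnint W (%w. nnint Y (%y. ind A x * ind D w * em (u x y >< v y w) S)))" by simp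
 qed
 also have "... = (nnint (X >< W) (%b. nnint Y (%y. ind A (fst b) * ind D (snd b) * em (u (fst b) y >< v y (snd b)) S)))"
 proof -
  have "(%z. ind A (fst (fst z)) * ind D (snd z) * em (?kp z) S) : BM ?Z"
   by (intro borel_measurable_times_ennreal kS S) measurable
  from measurable_compose[OF _ this, of "%a. ((fst (fst a), snd a), snd (fst a))" "(X >< W) >< Y"]
  have "(%(b, y). ind A (fst b) * ind D (snd b) * em (u (fst b) y >< v y (snd b)) S) : BM ((X >< W) >< Y)"
   by (simp add: split_beta')
  from Y.borel_measurable_nn_integral[OF this]
  show ?thesis by (subst W.nn_integral_fst[symmetric]) simp_all
 qed
 also have "... = (nnint (X >< W) (%(x, w). em (kernel_product Y u v x w) C * ind (A \<times> D) (x, w)))"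
 proof (rule nn_integral_cong)
  fix b assume "b : space (X >< W)"
  then have b: "fst b : space X" "snd b : space W" by (auto simp: space_pair_measure)
  have "(%z. em (?kp z) S) : BM ?Z" by (rule kS[OF S])
  from measurable_compose[OF _ this, of "%y. ((fst b, y), snd b)" Y]
  have m: "(%y. em (u (fst b) y >< v y (snd b)) S) : BM Y" using b by simp
  have "(nnint Y (%y. ind A (fst b) * ind D (snd b) * em (u (fst b) y >< v y (snd b)) S)) =
   ind A (fst b) * ind D (snd b) * (nnint Y (%y. em (u (fst b) y >< v y (snd b)) S))"
   by (rule nn_integral_cmult[OF m])
  also have "(nnint Y (%y. em (u (fst b) y >< v y (snd b)) S)) = em (kernel_product Y u v (fst b) (snd b)) C"
   unfolding kernel_product_emeasure[OF u(1) v(1) b C]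
   by (rule nn_integral_cong) (use emeasure_mult_convolution[OF su(1) sv(1) C] b in \<open>simp add: S_def\<close>)
  finally show "(nnint Y (%y. ind A (fst b) * ind D (snd b) * em (u (fst b) y >< v y (snd b)) S)) =
   (case b of (x, w) => em (kernel_product Y u v x w) C * ind (A \<times> D) (x, w))"
   by (cases b) (auto simp: indicator_def)
 qed
 finally show "em (joint_push X W R) (A \<times> D \<times> C) =
  (nnint (X >< W) (%(x, w). em (kernel_product Y u v x w) C * ind (A \<times> D) (x, w)))" .
qed

section \<open>Density of the polymorphisms given by kernels\<close>

lemma rpos_pushforward_eqI:
 assumes s: "sets p = sets (X >< (Y >< rpos))" "sets p' = sets (X >< (Y >< rpos))"
  and A: "A : sets X" and B: "B : sets Y"
  and eq: "!!C. C : sets rpos ==> em p' (A \<times> B \<times> C) = em p (A \<times> B \<times> C)"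
 shows "rpos_pushforward A B p' = rpos_pushforward A B p"
proof (rule measure_eqI)
 have *: "em (rpos_pushforward A B q) C = em q (A \<times> B \<times> C)"
  if s: "sets q = sets (X >< (Y >< rpos))" and C [measurable]: "C : sets rpos" for q C
 proof -
  note s[measurable_cong]
  have sp: "space q = space X \<times> space Y \<times> {0<..}" using sets_eq_imp_space_eq[OF s] by (simp add: space_pair_measure)
  have m [measurable]: "A \<times> B \<times> {0<..} : sets q" unfolding s
   using A B by (intro pair_measureI) (auto simp: sets_rpos_borel)
  have "em (rpos_pushforward A B q) C = (nnint (rpos_pushforward A B q) (%c. ind C c))"
   using C by (simp add: rpos_pushforward_def)
  also have "... = (nnint q (%z. ind (A \<times> B \<times> {0<..}) z * ind C (thd z)))"
   unfolding rpos_pushforward_def split_beta' by (subst nn_integral_distr) (simp_all add: nn_integral_density)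
  also have "... = (nnint q (%z. ind (A \<times> B \<times> C) z))"
   by (rule nn_integral_cong) (auto simp: indicator_def sp)
  also have "... = em q (A \<times> B \<times> C)"
   by (rule nn_integral_indicator) (use A B C s in simp)
  finally show ?thesis .
 qed
 fix C assume "C : sets (rpos_pushforward A B p')"
 then have "C : sets rpos" by (simp add: rpos_pushforward_def)
 then show "em (rpos_pushforward A B p') C = em (rpos_pushforward A B p) C"
  using *[OF s(1)] *[OF s(2)] eq by simp
qed (simp add: rpos_pushforward_def)

lemma Pol_eqI:
 assumes X: "prob_space X" and p: "p : Pol X Y" and p': "p' : Pol X Y"
  and eq: "!!A B C. A : sets X ==> B : sets Y ==> C : sets rpos ==> em p (A \<times> B \<times> C) = em p' (A \<times> B \<times> C)"
 shows "p = p'"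
proof (rule measure_eqI_rectangles[OF sets_Pol[OF p] sets_Pol[OF p']])
 interpret p: prob_space p by (rule Pol_prob_space[OF p X])
 interpret p': prob_space p' by (rule Pol_prob_space[OF p' X])
 show "em p (space X \<times> space (Y >< rpos)) ~= \<infinity>" by simp
 fix A E assume A [measurable]: "A : sets X" and E [measurable]: "E : sets (Y >< rpos)"
 \<comment> \<open>For fixed A a measure on pairs (y, t), to which the criterion by rectangles
   applies a second time.\<close>
 define N where "N q = distr (density q (%z. ind A (fst z))) (Y >< rpos) snd" for q :: "('a \<times> 'b \<times> real) measure"
 have N: "em (N q) E = em q (A \<times> E)" if q: "q : Pol X Y" and E [measurable]: "E : sets (Y >< rpos)" for q E
 proof -
  note sets_Pol[OF q, measurable_cong]
  have "em (N q) E = (nnint (N q) (%c. ind E c))" using E by (simp add: N_def)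
  also have "... = (nnint q (%z. ind A (fst z) * ind E (snd z)))"
   unfolding N_def by (subst nn_integral_distr) (simp_all add: nn_integral_density)
  also have "... = (nnint q (%z. ind (A \<times> E) z))"
   by (rule nn_integral_cong) (auto simp: indicator_def)
  also have "... = em q (A \<times> E)"
   by (rule nn_integral_indicator) (use A E sets_Pol[OF q] in simp)
  finally show ?thesis .
 qed
 have "N p = N p'"
 proof (rule measure_eqI_rectangles)
  show "sets (N p) = sets (Y >< rpos)" "sets (N p') = sets (Y >< rpos)" by (simp_all add: N_def)
  have "space Y \<times> space rpos : sets (Y >< rpos)" by (intro pair_measureI sets.top)
  then show "em (N p) (space Y \<times> space rpos) ~= \<infinity>" by (simp add: N[OF p])
  fix B C assume "B : sets Y" "C : sets rpos"
  then show "em (N p) (B \<times> C) = em (N p') (B \<times> C)"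
   using eq[OF A] by (simp add: N[OF p] N[OF p'])
 qed
 then show "em p (A \<times> E) = em p' (A \<times> E)" using N[OF p E] N[OF p' E] by simp
qed

text \<open>Each generating open set depends on the law of t over one rectangle only, and finite
  intersections involve finitely many rectangles. So density needs no estimates: matching p exactly
  over finitely many rectangles puts p' into the neighbourhood.\<close>

lemma pol_open_finitely_determined:
 assumes U: "openin (pol_topology X Y) U" and p: "p : U"
 shows "\<exists>\<A> \<B>. finite \<A> \<and> finite \<B> \<and> \<A> \<subseteq> sets X \<and> \<B> \<subseteq> sets Y \<and>
  (\<forall>p'\<in>Pol X Y. (\<forall>A\<in>\<A>. \<forall>B\<in>\<B>. \<forall>C\<in>sets rpos. em p' (A \<times> B \<times> C) = em p (A \<times> B \<times> C)) --> p' : U)"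
proof -
 have "generate_topology_on {{p : Pol X Y. F p : U} | F U. F : pol_tests X Y \<and> open U} U"
  using U unfolding pol_topology_def by (rule openin_topology_generated_by)
 then show ?thesis using p
 proof (induction rule: generate_topology_on.induct)
  case Empty then show ?case by simp
 next
  case (Int a b)
  then have pab: "p : a" "p : b" by auto
  from Int.IH(1)[OF pab(1)] obtain A1 B1 where 1: "finite A1" "finite B1" "A1 \<subseteq> sets X" "B1 \<subseteq> sets Y"
   "\<forall>p'\<in>Pol X Y. (\<forall>A\<in>A1. \<forall>B\<in>B1. \<forall>C\<in>sets rpos. em p' (A \<times> B \<times> C) = em p (A \<times> B \<times> C)) --> p' : a"
   by (elim exE conjE) (rule that)
  from Int.IH(2)[OF pab(2)] obtain A2 B2 where 2: "finite A2" "finite B2" "A2 \<subseteq> sets X" "B2 \<subseteq> sets Y"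
   "\<forall>p'\<in>Pol X Y. (\<forall>A\<in>A2. \<forall>B\<in>B2. \<forall>C\<in>sets rpos. em p' (A \<times> B \<times> C) = em p (A \<times> B \<times> C)) --> p' : b"
   by (elim exE conjE) (rule that)
  show ?case
   by (intro exI[of _ "A1 \<union> A2"] exI[of _ "B1 \<union> B2"]) (use 1 2 in auto)
 next
  case (UN K)
  then obtain k where k: "k : K" "p : k" by auto
  from UN.IH[OF this] obtain \<A> \<B> where "finite \<A>" "finite \<B>" "\<A> \<subseteq> sets X" "\<B> \<subseteq> sets Y"
   "\<forall>p'\<in>Pol X Y. (\<forall>A\<in>\<A>. \<forall>B\<in>\<B>. \<forall>C\<in>sets rpos. em p' (A \<times> B \<times> C) = em p (A \<times> B \<times> C)) --> p' : k"
   by (elim exE conjE) (rule that)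
  then show ?case using k(1) by (intro exI[of _ \<A>] exI[of _ \<B>]) auto
 next
  case (Basis s)
  then obtain F V where s: "s = {p : Pol X Y. F p : V}" "F : pol_tests X Y" by auto
  then obtain A B ph where AB: "A : sets X" "B : sets Y" and c: "continuous_on {0<..} ph"
   and F: "F = (%p. integral\<^sup>L (rpos_pushforward A B p) ph) \<or> F = (%p. integral\<^sup>L (rpos_pushforward A B (t_times p)) ph)"
   unfolding pol_tests_def by auto
  have [measurable]: "ph : BM rpos" by (rule continuous_on_rpos_measurable[OF c])
  have pP: "p : Pol X Y" using Basis s by auto
  have tt: "integral\<^sup>L (rpos_pushforward A B (t_times q)) ph = integral\<^sup>L (rpos_pushforward A B q) (%t. t * ph t)" if "q : Pol X Y" for q
   using integral_rpos_pushforward[of "t_times q" X Y A B ph] pol_test_t_times[OF sets_Pol[OF that] AB, of ph]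
    integral_rpos_pushforward[OF sets_Pol[OF that] AB, of "%t. t * ph t"] AB sets_Pol[OF that] by simp
  have "F p' = F p" if p': "p' : Pol X Y" and eq: "\<forall>C\<in>sets rpos. em p' (A \<times> B \<times> C) = em p (A \<times> B \<times> C)" for p'
  proof -
   have "rpos_pushforward A B p' = rpos_pushforward A B p"
    by (rule rpos_pushforward_eqI[OF sets_Pol[OF pP] sets_Pol[OF p'] AB]) (use eq in auto)
   note rp = this
   from F show ?thesis
   proof
    assume F: "F = (%p. integral\<^sup>L (rpos_pushforward A B p) ph)"
    show ?thesis by (simp only: F rp)
   next
    assume F: "F = (%p. integral\<^sup>L (rpos_pushforward A B (t_times p)) ph)"
    show ?thesis by (simp only: F tt[OF p'] tt[OF pP] rp)
   qed
  qed
  note det = this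
  show ?case
  proof (intro exI[of _ "{A}"] exI[of _ "{B}"] conjI ballI impI)
   fix p' assume p': "p' : Pol X Y"
    and eq: "\<forall>A\<in>{A}. \<forall>B\<in>{B}. \<forall>C\<in>sets rpos. em p' (A \<times> B \<times> C) = em p (A \<times> B \<times> C)"
   have "F p' = F p" by (rule det[OF p']) (use eq in simp)
   moreover have "F p : V" using Basis.prems by (simp add: s(1))
   ultimately show "p' : s" using p' by (simp add: s(1))
  qed (use AB in simp_all)
 qed
qed

text \<open>The atoms of the algebra generated by a finite family, indexed by the members that
  contain the point. Cells may be empty, which allows sums over the whole power set.\<close>

definition partition_cell :: "'x measure => 'x set set => 'x set set => 'x set" where
 "partition_cell X \<A> i = {x : space X. {A : \<A>. x : A} = i}"

context
 fixes X :: "'x measure" and \<A> :: "'x set set"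
 assumes fin: "finite \<A>" and sub: "\<A> \<subseteq> sets X"
begin

lemma partition_cell_sets: "partition_cell X \<A> i : sets X"
proof (cases "i \<subseteq> \<A>")
 case True
 have "partition_cell X \<A> i = {x : space X. \<forall>A\<in>\<A>. x : A \<longleftrightarrow> A : i}"
  using True by (auto simp: partition_cell_def)
 also have "... : sets X"
 proof (rule sets.sets_Collect_finite_All[OF _ fin])
  fix A assume "A : \<A>"
  then have "A : sets X" using sub by auto
  moreover have "{x : space X. x : A \<longleftrightarrow> A : i} = (if A : i then A \<inter> space X else space X - A)" by auto
  ultimately show "{x : space X. x : A \<longleftrightarrow> A : i} : sets X" by auto
 qed
 finally show ?thesis .
next
 case False
 then have "partition_cell X \<A> i = {}" by (auto simp: partition_cell_def)
 then show ?thesis by simp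
qed

lemma sum_partition_cell:
 fixes f :: "_ => ennreal"
 assumes x: "x : space X"
 shows "(\<Sum>i\<in>Pow \<A>. ind (partition_cell X \<A> i) x * f i) = f {A : \<A>. x : A}"
proof -
 have "(\<Sum>i\<in>Pow \<A>. ind (partition_cell X \<A> i) x * f i) = (\<Sum>i\<in>{{A : \<A>. x : A}}. ind (partition_cell X \<A> i) x * f i)"
  using fin x by (intro sum.mono_neutral_right) (auto simp: partition_cell_def indicator_def)
 then show ?thesis using x by (simp add: partition_cell_def)
qed

lemma sum_partition_cell_1: "x : space X ==> (\<Sum>i\<in>Pow \<A>. ind (partition_cell X \<A> i) x) = (1::ennreal)"
 using sum_partition_cell[of x "%_. 1"] by simp

lemma partition_cell_Int: "A : \<A> ==> A \<inter> partition_cell X \<A> i = (if A : i then partition_cell X \<A> i else {})"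
 by (auto simp: partition_cell_def)

lemma partition_emeasure:
 assumes A: "A : sets X"
 shows "em X A = (\<Sum>i\<in>Pow \<A>. em X (A \<inter> partition_cell X \<A> i))"
proof -
 note partition_cell_sets[measurable] and A[measurable]
 have "em X A = (nnint X (%x. (\<Sum>i\<in>Pow \<A>. ind (partition_cell X \<A> i) x) * ind A x))"
  using A by (simp add: sum_partition_cell_1 cong: nn_integral_cong)
 also have "... = (nnint X (%x. (\<Sum>i\<in>Pow \<A>. ind (A \<inter> partition_cell X \<A> i) x)))"
  by (rule nn_integral_cong) (simp add: sum_distrib_left indicator_inter_arith mult.commute)
 also have "... = (\<Sum>i\<in>Pow \<A>. em X (A \<inter> partition_cell X \<A> i))"
  by (subst nn_integral_sum) auto
 finally show ?thesis .
qed

end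

text \<open>Replacing \<open>p\<close> by its conditional expectation with respect to two finite partitions does not change
 the mass of the rectangles over sets of the partitions.\<close>

lemma kernel_polymorphism_agreeing:
 fixes X :: "'x measure" and Y :: "'y measure"
 assumes X: "prob_space X" and Y: "prob_space Y" and p: "p : Pol X Y"
  and \<A>: "finite \<A>" "\<A> \<subseteq> sets X" and \<B>: "finite \<B>" "\<B> \<subseteq> sets Y"
 obtains p' s where "p' : Pol X Y" "M_tri_kernel X Y s" "given_by X Y p' s"
  "!!A B C. A : \<A> ==> B : \<B> ==> C : sets rpos ==> em p' (A \<times> B \<times> C) = em p (A \<times> B \<times> C)"
proof -
 interpret X: prob_space X by fact
 interpret Y: prob_space Y by fact
 interpret p: prob_space p by (rule Pol_prob_space[OF p X])
 interpret XY: pair_prob_space X Y ..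
 note sets_Pol[OF p, measurable_cong]
 define c where "c i = partition_cell X \<A> i" for i
 define d where "d j = partition_cell Y \<B> j" for j
 have [measurable]: "c i : sets X" "d j : sets Y" for i j
  unfolding c_def d_def using partition_cell_sets \<A> \<B> by auto
 define m where "m i j = em X (c i) * em Y (d j)" for i j
 have mfin: "m i j ~= \<infinity>" for i j unfolding m_def by (simp add: ennreal_mult_eq_top_iff)
 define N where "N i j = distr (density p (%z. ind (c i) (fst z) * ind (d j) (mid z))) rpos (%z. thd z)" for i j
 have Nint: "(nnint (N i j) (%t. g t)) = (nnint p (%z. ind (c i) (fst z) * ind (d j) (mid z) * g (thd z)))"
  if [measurable]: "g : BM rpos" for i j g
  unfolding N_def by (subst nn_integral_distr) (simp_all add: nn_integral_density)
 \<comment> \<open>The law of t over a cell, divided by the mass of the cell. For a null cell the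
   scale is 0, since \<open>inverse 0\<close> is infinite in \<open>ennreal\<close>.\<close>
 define S where "S i j = scale_measure (if m i j = 0 then 0 else inverse (m i j)) (N i j)" for i j
 have sS [simp]: "sets (S i j) = sets rpos" "space (S i j) = {0<..}" for i j
  by (simp_all add: S_def N_def space_scale_measure)
 have Sint: "m i j * (nnint (S i j) (%t. g t)) = (nnint p (%z. ind (c i) (fst z) * ind (d j) (mid z) * g (thd z)))"
  if g [measurable]: "g : BM rpos" for i j g
 proof (cases "m i j = 0")
  case True
  then have "em X (c i) = 0 \<or> em Y (d j) = 0" by (simp add: m_def)
  then have "AE z in p. ind (c i) (fst z) * ind (d j) (mid z) * g (thd z) = 0"
  proof
   assume "em X (c i) = 0"
   then have "AE x in X. x \<notin> c i" by (intro AE_not_in) (auto simp: null_sets_def)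
   from Pol_AE_fst[OF p this] show ?thesis by eventually_elim simp
  next
   assume "em Y (d j) = 0"
   then have "AE x in Y. x \<notin> d j" by (intro AE_not_in) (auto simp: null_sets_def)
   from Pol_AE_snd[OF p this] show ?thesis by eventually_elim simp
  qed
  then have "(nnint p (%z. ind (c i) (fst z) * ind (d j) (mid z) * g (thd z))) = (nnint p (%z. 0))"
   by (rule nn_integral_cong_AE)
  then show ?thesis using True by simp
 next
  case False
  have gN: "g : BM (N i j)" using g by (simp add: N_def)
  have "m i j * (nnint (S i j) (%t. g t)) = (m i j * inverse (m i j)) * (nnint (N i j) (%t. g t))"
   using False by (simp add: S_def nn_integral_scale_measure[OF gN] mult.assoc)
  also have "m i j * inverse (m i j) = 1"
   using False mfin by (simp add: ennreal_divide_self less_top flip: divide_ennreal_def)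
  finally show ?thesis by (simp add: Nint[OF g])
 qed
 have Nle: "(nnint (N i j) (%t. g t)) <= (nnint p (%z. g (thd z)))" if "g : BM rpos" for i j g
  unfolding Nint[OF that] by (intro nn_integral_mono) (auto simp: indicator_def)
 have Sfin: "(nnint (S i j) (%t. g t)) < \<infinity>" if g: "g : BM rpos" and f: "(nnint p (%z. g (thd z))) < \<infinity>" for i j g
 proof -
  have gN: "g : BM (N i j)" using g by (simp add: N_def)
  have "(if m i j = 0 then 0 else inverse (m i j)) < \<infinity>" by (simp add: less_top[symmetric] ennreal_inverse_eq_top_iff)
  then show ?thesis
   using le_less_trans[OF Nle[OF g] f] unfolding S_def nn_integral_scale_measure[OF gN] by (simp add: ennreal_mult_less_top)
 qed
 have Stri: "S i j : M_tri" for i j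
  unfolding M_tri_def
 proof (intro CollectI conjI)
  show "finite_measure (S i j)"
   using Sfin[of "%_. 1" i j] by (intro finite_measureI) (simp add: p.emeasure_space_1 less_top)
  show "(nnint (S i j) (%t. ennreal t)) < \<infinity>"
   using Pol_nn_integral_t[OF p Y] by (intro Sfin) auto
 qed simp
 define s where "s x y = S {A : \<A>. x : A} {B : \<B>. y : B}" for x y
 have ssum: "(nnint (s x y) (%t. g t)) = (\<Sum>i\<in>Pow \<A>. \<Sum>j\<in>Pow \<B>. ind (c i) x * (ind (d j) y * (nnint (S i j) (%t. g t))))"
  if "x : space X" "y : space Y" for x y g
  unfolding s_def c_def d_def sum_distrib_left[symmetric] sum_partition_cell[OF \<B> that(2)] sum_partition_cell[OF \<A> that(1)] ..
 have kern: "M_tri_kernel X Y s"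
  unfolding M_tri_kernel_def
 proof (intro conjI ballI)
  show "s x y : M_tri" for x y by (simp add: s_def Stri)
  fix C assume C: "C : sets rpos"
  have "(%(x, y). \<Sum>i\<in>Pow \<A>. \<Sum>j\<in>Pow \<B>. ind (c i) x * (ind (d j) y * (nnint (S i j) (%t. ind C t)))) : BM (X >< Y)"
   by measurable
  moreover have "em (s x y) C = (\<Sum>i\<in>Pow \<A>. \<Sum>j\<in>Pow \<B>. ind (c i) x * (ind (d j) y * (nnint (S i j) (%t. ind C t))))"
   if "x : space X" "y : space Y" for x y
   using ssum[OF that, of "ind C"] C by (simp add: s_def)
  ultimately show "(%(x, y). em (s x y) C) : BM (X >< Y)"
   by (subst measurable_cong[where g = "%(x, y). \<Sum>i\<in>Pow \<A>. \<Sum>j\<in>Pow \<B>. ind (c i) x * (ind (d j) y * (nnint (S i j) (%t. ind C t)))"]) (auto simp: space_pair_measure)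
 qed
 have ne: "space rpos ~= {}" by (auto intro: exI[of _ 1])
 note fk = M_tri_kernel_fin_kernel[OF kern]
 define p' where "p' = distr (semidirect (X >< Y) rpos (%z. s (fst z) (snd z))) (X >< (Y >< rpos)) (%a. (fst (fst a), snd (fst a), snd a))"
 have [measurable_cong]: "sets p' = sets (X >< (Y >< rpos))" by (simp add: p'_def)
 have int1: "(nnint p' (%z. ind A (fst z) * ind B (mid z) * g (thd z))) =
   (nnint (X >< Y) (%a. ind (A \<times> B) a * (nnint (s (fst a) (snd a)) (%t. g t))))"
  if [measurable]: "A : sets X" "B : sets Y" "g : BM rpos" for A B g
 proof -
  have "(nnint p' (%z. ind A (fst z) * ind B (mid z) * g (thd z))) =
   (nnint (semidirect (X >< Y) rpos (%z. s (fst z) (snd z))) (%a. ind A (fst (fst a)) * ind B (snd (fst a)) * g (snd a)))"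
   unfolding p'_def by (subst nn_integral_distr) simp_all
  also have "... = (nnint (X >< Y) (%a. nnint (s (fst a) (snd a)) (%t. ind A (fst a) * ind B (snd a) * g t)))"
   by (subst nn_integral_semidirect[OF fk ne]) simp_all
  also have "... = (nnint (X >< Y) (%a. ind (A \<times> B) a * (nnint (s (fst a) (snd a)) (%t. g t))))"
  proof (rule nn_integral_cong)
   fix a
   have [measurable_cong]: "sets (s (fst a) (snd a)) = sets rpos" by (simp add: s_def)
   have "(nnint (s (fst a) (snd a)) (%t. ind A (fst a) * ind B (snd a) * g t)) = ind A (fst a) * ind B (snd a) * (nnint (s (fst a) (snd a)) (%t. g t))"
    by (rule nn_integral_cmult) measurable
   then show "(nnint (s (fst a) (snd a)) (%t. ind A (fst a) * ind B (snd a) * g t)) = ind (A \<times> B) a * (nnint (s (fst a) (snd a)) (%t. g t))"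
    by (cases a) (simp add: indicator_times)
  qed
  finally show ?thesis .
 qed
 have int: "(nnint p' (%z. ind A (fst z) * ind B (mid z) * g (thd z))) =
   (\<Sum>i\<in>Pow \<A>. \<Sum>j\<in>Pow \<B>. em X (A \<inter> c i) * (em Y (B \<inter> d j) * (nnint (S i j) (%t. g t))))"
  if [measurable]: "A : sets X" "B : sets Y" "g : BM rpos" for A B g
 proof -
  have "(nnint (X >< Y) (%a. ind (A \<times> B) a * (nnint (s (fst a) (snd a)) (%t. g t)))) =
   (nnint (X >< Y) (%a. (\<Sum>i\<in>Pow \<A>. \<Sum>j\<in>Pow \<B>. (nnint (S i j) (%t. g t)) * ind ((A \<inter> c i) \<times> (B \<inter> d j)) a)))"
  proof (rule nn_integral_cong)
   fix a assume "a : space (X >< Y)"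
   then have a: "fst a : space X" "snd a : space Y" by (auto simp: space_pair_measure)
   show "ind (A \<times> B) a * (nnint (s (fst a) (snd a)) (%t. g t)) =
    (\<Sum>i\<in>Pow \<A>. \<Sum>j\<in>Pow \<B>. (nnint (S i j) (%t. g t)) * ind ((A \<inter> c i) \<times> (B \<inter> d j)) a)"
    unfolding ssum[OF a] sum_distrib_left
    by (intro sum.cong refl) (cases a, simp add: indicator_times indicator_inter_arith mult_ac)
  qed
  also have "... = (\<Sum>i\<in>Pow \<A>. \<Sum>j\<in>Pow \<B>. nnint (X >< Y) (%a. (nnint (S i j) (%t. g t)) * ind ((A \<inter> c i) \<times> (B \<inter> d j)) a))"
  proof -
   have [measurable]: "(A \<inter> c i) \<times> (B \<inter> d j) : sets (X >< Y)" for i j by measurable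
   show ?thesis by (subst nn_integral_sum, measurable, intro sum.cong refl, subst nn_integral_sum, measurable)
  qed
  also have "... = (\<Sum>i\<in>Pow \<A>. \<Sum>j\<in>Pow \<B>. em X (A \<inter> c i) * (em Y (B \<inter> d j) * (nnint (S i j) (%t. g t))))"
  proof (intro sum.cong refl)
   fix i j
   have r: "(A \<inter> c i) \<times> (B \<inter> d j) : sets (X >< Y)" by measurable
   have "(nnint (X >< Y) (%a. (nnint (S i j) (%t. g t)) * ind ((A \<inter> c i) \<times> (B \<inter> d j)) a)) = (nnint (S i j) (%t. g t)) * em (X >< Y) ((A \<inter> c i) \<times> (B \<inter> d j))"
    by (rule nn_integral_cmult_indicator[OF r])
   also have "em (X >< Y) ((A \<inter> c i) \<times> (B \<inter> d j)) = em X (A \<inter> c i) * em Y (B \<inter> d j)"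
    by (rule Y.emeasure_pair_measure_Times) measurable
   finally show "(nnint (X >< Y) (%a. (nnint (S i j) (%t. g t)) * ind ((A \<inter> c i) \<times> (B \<inter> d j)) a)) = em X (A \<inter> c i) * (em Y (B \<inter> d j) * (nnint (S i j) (%t. g t)))"
    by (simp add: mult_ac)
  qed
  finally show ?thesis using int1[OF that] by simp
 qed
 have psum: "(\<Sum>i\<in>P. \<Sum>j\<in>Q. m i j * (nnint (S i j) (%t. g t))) = (nnint p (%z. (\<Sum>i\<in>P. ind (c i) (fst z)) * (\<Sum>j\<in>Q. ind (d j) (mid z)) * g (thd z)))"
  if [measurable]: "g : BM rpos" for P Q g
 proof -
  have "(\<Sum>i\<in>P. \<Sum>j\<in>Q. m i j * (nnint (S i j) (%t. g t))) =
   (\<Sum>i\<in>P. \<Sum>j\<in>Q. nnint p (%z. ind (c i) (fst z) * ind (d j) (mid z) * g (thd z)))"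
   by (simp add: Sint)
  also have "... = (nnint p (%z. (\<Sum>i\<in>P. \<Sum>j\<in>Q. ind (c i) (fst z) * ind (d j) (mid z) * g (thd z))))"
   by (subst nn_integral_sum, measurable, intro sum.cong refl, subst nn_integral_sum, measurable)
  also have "... = (nnint p (%z. (\<Sum>i\<in>P. ind (c i) (fst z)) * (\<Sum>j\<in>Q. ind (d j) (mid z)) * g (thd z)))"
   by (rule nn_integral_cong, subst sum_product) (simp only: sum_distrib_right)
  finally show ?thesis .
 qed
 have sumd: "(\<Sum>j\<in>Pow \<B>. ind (d j) y) = (1::ennreal)" if "y : space Y" for y
  unfolding d_def by (rule sum_partition_cell_1[OF \<B> that])
 have sumc: "(\<Sum>j\<in>Pow \<A>. ind (c j) y) = (1::ennreal)" if "y : space X" for y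
  unfolding c_def by (rule sum_partition_cell_1[OF \<A> that])
 have cancel: "a = 1" if "x * a = x" "x ~= 0" "x ~= \<infinity>" for a x :: ennreal
  using that ennreal_mult_cancel_left[of x a 1] by auto
 have margX: "(nnint p' (%z. ind A (fst z) * ind (space Y) (mid z) * 1)) = em X A" if A [measurable]: "A : sets X" for A
 proof -
  have "(nnint p' (%z. ind A (fst z) * ind (space Y) (mid z) * 1)) =
   (\<Sum>i\<in>Pow \<A>. \<Sum>j\<in>Pow \<B>. em X (A \<inter> c i) * (em Y (space Y \<inter> d j) * (nnint (S i j) (%t. 1))))"
   by (rule int) measurable
  also have "... = (\<Sum>i\<in>Pow \<A>. em X (A \<inter> c i))"
  proof (rule sum.cong[OF refl])
   fix i
   have dd: "space Y \<inter> d j = d j" for j by (auto simp: d_def partition_cell_def)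
   show "(\<Sum>j\<in>Pow \<B>. em X (A \<inter> c i) * (em Y (space Y \<inter> d j) * (nnint (S i j) (%t. 1)))) = em X (A \<inter> c i)"
   proof (cases "em X (c i) = 0")
    case True
    have "em X (A \<inter> c i) <= em X (c i)" by (rule emeasure_mono) auto
    then show ?thesis using True by simp
   next
    case False
    \<comment> \<open>Summed over j, the first marginal of p gives the strip over c i the mass of c
      i. This finite positive number cancels, so the kernel has total mass 1 over each x in the
      cell.\<close>
    have "em X (c i) * (\<Sum>j\<in>Pow \<B>. em Y (d j) * (nnint (S i j) (%t. 1))) = (\<Sum>i\<in>{i}. \<Sum>j\<in>Pow \<B>. m i j * (nnint (S i j) (%t. 1)))"
    by (simp only: sum_distrib_left m_def mult.assoc sum.insert[OF finite.emptyI] sum.empty add_0_right) simp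
    also have "... = (nnint p (%z. ind (c i) (fst z)))"
    by (subst psum) (auto intro!: nn_integral_cong simp: sumd space_Pol[OF p])
    also have "... = em X (c i)" using Pol_nn_integral_fst[OF p, of "ind (c i)"] by simp
    finally have "(\<Sum>j\<in>Pow \<B>. em Y (d j) * (nnint (S i j) (%t. 1))) = 1"
    by (rule cancel) (use False in auto)
    then show ?thesis unfolding sum_distrib_left[symmetric] dd by simp
   qed
  qed
  also have "... = em X A" unfolding c_def by (rule partition_emeasure[OF \<A> A, symmetric])
  finally show ?thesis .
 qed
 have margY: "(nnint p' (%z. ind (space X) (fst z) * ind B (mid z) * ennreal (thd z))) = em Y B" if B [measurable]: "B : sets Y" for B
 proof -
  have "(nnint p' (%z. ind (space X) (fst z) * ind B (mid z) * ennreal (thd z))) =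
   (\<Sum>i\<in>Pow \<A>. \<Sum>j\<in>Pow \<B>. em X (space X \<inter> c i) * (em Y (B \<inter> d j) * (nnint (S i j) (%t. ennreal t))))"
   by (rule int) measurable
  also have "... = (\<Sum>j\<in>Pow \<B>. \<Sum>i\<in>Pow \<A>. em Y (B \<inter> d j) * (em X (space X \<inter> c i) * (nnint (S i j) (%t. ennreal t))))"
   by (subst sum.swap) (simp add: mult_ac)
  also have "... = (\<Sum>j\<in>Pow \<B>. em Y (B \<inter> d j))"
  proof (rule sum.cong[OF refl])
   fix j
   have cc: "space X \<inter> c i = c i" for i by (auto simp: c_def partition_cell_def)
   show "(\<Sum>i\<in>Pow \<A>. em Y (B \<inter> d j) * (em X (space X \<inter> c i) * (nnint (S i j) (%t. ennreal t)))) = em Y (B \<inter> d j)"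
   proof (cases "em Y (d j) = 0")
    case True
    have "em Y (B \<inter> d j) <= em Y (d j)" by (rule emeasure_mono) auto
    then show ?thesis using True by simp
   next
    case False
    have "em Y (d j) * (\<Sum>i\<in>Pow \<A>. em X (c i) * (nnint (S i j) (%t. ennreal t))) = (\<Sum>i\<in>Pow \<A>. \<Sum>j\<in>{j}. m i j * (nnint (S i j) (%t. ennreal t)))"
    by (simp add: sum_distrib_left m_def mult_ac)
    also have "... = (nnint p (%z. ennreal (thd z) * ind (d j) (mid z)))"
    by (subst psum) (auto intro!: nn_integral_cong simp: sumc space_Pol[OF p] mult.commute)
    also have "... = em Y (d j)" using Pol_nn_integral_snd[OF p, of "ind (d j)"] by simp
    finally have "(\<Sum>i\<in>Pow \<A>. em X (c i) * (nnint (S i j) (%t. ennreal t))) = 1"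
    by (rule cancel) (use False in auto)
    then show ?thesis unfolding sum_distrib_left[symmetric] cc by simp
   qed
  qed
  also have "... = em Y B" unfolding d_def by (rule partition_emeasure[OF \<B> B, symmetric])
  finally show ?thesis .
 qed
 have spp': "space p' = space X \<times> space Y \<times> {0<..}" by (simp add: p'_def space_pair_measure)
 have p'Pol: "p' : Pol X Y"
 proof (rule PolI)
  show "sets p' = sets (X >< (Y >< rpos))" by (simp add: p'_def)
  show "(nnint p' (%z. ind A (fst z))) = em X A" if "A : sets X" for A
   unfolding margX[OF that, symmetric] by (rule nn_integral_cong) (auto simp: spp')
  show "(nnint p' (%z. ennreal (thd z) * ind B (mid z))) = em Y B" if "B : sets Y" for B
   unfolding margY[OF that, symmetric] by (rule nn_integral_cong) (auto simp: spp' mult.commute)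
 qed
 have rect: "em p' (A \<times> B \<times> C) = (nnint p' (%z. ind A (fst z) * ind B (mid z) * ind C (thd z)))"
  if "A : sets X" "B : sets Y" "C : sets rpos" for A B C
 proof -
  have "A \<times> B \<times> C : sets p'" using that by (simp add: p'_def)
  then have "em p' (A \<times> B \<times> C) = (nnint p' (%z. ind (A \<times> B \<times> C) z))" by simp
  also have "... = (nnint p' (%z. ind A (fst z) * ind B (mid z) * ind C (thd z)))"
   by (rule nn_integral_cong) (auto simp: indicator_def)
  finally show ?thesis .
 qed
 have given: "given_by X Y p' s"
  unfolding given_by_def
 proof (intro ballI)
  fix A B C assume A: "A : sets X" and B: "B : sets Y" and C: "C : sets rpos"
  have "(nnint (s x y) (%t. ind C t)) = em (s x y) C" for x y using C by (simp add: s_def)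
  then show "em p' (A \<times> B \<times> C) = (nnint (X >< Y) (%(x, y). em (s x y) C * ind (A \<times> B) (x, y)))"
   unfolding rect[OF A B C] using A B C by (subst int1) (auto intro!: nn_integral_cong simp: mult.commute split_beta')
 qed
 have agree: "em p' (A \<times> B \<times> C) = em p (A \<times> B \<times> C)" if A: "A : \<A>" and B: "B : \<B>" and C [measurable]: "C : sets rpos" for A B C
 proof -
  have [measurable]: "A : sets X" "B : sets Y" using A B \<A> \<B> by auto
  \<comment> \<open>A member of the family meets a cell in the whole cell or not at all, so the sums
    run over the cells that make up A and B.\<close>
  have Ac: "A \<inter> c i = (if A : i then c i else {})" for i unfolding c_def by (rule partition_cell_Int[OF \<A> A])
  have Bd: "B \<inter> d j = (if B : j then d j else {})" for j unfolding d_def by (rule partition_cell_Int[OF \<B> B])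
  have fA: "finite (Pow \<A>)" "finite (Pow \<B>)" using \<A> \<B> by auto
  have "em p' (A \<times> B \<times> C) = (\<Sum>i\<in>Pow \<A>. \<Sum>j\<in>Pow \<B>. em X (A \<inter> c i) * (em Y (B \<inter> d j) * (nnint (S i j) (%t. ind C t))))"
   by (subst rect) (simp_all add: int del: nn_integral_indicator)
  also have "... = (\<Sum>i\<in>{i\<in>Pow \<A>. A : i}. \<Sum>j\<in>{j\<in>Pow \<B>. B : j}. m i j * (nnint (S i j) (%t. ind C t)))"
   unfolding sum.inter_filter[OF fA(1)] sum.inter_filter[OF fA(2)]
   by (intro sum.cong refl) (auto simp: Ac Bd m_def mult.assoc intro!: sum.cong)
  also have "... = (nnint p (%z. (\<Sum>i\<in>{i\<in>Pow \<A>. A : i}. ind (c i) (fst z)) * (\<Sum>j\<in>{j\<in>Pow \<B>. B : j}. ind (d j) (mid z)) * ind C (thd z)))"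
   by (rule psum) measurable
  also have "... = (nnint p (%z. ind (A \<times> B \<times> C) z))"
  proof (rule nn_integral_cong)
   fix z assume "z : space p"
   then have z: "fst z : space X" "mid z : space Y" by (auto simp: space_Pol[OF p])
   have 1: "(\<Sum>i\<in>{i\<in>Pow \<A>. A : i}. ind (c i) (fst z)) = (ind A (fst z) :: ennreal)"
   proof -
    have "(\<Sum>i\<in>{i\<in>Pow \<A>. A : i}. ind (c i) (fst z)) = (\<Sum>i\<in>Pow \<A>. ind (c i) (fst z) * (if A : i then 1 else 0 :: ennreal))"
    unfolding sum.inter_filter[OF fA(1)] by (rule sum.cong) auto
    also have "... = (if A : {A : \<A>. fst z : A} then 1 else 0)"
    unfolding c_def by (rule sum_partition_cell[OF \<A> z(1)])
    finally show ?thesis using A by (simp add: indicator_def)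
   qed
   have 2: "(\<Sum>i\<in>{i\<in>Pow \<B>. B : i}. ind (d i) (mid z)) = (ind B (mid z) :: ennreal)"
   proof -
    have "(\<Sum>i\<in>{i\<in>Pow \<B>. B : i}. ind (d i) (mid z)) = (\<Sum>i\<in>Pow \<B>. ind (d i) (mid z) * (if B : i then 1 else 0 :: ennreal))"
    unfolding sum.inter_filter[OF fA(2)] by (rule sum.cong) auto
    also have "... = (if B : {B : \<B>. mid z : B} then 1 else 0)"
    unfolding d_def by (rule sum_partition_cell[OF \<B> z(2)])
    finally show ?thesis using B by (simp add: indicator_def)
   qed
   show "(\<Sum>i\<in>{i\<in>Pow \<A>. A : i}. ind (c i) (fst z)) * (\<Sum>j\<in>{j\<in>Pow \<B>. B : j}. ind (d j) (mid z)) * ind C (thd z) = (ind (A \<times> B \<times> C) z :: ennreal)"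
    unfolding 1 2 by (cases z) (auto simp: indicator_def)
  qed
  also have "... = em p (A \<times> B \<times> C)" by (rule nn_integral_indicator) (simp add: sets_Pol[OF p])
  finally show ?thesis .
 qed
 show ?thesis by (rule that[OF p'Pol kern given agree])
qed

definition kernel_pols :: "'x measure => 'y measure => ('x \<times> 'y \<times> real) measure set" where
 "kernel_pols X Y = {p : Pol X Y. \<exists>s. M_tri_kernel X Y s \<and> given_by X Y p s}"

lemma kernel_pols_dense:
 assumes X: "prob_space X" and Y: "prob_space Y" and p: "p : Pol X Y"
 shows "p : pol_topology X Y closure_of kernel_pols X Y"
 unfolding in_closure_of
proof (intro conjI allI impI)
 show "p : topspace (pol_topology X Y)" using p by simp
 fix U assume U: "p : U \<and> openin (pol_topology X Y) U"
 obtain \<A> \<B> where AB: "finite \<A>" "finite \<B>" "\<A> \<subseteq> sets X" "\<B> \<subseteq> sets Y"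
  and det: "\<forall>p'\<in>Pol X Y. (\<forall>A\<in>\<A>. \<forall>B\<in>\<B>. \<forall>C\<in>sets rpos. em p' (A \<times> B \<times> C) = em p (A \<times> B \<times> C)) --> p' : U"
  using pol_open_finitely_determined[of X Y U p] U by blast
 obtain p' s where p': "p' : Pol X Y" "M_tri_kernel X Y s" "given_by X Y p' s"
  "!!A B C. A : \<A> ==> B : \<B> ==> C : sets rpos ==> em p' (A \<times> B \<times> C) = em p (A \<times> B \<times> C)"
  by (rule kernel_polymorphism_agreeing[OF X Y p AB(1,3,2,4)], rule that)
 then have "p' : kernel_pols X Y" by (auto simp: kernel_pols_def)
 moreover have "p' : U" using det p' by blast
 ultimately show "\<exists>y. y : kernel_pols X Y \<and> y : U" by blast
qed

lemma joint_product_is_pol_product: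
 fixes X :: "'x measure" and Y :: "'y measure" and W :: "'w measure"
 assumes X: "prob_space X" and Y: "prob_space Y" and W: "lebesgue_prob_space W"
 shows "is_pol_product X Y W (joint_product X Y W)"
 unfolding is_pol_product_def
proof (intro conjI ballI allI impI)
 fix p q assume p: "p : Pol X Y" and q: "q : Pol Y W"
 show "joint_product X Y W p q : Pol X W" by (rule joint_product_Pol[OF X Y W p q])
 fix u v assume uv: "M_tri_kernel X Y u \<and> given_by X Y p u \<and> M_tri_kernel Y W v \<and> given_by Y W q v"
 show "given_by X W (joint_product X Y W p q) (kernel_product Y u v)"
  unfolding joint_product_def
  by (rule joint_push_given_by[OF X Y lebesgue_prob_spaceD[OF W] p q some_joint[OF X Y W p q]]) (use uv in auto)
next
 show "continuous_map (pol_topology X Y) (pol_topology X W) (%p. joint_product X Y W p q)" if "q : Pol Y W" for q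
  by (rule joint_product_continuous_fst[OF X Y W that])
 show "continuous_map (pol_topology Y W) (pol_topology X W) (%q. joint_product X Y W p q)" if "p : Pol X Y" for p
  by (rule joint_product_continuous_snd[OF X Y W that])
qed

section \<open>Fourier uniqueness and the uniqueness of the product\<close>

text \<open>Levy's theorem is about probability measures. The total mass is the value of the
  characteristic function at 0, so both measures may be normalised by the same constant unless both
  vanish.\<close>

lemma finite_measure_char_unique:
 assumes fin: "finite_measure M" "finite_measure N" and sets: "sets M = sets borel" "sets N = sets borel"
  and char: "!!th. char M th = char N th"
 shows "M = N"
proof -
 interpret M: finite_measure M by fact
 interpret N: finite_measure N by fact
 have sp: "space M = UNIV" "space N = UNIV" using sets[THEN sets_eq_imp_space_eq] by auto
 have "complex_of_real (measure M UNIV) = char M 0" by (simp add: char_def sp scaleR_conv_of_real)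
 also have "... = complex_of_real (measure N UNIV)" unfolding char by (simp add: char_def sp scaleR_conv_of_real)
 finally have mass: "measure M UNIV = measure N UNIV" by simp
 show ?thesis
 proof (cases "measure M UNIV = 0")
  case True
  show ?thesis
  proof (rule measure_eqI)
   fix E assume "E : sets M"
   have "em M E <= em M (space M)" by (rule emeasure_space)
   moreover have "em N E <= em N (space N)" by (rule emeasure_space)
   ultimately show "em M E = em N E"
    using True mass by (simp add: M.emeasure_eq_measure N.emeasure_eq_measure sp measure_le_0_iff)
  qed (simp add: sets)
 next
  case False
  define c where "c = 1 / measure M UNIV"
  have c: "c > 0" using False by (simp add: c_def zero_less_measure_iff)
  have rd: "real_distribution (density Q (%_. ennreal c))" and ch: "char (density Q (%_. ennreal c)) th = c *\<^sub>R char Q th"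
   if Q: "finite_measure Q" "sets Q = sets borel" "measure Q UNIV = measure M UNIV" for Q th
  proof -
   interpret Q: finite_measure Q by fact
   note Q(2)[measurable_cong]
   have spQ: "space Q = UNIV" using Q(2) by (auto dest: sets_eq_imp_space_eq)
   have "em (density Q (%_. ennreal c)) (space (density Q (%_. ennreal c))) = ennreal c * em Q UNIV"
    by (simp add: emeasure_density spQ nn_integral_cmult)
   also have "... = 1" using c Q(3) False by (simp add: Q.emeasure_eq_measure c_def ennreal_mult[symmetric] flip: ennreal_1)
   finally show "real_distribution (density Q (%_. ennreal c))"
    using Q(2) spQ by (auto simp: real_distribution_def real_distribution_axioms_def intro!: prob_spaceI)
   show "char (density Q (%_. ennreal c)) th = c *\<^sub>R char Q th"
   proof -
    have "(%x. iexp (th * x)) : BM borel"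
    by (intro borel_measurable_continuous_onI continuous_intros)
    then have m: "(%x. iexp (th * x)) : BM Q" using Q(2) by (simp cong: measurable_cong_sets)
    have "(LINT x|(density Q (%_. ennreal c)). iexp (th * x)) = (LINT x|Q. c *\<^sub>R iexp (th * x))"
    by (rule integral_density[OF m]) (use c in auto)
    then show ?thesis by (simp add: char_def)
   qed
  qed
  have "density M (%_. ennreal c) = density N (%_. ennreal c)"
   by (rule Levy_uniqueness[OF rd rd]) (use fin sets mass in \<open>auto simp: ch char\<close>)
  then have d: "em (density M (%_. ennreal c)) E = em (density N (%_. ennreal c)) E" for E by simp
  show ?thesis
  proof (rule measure_eqI)
   fix E assume E: "E : sets M"
   then have "ennreal c * em M E = ennreal c * em N E"
    using d[of E] sets by (simp add: emeasure_density nn_integral_cmult_indicator)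
   then show "em M E = em N E" using c by (simp add: ennreal_mult_cancel_left)
  qed (simp add: sets)
 qed
qed

text \<open>Over A and B the measure w(t) p has a finite image under ln t, and the two tests are the
  real and imaginary parts of its characteristic function. As w is positive it can be divided out.
  The weights in use are 1, for continuity arguments, and sqrt t, for the representation.\<close>

lemma Pol_eqI_char:
 fixes X :: "'x measure" and Y :: "'y measure"
 assumes X: "prob_space X" and Y: "prob_space Y" and p: "p : Pol X Y" and p': "p' : Pol X Y"
  and w: "continuous_on {0<..} w" "!!t. 0 < t ==> 0 < w t \<and> w t <= 1 + t"
  and cos: "!!A B th. A : sets X ==> B : sets Y ==> pol_test A B (%t. w t * cos (th * ln t)) p = pol_test A B (%t. w t * cos (th * ln t)) p'"
  and sin: "!!A B th. A : sets X ==> B : sets Y ==> pol_test A B (%t. w t * sin (th * ln t)) p = pol_test A B (%t. w t * sin (th * ln t)) p'"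
 shows "p = p'"
proof (rule Pol_eqI[OF X p p'])
 fix A B C assume A [measurable]: "A : sets X" and B [measurable]: "B : sets Y" and C [measurable]: "C : sets rpos"
 have wm [measurable]: "w : BM rpos" by (rule continuous_on_rpos_measurable[OF w(1)])
 define h where "h z = ind A (fst z) * ind B (mid z) * w (thd z)" for z
 have hm [measurable]: "h : BM (X >< (Y >< rpos))" unfolding h_def by measurable
 define N where "N q = distr (density q (%z. ennreal (h z))) borel (%z. ln (thd z))" for q :: "('x \<times> 'y \<times> real) measure"
 have fin: "finite_measure (N q)"
  and nn: "!!f. f : BM borel ==> (nnint (N q) (%x. f x)) = (nnint q (%z. ennreal (h z) * f (ln (thd z))))"
  and ch: "!!th. char (N q) th = complex_of_real (pol_test A B (%t. w t * cos (th * ln t)) q) + \<i> * complex_of_real (pol_test A B (%t. w t * sin (th * ln t)) q)"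
  if q: "q : Pol X Y" for q
 proof -
  note sets_Pol[OF q, measurable_cong]
  have h0: "0 <= h z" "norm (h z) <= 1 * (1 + thd z)" if "z : space q" for z
   using w(2)[of "thd z"] that by (auto simp: h_def space_Pol[OF q] indicator_def)
  have hint: "integrable q h" by (rule pol_integrable_dominated[OF q X Y hm h0(2)])
  show nn: "(nnint (N q) (%x. f x)) = (nnint q (%z. ennreal (h z) * f (ln (thd z))))"
   if [measurable]: "f : BM borel" for f
   unfolding N_def by (subst nn_integral_distr) (simp_all add: nn_integral_density)
  have "em (N q) (space (N q)) = (nnint (N q) (%x. 1))" by simp
  also have "... = (nnint q (%z. ennreal (h z)))" by (subst nn) simp_all
  also have "... < \<infinity>" using hint h0 by (subst nn_integral_eq_integral) (auto intro!: AE_I2)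
  finally show fin: "finite_measure (N q)" by (intro finite_measureI) simp
  interpret N: finite_measure "N q" by (rule fin)
  have ri: "(LINT x|(N q). f x) = pol_test A B (%t. w t * f (ln t)) q" if [measurable]: "f : BM borel" for f :: "real => real"
  proof -
   have "(LINT x|(N q). f x) = (LINT z|(density q (%z. ennreal (h z))). f (ln (thd z)))"
    unfolding N_def by (rule integral_distr) auto
   also have "... = (LINT z|q. h z *\<^sub>R f (ln (thd z)))"
    by (rule integral_density) (use h0 in \<open>auto intro!: AE_I2\<close>)
   finally show ?thesis by (simp add: pol_test_def h_def mult.assoc)
  qed
  show "char (N q) th = complex_of_real (pol_test A B (%t. w t * cos (th * ln t)) q) + \<i> * complex_of_real (pol_test A B (%t. w t * sin (th * ln t)) q)" for th
  proof -
   have [measurable_cong]: "sets (N q) = sets borel" by (simp add: N_def)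
   have i: "integrable (N q) (%x. iexp (th * x))"
   proof (rule N.integrable_const_bound[where B = 1])
    have "(%x. iexp (th * x)) : BM borel"
    by (intro borel_measurable_continuous_onI continuous_intros)
    then show "(%x. iexp (th * x)) : BM (N q)" by (simp add: N_def)
   qed auto
   have "Re (char (N q) th) = (LINT x|(N q). cos (th * x))" "Im (char (N q) th) = (LINT x|(N q). sin (th * x))"
    using integral_Re[OF i] integral_Im[OF i] by (simp_all add: char_def Re_exp Im_exp)
   then show ?thesis
    using ri[of "%x. cos (th * x)"] ri[of "%x. sin (th * x)"] by (simp add: complex_eq_iff)
  qed
 qed
 have "N p = N p'"
 proof (rule finite_measure_char_unique[OF fin[OF p] fin[OF p']])
  show "sets (N p) = sets borel" "sets (N p') = sets borel" by (simp_all add: N_def)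
  show "char (N p) th = char (N p') th" for th by (simp only: ch[OF p] ch[OF p'] cos[OF A B] sin[OF A B])
 qed
 have em: "em q (A \<times> B \<times> C) = (nnint (N q) (%x. ennreal (1 / w (exp x)) * ind C (exp x)))" if q: "q : Pol X Y" for q
 proof -
  note sets_Pol[OF q, measurable_cong]
  have [measurable]: "exp : borel \<rightarrow>\<^sub>M rpos" by (rule measurable_into_rpos) auto
  have "em q (A \<times> B \<times> C) = (nnint q (%z. ind (A \<times> B \<times> C) z))"
   by (rule nn_integral_indicator[symmetric]) (simp add: sets_Pol[OF q])
  also have "... = (nnint q (%z. ennreal (h z) * (ennreal (1 / w (exp (ln (thd z)))) * ind C (exp (ln (thd z))))))"
  proof (rule nn_integral_cong)
   fix z assume "z : space q"
   then have t: "thd z > 0" by (auto simp: space_Pol[OF q])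
   then have w0: "w (thd z) > 0" using w(2) by blast
   have "ennreal (w (thd z)) * ennreal (1 / w (thd z)) = 1"
    using w0 by (simp add: ennreal_mult[symmetric])
   then show "ind (A \<times> B \<times> C) z = ennreal (h z) * (ennreal (1 / w (exp (ln (thd z)))) * ind C (exp (ln (thd z))))"
    using t by (cases z) (auto simp: h_def indicator_def)
  qed
  also have "... = (nnint (N q) (%x. ennreal (1 / w (exp x)) * ind C (exp x)))"
   by (subst nn[OF q]) simp_all
  finally show ?thesis .
 qed
 show "em p (A \<times> B \<times> C) = em p' (A \<times> B \<times> C)"
  unfolding em[OF p] em[OF p'] \<open>N p = N p'\<close> ..
qed

lemma pol_test_cos_sin_continuous:
 assumes "A : sets X" "B : sets Y"
 shows "continuous_map (pol_topology X Y) euclideanreal (pol_test A B (%t. 1 * cos (th * ln t)))"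
  and "continuous_map (pol_topology X Y) euclideanreal (pol_test A B (%t. 1 * sin (th * ln t)))"
proof -
 have "bounded ((%t. 1 * cos (th * ln t)) ` {0<..})" "bounded ((%t. 1 * sin (th * ln t)) ` {0<..})"
  by (auto simp: bounded_iff intro!: exI[of _ 1])
 then show "continuous_map (pol_topology X Y) euclideanreal (pol_test A B (%t. 1 * cos (th * ln t)))"
  "continuous_map (pol_topology X Y) euclideanreal (pol_test A B (%t. 1 * sin (th * ln t)))"
  by (intro continuous_map_pol_test assms continuous_intros; simp)+
qed

text \<open>The points of \<open>Pol X Y\<close> are separated by continuous real functionals: the
  tests with cos (th ln t) and sin (th ln t) are bounded.\<close>

lemma continuous_map_pol_eq_on_closure:
 fixes X :: "'x measure" and Y :: "'y measure"
 assumes X: "prob_space X" and Y: "prob_space Y"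
  and f: "continuous_map T (pol_topology X Y) f" and g: "continuous_map T (pol_topology X Y) g"
  and x: "x : T closure_of S" and eq: "!!y. y : S ==> f y = g y"
 shows "f x = g x"
proof (rule Pol_eqI_char[OF X Y, of _ _ "%_. 1"])
 have xT: "x : topspace T" using x by (simp add: in_closure_of)
 show "f x : Pol X Y" "g x : Pol X Y"
  using continuous_map_image_subset_topspace[OF f] continuous_map_image_subset_topspace[OF g] xT by auto
 have test: "F (f x) = F (g x)" if F: "continuous_map (pol_topology X Y) euclideanreal F" for F
  using forall_in_closure_of_eq[OF x Hausdorff_space_euclidean continuous_map_compose[OF f F] continuous_map_compose[OF g F]] eq by simp
 fix A B th assume "A : sets X" "B : sets Y"
 from pol_test_cos_sin_continuous[OF this, THEN test]
 show "pol_test A B (%t. 1 * cos (th * ln t)) (f x) = pol_test A B (%t. 1 * cos (th * ln t)) (g x)"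
  "pol_test A B (%t. 1 * sin (th * ln t)) (f x) = pol_test A B (%t. 1 * sin (th * ln t)) (g x)" by blast+
qed auto

text \<open>Separate continuity permits one variable at a time: first q becomes arbitrary while p is
  given by a kernel, then p.\<close>

lemma is_pol_product_unique:
 fixes X :: "'x measure" and Y :: "'y measure" and W :: "'w measure"
 assumes X: "prob_space X" and Y: "prob_space Y" and W: "prob_space W"
  and P: "is_pol_product X Y W P" and P': "is_pol_product X Y W P'"
  and p: "p : Pol X Y" and q: "q : Pol Y W"
 shows "P p q = P' p q"
proof -
 have 1: "P p q = P' p q" if p: "p : kernel_pols X Y" and q: "q : kernel_pols Y W" for p q
 proof -
  from p q obtain u v where pq: "p : Pol X Y" "q : Pol Y W"
   and uv: "M_tri_kernel X Y u \<and> given_by X Y p u \<and> M_tri_kernel Y W v \<and> given_by Y W q v"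
   by (auto simp: kernel_pols_def)
  have PP: "P p q : Pol X W" "P' p q : Pol X W" using P P' pq by (auto simp: is_pol_product_def)
  have g: "given_by X W (P p q) (kernel_product Y u v)" "given_by X W (P' p q) (kernel_product Y u v)"
   using P P' pq uv unfolding is_pol_product_def by blast+
  show ?thesis
   by (rule Pol_eqI[OF X PP]) (use g in \<open>simp add: given_by_def\<close>)
 qed
 have 2: "P p q = P' p q" if p: "p : kernel_pols X Y" and q: "q : Pol Y W" for p q
 proof -
  have pp: "p : Pol X Y" using p by (simp add: kernel_pols_def)
  show ?thesis
   by (rule continuous_map_pol_eq_on_closure[OF X W _ _ kernel_pols_dense[OF Y W q], of "P p" "P' p"])
    (use P P' pp 1[OF p] in \<open>auto simp: is_pol_product_def\<close>)
 qed
 show ?thesis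
  by (rule continuous_map_pol_eq_on_closure[OF X W _ _ kernel_pols_dense[OF X Y p], of "%p. P p q" "%p. P' p q"])
   (use P P' q 2[OF _ q] in \<open>auto simp: is_pol_product_def\<close>)
qed

text \<open>This turns the abstract choice in \<open>pol_product\<close> into a formula: exhibiting
  any joint measure computes the product.\<close>

lemma pol_product_eq:
 fixes X :: "'x measure" and Y :: "'y measure" and W :: "'w measure"
 assumes X: "prob_space X" and Y: "prob_space Y" and W: "lebesgue_prob_space W"
  and p: "p : Pol X Y" and q: "q : Pol Y W" and R: "is_joint X Y W p q R"
 shows "pol_product X Y W p q = joint_push X W R"
proof -
 have "is_pol_product X Y W (pol_product X Y W)"
  unfolding pol_product_def by (rule someI[of "is_pol_product X Y W", OF joint_product_is_pol_product[OF X Y W]])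
 then have "pol_product X Y W p q = joint_product X Y W p q"
  by (rule is_pol_product_unique[OF X Y lebesgue_prob_spaceD[OF W] _ joint_product_is_pol_product[OF X Y W] p q])
 then show ?thesis using joint_product_eq[OF X Y p q R] by simp
qed

section \<open>Graphs, nonsingular transformations and the explicit form of \<S>\<close>

lemma graph_Pol:
 assumes [measurable]: "a : M \<rightarrow>\<^sub>M X" "b : M \<rightarrow>\<^sub>M Y" "\<tau> : M \<rightarrow>\<^sub>M rpos"
  and a: "distr M X a = X" and b: "!!B. B : sets Y ==> (nnint M (%z. ennreal (\<tau> z) * ind B (b z))) = em Y B"
 shows "distr M (X >< (Y >< rpos)) (%z. (a z, b z, \<tau> z)) : Pol X Y"
proof (rule PolI)
 fix A assume A [measurable]: "A : sets X"
 have "(nnint M (%z. ind A (a z))) = (nnint (distr M X a) (%x. ind A x))" by (rule nn_integral_distr[symmetric]) auto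
 then show "(nnint (distr M (X >< (Y >< rpos)) (%z. (a z, b z, \<tau> z))) (%z. ind A (fst z))) = em X A"
  by (subst nn_integral_distr) (simp_all add: a)
next
 fix B assume B [measurable]: "B : sets Y"
 show "(nnint (distr M (X >< (Y >< rpos)) (%z. (a z, b z, \<tau> z))) (%z. ennreal (thd z) * ind B (mid z))) = em Y B"
  by (subst nn_integral_distr) (simp_all add: b[OF B])
qed simp

text \<open>When q sits on a graph over Y, the point w and its multiplier are functions of y. The
  gluing then just attaches these values to the points of p.\<close>

lemma is_joint_graph:
 assumes p: "p : Pol X Y" and [measurable]: "ph : Y \<rightarrow>\<^sub>M W" "\<tau> : Y \<rightarrow>\<^sub>M rpos"
 shows "is_joint X Y W p (distr Y (Y >< (W >< rpos)) (%y. (y, ph y, \<tau> y)))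
  (distr p ((X >< (Y >< rpos)) >< (W >< rpos)) (%z. (z, ph (mid z), \<tau> (mid z))))"
 unfolding is_joint_def
proof (intro conjI allI impI)
 note sets_Pol[OF p, measurable_cong]
 let ?q = "distr Y (Y >< (W >< rpos)) (%y. (y, ph y, \<tau> y))"
 let ?R = "distr p ((X >< (Y >< rpos)) >< (W >< rpos)) (%z. (z, ph (mid z), \<tau> (mid z)))"
 fix F k and H :: "_ => ennreal"
 assume [measurable]: "F : BM (X >< (Y >< rpos))" "k : BM Y" "H : BM (W >< rpos)"
  and Fk: "\<forall>B\<in>sets Y. (nnint p (%z. F z * ind B (mid z))) = (nnint Y (%y. k y * ind B y))"
 have "(nnint ?R (%e. F (fst e) * H (snd e))) = (nnint p (%z. F z * H (ph (mid z), \<tau> (mid z))))"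
  by (subst nn_integral_distr) simp_all
 also have "... = (nnint Y (%y. k y * H (ph y, \<tau> y)))"
  by (rule nn_integral_eq_of_sets[where g = "%z. mid z" and h = "%y. H (ph y, \<tau> y)"]) (use Fk in simp_all)
 also have "... = (nnint ?q (%z. k (fst z) * H (snd z)))"
  by (subst nn_integral_distr) simp_all
 finally show "(nnint ?R (%e. F (fst e) * H (snd e))) = (nnint ?q (%z. k (fst z) * H (snd z)))" .
qed simp

lemma pol_product_graph:
 assumes X: "prob_space X" and Y: "prob_space Y" and W: "lebesgue_prob_space W"
  and p: "p : Pol X Y" and [measurable]: "ph : Y \<rightarrow>\<^sub>M W" "\<tau> : Y \<rightarrow>\<^sub>M rpos"
  and q: "distr Y (Y >< (W >< rpos)) (%y. (y, ph y, \<tau> y)) : Pol Y W"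
 shows "pol_product X Y W p (distr Y (Y >< (W >< rpos)) (%y. (y, ph y, \<tau> y))) =
  distr p (X >< (W >< rpos)) (%z. (fst z, ph (mid z), thd z * \<tau> (mid z)))"
proof -
 note sets_Pol[OF p, measurable_cong]
 show ?thesis
  unfolding pol_product_eq[OF X Y W p q is_joint_graph[OF p assms(5,6)]] joint_push_def
  by (subst distr_distr) (simp_all add: comp_def)
qed

context
 fixes Z :: "'z measure" and q :: "'z => 'z"
 assumes Z: "prob_space Z" and ns: "nonsingular Z q"
begin

lemma nonsingular_bij: "bij_betw q (space Z) (space Z)"
 using ns by (simp add: nonsingular_def)

lemma nonsingular_space: "z : space Z ==> q z : space Z"
 using nonsingular_bij by (auto simp: bij_betw_def)

lemma nonsingular_image_sets: "A \<subseteq> space Z ==> q ` A : sets Z \<longleftrightarrow> A : sets Z"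
 using ns by (simp add: nonsingular_def)

lemma nonsingular_image_null: "A \<subseteq> space Z ==> q ` A : null_sets Z \<longleftrightarrow> A : null_sets Z"
 using ns by (simp add: nonsingular_def)

lemma nonsingular_image_vimage: "A \<subseteq> space Z ==> q ` (q -` A \<inter> space Z) = A"
 using nonsingular_bij by (fastforce simp: bij_betw_def)

lemma nonsingular_vimage_image: "A \<subseteq> space Z ==> q -` (q ` A) \<inter> space Z = A"
 using nonsingular_bij by (auto simp: bij_betw_def inj_on_def)

lemma nonsingular_measurable: "q : Z \<rightarrow>\<^sub>M Z"
proof (rule measurableI)
 fix A assume A: "A : sets Z"
 then have "q ` (q -` A \<inter> space Z) : sets Z"
  using nonsingular_image_vimage[of A] sets.sets_into_space[OF A] by simp
 then show "q -` A \<inter> space Z : sets Z" by (subst (asm) nonsingular_image_sets) auto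
qed (rule nonsingular_space)

lemma nonsingular_AE:
 assumes "AE z in Z. P z" shows "AE z in Z. P (q z)"
proof -
 obtain N where N: "N : null_sets Z" "{z\<in>space Z. \<not> P z} \<subseteq> N"
  using assms by (auto simp: eventually_ae_filter)
 have sub: "N \<subseteq> space Z" using N(1) sets.sets_into_space by auto
 have "q ` (q -` N \<inter> space Z) : null_sets Z" using nonsingular_image_vimage[OF sub] N(1) by simp
 then have "q -` N \<inter> space Z : null_sets Z" by (subst (asm) nonsingular_image_null) auto
 then show ?thesis by (rule AE_I') (use N(2) nonsingular_space in auto)
qed

text \<open>Radon-Nikodym for the image of Z under the inverse of q. The density is replaced by 1
  where it is infinite or 0. The zero set is null because its image under q has measure 0 and q
  reflects null sets.\<close>

lemma ns_deriv_exists: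
 "\<exists>f. f : Z \<rightarrow>\<^sub>M rpos \<and> (\<forall>A\<in>sets Z. em Z (q ` A) = (nnint Z (%z. ennreal (f z) * ind A z)))"
proof -
 interpret prob_space Z by (rule Z)
 define r where "r = the_inv_into (space Z) q"
 have rv: "r -` A \<inter> space Z = q ` A" if "A \<subseteq> space Z" for A
 proof -
  have "r (q a) = a" if "a : space Z" for a
   unfolding r_def using nonsingular_bij that by (simp add: bij_betw_def the_inv_into_f_f)
  moreover have "\<exists>a\<in>space Z. z = q a" if "z : space Z" for z
   using nonsingular_bij that by (auto simp: bij_betw_def)
  ultimately show ?thesis using that nonsingular_space by fastforce
 qed
 have rm [measurable]: "r : Z \<rightarrow>\<^sub>M Z"
 proof (rule measurableI)
  show "r z : space Z" if "z : space Z" for z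
   unfolding r_def using nonsingular_bij that by (auto simp: bij_betw_def intro!: the_inv_into_into)
  show "r -` A \<inter> space Z : sets Z" if "A : sets Z" for A
   using that rv[of A] nonsingular_image_sets[of A] sets.sets_into_space[OF that] by simp
 qed
 define N where "N = distr Z Z r"
 have N: "em N A = em Z (q ` A)" if "A : sets Z" for A
  unfolding N_def using that rv[of A] sets.sets_into_space[OF that] by (simp add: emeasure_distr)
 have null: "em N B = 0" if "B : null_sets Z" for B
 proof -
  have "q ` B : null_sets Z" using that sets.sets_into_space[of B Z] by (subst nonsingular_image_null) auto
  then show ?thesis using that by (simp add: N null_setsD1 null_setsD2)
 qed
 obtain k :: "'z => ennreal" where k [measurable]: "k : BM Z"
  and kN: "!!B. B : sets Z ==> em N B = (nnint Z (%y. k y * ind B y))"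
  by (rule density_exists[OF Z _ null]) (auto simp: N_def)
 have "(nnint Z (%y. k y)) = (nnint Z (%y. k y * ind (space Z) y))" by (rule nn_integral_cong) simp
 also have "... = em Z (q ` space Z)" using kN[OF sets.top] N[OF sets.top] by simp
 finally have "(nnint Z (%y. k y)) ~= \<infinity>" by simp
 then have fin: "AE z in Z. k z ~= \<infinity>" by (intro nn_integral_noteq_infinite) auto
 have pos: "AE z in Z. k z ~= 0"
 proof -
  have B: "{z : space Z. k z = 0} : sets Z" by measurable
  have "em Z (q ` {z : space Z. k z = 0}) = (nnint Z (%y. k y * ind {z : space Z. k z = 0} y))"
   using kN[OF B] N[OF B] by simp
  also have "... = (nnint Z (%y. 0))" by (rule nn_integral_cong) (simp add: indicator_def)
  finally have "q ` {z : space Z. k z = 0} : null_sets Z"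
   using nonsingular_image_sets[of "{z : space Z. k z = 0}"] B by (auto simp: null_sets_def)
  then have "{z : space Z. k z = 0} : null_sets Z" by (subst (asm) nonsingular_image_null) auto
  then show ?thesis by (rule AE_I') auto
 qed
 define f where "f z = (if k z = 0 \<or> k z = \<infinity> then 1 else enn2real (k z))" for z
 have "0 < f z" for z
  by (cases "k z") (auto simp: f_def)
 moreover have "f : BM Z" unfolding f_def by measurable
 ultimately have "f : Z \<rightarrow>\<^sub>M rpos" by (intro measurable_into_rpos)
 moreover have "em Z (q ` A) = (nnint Z (%z. ennreal (f z) * ind A z))" if A: "A : sets Z" for A
 proof -
  have "(nnint Z (%z. ennreal (f z) * ind A z)) = (nnint Z (%z. k z * ind A z))"
   by (rule nn_integral_cong_AE, use fin pos in eventually_elim) (auto simp: f_def less_top)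
  then show ?thesis using kN[OF A] N[OF A] by simp
 qed
 ultimately show ?thesis by blast
qed

lemma ns_deriv_measurable: "ns_deriv Z q : Z \<rightarrow>\<^sub>M rpos"
 and ns_deriv_image: "A : sets Z ==> em Z (q ` A) = (nnint Z (%z. ennreal (ns_deriv Z q z) * ind A z))"
 using someI_ex[OF ns_deriv_exists] unfolding ns_deriv_def[symmetric] by auto

lemma ns_deriv_pos: "z : space Z ==> 0 < ns_deriv Z q z"
 using measurable_space[OF ns_deriv_measurable] by simp

lemma ns_deriv_unique:
 assumes f [measurable]: "f : BM Z" and f0: "!!z. z : space Z ==> 0 <= f z"
  and eq: "!!A. A : sets Z ==> em Z (q ` A) = (nnint Z (%z. ennreal (f z) * ind A z))"
 shows "AE z in Z. ns_deriv Z q z = f z"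
proof -
 interpret prob_space Z by (rule Z)
 note ns_deriv_measurable[measurable]
 have "density Z (%z. ennreal (ns_deriv Z q z)) = density Z (%z. ennreal (f z))"
  by (rule measure_eqI) (auto simp: emeasure_density ns_deriv_image[symmetric] eq)
 then have "AE z in Z. ennreal (ns_deriv Z q z) = ennreal (f z)"
  by (subst (asm) density_unique_iff) auto
 with AE_space show ?thesis
 proof eventually_elim
  case (elim z)
  then show ?case using f0[of z] ns_deriv_pos[of z] by simp
 qed
qed

lemma nonsingular_change_of_variables:
 assumes g [measurable]: "g : BM Z"
 shows "(nnint Z (%z. ennreal (ns_deriv Z q z) * g (q z))) = (nnint Z (%z. g z))"
proof -
 note ns_deriv_measurable[measurable] and nonsingular_measurable[measurable]
 have "distr (density Z (%z. ennreal (ns_deriv Z q z))) Z q = Z"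
 proof (rule measure_eqI)
  fix A assume "A : sets (distr (density Z (%z. ennreal (ns_deriv Z q z))) Z q)"
  then have A: "A : sets Z" by simp
  have m: "q -` A \<inter> space Z : sets Z" using A by measurable
  have "em (distr (density Z (%z. ennreal (ns_deriv Z q z))) Z q) A = em Z (q ` (q -` A \<inter> space Z))"
   using A m by (subst emeasure_distr) (auto simp: emeasure_density ns_deriv_image)
  then show "em (distr (density Z (%z. ennreal (ns_deriv Z q z))) Z q) A = em Z A"
   using nonsingular_image_vimage[of A] sets.sets_into_space[OF A] by simp
 qed simp
 then have "(nnint Z (%z. g z)) = (nnint (distr (density Z (%z. ennreal (ns_deriv Z q z))) Z q) (%z. g z))" by simp
 also have "... = (nnint Z (%z. ennreal (ns_deriv Z q z) * g (q z)))"
  by (subst nn_integral_distr) (simp_all add: nn_integral_density)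
 finally show ?thesis ..
qed

lemma transf_pol_Pol: "transf_pol Z q : Pol Z Z"
 unfolding transf_pol_def
proof (rule graph_Pol)
 show "distr Z Z (%z. z) = Z" by (rule distr_id)
 fix B assume "B : sets Z"
 then show "(nnint Z (%z. ennreal (ns_deriv Z q z) * ind B (q z))) = em Z B"
  by (subst nonsingular_change_of_variables) auto
qed (use ns_deriv_measurable nonsingular_measurable in auto)

lemma measure_preserving_ns_deriv:
 assumes mp: "measure_preserving_transf Z q"
 shows "AE z in Z. ns_deriv Z q z = 1"
proof (rule ns_deriv_unique)
 fix A assume A: "A : sets Z"
 have sub: "A \<subseteq> space Z" by (rule sets.sets_into_space[OF A])
 have qA: "q ` A : sets Z" using A sub by (simp add: nonsingular_image_sets)
 have "em Z (q ` A) = em (distr Z Z q) (q ` A)" using mp by (simp add: measure_preserving_transf_def)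
 also have "... = em Z (q -` (q ` A) \<inter> space Z)" by (rule emeasure_distr[OF nonsingular_measurable qA])
 also have "... = em Z A" by (simp only: nonsingular_vimage_image[OF sub])
 finally show "em Z (q ` A) = (nnint Z (%z. ennreal 1 * ind A z))" using A by simp
qed auto

end

text \<open>The chain rule for a map k that is the composite only almost everywhere, as the group
  law of an action is. The exceptional set has null images under both maps, so image measures are
  unaffected.\<close>

lemma ns_deriv_compose:
 assumes Z: "prob_space Z" and g: "nonsingular Z g" and h: "nonsingular Z h" and k: "nonsingular Z k"
  and eq: "AE z in Z. k z = h (g z)"
 shows "AE z in Z. ns_deriv Z k z = ns_deriv Z g z * ns_deriv Z h (g z)"
proof (rule ns_deriv_unique[OF Z k])
 note [measurable] = ns_deriv_measurable[OF Z g] ns_deriv_measurable[OF Z h] nonsingular_measurable[OF Z g] nonsingular_measurable[OF Z h]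
 show "(%z. ns_deriv Z g z * ns_deriv Z h (g z)) : BM Z"
  by measurable
 show "0 <= ns_deriv Z g z * ns_deriv Z h (g z)" if "z : space Z" for z
  using ns_deriv_pos[OF Z g that] ns_deriv_pos[OF Z h nonsingular_space[OF Z g that]] by simp
 fix A assume A [measurable]: "A : sets Z"
 have sub: "A \<subseteq> space Z" by (rule sets.sets_into_space[OF A])
 have gA [measurable]: "g ` A : sets Z" using A sub by (simp add: nonsingular_image_sets[OF Z g])
 have gsub: "g ` A \<subseteq> space Z" using sub nonsingular_space[OF Z g] by auto
 have hgA: "h ` g ` A : sets Z" using gA gsub by (simp add: nonsingular_image_sets[OF Z h])
 have kA: "k ` A : sets Z" using A sub by (simp add: nonsingular_image_sets[OF Z k])
 obtain N where N: "N : null_sets Z" "{z\<in>space Z. k z ~= h (g z)} \<subseteq> N"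
  using eq by (auto simp: eventually_ae_filter)
 have Nsub: "N \<subseteq> space Z" using N(1) sets.sets_into_space by auto
 have Nk: "k ` N : null_sets Z" using N(1) by (simp add: nonsingular_image_null[OF Z k Nsub])
 have "g ` N : null_sets Z" using N(1) by (simp add: nonsingular_image_null[OF Z g Nsub])
 moreover have "g ` N \<subseteq> space Z" using Nsub nonsingular_space[OF Z g] by auto
 ultimately have Nhg: "h ` g ` N : null_sets Z" by (simp add: nonsingular_image_null[OF Z h])
 have kN: "k ` N \<union> h ` g ` N : null_sets Z" using Nk Nhg by (rule null_sets.Un)
 have "AE z in Z. z : k ` A \<longleftrightarrow> z : h ` g ` A"
  by (rule AE_I'[OF kN]) (use N(2) sub in force)
 then have "em Z (k ` A) = em Z (h ` g ` A)"
  by (intro emeasure_eq_AE kA hgA)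
 also have "... = (nnint Z (%z. ennreal (ns_deriv Z h z) * ind (g ` A) z))"
  by (rule ns_deriv_image[OF Z h gA])
 also have "... = (nnint Z (%z. ennreal (ns_deriv Z g z) * (ennreal (ns_deriv Z h (g z)) * ind (g ` A) (g z))))"
  by (rule nonsingular_change_of_variables[OF Z g, symmetric]) measurable
 also have "... = (nnint Z (%z. ennreal (ns_deriv Z g z * ns_deriv Z h (g z)) * ind A z))"
 proof (rule nn_integral_cong)
  fix z assume z: "z : space Z"
  have "g z : g ` A \<longleftrightarrow> z : A"
   using nonsingular_vimage_image[OF Z g sub] z by auto
  then show "ennreal (ns_deriv Z g z) * (ennreal (ns_deriv Z h (g z)) * ind (g ` A) (g z)) = ennreal (ns_deriv Z g z * ns_deriv Z h (g z)) * ind A z"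
   using ns_deriv_pos[OF Z g z] ns_deriv_pos[OF Z h nonsingular_space[OF Z g z]]
   by (simp add: ennreal_mult mult.assoc indicator_def)
 qed
 finally show "em Z (k ` A) = (nnint Z (%z. ennreal (ns_deriv Z g z * ns_deriv Z h (g z)) * ind A z))" .
qed

lemma quot_pol_Pol:
 assumes Y: "\<pi> : Z \<rightarrow>\<^sub>M Y" "distr Z Y \<pi> = Y"
 shows "quot_pol Z Y \<pi> : Pol Z Y" and "quot_pol_star Z Y \<pi> : Pol Y Z"
proof -
 note Y(1)[measurable]
 have int: "(nnint Z (%z. ind B (\<pi> z))) = em Y B" if B [measurable]: "B : sets Y" for B
 proof -
  have "em Y B = (nnint (distr Z Y \<pi>) (%y. ind B y))" using B by (simp add: Y(2))
  also have "... = (nnint Z (%z. ind B (\<pi> z)))" by (rule nn_integral_distr) measurable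
  finally show ?thesis ..
 qed
 show "quot_pol Z Y \<pi> : Pol Z Y"
  unfolding quot_pol_def by (rule graph_Pol) (simp_all add: int distr_id)
 show "quot_pol_star Z Y \<pi> : Pol Y Z"
  unfolding quot_pol_star_def by (rule graph_Pol) (simp_all add: Y(2))
qed

text \<open>In both products the right factor, first \<sigma>(g) and then the projection, is a graph
  over Z. Multiplying by it is a substitution, so \<S> is the image of the measure of Z under an
  explicit map.\<close>

lemma train_map_eq:
 assumes Z: "lebesgue_prob_space Z" and g: "nonsingular Z (\<sigma> g)"
  and A: "prob_space (ZZ \<alpha>)" "\<pi> \<alpha> : Z \<rightarrow>\<^sub>M ZZ \<alpha>" "distr Z (ZZ \<alpha>) (\<pi> \<alpha>) = ZZ \<alpha>"
  and B: "lebesgue_prob_space (ZZ \<beta>)" "\<pi> \<beta> : Z \<rightarrow>\<^sub>M ZZ \<beta>" "distr Z (ZZ \<beta>) (\<pi> \<beta>) = ZZ \<beta>"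
 shows "train_map Z \<sigma> ZZ \<pi> \<alpha> \<beta> g = distr Z (ZZ \<alpha> >< (ZZ \<beta> >< rpos)) (%z. (\<pi> \<alpha> z, \<pi> \<beta> (\<sigma> g z), ns_deriv Z (\<sigma> g) z))"
  and "train_map Z \<sigma> ZZ \<pi> \<alpha> \<beta> g : Pol (ZZ \<alpha>) (ZZ \<beta>)"
proof -
 have Zp: "prob_space Z" by (rule lebesgue_prob_spaceD[OF Z])
 note [measurable] = A(2) B(2) ns_deriv_measurable[OF Zp g] nonsingular_measurable[OF Zp g]
 have t: "transf_pol Z (\<sigma> g) : Pol Z Z" by (rule transf_pol_Pol[OF Zp g])
 have a: "quot_pol_star Z (ZZ \<alpha>) (\<pi> \<alpha>) : Pol (ZZ \<alpha>) Z" by (rule quot_pol_Pol[OF A(2,3)])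
 have b: "quot_pol Z (ZZ \<beta>) (\<pi> \<beta>) : Pol Z (ZZ \<beta>)" by (rule quot_pol_Pol[OF B(2,3)])
 have 1: "pol_product (ZZ \<alpha>) Z Z (quot_pol_star Z (ZZ \<alpha>) (\<pi> \<alpha>)) (transf_pol Z (\<sigma> g)) =
  distr Z (ZZ \<alpha> >< (Z >< rpos)) (%z. (\<pi> \<alpha> z, \<sigma> g z, ns_deriv Z (\<sigma> g) z))"
  using t unfolding transf_pol_def
  by (subst pol_product_graph[OF A(1) Zp Z a]) (simp_all add: quot_pol_star_def distr_distr comp_def)
 have 2: "distr Z (ZZ \<alpha> >< (Z >< rpos)) (%z. (\<pi> \<alpha> z, \<sigma> g z, ns_deriv Z (\<sigma> g) z)) : Pol (ZZ \<alpha>) Z"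
 proof (rule graph_Pol)
  fix B assume "B : sets Z"
  then show "(nnint Z (%z. ennreal (ns_deriv Z (\<sigma> g) z) * ind B (\<sigma> g z))) = em Z B"
   by (subst nonsingular_change_of_variables[OF Zp g]) auto
 qed (simp_all add: A(3))
 show 3: "train_map Z \<sigma> ZZ \<pi> \<alpha> \<beta> g = distr Z (ZZ \<alpha> >< (ZZ \<beta> >< rpos)) (%z. (\<pi> \<alpha> z, \<pi> \<beta> (\<sigma> g z), ns_deriv Z (\<sigma> g) z))"
  unfolding train_map_def 1 using b unfolding quot_pol_def
  by (subst pol_product_graph[OF A(1) Zp B(1) 2]) (simp_all add: distr_distr comp_def)
 show "train_map Z \<sigma> ZZ \<pi> \<alpha> \<beta> g : Pol (ZZ \<alpha>) (ZZ \<beta>)"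
  unfolding 3
 proof (rule graph_Pol)
  fix C assume C [measurable]: "C : sets (ZZ \<beta>)"
  have "(nnint Z (%z. ennreal (ns_deriv Z (\<sigma> g) z) * ind C (\<pi> \<beta> (\<sigma> g z)))) = (nnint Z (%z. ind C (\<pi> \<beta> z)))"
   by (rule nonsingular_change_of_variables[OF Zp g]) measurable
  also have "... = (nnint (distr Z (ZZ \<beta>) (\<pi> \<beta>)) (%y. ind C y))" by (rule nn_integral_distr[symmetric]) measurable
  also have "... = em (ZZ \<beta>) C" using C by (simp add: B(3))
  finally show "(nnint Z (%z. ennreal (ns_deriv Z (\<sigma> g) z) * ind C (\<pi> \<beta> (\<sigma> g z)))) = em (ZZ \<beta>) C" .
 qed (simp_all add: A(3))
qed

section \<open>Square integrable functions\<close>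

text \<open>Functions and not classes; the identification modulo null sets is made by the
  coefficient map \<open>L2_coef\<close>.\<close>

definition L2 :: "'a measure => ('a => complex) set" where
 "L2 M = {f : BM M. integrable M (%z. (cmod (f z))\<^sup>2)}"

definition L2_sq :: "'a measure => ('a => complex) => real" where
 "L2_sq M f = (LINT z|M. (cmod (f z))\<^sup>2)"

definition L2_ip :: "'a measure => ('a => complex) => ('a => complex) => complex" where
 "L2_ip M f g = (LINT z|M. f z * cnj (g z))"

lemma L2_measurable: "f : L2 M ==> f : BM M" by (simp add: L2_def)

lemma L2_integrable_sq: "f : L2 M ==> integrable M (%z. (cmod (f z))\<^sup>2)" by (simp add: L2_def)

lemma L2_sq_nonneg [simp]: "0 <= L2_sq M f" by (simp add: L2_sq_def)

lemma borel_measurable_cnj [measurable (raw)]: "f : BM M ==> (%z. cnj (f z)) : BM M"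
 by (rule measurable_compose[OF _ borel_measurable_continuous_onI]) (auto intro: continuous_intros)

lemma L2_dominated:
 assumes [measurable]: "f : BM M" and g: "integrable M g" and le: "AE z in M. (cmod (f z))\<^sup>2 <= g z"
 shows "f : L2 M"
proof -
 have "AE z in M. norm ((cmod (f z))\<^sup>2) <= norm (g z)" using le by eventually_elim simp
 then show ?thesis unfolding L2_def using B_integrable_bound[OF g, of "%z. (cmod (f z))\<^sup>2"] by simp
qed

lemma cmod_add_sq_le: "(cmod (a + b))\<^sup>2 <= 2 * (cmod a)\<^sup>2 + 2 * (cmod b)\<^sup>2"
proof -
 have "(cmod (a + b))\<^sup>2 <= (cmod a + cmod b)\<^sup>2" by (intro power_mono norm_triangle_ineq) simp
 also have "... <= 2 * (cmod a)\<^sup>2 + 2 * (cmod b)\<^sup>2" using sum_squares_bound[of "cmod a" "cmod b"] by (simp add: power2_sum)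
 finally show ?thesis .
qed

lemma L2_add:
 assumes f: "f : L2 M" and g: "g : L2 M" shows "(%z. f z + g z) : L2 M"
proof (rule L2_dominated)
 show "integrable M (%z. 2 * (cmod (f z))\<^sup>2 + 2 * (cmod (g z))\<^sup>2)" using L2_integrable_sq[OF f] L2_integrable_sq[OF g] by simp
qed (use L2_measurable[OF f] L2_measurable[OF g] cmod_add_sq_le in auto)

lemma L2_cmult: assumes f: "f : L2 M" shows "(%z. c * f z) : L2 M"
 using assms by (auto simp: L2_def norm_mult power_mult_distrib)

lemma L2_diff: "f : L2 M ==> g : L2 M ==> (%z. f z - g z) : L2 M"
 using L2_add[OF _ L2_cmult[of g M "-1"], of f] by simp

lemma L2_sum: "(!!i. i : I ==> f i : L2 M) ==> (%z. \<Sum>i\<in>I. f i z) : L2 M"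
proof (induction I rule: infinite_finite_induct)
 case (insert i I) then show ?case using L2_add[of "f i" M "%z. \<Sum>i\<in>I. f i z"] by simp
qed (simp_all add: L2_def)

lemma L2_mult_integrable:
 assumes f: "f : L2 M" and g: "g : L2 M"
 shows "integrable M (%z. f z * cnj (g z))"
proof (rule B_integrable_bound)
 show "integrable M (%z. (cmod (f z))\<^sup>2 + (cmod (g z))\<^sup>2)" using L2_integrable_sq[OF f] L2_integrable_sq[OF g] by simp
 have "cmod (f z) * cmod (g z) <= (cmod (f z))\<^sup>2 + (cmod (g z))\<^sup>2" for z
 proof -
  have "0 <= cmod (f z) * cmod (g z)" by simp
  with sum_squares_bound[of "cmod (f z)" "cmod (g z)"] show ?thesis by linarith
 qed
 then show "AE z in M. norm (f z * cnj (g z)) <= norm ((cmod (f z))\<^sup>2 + (cmod (g z))\<^sup>2)" by (simp add: norm_mult)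
qed (use L2_measurable[OF f] L2_measurable[OF g] in measurable)

lemma L2_ip_cnj: "L2_ip M g f = cnj (L2_ip M f g)"
proof -
 have "(%z. g z * cnj (f z)) = (%z. cnj (f z * cnj (g z)))" by (simp add: mult.commute)
 then show ?thesis unfolding L2_ip_def by (simp only: B_integral_cnj)
qed

lemma L2_ip_self: "f : L2 M ==> L2_ip M f f = of_real (L2_sq M f)"
 unfolding L2_ip_def L2_sq_def by (simp add: complex_norm_square[symmetric] flip: integral_complex_of_real of_real_power)

lemma L2_ip_add: "f : L2 M ==> g : L2 M ==> k : L2 M ==> L2_ip M (%z. f z + g z) k = L2_ip M f k + L2_ip M g k"
 unfolding L2_ip_def by (simp add: distrib_right L2_mult_integrable)

lemma L2_ip_diff: "f : L2 M ==> g : L2 M ==> k : L2 M ==> L2_ip M (%z. f z - g z) k = L2_ip M f k - L2_ip M g k"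
 unfolding L2_ip_def by (simp add: left_diff_distrib L2_mult_integrable)

lemma L2_ip_cmult: "L2_ip M (%z. c * f z) k = c * L2_ip M f k"
 unfolding L2_ip_def by (simp add: mult.assoc)

lemma L2_ip_AE:
 assumes "AE z in M. f z = f' z" "AE z in M. g z = g' z" "f : BM M" "f' : BM M" "g : BM M" "g' : BM M"
 shows "L2_ip M f g = L2_ip M f' g'"
 unfolding L2_ip_def using assms(3-) by (intro integral_cong_AE) (use assms(1,2) in \<open>auto elim: AE_mp\<close>)

lemma L2_sq_diff:
 assumes f: "f : L2 M" and g: "g : L2 M"
 shows "L2_sq M (%z. f z - g z) = L2_sq M f + L2_sq M g - 2 * Re (L2_ip M f g)"
proof -
 have "(cmod (f z - g z))\<^sup>2 = (cmod (f z))\<^sup>2 + (cmod (g z))\<^sup>2 - 2 * Re (f z * cnj (g z))" for z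
  unfolding cmod_power2 by (simp add: power2_eq_square algebra_simps)
 then have "L2_sq M (%z. f z - g z) = (LINT z|M. (cmod (f z))\<^sup>2 + (cmod (g z))\<^sup>2 - 2 * Re (f z * cnj (g z)))"
  by (simp only: L2_sq_def)
 also have "... = L2_sq M f + L2_sq M g - 2 * Re (L2_ip M f g)"
  unfolding L2_sq_def L2_ip_def integral_Re[OF L2_mult_integrable[OF f g], symmetric]
  by (subst B_integral_diff B_integral_add integral_mult_right_zero
   | rule B_integrable_add L2_integrable_sq f g integrable_mult_right integrable_Re L2_mult_integrable refl)+
 finally show ?thesis .
qed

lemma L2_sq_cmult: "L2_sq M (%z. c * f z) = (cmod c)\<^sup>2 * L2_sq M f"
 by (simp add: L2_sq_def norm_mult power_mult_distrib)

lemma L2_sq_eq_0: "f : L2 M ==> L2_sq M f = 0 \<longleftrightarrow> (AE z in M. f z = 0)"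
 unfolding L2_sq_def by (subst integral_nonneg_eq_0_iff_AE) (auto simp: L2_integrable_sq)

lemma L2_Cauchy_Schwarz:
 assumes f: "f : L2 M" and g: "g : L2 M"
 shows "\<bar>Re (L2_ip M f g)\<bar> <= sqrt (L2_sq M f) * sqrt (L2_sq M g)"
proof -
 let ?a = "L2_sq M f" and ?b = "Re (L2_ip M f g)" and ?c = "L2_sq M g"
 have q: "0 <= ?a + t\<^sup>2 * ?c - 2 * t * ?b" for t :: real
 proof -
  have "Re (L2_ip M f (%z. of_real t * g z)) = t * ?b"
   by (subst L2_ip_cnj, subst L2_ip_cmult, subst L2_ip_cnj) simp
  then show ?thesis
   using L2_sq_diff[OF f L2_cmult[OF g], of "of_real t"] L2_sq_nonneg[of M "%z. f z - of_real t * g z"]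
   by (simp add: L2_sq_cmult)
 qed
 have "?b\<^sup>2 <= ?a * ?c"
 proof (cases "?c = 0")
  case True
  have "?b = 0"
  proof (rule ccontr)
   assume "?b ~= 0"
   \<comment> \<open>With vanishing quadratic term the expression is linear in t, and this t gives
     it the value -1.\<close>
   then show False using q[of "(?a + 1) / (2 * ?b)"] True by (simp add: field_simps)
  qed
  then show ?thesis by simp
 next
  case False
  then have "?c > 0" using L2_sq_nonneg[of M g] by linarith
  with q[of "?b / ?c"] show ?thesis by (simp add: field_simps power2_eq_square)
 qed
 then have "sqrt (?b\<^sup>2) <= sqrt (?a * ?c)" by (rule real_sqrt_le_mono)
 then show ?thesis by (simp add: real_sqrt_mult)
qed

lemma L2_triangle:
 assumes f: "f : L2 M" and g: "g : L2 M" and h: "h : L2 M"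
 shows "sqrt (L2_sq M (%z. f z - h z)) <= sqrt (L2_sq M (%z. f z - g z)) + sqrt (L2_sq M (%z. g z - h z))"
proof (rule real_le_lsqrt)
 let ?u = "%z. f z - g z" and ?v = "%z. h z - g z"
 have uv: "?u : L2 M" "?v : L2 M" using f g h by (auto intro: L2_diff)
 have sw: "L2_sq M (%z. g z - h z) = L2_sq M ?v" by (simp add: L2_sq_def norm_minus_commute)
 show "L2_sq M (%z. f z - h z) <= (sqrt (L2_sq M (%z. f z - g z)) + sqrt (L2_sq M (%z. g z - h z)))\<^sup>2"
  using L2_sq_diff[OF uv] L2_Cauchy_Schwarz[OF uv] by (simp add: power2_sum sw)
qed simp

context
 fixes M :: "'a measure"
 assumes M: "prob_space M"
begin

lemma L2_bounded:
 assumes [measurable]: "f : BM M" and le: "!!z. z : space M ==> cmod (f z) <= C"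
 shows "f : L2 M"
proof (rule L2_dominated)
 interpret prob_space M by (rule M)
 show "integrable M (%z. C\<^sup>2)" by simp
 show "AE z in M. (cmod (f z))\<^sup>2 <= C\<^sup>2" using AE_space by eventually_elim (intro power_mono le, auto)
qed simp

lemma L2_indicator: "D : sets M ==> (%z. c * ind D z) : L2 M"
 by (rule L2_bounded[where C = "cmod c"]) (auto simp: indicator_def)

lemma L2_integrable: assumes f: "f : L2 M" shows "integrable M f"
 using L2_mult_integrable[OF f, of "%_. 1"] L2_bounded[of "%_. 1" 1] by simp

lemma L2_norm_L1: assumes f: "f : L2 M" shows "(LINT z|M. cmod (f z)) <= sqrt (L2_sq M f)"
proof -
 interpret prob_space M by (rule M)
 note L2_measurable[OF f, measurable]
 have "(%z. of_real (cmod (f z))) : L2 M" by (rule L2_dominated[OF _ L2_integrable_sq[OF f]]) auto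
 from L2_Cauchy_Schwarz[OF this, of "%_. 1"] show ?thesis
  using L2_bounded[of "%_. 1" 1] by (simp add: L2_ip_def L2_sq_def prob_space)
qed

text \<open>Riesz-Fischer: on a probability space an L2 Cauchy sequence is Cauchy in L1, hence has
  an almost everywhere convergent subsequence. Fatou's lemma bounds the L2 distance to its
  limit.\<close>

lemma L2_complete:
 assumes F: "!!n::nat. F n : L2 M" and C: "!!e. e > 0 ==> \<exists>N. \<forall>i\<ge>N. \<forall>j\<ge>N. L2_sq M (%z. F i z - F j z) < e"
 obtains f where "f : L2 M" "!!e. e > 0 ==> \<exists>N. \<forall>n\<ge>N. L2_sq M (%z. F n z - f z) <= e"
proof -
 note L2_measurable[OF F, measurable]
 have L1: "\<exists>N. \<forall>i\<ge>N. \<forall>j\<ge>N. (LINT z|M. norm (F i z - F j z)) < e" if e: "0 < e" for e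
 proof -
  obtain N where N: "\<forall>i\<ge>N. \<forall>j\<ge>N. L2_sq M (%z. F i z - F j z) < e\<^sup>2" using C[of "e\<^sup>2"] e by auto
  have "(LINT z|M. norm (F i z - F j z)) < e" if "i \<ge> N" "j \<ge> N" for i j
  proof -
   have "sqrt (L2_sq M (%z. F i z - F j z)) < e" using N that e by (intro real_less_lsqrt) auto
   with L2_norm_L1[OF L2_diff[OF F F], of i j] show ?thesis by linarith
  qed
  then show ?thesis by blast
 qed
 obtain r :: "nat => nat" where r: "strict_mono r" "AE z in M. Cauchy (%i. F (r i) z)"
  by (rule cauchy_L1_AE_cauchy_subseq[OF L2_integrable[OF F] L1])
 define f where "f z = lim (%i. F (r i) z)" for z
 have [measurable]: "f : BM M" unfolding f_def by measurable
 have lim: "AE z in M. (%i. F (r i) z) \<longlonglongrightarrow> f z"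
  using r(2) by eventually_elim (simp add: f_def Cauchy_convergent convergent_LIMSEQ_iff[symmetric])
 have fat: "(nnint M (%z. ennreal ((cmod (F n z - f z))\<^sup>2))) <= ennreal e"
  if N: "\<forall>i\<ge>N. \<forall>j\<ge>N. L2_sq M (%z. F i z - F j z) < e" and n: "n \<ge> N" for e N n
 proof -
  have "(nnint M (%z. ennreal ((cmod (F n z - f z))\<^sup>2))) = (nnint M (%z. liminf (%i. ennreal ((cmod (F n z - F (r i) z))\<^sup>2))))"
  proof (rule nn_integral_cong_AE, use lim in eventually_elim)
   case (elim z)
   have "(%i. ennreal ((cmod (F n z - F (r i) z))\<^sup>2)) \<longlonglongrightarrow> ennreal ((cmod (F n z - f z))\<^sup>2)"
    by (intro tendsto_intros elim)
   then show ?case using lim_imp_Liminf[OF sequentially_bot] by metis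
  qed
  also have "... <= liminf (%i. nnint M (%z. ennreal ((cmod (F n z - F (r i) z))\<^sup>2)))" by (rule nn_integral_liminf) measurable
  also have "... <= liminf (%i. ennreal e)"
  proof (rule Liminf_mono, rule eventually_sequentiallyI)
   fix i assume "N <= i"
   then have "N <= r i" using seq_suble[OF r(1), of i] by linarith
   then have "L2_sq M (%z. F n z - F (r i) z) < e" using N n by blast
   moreover have "(nnint M (%z. ennreal ((cmod (F n z - F (r i) z))\<^sup>2))) = ennreal (L2_sq M (%z. F n z - F (r i) z))"
    unfolding L2_sq_def by (rule nn_integral_eq_integral[OF L2_integrable_sq[OF L2_diff[OF F F]]]) simp
   ultimately show "(nnint M (%z. ennreal ((cmod (F n z - F (r i) z))\<^sup>2))) <= ennreal e" by (simp add: ennreal_leI)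
  qed
  finally show ?thesis by (simp add: Liminf_const)
 qed
 have inL2: "(%z. F n z - f z) : L2 M" if "\<forall>i\<ge>N. \<forall>j\<ge>N. L2_sq M (%z. F i z - F j z) < e" "n \<ge> N" for e N n
  unfolding L2_def using fat[OF that] by (auto simp: integrable_iff_bounded less_top[symmetric] top_unique)
 obtain N where N: "\<forall>i\<ge>N. \<forall>j\<ge>N. L2_sq M (%z. F i z - F j z) < 1" using C[of 1] by auto
 have "(%z. F N z - (F N z - f z)) : L2 M" by (rule L2_diff[OF F inL2[OF N]]) simp
 then have f: "f : L2 M" by simp
 show thesis
 proof (rule that[OF f])
  fix e :: real assume e: "e > 0"
  obtain N where N: "\<forall>i\<ge>N. \<forall>j\<ge>N. L2_sq M (%z. F i z - F j z) < e" using C[OF e] by auto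
  have "L2_sq M (%z. F n z - f z) <= e" if "n \<ge> N" for n
  proof -
   have "ennreal (L2_sq M (%z. F n z - f z)) <= ennreal e"
    using fat[OF N that] unfolding L2_sq_def
    by (subst nn_integral_eq_integral[symmetric, OF L2_integrable_sq[OF inL2[OF N that]]]) simp_all
   then show ?thesis using e by simp
  qed
  then show "\<exists>N. \<forall>n\<ge>N. L2_sq M (%z. F n z - f z) <= e" by blast
 qed
qed

lemma L2_induct [consumes 1, case_names indicator add lim]:
 assumes f: "f : L2 M"
  and ind: "!!D c. D : sets M ==> P (%z. c * ind D z)"
  and add: "!!f g. f : L2 M ==> g : L2 M ==> P f ==> P g ==> P (%z. f z + g z)"
  and lim: "!!f. f : L2 M ==> (!!e. e > 0 ==> \<exists>g\<in>L2 M. P g \<and> L2_sq M (%z. f z - g z) < e) ==> P f"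
 shows "P f"
proof (rule lim[OF f])
 fix e :: real assume e: "e > 0"
 note L2_measurable[OF f, measurable]
 obtain F where F: "!!i. simple_function M (F i)" "!!z. z : space M ==> (%i. F i z) \<longlonglongrightarrow> f z"
  "!!i z. z : space M ==> dist (F i z) 0 <= 2 * dist (f z) 0"
  using borel_measurable_implies_sequence_metric[of f M 0] L2_measurable[OF f] by blast
 have [measurable]: "F i : BM M" for i by (rule borel_measurable_simple_function[OF F(1)])
 have "(%i. LINT z|M. (cmod (f z - F i z))\<^sup>2) \<longlonglongrightarrow> (LINT z|M. 0)"
 proof (rule integral_dominated_convergence)
  \<comment> \<open>The simple functions satisfy |F_i| <= 2 |f|, so |f - F_i| <= 3 |f|.\<close>
  show "integrable M (%z. 9 * (cmod (f z))\<^sup>2)" using L2_integrable_sq[OF f] by simp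
  show "AE z in M. (%i. (cmod (f z - F i z))\<^sup>2) \<longlonglongrightarrow> 0" using AE_space
  proof eventually_elim
   case (elim z)
   have "(%i. (cmod (f z - F i z))\<^sup>2) \<longlonglongrightarrow> (cmod (f z - f z))\<^sup>2" by (intro tendsto_intros F elim)
   then show ?case by simp
  qed
  show "AE z in M. norm ((cmod (f z - F i z))\<^sup>2) <= 9 * (cmod (f z))\<^sup>2" for i using AE_space
  proof eventually_elim
   case (elim z)
   have "cmod (f z - F i z) <= 3 * cmod (f z)" using norm_triangle_ineq4[of "f z" "F i z"] F(3)[OF elim, of i] by (simp add: dist_norm)
   then have "(cmod (f z - F i z))\<^sup>2 <= (3 * cmod (f z))\<^sup>2" by (intro power_mono) auto
   then show ?case by (simp add: power_mult_distrib)
  qed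
 qed measurable
 then have "eventually (%i. L2_sq M (%z. f z - F i z) < e) sequentially"
  unfolding L2_sq_def[symmetric] by (rule order_tendstoD) (use e in simp)
 then obtain i where i: "L2_sq M (%z. f z - F i z) < e" by (auto simp: eventually_sequentially)
 define g where "g = (%z. \<Sum>y\<in>F i ` space M. y * ind (F i -` {y} \<inter> space M) z)"
 have fin: "finite (F i ` space M)" and m: "!!y. F i -` {y} \<inter> space M : sets M"
  using F(1)[of i] by (auto simp: simple_function_def)
 have eq: "g z = F i z" if "z : space M" for z
 proof -
  have "g z = (\<Sum>y\<in>F i ` space M. if y = F i z then y else 0)"
   unfolding g_def by (rule sum.cong) (auto simp: that indicator_def)
  then show ?thesis using fin that by simp
 qed
 have "(%z. \<Sum>y\<in>S. y * ind (F i -` {y} \<inter> space M) z) : L2 M \<and> P (%z. \<Sum>y\<in>S. y * ind (F i -` {y} \<inter> space M) z)"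
  if "finite S" for S using that
 proof induction
  case empty show ?case using ind[of "{}" 0] L2_bounded[of "%_. 0" 0] by simp
 next
  case (insert y S)
  have "P (%z. y * ind (F i -` {y} \<inter> space M) z)" by (rule ind[OF m])
  with insert add[OF L2_indicator[OF m[of y], of y], of "%z. \<Sum>y\<in>S. y * ind (F i -` {y} \<inter> space M) z"]
   L2_add[OF L2_indicator[OF m[of y], of y], of "%z. \<Sum>y\<in>S. y * ind (F i -` {y} \<inter> space M) z"]
  show ?case by (simp only: sum.insert simp_thms)
 qed
 from this[OF fin] have "g : L2 M" "P g" by (simp_all add: g_def)
 moreover have "L2_sq M (%z. f z - g z) = L2_sq M (%z. f z - F i z)"
  unfolding L2_sq_def by (rule B_integral_cong) (auto simp: eq)
 ultimately show "\<exists>g\<in>L2 M. P g \<and> L2_sq M (%z. f z - g z) < e" using i by auto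
qed

end

section \<open>A countable separating family, and L2 as a Hilbert space of sequences\<close>

text \<open>Half-lines with rational end points form a countable generator that is closed under
  intersection, so complements and disjoint unions suffice by Dynkin's theorem.\<close>

lemma borel_rational_induct [consumes 1, case_names atMost empty compl union]:
 assumes E: "E : sets borel"
  and atMost: "!!q :: rat. Q {..of_rat q}" and empty: "Q {}" and compl: "!!A. A : sets borel ==> Q A ==> Q (- A)"
  and union: "!!A. disjoint_family A ==> range A \<subseteq> sets borel ==> (!!n. Q (A n)) ==> Q (\<Union>n::nat. A n)"
 shows "Q (E :: real set)"
proof -
 let ?G = "range (%q :: rat. {..of_rat q :: real})"
 have borel: "(borel :: real measure) = sigma UNIV ?G"
 proof (rule borel_eq_sigmaI1[OF borel_eq_atMost])
  fix X :: "real set" assume "X : range (%x. {..x})"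
  then obtain x where X: "X = {..x}" by auto
  have eq: "{..x} = (\<Inter>q\<in>{q :: rat. x < of_rat q}. {..of_rat q :: real})"
  proof (intro equalityI subsetI)
   fix y assume y: "y : (\<Inter>q\<in>{q :: rat. x < of_rat q}. {..of_rat q :: real})"
   have "\<not> x < y"
   proof
    assume "x < y"
    then obtain q where "x < of_rat q" "of_rat q < y" using of_rat_dense by blast
    then show False using y by fastforce
   qed
   then show "y : {..x}" by simp
  qed auto
  obtain q :: rat where "x < of_rat q" using of_rat_dense[of x "x + 1"] by auto
  then show "X : sets (sigma UNIV ?G)"
   unfolding X eq by (intro sets.countable_INT') auto
 qed auto
 have sG: "sigma_sets UNIV ?G = sets borel" by (subst borel) simp
 have E': "E : sigma_sets UNIV ?G" using E by (simp add: sG)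
 have IS: "Int_stable ?G"
 proof (rule Int_stableI)
  fix a b assume "a : ?G" "b : ?G"
  moreover from this have "a \<inter> b = a \<or> a \<inter> b = b" by auto
  ultimately show "a \<inter> b : ?G" by metis
 qed
 show ?thesis
 proof (rule sigma_sets_induct_disjoint[OF IS _ E'])
  show "Q A" if "A : ?G" for A using that atMost by auto
  show "Q (UNIV - A)" if "A : sigma_sets UNIV ?G" "Q A" for A
   using compl[of A] that by (simp add: sG Compl_eq_Diff_UNIV)
  show "Q (\<Union>n::nat. A n)" if "disjoint_family A" "range A \<subseteq> sigma_sets UNIV ?G" "!!n. Q (A n)" for A
   using union[of A] that by (simp add: sG)
 qed (simp_all add: empty)
qed

text \<open>Countably many sets that generate all measurable sets up to null sets, stated as an
  induction principle. It serves twice: for the injectivity of the coefficient map and for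
  separability. The whole space comes first, since complements need the total integral.\<close>

definition separating :: "'a measure => (nat => 'a set) => bool" where
 "separating Z B \<longleftrightarrow> range B \<subseteq> sets Z \<and> B 0 = space Z \<and>
  (\<forall>P. (\<forall>n. P (B n)) --> (\<forall>D\<in>sets Z. P D --> P (space Z - D)) -->
   (\<forall>A. range A \<subseteq> sets Z --> disjoint_family A --> (\<forall>n. P (A n)) --> P (\<Union>n::nat. A n)) -->
   (\<forall>D\<in>sets Z. \<forall>E\<in>sets Z. P D --> sym_diff D E : null_sets Z --> P E) --> (\<forall>D\<in>sets Z. P D))"

text \<open>The family consists of the preimages of rational half-lines under the real code. A
  measurable set D differs by a null set from the preimage of the inner Borel set of its
  sandwich.\<close>

lemma separating_exists:
 assumes Z: "lebesgue_prob_space (Z :: 'a measure)"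
 shows "\<exists>B. separating Z B"
proof -
 obtain j :: "'a => real" and i where ji: "j : BM Z" "AE w in Z. i (j w) = w" "!!x. i x : space Z"
  "!!D. D : sets Z ==> \<exists>E1\<in>sets borel. \<exists>E2\<in>sets borel. E1 \<subseteq> i -` D \<and> i -` D \<subseteq> E2 \<and> j -` (E2 - E1) \<inter> space Z : null_sets Z"
  by (rule lebesgue_prob_space_real_code[OF Z], rule that)
 note ji(1)[measurable]
 define B where "B n = (case n of 0 => space Z | Suc n => j -` {..of_rat (from_nat_into UNIV n)} \<inter> space Z)" for n
 have B: "B n : sets Z" for n by (cases n) (auto simp: B_def intro!: measurable_sets[OF ji(1)])
 have main: "P D" if P: "!!n. P (B n)" "!!D. D : sets Z ==> P D ==> P (space Z - D)"
   "!!A. range A \<subseteq> sets Z ==> disjoint_family A ==> (!!n. P (A n)) ==> P (\<Union>n::nat. A n)"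
   "!!D E. D : sets Z ==> E : sets Z ==> P D ==> sym_diff D E : null_sets Z ==> P E" and D: "D : sets Z" for P D
 proof -
  obtain E1 E2 where E: "E1 : sets borel" "E2 : sets borel" "E1 \<subseteq> i -` D" "i -` D \<subseteq> E2" and N: "j -` (E2 - E1) \<inter> space Z : null_sets Z"
   using ji(4)[OF D] by (elim bexE conjE) (rule that)
  have Q: "P (j -` E \<inter> space Z)" if "E : sets borel" for E
   using that
  proof (induction rule: borel_rational_induct)
   case (atMost q)
   obtain n where "from_nat_into (UNIV :: rat set) n = q"
    using from_nat_into_surj[of "UNIV :: rat set" q] by auto
   then show ?case using P(1)[of "Suc n"] by (simp add: B_def)
  next
   case empty
   show ?case using P(2)[OF sets.top] P(1)[of 0] by (simp add: B_def)
  next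
   case (compl A)
   then have "j -` A \<inter> space Z : sets Z" by measurable
   moreover have "j -` (- A) \<inter> space Z = space Z - (j -` A \<inter> space Z)" by auto
   ultimately show ?case using P(2) compl by simp
  next
   case (union A)
   have "j -` (\<Union>(range A)) \<inter> space Z = (\<Union>n. j -` A n \<inter> space Z)" by auto
   moreover have "disjoint_family (%n. j -` A n \<inter> space Z)" using union(1) by (auto simp: disjoint_family_on_def)
   moreover have "range (%n. j -` A n \<inter> space Z) \<subseteq> sets Z" using union(2) by (auto intro!: measurable_sets[OF ji(1)])
   ultimately show ?case using P(3)[of "%n. j -` A n \<inter> space Z"] union(3) by simp
  qed
  have "P (j -` E1 \<inter> space Z)" using Q E(1) by simp
  moreover have "sym_diff (j -` E1 \<inter> space Z) D : null_sets Z"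
  proof -
   obtain N' where N': "N' : null_sets Z" "{w : space Z. i (j w) ~= w} \<subseteq> N'" using ji(2) by (auto simp: eventually_ae_filter)
   have "sym_diff (j -` E1 \<inter> space Z) D \<subseteq> N' \<union> (j -` (E2 - E1) \<inter> space Z)"
   proof
    fix w assume w: "w : sym_diff (j -` E1 \<inter> space Z) D"
    then have ws: "w : space Z" using sets.sets_into_space[OF D] by auto
    show "w : N' \<union> (j -` (E2 - E1) \<inter> space Z)"
    proof (cases "i (j w) = w")
    case True
    then have "j w : i -` D \<longleftrightarrow> w : D" by simp
    then show ?thesis using w ws E(3,4) by auto
    qed (use N'(2) ws in auto)
   qed
   then show ?thesis
   proof (rule null_sets_subset[rotated 2])
    show "sym_diff (j -` E1 \<inter> space Z) D : sets Z" using E(1) D by measurable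
   qed (use N N' in auto)
  qed
  ultimately show "P D" using P(4)[OF _ D] E(1) by (auto intro: measurable_sets[OF ji(1)])
 qed
 show ?thesis unfolding separating_def
 proof (intro exI[of _ B] conjI allI impI ballI)
  show "range B \<subseteq> sets Z" "B 0 = space Z" using B by (auto simp: B_def)
  fix P D
  assume *: "\<forall>n. P (B n)" "\<forall>D\<in>sets Z. P D --> P (space Z - D)"
   "\<forall>A. range A \<subseteq> sets Z --> disjoint_family A --> (\<forall>n. P (A n)) --> P (\<Union>n::nat. A n)"
   "\<forall>D\<in>sets Z. \<forall>E\<in>sets Z. P D --> sym_diff D E : null_sets Z --> P E" and "D : sets Z"
  show "P D"
  proof (rule main[of P])
   show "P (B n)" for n using *(1) ..
   show "P (space Z - D)" if "D : sets Z" "P D" for D using *(2) that by (elim ballE impE) auto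
   show "P (\<Union>n. A n)" if "range A \<subseteq> sets Z" "disjoint_family A" "!!n. P (A n)" for A :: "nat => 'a set"
    using *(3)[rule_format, OF that] .
   show "P E" if "D : sets Z" "E : sets Z" "P D" "sym_diff D E : null_sets Z" for D E
    using *(4)[rule_format, OF that] .
  qed fact
 qed
qed

text \<open>The integrals over the separating family encode the class of f as an element of
  \<open>nat => complex\<close>, the type over which \<open>reduced_rel\<close> quantifies.\<close>

definition L2_coef :: "'a measure => (nat => 'a set) => ('a => complex) => nat => complex" where
 "L2_coef M B f = (%n. LINT z|M. ind (B n) z *\<^sub>R f z)"

definition L2_rep :: "'a measure => (nat => 'a set) => (nat => complex) => 'a => complex" where
 "L2_rep M B v = (SOME f. f : L2 M \<and> L2_coef M B f = v)"

text \<open>The ring multiplication and its unit play no role in a module.\<close>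

definition L2_hilbert :: "'a measure => (nat => 'a set) => (nat => complex) hilbert" where
 "L2_hilbert M B = \<lparr>carrier = L2_coef M B ` L2 M, mult = (%_ _ _. 0), one = (%_. 0), zero = (%_. 0),
   add = (%v w n. v n + w n), smult = (%c v n. c * v n),
   inner_prod = (%v w. L2_ip M (L2_rep M B v) (L2_rep M B w))\<rparr>"

lemma L2_sq_add_le:
 assumes f: "f : L2 M" and g: "g : L2 M"
 shows "L2_sq M (%z. f z + g z) <= 2 * L2_sq M f + 2 * L2_sq M g"
proof -
 have "L2_sq M (%z. f z + g z) <= (LINT z|M. 2 * (cmod (f z))\<^sup>2 + 2 * (cmod (g z))\<^sup>2)"
  unfolding L2_sq_def by (intro integral_mono L2_integrable_sq L2_add f g cmod_add_sq_le) (simp add: L2_integrable_sq f g)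
 also have "... = 2 * L2_sq M f + 2 * L2_sq M g" by (simp add: L2_sq_def L2_integrable_sq f g)
 finally show ?thesis .
qed

context
 fixes M :: "'a measure" and B :: "nat => 'a set"
 assumes M: "prob_space M" and B: "separating M B"
begin

lemma separating_sets: "B n : sets M" and separating_0: "B 0 = space M"
 using B by (auto simp: separating_def)

lemma separating_induct:
 assumes "D : sets M" and "!!n. P (B n)" and "!!D. D : sets M ==> P D ==> P (space M - D)"
  and "!!A. range A \<subseteq> sets M ==> disjoint_family A ==> (!!n. P (A n)) ==> P (\<Union>n::nat. A n)"
  and "!!D E. D : sets M ==> E : sets M ==> P D ==> sym_diff D E : null_sets M ==> P E"
 shows "P D"
 using B[unfolded separating_def, THEN conjunct2, THEN conjunct2, rule_format, of P D] assms by blast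

lemma sym_diff_null_AE: "sym_diff D E : null_sets M ==> AE z in M. ind D z = (ind E z :: 'b :: zero_neq_one)"
 by (rule AE_I'[of "sym_diff D E"]) (auto simp: indicator_def)

lemma integral_eq_0_AE:
 fixes k :: "'a => complex"
 assumes k: "integrable M k" and 0: "!!D. D : sets M ==> (LINT z|M. ind D z *\<^sub>R k z) = 0"
 shows "AE z in M. k z = 0"
proof -
 have int: "integrable M (%z. ind D z *\<^sub>R k z)" if "D : sets M" for D by (rule integrable_mult_indicator[OF that k])
 have "AE z in M. Re (k z) = 0"
 proof (rule density_unique_real)
  fix D assume "D : sets M"
  from integral_Re[OF int[OF this]] 0[OF this] show "(LINT z:D|M. Re (k z)) = (LINT z:D|M. 0)"
   by (simp add: set_lebesgue_integral_def)
 qed (use k in auto)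
 moreover have "AE z in M. Im (k z) = 0"
 proof (rule density_unique_real)
  fix D assume "D : sets M"
  from integral_Im[OF int[OF this]] 0[OF this] show "(LINT z:D|M. Im (k z)) = (LINT z:D|M. 0)"
   by (simp add: set_lebesgue_integral_def)
 qed (use k in auto)
 ultimately show ?thesis by eventually_elim (simp add: complex_eq_iff)
qed

text \<open>The sets over which f - g has integral 0 are closed under the operations in
  \<open>separating\<close>. The complement step uses that the total integral vanishes, which is the
  coefficient at index 0.\<close>

lemma L2_coef_eq_iff:
 assumes f: "f : L2 M" and g: "g : L2 M"
 shows "L2_coef M B f = L2_coef M B g \<longleftrightarrow> (AE z in M. f z = g z)"
proof
 assume eq: "L2_coef M B f = L2_coef M B g"
 define k where "k z = f z - g z" for z
 have k: "integrable M k" unfolding k_def by (intro B_integrable_diff L2_integrable M f g)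
 note L2_measurable[OF f, measurable] L2_measurable[OF g, measurable]
 have int: "integrable M (%z. ind D z *\<^sub>R h z)" if "D : sets M" "integrable M h" for D and h :: "'a => complex"
  using that by (rule integrable_mult_indicator)
 have base: "(LINT z|M. ind (B n) z *\<^sub>R k z) = 0" for n
  using fun_cong[OF eq, of n] int[OF separating_sets L2_integrable[OF M f], of n] int[OF separating_sets L2_integrable[OF M g], of n]
  by (simp add: k_def L2_coef_def scaleR_diff_right)
 have "(LINT z|M. k z) = (LINT z|M. ind (B 0) z *\<^sub>R k z)"
  by (rule B_integral_cong) (auto simp: separating_0)
 then have tot: "(LINT z|M. k z) = 0" by (simp add: base)
 have "(LINT z|M. ind D z *\<^sub>R k z) = 0" if "D : sets M" for D
  using that
 proof (rule separating_induct)
  fix D assume D: "D : sets M" and 0: "(LINT z|M. ind D z *\<^sub>R k z) = 0"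
  have "(LINT z|M. ind (space M - D) z *\<^sub>R k z) = (LINT z|M. k z - ind D z *\<^sub>R k z)"
   by (rule B_integral_cong) (auto simp: indicator_def)
  then show "(LINT z|M. ind (space M - D) z *\<^sub>R k z) = 0" using tot 0 int[OF D k] k by simp
 next
  fix A :: "nat => 'a set" assume A: "range A \<subseteq> sets M" "disjoint_family A" "!!n. (LINT z|M. ind (A n) z *\<^sub>R k z) = 0"
  have "(LINT z:(\<Union>n. A n)|M. k z) = (\<Sum>n. LINT z:A n|M. k z)"
   by (rule lebesgue_integral_countable_add) (use A in \<open>auto simp: disjoint_family_on_def set_integrable_def intro!: int k\<close>)
  then show "(LINT z|M. ind (\<Union>n. A n) z *\<^sub>R k z) = 0" using A(3) by (simp add: set_lebesgue_integral_def)
 next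
  fix D E assume "D : sets M" "E : sets M" "(LINT z|M. ind D z *\<^sub>R k z) = 0" and N: "sym_diff D E : null_sets M"
  moreover have "(LINT z|M. ind D z *\<^sub>R k z) = (LINT z|M. ind E z *\<^sub>R k z)"
  proof (rule integral_cong_AE)
   show "AE z in M. ind D z *\<^sub>R k z = ind E z *\<^sub>R k z"
    using sym_diff_null_AE[OF N, where 'b = real] by eventually_elim simp
  qed (use calculation k_def in simp_all)
  ultimately show "(LINT z|M. ind E z *\<^sub>R k z) = 0" by simp
 qed (rule base)
 then have "AE z in M. k z = 0" by (rule integral_eq_0_AE[OF k])
 then show "AE z in M. f z = g z" by eventually_elim (simp add: k_def)
next
 assume eq: "AE z in M. f z = g z"
 note L2_measurable[OF f, measurable] L2_measurable[OF g, measurable] separating_sets[measurable]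
 show "L2_coef M B f = L2_coef M B g"
  unfolding L2_coef_def by (intro ext integral_cong_AE) (use eq in \<open>auto elim: AE_mp\<close>)
qed

lemma L2_rep_coef:
 assumes "f : L2 M"
 shows "L2_rep M B (L2_coef M B f) : L2 M" "AE z in M. L2_rep M B (L2_coef M B f) z = f z"
proof -
 have "\<exists>g. g : L2 M \<and> L2_coef M B g = L2_coef M B f" using assms by blast
 from someI_ex[OF this] have "L2_rep M B (L2_coef M B f) : L2 M \<and> L2_coef M B (L2_rep M B (L2_coef M B f)) = L2_coef M B f"
  unfolding L2_rep_def .
 with assms show "L2_rep M B (L2_coef M B f) : L2 M" "AE z in M. L2_rep M B (L2_coef M B f) z = f z"
  using L2_coef_eq_iff by auto
qed

lemma L2_hilbert_carrier: "carrier (L2_hilbert M B) = L2_coef M B ` L2 M"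
 by (simp add: L2_hilbert_def)

lemma L2_hilbert_inner: "f : L2 M ==> g : L2 M ==> inner_prod (L2_hilbert M B) (L2_coef M B f) (L2_coef M B g) = L2_ip M f g"
 unfolding L2_hilbert_def by (simp, intro L2_ip_AE) (auto intro: L2_rep_coef L2_measurable)

lemma L2_hilbert_add: "f : L2 M ==> g : L2 M ==> L2_coef M B f \<oplus>\<^bsub>L2_hilbert M B\<^esub> L2_coef M B g = L2_coef M B (%z. f z + g z)"
 unfolding L2_hilbert_def L2_coef_def
 by (simp add: scaleR_add_right integrable_mult_indicator separating_sets L2_integrable[OF M])

lemma L2_hilbert_smult: "c \<odot>\<^bsub>L2_hilbert M B\<^esub> L2_coef M B f = L2_coef M B (%z. c * f z)"
 unfolding L2_hilbert_def L2_coef_def by (simp add: integral_mult_right_zero[symmetric] del: integral_mult_right_zero)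

lemma L2_hilbert_zero: "\<zero>\<^bsub>L2_hilbert M B\<^esub> = L2_coef M B (%_. 0)"
 by (simp add: L2_hilbert_def L2_coef_def)

lemma L2_0: "(%_. 0) : L2 M" by (simp add: L2_def)

lemma L2_hilbert_abelian_group: "abelian_group (L2_hilbert M B)"
proof (rule abelian_groupI)
 fix x assume "x : carrier (L2_hilbert M B)"
 then obtain f where f: "f : L2 M" "x = L2_coef M B f" by (auto simp: L2_hilbert_carrier)
 show "\<exists>y\<in>carrier (L2_hilbert M B). y \<oplus>\<^bsub>L2_hilbert M B\<^esub> x = \<zero>\<^bsub>L2_hilbert M B\<^esub>"
  using f L2_cmult[OF f(1), of "-1"]
  by (intro bexI[of _ "L2_coef M B (%z. - 1 * f z)"]) (auto simp: L2_hilbert_carrier L2_hilbert_add L2_hilbert_zero)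
qed (auto simp: L2_hilbert_carrier L2_hilbert_add L2_add L2_0 L2_hilbert_zero add_ac)

lemma L2_hilbert_module: "module complex_ring (L2_hilbert M B)"
proof (rule moduleI)
 show "cring complex_ring"
  by (rule cringI, rule abelian_groupI)
   (auto simp: complex_ring_def algebra_simps intro!: comm_monoidI exI[of _ "- _"])
qed (use L2_hilbert_abelian_group in \<open>auto simp: L2_hilbert_carrier L2_hilbert_smult complex_ring_def L2_hilbert_add L2_cmult L2_add distrib_right distrib_left mult.assoc\<close>)

lemma L2_hilbert_minus:
 assumes f: "f : L2 M" and g: "g : L2 M"
 shows "L2_coef M B f \<ominus>\<^bsub>L2_hilbert M B\<^esub> L2_coef M B g = L2_coef M B (%z. f z - g z)"
proof -
 interpret abelian_group "L2_hilbert M B" by (rule L2_hilbert_abelian_group)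
 have g': "(%z. - 1 * g z) : L2 M" using g by (rule L2_cmult)
 have "\<ominus>\<^bsub>L2_hilbert M B\<^esub> L2_coef M B g = L2_coef M B (%z. - 1 * g z)"
  by (rule minus_equality) (use g g' in \<open>auto simp: L2_hilbert_carrier L2_hilbert_add L2_hilbert_zero\<close>)
 then show ?thesis using f g' by (simp add: a_minus_def L2_hilbert_add)
qed

lemma L2_hdist: "f : L2 M ==> g : L2 M ==> hdist (L2_hilbert M B) (L2_coef M B f) (L2_coef M B g) = sqrt (L2_sq M (%z. f z - g z))"
 by (simp add: hdist_def L2_hilbert_carrier L2_hilbert_minus L2_hilbert_inner L2_diff L2_ip_self)

lemma L2_Metric_space: "Metric_space (carrier (L2_hilbert M B)) (hdist (L2_hilbert M B))"
proof
 show "0 <= hdist (L2_hilbert M B) x y" for x y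
 proof (cases "x : carrier (L2_hilbert M B) \<and> y : carrier (L2_hilbert M B)")
  case True then show ?thesis by (auto simp: L2_hilbert_carrier L2_hdist)
 qed (auto simp: hdist_def)
 show "hdist (L2_hilbert M B) x y = hdist (L2_hilbert M B) y x" for x y
 proof (cases "x : carrier (L2_hilbert M B) \<and> y : carrier (L2_hilbert M B)")
  case True then show ?thesis by (auto simp: L2_hilbert_carrier L2_hdist) (simp add: L2_sq_def norm_minus_commute)
 qed (auto simp: hdist_def)
next
 fix x y assume "x : carrier (L2_hilbert M B)" "y : carrier (L2_hilbert M B)"
 then obtain f g where "f : L2 M" "x = L2_coef M B f" "g : L2 M" "y = L2_coef M B g" by (auto simp: L2_hilbert_carrier)
 then show "hdist (L2_hilbert M B) x y = 0 \<longleftrightarrow> x = y" by (simp add: L2_hdist L2_sq_eq_0 L2_diff L2_coef_eq_iff)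
next
 fix x y z assume "x : carrier (L2_hilbert M B)" "y : carrier (L2_hilbert M B)" "z : carrier (L2_hilbert M B)"
 then show "hdist (L2_hilbert M B) x z <= hdist (L2_hilbert M B) x y + hdist (L2_hilbert M B) y z"
  by (auto simp: L2_hilbert_carrier L2_hdist intro: L2_triangle)
qed

interpretation H: Metric_space "carrier (L2_hilbert M B)" "hdist (L2_hilbert M B)" by (rule L2_Metric_space)

lemma L2_mcomplete: "H.mcomplete"
 unfolding H.mcomplete_def
proof (intro allI impI)
 fix v assume v: "H.MCauchy v"
 have "v n : carrier (L2_hilbert M B)" for n using v by (auto simp: H.MCauchy_def)
 then have "\<exists>f. f : L2 M \<and> v n = L2_coef M B f" for n unfolding L2_hilbert_carrier image_iff by blast
 then obtain F where F: "!!n. F n : L2 M" "!!n. v n = L2_coef M B (F n)" by metis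
 have "\<exists>N. \<forall>i\<ge>N. \<forall>j\<ge>N. L2_sq M (%z. F i z - F j z) < e" if e: "e > 0" for e
 proof -
  from e have "sqrt e > 0" by simp
  with v obtain N where "!!i j. N <= i ==> N <= j ==> hdist (L2_hilbert M B) (v i) (v j) < sqrt e"
   unfolding H.MCauchy_def by blast
  then show ?thesis by (auto simp: F L2_hdist)
 qed
 from L2_complete[OF M F(1) this] obtain f where f: "f : L2 M" "!!e. e > 0 ==> \<exists>N. \<forall>n\<ge>N. L2_sq M (%z. F n z - f z) <= e"
  by metis
 have "\<exists>N. \<forall>n\<ge>N. hdist (L2_hilbert M B) (v n) (L2_coef M B f) < e" if e: "e > 0" for e
 proof -
  \<comment> \<open>The bound from completeness is not strict; halving e makes it so.\<close>
  obtain N where N: "\<forall>n\<ge>N. L2_sq M (%z. F n z - f z) <= (e/2)\<^sup>2" using f(2)[of "(e/2)\<^sup>2"] e by auto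
  have "hdist (L2_hilbert M B) (v n) (L2_coef M B f) < e" if "n \<ge> N" for n
  proof -
   have "sqrt (L2_sq M (%z. F n z - f z)) <= e/2" using N that e by (intro real_le_lsqrt) auto
   then show ?thesis using e by (simp add: F L2_hdist f(1))
  qed
  then show ?thesis by blast
 qed
 then show "\<exists>x. limitin H.mtopology v x sequentially"
  using f(1) F by (intro exI[of _ "L2_coef M B f"]) (subst H.limit_metric_sequentially, auto simp: L2_hilbert_carrier)
qed

text \<open>The dense set consists of combinations of the indicators of the B k with complex
  rational coefficients, kept as lists so that sums are concatenations. Functions approximable by
  them are closed under sums and limits, and induction over \<open>separating\<close> supplies all
  indicators.\<close>

lemma L2_separable: "separable_space H.mtopology"
proof -
 interpret prob_space M by (rule M)
 define S :: "(nat \<times> rat \<times> rat) list => 'a => complex"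
  where "S l z = (\<Sum>(k, a, b)\<leftarrow>l. Complex (of_rat a) (of_rat b) * ind (B k) z)" for l z
 have S: "S l : L2 M" for l
 proof (induction l)
  case (Cons x l)
  obtain k a b where x: "x = (k, a, b)" by (cases x)
  show ?case using L2_add[OF L2_indicator[OF M separating_sets, of "Complex (of_rat a) (of_rat b)" k] Cons]
   by (simp add: S_def x)
 qed (simp add: S_def L2_0)
 define A where "A f \<longleftrightarrow> (\<forall>e>0. \<exists>l. L2_sq M (%z. f z - S l z) < e)" for f
 have A_lim: "A f" if f: "f : L2 M" and a: "!!e. e > 0 ==> \<exists>g\<in>L2 M. A g \<and> L2_sq M (%z. f z - g z) < e" for f
  unfolding A_def
 proof (intro allI impI)
  fix e :: real assume e: "e > 0"
  \<comment> \<open>The squared norm of a sum is at most twice the sum of the squared norms, so two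
    errors below e/4 give one below e.\<close>
  obtain g where g: "g : L2 M" "A g" "L2_sq M (%z. f z - g z) < e/4" using a[of "e/4"] e by auto
  obtain l where "L2_sq M (%z. g z - S l z) < e/4" using g(2) e unfolding A_def by (meson divide_pos_pos zero_less_numeral)
  moreover have "L2_sq M (%z. f z - S l z) <= 2 * L2_sq M (%z. f z - g z) + 2 * L2_sq M (%z. g z - S l z)"
   using L2_sq_add_le[OF L2_diff[OF f g(1)] L2_diff[OF g(1) S[of l]]] by simp
  ultimately show "\<exists>l. L2_sq M (%z. f z - S l z) < e" using g(3) by (intro exI[of _ l]) linarith
 qed
 have A_add: "A (%z. f z + g z)" if fg: "f : L2 M" "g : L2 M" "A f" "A g" for f g
  unfolding A_def
 proof (intro allI impI)
  fix e :: real assume e: "e > 0"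
  then have "e/4 > 0" by simp
  then obtain l l' where l: "L2_sq M (%z. f z - S l z) < e/4" "L2_sq M (%z. g z - S l' z) < e/4" using fg(3,4) unfolding A_def by meson
  have "(%z. f z + g z - S (l @ l') z) = (%z. (f z - S l z) + (g z - S l' z))" by (simp add: S_def algebra_simps)
  then show "\<exists>l. L2_sq M (%z. f z + g z - S l z) < e"
   using L2_sq_add_le[OF L2_diff[OF fg(1) S[of l]] L2_diff[OF fg(2) S[of l']]] l by (intro exI[of _ "l @ l'"]) simp
 qed
 have A_B: "A (%z. c * ind (B n) z)" for c n
  unfolding A_def
 proof (intro allI impI)
  fix e :: real assume e: "e > 0"
  \<comment> \<open>The real and imaginary parts each contribute a square below e/4.\<close>
  define d where "d = sqrt (e/4)"
  have d: "d > 0" "d\<^sup>2 = e/4" using e by (auto simp: d_def)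
  obtain a where a: "Re c < of_rat a" "of_rat a < Re c + d" using of_rat_dense[of "Re c" "Re c + d"] d by auto
  obtain b where b: "Im c < of_rat b" "of_rat b < Im c + d" using of_rat_dense[of "Im c" "Im c + d"] d by auto
  let ?c = "c - Complex (of_rat a) (of_rat b)"
  have "(Re ?c)\<^sup>2 < d\<^sup>2" "(Im ?c)\<^sup>2 < d\<^sup>2" using a b by (auto intro!: power2_strict_mono)
  then have c: "(cmod ?c)\<^sup>2 < e/2" by (simp add: cmod_power2 d(2))
  have "L2_sq M (%z. ?c * ind (B n) z) <= (LINT z|M. (cmod ?c)\<^sup>2)"
   unfolding L2_sq_def by (rule integral_mono[OF L2_integrable_sq[OF L2_indicator[OF M separating_sets]]]) (auto simp: indicator_def)
  with c e show "\<exists>l. L2_sq M (%z. c * ind (B n) z - S l z) < e"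
   by (intro exI[of _ "[(n, a, b)]"]) (simp add: S_def left_diff_distrib prob_space)
 qed
 have A_AE: "A g" if "A f" "AE z in M. f z = g z" "f : L2 M" "g : L2 M" for f g
 proof (rule A_lim[OF that(4)])
  have "L2_sq M (%z. g z - f z) = 0" using that by (subst L2_sq_eq_0) (auto intro!: L2_diff elim: AE_mp)
  then show "\<exists>h\<in>L2 M. A h \<and> L2_sq M (%z. g z - h z) < e" if "0 < e" for e
   using \<open>A f\<close> \<open>f \<in> L2 M\<close> that by (intro bexI[of _ f]) auto
 qed
 have A_ind: "\<forall>c. A (%z. c * ind D z)" if "D : sets M" for D
  using that
 proof (rule separating_induct)
  show "\<forall>c. A (%z. c * ind (B n) z)" for n using A_B by simp
 next
  fix D assume D: "D : sets M" "\<forall>c. A (%z. c * ind D z)"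
  show "\<forall>c. A (%z. c * ind (space M - D) z)"
  proof
   fix c
   show "A (%z. c * ind (space M - D) z)"
   proof (rule A_AE[OF A_add[OF L2_indicator[OF M separating_sets] L2_indicator[OF M D(1)] A_B D(2)[rule_format]]])
    show "AE z in M. c * ind (B 0) z + - c * ind D z = c * ind (space M - D) z"
    using AE_space by eventually_elim (auto simp: separating_0 indicator_def)
   qed (use D in \<open>auto intro!: L2_add L2_diff L2_indicator M separating_sets\<close>)
  qed
 next
  fix C :: "nat => 'a set" assume C: "range C \<subseteq> sets M" "disjoint_family C" "!!n. \<forall>c. A (%z. c * ind (C n) z)"
  have Um [measurable]: "(\<Union>i<n. C i) : sets M" "(\<Union>i. C i) : sets M" for n using C(1) by auto
  show "\<forall>c. A (%z. c * ind (\<Union>n. C n) z)"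
  proof
   fix c
   have U: "A (%z. c * ind (\<Union>i<n. C i) z)" for n
   proof (induction n)
    case 0 show ?case using A_B[of 0 0] by simp
   next
    case (Suc n)
    have "(%z. c * ind (\<Union>i<Suc n. C i) z) = (%z. c * ind (\<Union>i<n. C i) z + c * ind (C n) z)"
    proof (rule ext)
    fix z
    have "z \<notin> C i" if "z : C n" "i < n" for i using disjoint_family_onD[OF C(2), of n i] that by auto
    moreover have "(\<Union>i<Suc n. C i) = (\<Union>i<n. C i) \<union> C n" unfolding lessThan_Suc by blast
    ultimately show "c * ind (\<Union>i<Suc n. C i) z = c * ind (\<Union>i<n. C i) z + c * ind (C n) z"
    unfolding indicator_def by (cases "z : C n") auto
    qed
    moreover have "C n : sets M" using C(1) by auto
    ultimately show ?case
    using A_add[OF L2_indicator[OF M Um(1)[of n], of c] L2_indicator[OF M, of "C n" c] Suc C(3)[of n, THEN spec, of c]] by (simp only:)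
   qed
   show "A (%z. c * ind (\<Union>n. C n) z)"
   proof (rule A_lim[OF L2_indicator[OF M Um(2)]])
    fix e :: real assume e: "e > 0"
    have "(%n. LINT z|M. (cmod (c * ind (\<Union>n. C n) z - c * ind (\<Union>i<n. C i) z))\<^sup>2) \<longlonglongrightarrow> (LINT z|M. 0)"
    proof (rule integral_dominated_convergence[where w = "%_. (cmod c)\<^sup>2"])
    show "AE z in M. (%n. (cmod (c * ind (\<Union>n. C n) z - c * ind (\<Union>i<n. C i) z))\<^sup>2) \<longlonglongrightarrow> 0"
    proof (rule AE_I2)
    fix z
    have "(%n. (cmod (c * ind (\<Union>n. C n) z - c * ind (\<Union>i<n. C i) z))\<^sup>2) \<longlonglongrightarrow>
    (cmod (c * ind (\<Union>n. C n) z - c * ind (\<Union>n. C n) z))\<^sup>2"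
    by (intro tendsto_intros LIMSEQ_indicator_UN)
    then show "(%n. (cmod (c * ind (\<Union>n. C n) z - c * ind (\<Union>i<n. C i) z))\<^sup>2) \<longlonglongrightarrow> 0" by simp
    qed
    show "AE z in M. norm ((cmod (c * ind (\<Union>n. C n) z - c * ind (\<Union>i<n. C i) z))\<^sup>2) <= (cmod c)\<^sup>2" for n
    by (rule AE_I2) (auto simp: indicator_def)
    qed auto
    then have "eventually (%n. L2_sq M (%z. c * ind (\<Union>n. C n) z - c * ind (\<Union>i<n. C i) z) < e) sequentially"
    unfolding L2_sq_def[symmetric] by (rule order_tendstoD) (use e in simp)
    then obtain n where "L2_sq M (%z. c * ind (\<Union>n. C n) z - c * ind (\<Union>i<n. C i) z) < e"
    by (auto simp: eventually_sequentially)
    then show "\<exists>g\<in>L2 M. A g \<and> L2_sq M (%z. c * ind (\<Union>n. C n) z - g z) < e"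
    by (intro bexI[of _ "%z. c * ind (\<Union>i<n. C i) z"] conjI U L2_indicator M Um)
   qed
  qed
 next
  fix D E assume DE: "D : sets M" "E : sets M" "\<forall>c. A (%z. c * ind D z)" "sym_diff D E : null_sets M"
  have "A (%z. c * ind E z)" for c
  proof (rule A_AE[OF DE(3)[rule_format]])
   show "AE z in M. c * ind D z = c * ind E z"
    using sym_diff_null_AE[OF DE(4), where 'b = complex] by eventually_elim simp
  qed (use DE in \<open>auto intro!: L2_indicator M\<close>)
  then show "\<forall>c. A (%z. c * ind E z)" ..
 qed
 have A: "A f" if "f : L2 M" for f
  by (rule L2_induct[OF M that]) (use A_ind in \<open>auto intro: A_add A_lim\<close>)
 show ?thesis
  unfolding separable_space_def
 proof (intro exI[of _ "L2_coef M B ` range S"] conjI)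
  show "countable (L2_coef M B ` range S)" by (intro countable_image) auto
  show "L2_coef M B ` range S \<subseteq> topspace H.mtopology" by (subst H.topspace_mtopology) (use S in \<open>auto simp: L2_hilbert_carrier\<close>)
  have "\<exists>y\<in>L2_coef M B ` range S. y : H.mball x r" if x: "x : carrier (L2_hilbert M B)" and r: "r > 0" for x r
  proof -
   obtain f where f: "f : L2 M" "x = L2_coef M B f" using x by (auto simp: L2_hilbert_carrier)
   obtain l where l: "L2_sq M (%z. f z - S l z) < r\<^sup>2" using A[OF f(1)] r unfolding A_def by (meson zero_less_power)
   then have "sqrt (L2_sq M (%z. f z - S l z)) < r" using r by (intro real_less_lsqrt) auto
   moreover have "L2_coef M B (S l) : carrier (L2_hilbert M B)" using S by (simp add: L2_hilbert_carrier)
   ultimately show ?thesis using x f S by (intro bexI[of _ "L2_coef M B (S l)"]) (simp_all add: L2_hdist)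
  qed
  then show "H.mtopology closure_of (L2_coef M B ` range S) = topspace H.mtopology"
   unfolding H.metric_closure_of H.topspace_mtopology by auto
 qed
qed

lemma L2_separable_hilbert_space: "separable_hilbert_space (L2_hilbert M B)"
 unfolding separable_hilbert_space_def
proof (intro conjI ballI allI impI)
 fix x y assume xy: "x : carrier (L2_hilbert M B)" "y : carrier (L2_hilbert M B)"
 show "inner_prod (L2_hilbert M B) y x = cnj (inner_prod (L2_hilbert M B) x y)"
  by (simp add: L2_hilbert_def L2_ip_cnj[symmetric])
 show "inner_prod (L2_hilbert M B) (c \<odot>\<^bsub>L2_hilbert M B\<^esub> x) y = c * inner_prod (L2_hilbert M B) x y" for c
  using xy by (auto simp: L2_hilbert_carrier L2_hilbert_smult L2_hilbert_inner L2_cmult L2_ip_cmult)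
 show "inner_prod (L2_hilbert M B) (x \<oplus>\<^bsub>L2_hilbert M B\<^esub> y) z = inner_prod (L2_hilbert M B) x z + inner_prod (L2_hilbert M B) y z"
  if "z : carrier (L2_hilbert M B)" for z
  using xy that by (auto simp: L2_hilbert_carrier L2_hilbert_add L2_hilbert_inner L2_add L2_ip_add)
next
 fix x assume "x : carrier (L2_hilbert M B)" "x ~= \<zero>\<^bsub>L2_hilbert M B\<^esub>"
 then obtain f where f: "f : L2 M" "x = L2_coef M B f" "\<not> (AE z in M. f z = 0)"
  by (auto simp: L2_hilbert_carrier L2_hilbert_zero L2_coef_eq_iff L2_0)
 then have "L2_sq M f ~= 0" by (simp add: L2_sq_eq_0)
 then have "L2_sq M f > 0" using L2_sq_nonneg[of M f] by linarith
 then show "Re (inner_prod (L2_hilbert M B) x x) > 0" using f by (simp add: L2_hilbert_inner L2_ip_self)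
qed (rule L2_hilbert_module L2_mcomplete L2_separable)+

end

section \<open>The unitary representation by weighted composition operators\<close>

text \<open>This is t powr (1/2 + i th), a homomorphism from the positive reals into the nonzero
  complex numbers whose squared modulus is t.\<close>

definition half_char :: "real => real => complex" where
 "half_char th t = of_real (sqrt t) * cis (th * ln t)"

lemma half_char_mult: "0 < s ==> 0 < t ==> half_char th (s * t) = half_char th s * half_char th t"
 by (simp add: half_char_def real_sqrt_mult ln_mult distrib_left cis_mult[symmetric] mult_ac)

lemma half_char_1 [simp]: "half_char th 1 = 1" by (simp add: half_char_def)

lemma cmod_half_char [simp]: "0 < t ==> cmod (half_char th t) = sqrt t"
 by (simp add: half_char_def norm_mult)

lemma Re_half_char: "Re (half_char th t) = sqrt t * cos (th * ln t)"
 and Im_half_char: "Im (half_char th t) = sqrt t * sin (th * ln t)"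
 by (simp_all add: half_char_def)

lemma half_char_cnj: "0 < t ==> half_char th t * cnj (half_char th t) = of_real t"
 using complex_norm_square[of "half_char th t"] by (simp flip: of_real_power)

lemma half_char_borel [measurable]: "half_char th : BM borel"
 unfolding half_char_def cis_conv_exp by measurable

lemma half_char_rpos [measurable]: "half_char th : BM rpos"
 by (rule borel_measurable_rpos) simp

definition koopman :: "'z measure => real => ('z => 'z) => ('z => complex) => 'z => complex" where
 "koopman Z th q f z = f (q z) * half_char th (ns_deriv Z q z)"

lemma koopman_add: "koopman Z th q (%z. f z + g z) = (%z. koopman Z th q f z + koopman Z th q g z)"
 by (rule ext) (simp add: koopman_def distrib_right)

lemma koopman_diff: "koopman Z th q (%z. f z - g z) = (%z. koopman Z th q f z - koopman Z th q g z)"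
 by (rule ext) (simp add: koopman_def left_diff_distrib)

lemma koopman_cmult: "koopman Z th q (%z. c * f z) = (%z. c * koopman Z th q f z)"
 by (rule ext) (simp add: koopman_def)

context
 fixes Z :: "'z measure" and q :: "'z => 'z"
 assumes Z: "prob_space Z" and ns: "nonsingular Z q"
begin

lemma nonsingular_distr: "distr (density Z (%z. ennreal (ns_deriv Z q z))) Z q = Z"
proof (rule measure_eqI)
 note ns_deriv_measurable[OF Z ns, measurable] nonsingular_measurable[OF Z ns, measurable]
 fix A assume "A : sets (distr (density Z (%z. ennreal (ns_deriv Z q z))) Z q)"
 then have A [measurable]: "A : sets Z" by simp
 have "em (distr (density Z (%z. ennreal (ns_deriv Z q z))) Z q) A =
  (nnint (distr (density Z (%z. ennreal (ns_deriv Z q z))) Z q) (%z. ind A z))" by simp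
 also have "... = (nnint Z (%z. ennreal (ns_deriv Z q z) * ind A (q z)))"
  by (subst nn_integral_distr) (simp_all add: nn_integral_density)
 also have "... = em Z A" by (subst nonsingular_change_of_variables[OF Z ns]) auto
 finally show "em (distr (density Z (%z. ennreal (ns_deriv Z q z))) Z q) A = em Z A" .
qed simp

lemma koopman_measurable: "f : BM Z ==> koopman Z th q f : BM Z"
 unfolding koopman_def[abs_def]
 by (intro borel_measurable_times measurable_compose[OF ns_deriv_measurable[OF Z ns] half_char_rpos] measurable_compose[OF nonsingular_measurable[OF Z ns]])

lemma koopman_change_of_variables:
 fixes f :: "'z => 'b :: {banach, second_countable_topology}"
 assumes f [measurable]: "f : BM Z"
 shows "(LINT z|Z. ns_deriv Z q z *\<^sub>R f (q z)) = (LINT z|Z. f z)"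
  and "integrable Z (%z. ns_deriv Z q z *\<^sub>R f (q z)) \<longleftrightarrow> integrable Z f"
proof -
 note ns_deriv_measurable[OF Z ns, measurable] nonsingular_measurable[OF Z ns, measurable]
 have nn: "AE z in Z. 0 <= ns_deriv Z q z" using AE_space by eventually_elim (simp add: ns_deriv_pos[OF Z ns] less_imp_le)
 have m: "ns_deriv Z q : BM Z" by measurable
 have "(LINT z|Z. f z) = (LINT z|(distr (density Z (%z. ennreal (ns_deriv Z q z))) Z q). f z)" by (simp add: nonsingular_distr)
 also have "... = (LINT z|(density Z (%z. ennreal (ns_deriv Z q z))). f (q z))" by (rule integral_distr) measurable
 also have "... = (LINT z|Z. ns_deriv Z q z *\<^sub>R f (q z))" using m nn by (intro integral_density) auto
 finally show "(LINT z|Z. ns_deriv Z q z *\<^sub>R f (q z)) = (LINT z|Z. f z)" ..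
 have "integrable Z f \<longleftrightarrow> integrable (distr (density Z (%z. ennreal (ns_deriv Z q z))) Z q) f" by (simp add: nonsingular_distr)
 also have "... \<longleftrightarrow> integrable (density Z (%z. ennreal (ns_deriv Z q z))) (%z. f (q z))" by (rule integrable_distr_eq) measurable
 also have "... \<longleftrightarrow> integrable Z (%z. ns_deriv Z q z *\<^sub>R f (q z))" using m nn by (intro integrable_density) auto
 finally show "integrable Z (%z. ns_deriv Z q z *\<^sub>R f (q z)) \<longleftrightarrow> integrable Z f" ..
qed

lemma koopman_L2: assumes f: "f : L2 Z" shows "koopman Z th q f : L2 Z"
proof (rule L2_dominated[OF koopman_measurable[OF L2_measurable[OF f]]])
 show "integrable Z (%z. ns_deriv Z q z *\<^sub>R (cmod (f (q z)))\<^sup>2)"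
  using L2_integrable_sq[OF f] L2_measurable[OF f] by (subst koopman_change_of_variables(2)) auto
 show "AE z in Z. (cmod (koopman Z th q f z))\<^sup>2 <= ns_deriv Z q z *\<^sub>R (cmod (f (q z)))\<^sup>2"
  using AE_space by eventually_elim (use ns_deriv_pos[OF Z ns] in \<open>simp add: koopman_def norm_mult power_mult_distrib less_imp_le\<close>)
qed

lemma koopman_ip: assumes f: "f : L2 Z" and g: "g : L2 Z" shows "L2_ip Z (koopman Z th q f) (koopman Z th q g) = L2_ip Z f g"
proof -
 note L2_measurable[OF f, measurable] L2_measurable[OF g, measurable]
 have "L2_ip Z (koopman Z th q f) (koopman Z th q g) = (LINT z|Z. ns_deriv Z q z *\<^sub>R (f (q z) * cnj (g (q z))))"
  unfolding L2_ip_def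
 proof (rule B_integral_cong)
  fix z assume "z : space Z"
  from half_char_cnj[OF ns_deriv_pos[OF Z ns this]]
  show "koopman Z th q f z * cnj (koopman Z th q g z) = ns_deriv Z q z *\<^sub>R (f (q z) * cnj (g (q z)))"
   by (simp add: koopman_def scaleR_conv_of_real mult_ac)
 qed simp
 also have "... = L2_ip Z f g" unfolding L2_ip_def by (rule koopman_change_of_variables(1)) measurable
 finally show ?thesis .
qed

lemma koopman_sq: "f : L2 Z ==> L2_sq Z (koopman Z th q f) = L2_sq Z f"
 using koopman_ip[of f f th] by (simp add: L2_ip_self koopman_L2)

lemma koopman_AE: "AE z in Z. f z = g z ==> AE z in Z. koopman Z th q f z = koopman Z th q g z"
 by (drule nonsingular_AE[OF Z ns], erule AE_mp) (simp add: koopman_def)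

text \<open>The link between the two topologies: a matrix element between indicators is a test, with
  a function of size sqrt t, of the polymorphism of q.\<close>

lemma koopman_indicator_ip:
 assumes D [measurable]: "D : sets Z" and E [measurable]: "E : sets Z"
 shows "L2_ip Z (koopman Z th q (%z. ind D z)) (%z. c * ind E z) =
  cnj c * Complex (pol_test E D (%t. sqrt t * cos (th * ln t)) (transf_pol Z q)) (pol_test E D (%t. sqrt t * sin (th * ln t)) (transf_pol Z q))"
proof -
 note ns_deriv_measurable[OF Z ns, measurable] nonsingular_measurable[OF Z ns, measurable]
 note [measurable] = borel_measurable_rpos[of "%t. sqrt t * cos (th * ln t)"] borel_measurable_rpos[of "%t. sqrt t * sin (th * ln t)"]
 let ?F = "%z. koopman Z th q (%z. ind D z) z * ind E z"
 have DE: "(%z. ind D z) : L2 Z" "(%z. ind E z) : L2 Z" using L2_indicator[OF Z, of _ 1] by auto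
 have cj: "cnj (ind E z) = ind E z" for z by (simp add: indicator_def)
 have F: "integrable Z ?F"
  using L2_mult_integrable[OF koopman_L2[OF DE(1)] DE(2), of th] by (simp only: cj)
 have "L2_ip Z (koopman Z th q (%z. ind D z)) (%z. c * ind E z) = cnj c * (LINT z|Z. ?F z)"
  unfolding L2_ip_def integral_mult_right_zero[symmetric] by (rule B_integral_cong) (auto simp: indicator_def)
 also have "(LINT z|Z. ?F z) = Complex (LINT z|Z. Re (?F z)) (LINT z|Z. Im (?F z))"
  by (simp only: complex_eq_iff complex.sel integral_Re[OF F] integral_Im[OF F] simp_thms)
 also have "(LINT z|Z. Re (?F z)) = pol_test E D (%t. sqrt t * cos (th * ln t)) (transf_pol Z q)"
  unfolding pol_test_def transf_pol_def
  by (subst integral_distr) (auto simp: koopman_def Re_half_char indicator_def intro!: B_integral_cong)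
 also have "(LINT z|Z. Im (?F z)) = pol_test E D (%t. sqrt t * sin (th * ln t)) (transf_pol Z q)"
  unfolding pol_test_def transf_pol_def
  by (subst integral_distr) (auto simp: koopman_def Im_half_char indicator_def intro!: B_integral_cong)
 finally show ?thesis .
qed

end

text \<open>The chain rule for the derivative and multiplicativity of \<open>half_char\<close>.
  Since \<sigma>(gh) is \<sigma>(h) after \<sigma>(g), the operators multiply in the order of the
  group.\<close>

lemma koopman_compose:
 assumes Z: "prob_space Z" and g: "nonsingular Z g" and h: "nonsingular Z h" and k: "nonsingular Z k"
  and eq: "AE z in Z. k z = h (g z)"
 shows "AE z in Z. koopman Z th k f z = koopman Z th g (koopman Z th h f) z"
 using ns_deriv_compose[OF assms] eq AE_space
proof eventually_elim
 case (elim z)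
 then show ?case
  using half_char_mult[OF ns_deriv_pos[OF Z g elim(3)] ns_deriv_pos[OF Z h nonsingular_space[OF Z g elim(3)]]]
  by (simp add: koopman_def)
qed

text \<open>For u an indicator this is a continuous test. The operators are isometric, so an error
  in u changes the matrix element uniformly little, and the claim passes to limits.\<close>

lemma koopman_indicator_ip_continuous:
 assumes Z: "prob_space Z" and ns: "!!g. g : topspace T ==> nonsingular Z (\<sigma> g)"
  and cont: "continuous_map T (pol_topology Z Z) (%g. transf_pol Z (\<sigma> g))"
  and D: "D : sets Z" and u: "u : L2 Z"
 shows "continuous_map T euclideanreal (%g. Re (L2_ip Z (koopman Z th (\<sigma> g) (%z. ind D z)) u))"
 using u
proof (induction rule: L2_induct[OF Z, consumes 1, case_names indicator add lim])
 case (indicator E c)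
 have c: "continuous_map T euclideanreal (%g. pol_test E D \<psi> (transf_pol Z (\<sigma> g)))"
  if "continuous_on {0<..} \<psi>" "!!t. t > 0 ==> \<bar>\<psi> t\<bar> <= sqrt t" for \<psi>
  using continuous_map_compose[OF cont continuous_map_pol_sqrt[OF Z Z indicator D that]] by (simp add: comp_def)
 have "continuous_map T euclideanreal (%g. Re c * pol_test E D (%t. sqrt t * cos (th * ln t)) (transf_pol Z (\<sigma> g))
  + Im c * pol_test E D (%t. sqrt t * sin (th * ln t)) (transf_pol Z (\<sigma> g)))"
  by (intro continuous_map_add continuous_map_real_mult continuous_map_const[THEN iffD2] disjI2 c)
   (auto intro!: continuous_intros mult_left_le simp: abs_mult)
 then show ?case
  by (rule continuous_map_eq) (simp add: koopman_indicator_ip[OF Z ns D indicator])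
next
 case (add u v)
 have "L2_ip Z (koopman Z th (\<sigma> g) (%z. ind D z)) (%z. u z + v z) =
  L2_ip Z (koopman Z th (\<sigma> g) (%z. ind D z)) u + L2_ip Z (koopman Z th (\<sigma> g) (%z. ind D z)) v" if "g : topspace T" for g
  using koopman_L2[OF Z ns[OF that] L2_indicator[OF Z D, of 1]] add(1,2)
  by (subst (1 2 3) L2_ip_cnj) (simp add: L2_ip_add)
 then show ?case by (intro continuous_map_eq[OF continuous_map_add[OF add(3,4)]]) simp
next
 case (lim u)
 note D2 = L2_indicator[OF Z D, of 1, simplified]
 show ?case
 proof (rule continuous_map_uniform_approx)
  fix e :: real assume e: "0 < e"
  \<comment> \<open>The summand 1 keeps b positive when D is null.\<close>
  define b where "b = L2_sq Z (%z. ind D z) + 1"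
  have b: "b > 0" unfolding b_def using L2_sq_nonneg[of Z "%z. ind D z"] by linarith
  obtain v where v: "v : L2 Z" "continuous_map T euclideanreal (%g. Re (L2_ip Z (koopman Z th (\<sigma> g) (%z. ind D z)) v))"
   "L2_sq Z (%z. u z - v z) < e\<^sup>2 / b" using lim(2)[of "e\<^sup>2 / b"] e b by auto
  have "\<bar>Re (L2_ip Z (koopman Z th (\<sigma> g) (%z. ind D z)) u) - Re (L2_ip Z (koopman Z th (\<sigma> g) (%z. ind D z)) v)\<bar> <= e"
   if "g : topspace T" for g
  proof -
   note k = koopman_L2[OF Z ns[OF that] D2, of th]
   have "\<bar>Re (L2_ip Z (koopman Z th (\<sigma> g) (%z. ind D z)) (%z. u z - v z))\<bar> <= sqrt (L2_sq Z (%z. ind D z)) * sqrt (L2_sq Z (%z. u z - v z))"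
    using L2_Cauchy_Schwarz[OF k L2_diff[OF lim(1) v(1)]] by (simp add: koopman_sq[OF Z ns[OF that] D2])
   also have "... <= sqrt b * sqrt (e\<^sup>2 / b)"
    using v(3) by (intro mult_mono real_sqrt_le_mono) (auto simp: b_def)
   also have "... = e" using b e by (simp add: real_sqrt_mult[symmetric])
   finally show ?thesis using k lim(1) v(1) by (subst (asm) L2_ip_cnj, subst (1 2) L2_ip_cnj) (simp add: L2_ip_diff)
  qed
  with v(2) show "\<exists>G. continuous_map T euclideanreal G \<and> (\<forall>g\<in>topspace T. \<bar>Re (L2_ip Z (koopman Z th (\<sigma> g) (%z. ind D z)) u) - G g\<bar> <= e)"
   by blast
 qed
qed

text \<open>For isometries weak continuity implies strong continuity: the squared distance of T(g0)
  f and T(g) f is 2 |f|^2 - 2 Re <T(g) f, T(g0) f>. This is used for indicators and carried to all f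
  by isometry.\<close>

lemma koopman_strongly_continuous:
 assumes Z: "prob_space Z" and ns: "!!g. g : topspace T ==> nonsingular Z (\<sigma> g)"
  and cont: "continuous_map T (pol_topology Z Z) (%g. transf_pol Z (\<sigma> g))"
  and f: "f : L2 Z"
 shows "\<forall>g0\<in>topspace T. \<forall>e>0. \<exists>U. openin T U \<and> g0 : U \<and> (\<forall>g\<in>U. L2_sq Z (%z. koopman Z th (\<sigma> g0) f z - koopman Z th (\<sigma> g) f z) < e)"
  (is "\<forall>g0\<in>_. \<forall>e>0. ?C f g0 e")
 using f
proof (induction rule: L2_induct[OF Z, consumes 1, case_names indicator add lim])
 case (indicator D c)
 note D2 = L2_indicator[OF Z indicator, of 1, simplified]
 show ?case
 proof (intro ballI allI impI)
  fix g0 and e :: real assume g0: "g0 : topspace T" and e: "e > 0"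
  note k = koopman_L2[OF Z ns D2, of _ th]
  define F where "F g = Re (L2_ip Z (koopman Z th (\<sigma> g) (%z. ind D z)) (koopman Z th (\<sigma> g0) (%z. ind D z)))" for g
  define a where "a = L2_sq Z (%z. ind D z)"
  have "continuous_map T euclideanreal F"
   unfolding F_def by (rule koopman_indicator_ip_continuous[OF Z ns cont indicator k[OF g0]])
  \<comment> \<open>The squared distance will be 2 |c|^2 (a - F g); the summand 1 in the denominator
    takes care of c = 0.\<close>
  from openin_continuous_map_preimage[OF this, of "{a - e / (2 * (cmod c)\<^sup>2 + 1) <..}"]
  have "openin T {g : topspace T. a - e / (2 * (cmod c)\<^sup>2 + 1) < F g}" by simp
  moreover have "F g0 = a" unfolding F_def a_def using g0 by (simp add: L2_ip_self k koopman_sq[OF Z ns D2])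
  moreover have "0 < e / (2 * (cmod c)\<^sup>2 + 1)" using e by (intro divide_pos_pos add_nonneg_pos) auto
  moreover have "L2_sq Z (%z. koopman Z th (\<sigma> g0) (%z. c * ind D z) z - koopman Z th (\<sigma> g) (%z. c * ind D z) z) < e"
   if g: "g : topspace T" "a - e / (2 * (cmod c)\<^sup>2 + 1) < F g" for g
  proof -
   have "L2_sq Z (%z. koopman Z th (\<sigma> g0) (%z. c * ind D z) z - koopman Z th (\<sigma> g) (%z. c * ind D z) z)
    = L2_sq Z (%z. c * (koopman Z th (\<sigma> g0) (%z. ind D z) z - koopman Z th (\<sigma> g) (%z. ind D z) z))"
    by (simp add: koopman_cmult right_diff_distrib)
   also have "... = (cmod c)\<^sup>2 * (2 * (a - F g))"
    unfolding L2_sq_cmult L2_sq_diff[OF k[OF g0] k[OF g(1)]]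
    by (subst L2_ip_cnj) (simp add: F_def a_def koopman_sq[OF Z ns D2] g0 g(1))
   also have "... = (2 * (cmod c)\<^sup>2) * (a - F g)" by simp
   also have "... <= (2 * (cmod c)\<^sup>2) * (e / (2 * (cmod c)\<^sup>2 + 1))"
    using g(2) by (intro mult_left_mono) auto
   also have "... < e" using e add_nonneg_pos[of "2 * (cmod c)\<^sup>2" 1] by (simp add: field_simps)
   finally show ?thesis .
  qed
  ultimately show "?C (%z. c * ind D z) g0 e"
   using g0 by (intro exI[of _ "{g : topspace T. a - e / (2 * (cmod c)\<^sup>2 + 1) < F g}"]) auto
 qed
next
 case (add f h)
 show ?case
 proof (intro ballI allI impI)
  fix g0 and e :: real assume g0: "g0 : topspace T" and e: "e > 0"
  then have e4: "e/4 > 0" by simp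
  obtain U where U: "openin T U" "g0 : U" "!!g. g : U ==> L2_sq Z (%z. koopman Z th (\<sigma> g0) f z - koopman Z th (\<sigma> g) f z) < e/4"
   using add(3)[rule_format, OF g0 e4] by auto
  obtain V where V: "openin T V" "g0 : V" "!!g. g : V ==> L2_sq Z (%z. koopman Z th (\<sigma> g0) h z - koopman Z th (\<sigma> g) h z) < e/4"
   using add(4)[rule_format, OF g0 e4] by auto
  have "L2_sq Z (%z. koopman Z th (\<sigma> g0) (%z. f z + h z) z - koopman Z th (\<sigma> g) (%z. f z + h z) z) < e" if g: "g : U \<inter> V" for g
  proof -
   have gT: "g : topspace T" using g openin_subset[OF U(1)] by auto
   have "L2_sq Z (%z. koopman Z th (\<sigma> g0) (%z. f z + h z) z - koopman Z th (\<sigma> g) (%z. f z + h z) z) =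
    L2_sq Z (%z. (koopman Z th (\<sigma> g0) f z - koopman Z th (\<sigma> g) f z) + (koopman Z th (\<sigma> g0) h z - koopman Z th (\<sigma> g) h z))"
    by (simp add: koopman_add algebra_simps)
   also have "... <= 2 * L2_sq Z (%z. koopman Z th (\<sigma> g0) f z - koopman Z th (\<sigma> g) f z) + 2 * L2_sq Z (%z. koopman Z th (\<sigma> g0) h z - koopman Z th (\<sigma> g) h z)"
    by (intro L2_sq_add_le L2_diff koopman_L2 Z ns g0 gT add(1,2))
   also have "... < e" using U(3)[of g] V(3)[of g] g by simp
   finally show ?thesis .
  qed
  then show "?C (%z. f z + h z) g0 e" using U V by (intro exI[of _ "U \<inter> V"]) auto
 qed
next
 case (lim f)
 show ?case
 proof (intro ballI allI impI)
  fix g0 and e :: real assume g0: "g0 : topspace T" and e: "e > 0"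
  \<comment> \<open>The errors add up to at most 2 (e/16) + 8 (e/16), which is below e.\<close>
  then have e16: "e/16 > 0" by simp
  obtain h where h: "h : L2 Z" "\<forall>g0\<in>topspace T. \<forall>e>0. ?C h g0 e" "L2_sq Z (%z. f z - h z) < e/16" using lim(2)[OF e16] by auto
  obtain U where U: "openin T U" "g0 : U" "!!g. g : U ==> L2_sq Z (%z. koopman Z th (\<sigma> g0) h z - koopman Z th (\<sigma> g) h z) < e/16"
   using h(2)[rule_format, OF g0 e16] by auto
  have "L2_sq Z (%z. koopman Z th (\<sigma> g0) f z - koopman Z th (\<sigma> g) f z) < e" if g: "g : U" for g
  proof -
   have gT: "g : topspace T" using g openin_subset[OF U(1)] by auto
   let ?d = "%z. f z - h z" and ?d' = "%z. - 1 * (f z - h z)"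
   note fh = L2_diff[OF lim(1) h(1)]
   have "L2_sq Z (%z. koopman Z th (\<sigma> g0) f z - koopman Z th (\<sigma> g) f z) =
    L2_sq Z (%z. (koopman Z th (\<sigma> g0) h z - koopman Z th (\<sigma> g) h z) + (koopman Z th (\<sigma> g0) ?d z + koopman Z th (\<sigma> g) ?d' z))"
    unfolding koopman_cmult koopman_diff by (simp add: algebra_simps)
   also have "... <= 2 * L2_sq Z (%z. koopman Z th (\<sigma> g0) h z - koopman Z th (\<sigma> g) h z) + 2 * L2_sq Z (%z. koopman Z th (\<sigma> g0) ?d z + koopman Z th (\<sigma> g) ?d' z)"
    by (intro L2_sq_add_le L2_diff L2_add koopman_L2 Z ns g0 gT h(1) fh L2_cmult)
   also have "L2_sq Z (%z. koopman Z th (\<sigma> g0) ?d z + koopman Z th (\<sigma> g) ?d' z) <= 2 * L2_sq Z (koopman Z th (\<sigma> g0) ?d) + 2 * L2_sq Z (koopman Z th (\<sigma> g) ?d')"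
    by (intro L2_sq_add_le koopman_L2 Z ns g0 gT fh L2_cmult)
   also have "... = 4 * L2_sq Z ?d"
    using koopman_sq[OF Z ns[OF g0] fh] koopman_sq[OF Z ns[OF gT] L2_cmult[OF fh, of "-1"]] by (simp only: L2_sq_cmult) simp
   finally show ?thesis using U(3)[OF g] h(3) e by simp
  qed
  then show "?C f g0 e" using U by (intro exI[of _ U]) auto
 qed
qed

definition koopman_rep :: "'z measure => (nat => 'z set) => ('g => 'z => 'z) => real => 'g => (nat => complex) => nat => complex" where
 "koopman_rep Z B \<sigma> th g v = L2_coef Z B (koopman Z th (\<sigma> g) (L2_rep Z B v))"

text \<open>Injectivity cancels one q. This identifies the transformation of the unit, for which the
  group law gives only idempotence almost everywhere.\<close>

lemma nonsingular_idempotent_AE: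
 assumes "nonsingular Z q" and "AE z in Z. q z = q (q z)"
 shows "AE z in Z. q z = z"
 using assms(2) AE_space
proof eventually_elim
 case (elim z)
 have inj: "inj_on q (space Z)" and im: "q ` space Z = space Z" using assms(1) by (simp_all add: nonsingular_def bij_betw_def)
 have "q z : space Z" using im elim(2) by blast
 then show ?case using inj_onD[OF inj elim(1) elim(2)] by simp
qed

context
 fixes Z :: "'z measure" and B and G :: "('g, 'm) monoid_scheme" and T and \<sigma> :: "'g => 'z => 'z"
 assumes Z: "prob_space Z" and B: "separating Z B" and G: "topological_group G T" and act: "nonsingular_action G T Z \<sigma>"
  and one: "measure_preserving_transf Z (\<sigma> \<one>\<^bsub>G\<^esub>)"
begin

lemma action_ns: "g : carrier G ==> nonsingular Z (\<sigma> g)"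
 using act by (simp add: nonsingular_action_def)

lemma action_mult: "g : carrier G ==> h : carrier G ==> AE z in Z. \<sigma> (g \<otimes>\<^bsub>G\<^esub> h) z = \<sigma> h (\<sigma> g z)"
 using act unfolding nonsingular_action_def by (elim conjE) (drule (1) bspec)+

lemma action_one: "AE z in Z. \<sigma> \<one>\<^bsub>G\<^esub> z = z"
proof (rule nonsingular_idempotent_AE)
 interpret group G using G by (simp add: topological_group_def)
 show "nonsingular Z (\<sigma> \<one>\<^bsub>G\<^esub>)" by (simp add: action_ns)
 show "AE z in Z. \<sigma> \<one>\<^bsub>G\<^esub> z = \<sigma> \<one>\<^bsub>G\<^esub> (\<sigma> \<one>\<^bsub>G\<^esub> z)" using action_mult[OF one_closed one_closed] by simp
qed

lemma koopman_rep_coef: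
 assumes g: "g : carrier G" and f: "f : L2 Z"
 shows "koopman_rep Z B \<sigma> th g (L2_coef Z B f) = L2_coef Z B (koopman Z th (\<sigma> g) f)"
proof -
 note r = L2_rep_coef[OF Z B f] and ns = action_ns[OF g]
 show ?thesis
  unfolding koopman_rep_def
  using L2_coef_eq_iff[OF Z B koopman_L2[OF Z ns r(1)] koopman_L2[OF Z ns f]] koopman_AE[OF Z ns r(2)] by simp
qed

lemma koopman_rep_mult:
 assumes g: "g : carrier G" and h: "h : carrier G" and v: "v : carrier (L2_hilbert Z B)"
 shows "koopman_rep Z B \<sigma> th (g \<otimes>\<^bsub>G\<^esub> h) v = koopman_rep Z B \<sigma> th g (koopman_rep Z B \<sigma> th h v)"
proof -
 interpret group G using G by (simp add: topological_group_def)
 obtain f where f: "f : L2 Z" "v = L2_coef Z B f" using v by (auto simp: L2_hilbert_carrier[OF Z B])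
 have gh: "g \<otimes>\<^bsub>G\<^esub> h : carrier G" using g h by simp
 show ?thesis
  using f g h gh action_mult[OF g h]
  by (simp add: koopman_rep_coef koopman_L2[OF Z action_ns] L2_coef_eq_iff[OF Z B] koopman_compose[OF Z action_ns action_ns action_ns])
qed

lemma koopman_rep_one:
 assumes v: "v : carrier (L2_hilbert Z B)"
 shows "koopman_rep Z B \<sigma> th \<one>\<^bsub>G\<^esub> v = v"
proof -
 interpret group G using G by (simp add: topological_group_def)
 obtain f where f: "f : L2 Z" "v = L2_coef Z B f" using v by (auto simp: L2_hilbert_carrier[OF Z B])
 have "AE z in Z. koopman Z th (\<sigma> \<one>\<^bsub>G\<^esub>) f z = f z"
  using action_one measure_preserving_ns_deriv[OF Z action_ns[OF one_closed] one] by eventually_elim (simp add: koopman_def)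
 then show ?thesis using f by (simp add: koopman_rep_coef L2_coef_eq_iff[OF Z B] koopman_L2[OF Z action_ns])
qed

lemma koopman_rep_unitary: "unitary_rep G T (L2_hilbert Z B) (koopman_rep Z B \<sigma> th)"
 unfolding unitary_rep_def unitary_operator_def
proof (intro conjI ballI allI)
 interpret group G using G by (simp add: topological_group_def)
 let ?H = "L2_hilbert Z B" and ?\<rho> = "koopman_rep Z B \<sigma> th"
 show "separable_hilbert_space ?H" by (rule L2_separable_hilbert_space[OF Z B])
 have closed: "?\<rho> g v : carrier ?H" if "g : carrier G" "v : carrier ?H" for g v
  using that by (auto simp: L2_hilbert_carrier[OF Z B] koopman_rep_coef koopman_L2[OF Z action_ns])
 fix g assume g: "g : carrier G"
 show "bij_betw (?\<rho> g) (carrier ?H) (carrier ?H)"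
 proof (rule bij_betw_byWitness[where f' = "?\<rho> (inv\<^bsub>G\<^esub> g)"])
  show "\<forall>v\<in>carrier ?H. ?\<rho> (inv\<^bsub>G\<^esub> g) (?\<rho> g v) = v" "\<forall>v\<in>carrier ?H. ?\<rho> g (?\<rho> (inv\<^bsub>G\<^esub> g) v) = v"
   using g by (simp_all add: koopman_rep_mult[symmetric] koopman_rep_one)
 qed (use closed g in auto)
 show "?\<rho> g (v \<oplus>\<^bsub>?H\<^esub> w) = ?\<rho> g v \<oplus>\<^bsub>?H\<^esub> ?\<rho> g w" if "v : carrier ?H" "w : carrier ?H" for v w
  using g that by (auto simp: L2_hilbert_carrier[OF Z B] L2_hilbert_add[OF Z B] koopman_rep_coef koopman_L2[OF Z action_ns] L2_add koopman_add)
 show "?\<rho> g (c \<odot>\<^bsub>?H\<^esub> v) = c \<odot>\<^bsub>?H\<^esub> ?\<rho> g v" if "v : carrier ?H" for c v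
  using g that by (auto simp: L2_hilbert_carrier[OF Z B] L2_hilbert_smult[OF Z B] koopman_rep_coef L2_cmult koopman_cmult)
 show "inner_prod ?H (?\<rho> g v) (?\<rho> g w) = inner_prod ?H v w" if "v : carrier ?H" "w : carrier ?H" for v w
  using g that by (auto simp: L2_hilbert_carrier[OF Z B] L2_hilbert_inner[OF Z B] koopman_rep_coef koopman_L2[OF Z action_ns] koopman_ip[OF Z action_ns])
 show "?\<rho> (g \<otimes>\<^bsub>G\<^esub> h) v = ?\<rho> g (?\<rho> h v)" if "h : carrier G" "v : carrier ?H" for h v
  by (rule koopman_rep_mult[OF g that])
next
 let ?H = "L2_hilbert Z B" and ?\<rho> = "koopman_rep Z B \<sigma> th"
 interpret H: Metric_space "carrier ?H" "hdist ?H" by (rule L2_Metric_space[OF Z B])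
 have TG: "topspace T = carrier G" using G by (simp add: topological_group_def)
 fix v assume "v : carrier ?H"
 then obtain f where f: "f : L2 Z" "v = L2_coef Z B f" by (auto simp: L2_hilbert_carrier[OF Z B])
 have cont: "continuous_map T (pol_topology Z Z) (%g. transf_pol Z (\<sigma> g))" using act by (simp add: nonsingular_action_def)
 show "continuous_map T H.mtopology (%g. ?\<rho> g v)"
  unfolding H.continuous_map_to_metric
 proof (intro ballI allI impI)
  fix g0 and e :: real assume g0: "g0 : topspace T" and e: "0 < e"
  have e2: "0 < e\<^sup>2" using e by simp
  have ns: "!!g. g : topspace T ==> nonsingular Z (\<sigma> g)" by (simp add: TG action_ns)
  have sc: "\<forall>g0\<in>topspace T. \<forall>e>0. \<exists>U. openin T U \<and> g0 : U \<and> (\<forall>g\<in>U. L2_sq Z (%z. koopman Z th (\<sigma> g0) f z - koopman Z th (\<sigma> g) f z) < e)"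
   by (rule koopman_strongly_continuous[OF Z ns cont f(1)])
  obtain U where U: "openin T U" "g0 : U"
   "!!g. g : U ==> L2_sq Z (%z. koopman Z th (\<sigma> g0) f z - koopman Z th (\<sigma> g) f z) < e\<^sup>2"
   using sc[THEN bspec, THEN spec, THEN mp, OF g0 e2] by (elim exE conjE) (rule that, auto)
  have "?\<rho> g v : H.mball (?\<rho> g0 v) e" if g: "g : U" for g
  proof -
   have gs: "g : carrier G" "g0 : carrier G" using g g0 openin_subset[OF U(1)] by (auto simp: TG)
   have "sqrt (L2_sq Z (%z. koopman Z th (\<sigma> g0) f z - koopman Z th (\<sigma> g) f z)) < e"
    using U(3)[OF g] e by (intro real_less_lsqrt) auto
   moreover have "L2_coef Z B (koopman Z th (\<sigma> g) f) : carrier ?H" if "g : carrier G" for g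
    using that f by (simp add: L2_hilbert_carrier[OF Z B] koopman_L2[OF Z action_ns])
   ultimately show ?thesis using gs f by (simp add: koopman_rep_coef L2_hdist[OF Z B] koopman_L2[OF Z action_ns])
  qed
  then show "\<exists>U. openin T U \<and> g0 : U \<and> (\<forall>g\<in>U. ?\<rho> g v : H.mball (?\<rho> g0 v) e)" using U by blast
 qed
qed

end

section \<open>Conditional expectations of square integrable functions\<close>

text \<open>m is the conditional expectation of u given \<pi>, moved to Y as a density. The content
  is that conditioning preserves square integrability.\<close>

lemma nonneg_pushdown:
 fixes u :: "'z => real"
 assumes Z: "prob_space Z" and Y: "prob_space Y" and \<pi> [measurable]: "\<pi> : Z \<rightarrow>\<^sub>M Y" and d: "distr Z Y \<pi> = Y"
  and u [measurable]: "u : BM Z" and u0: "!!z. 0 <= u z" and fin: "integrable Z (%z. (u z)\<^sup>2)"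
 shows "\<exists>m. m : BM Y \<and> (\<forall>y. 0 <= m y) \<and> integrable Y (%y. (m y)\<^sup>2) \<and>
  (\<forall>B\<in>sets Y. (nnint Z (%z. ennreal (u z) * ind B (\<pi> z))) = (nnint Y (%y. ennreal (m y) * ind B y)))"
proof -
 interpret Z: prob_space Z by (rule Z)
 interpret Y: prob_space Y by (rule Y)
 have int: "(nnint Z (%z. f (\<pi> z))) = (nnint Y (%y. f y))" if [measurable]: "f : BM Y" for f
  using nn_integral_distr[OF \<pi>, of f] by (simp add: d)
 have AEpi: "AE z in Z. P (\<pi> z)" if "AE y in Y. P y" for P
  by (rule AE_distrD[OF \<pi>], subst d, rule that)
 have ku: "(%z. ennreal (u z)) : BM Z" by measurable
 obtain k :: "'a => ennreal" where k [measurable]: "k : BM Y"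
  and kN: "!!B. B : sets Y ==> (nnint Z (%z. ennreal (u z) * ind B (\<pi> z))) = (nnint Y (%y. k y * ind B y))"
  by (rule pushforward_density[OF Y \<pi> AEpi ku], assumption, rule that)
 have u1: "(nnint Z (%z. ennreal (u z))) < \<infinity>"
 proof -
  have "(nnint Z (%z. ennreal (u z))) <= (nnint Z (%z. ennreal (1 + (u z)\<^sup>2)))"
  proof (rule nn_integral_mono, rule ennreal_leI)
   fix z show "u z <= 1 + (u z)\<^sup>2" using sum_squares_bound[of "u z" 1] u0[of z] by simp
  qed
  also have "... < \<infinity>" using fin by (subst nn_integral_eq_integral) auto
  finally show ?thesis .
 qed
 have "(nnint Y (%y. k y)) = (nnint Y (%y. k y * ind (space Y) y))" by (rule nn_integral_cong) simp
 also have "... = (nnint Z (%z. ennreal (u z) * ind (space Y) (\<pi> z)))" using kN[OF sets.top] by simp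
 also have "... <= (nnint Z (%z. ennreal (u z)))" by (rule nn_integral_mono) (auto simp: indicator_def)
 finally have "(nnint Y (%y. k y)) ~= \<infinity>" using u1 by (simp add: less_top top_unique)
 then have kfin: "AE y in Y. k y ~= \<infinity>" by (intro nn_integral_noteq_infinite) auto
 define m where "m y = enn2real (k y)" for y
 have m [measurable]: "m : BM Y" unfolding m_def by measurable
 have m0: "0 <= m y" for y by (simp add: m_def)
 have km: "AE y in Y. k y = ennreal (m y)" using kfin by eventually_elim (simp add: m_def less_top)
 have rel: "(nnint Z (%z. ennreal (u z) * ind B (\<pi> z))) = (nnint Y (%y. ennreal (m y) * ind B y))" if B: "B : sets Y" for B
 proof -
  have "(nnint Y (%y. k y * ind B y)) = (nnint Y (%y. ennreal (m y) * ind B y))"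
   using km by (intro nn_integral_cong_AE) auto
  then show ?thesis using kN[OF B] by simp
 qed
 \<comment> \<open>With h = min m n, the integral of h^2 is at most that of m h, which is the
   integral of u times the pullback of h, hence at most half the sum of the integrals of u^2 and
   h^2. Truncation makes the integral of h^2 finite, so it cancels.\<close>
 have bound: "(nnint Y (%y. ennreal ((min (m y) (real n))\<^sup>2))) <= (nnint Z (%z. ennreal ((u z)\<^sup>2)))" for n
 proof -
  define h where "h y = min (m y) (real n)" for y
  have h [measurable]: "h : BM Y" unfolding h_def by measurable
  have h0: "0 <= h y" "h y <= m y" "h y <= real n" for y using m0[of y] by (auto simp: h_def)
  let ?I = "nnint Y (%y. ennreal ((h y)\<^sup>2))"
  have "?I <= (nnint Y (%y. ennreal ((real n)\<^sup>2)))" using h0 by (intro nn_integral_mono ennreal_leI power_mono)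
  then have Ifin: "?I ~= \<infinity>" by (auto simp: Y.emeasure_space_1 top_unique)
  have "2 * ?I <= 2 * (nnint Y (%y. ennreal (m y) * ennreal (h y)))"
  proof (intro mult_left_mono nn_integral_mono)
   fix y
   have "ennreal ((h y)\<^sup>2) <= ennreal (m y * h y)" using h0 by (intro ennreal_leI) (simp add: power2_eq_square mult_right_mono)
   then show "ennreal ((h y)\<^sup>2) <= ennreal (m y) * ennreal (h y)" by (simp add: ennreal_mult m0 h0)
  qed simp
  also have "(nnint Y (%y. ennreal (m y) * ennreal (h y))) = (nnint Z (%z. ennreal (u z) * ennreal (h (\<pi> z))))"
   by (rule nn_integral_eq_of_sets[symmetric, where h = "%y. ennreal (h y)", OF rel]) auto
  also have "2 * ... = (nnint Z (%z. ennreal (2 * u z * h (\<pi> z))))"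
   by (subst nn_integral_cmult[symmetric]) (use u0 h0 in \<open>auto simp: ennreal_mult mult.assoc intro!: nn_integral_cong\<close>)
  also have "... <= (nnint Z (%z. ennreal ((u z)\<^sup>2) + ennreal ((h (\<pi> z))\<^sup>2)))"
   using sum_squares_bound by (intro nn_integral_mono) (simp flip: ennreal_plus)
  also have "... = (nnint Z (%z. ennreal ((u z)\<^sup>2))) + (nnint Z (%z. ennreal ((h (\<pi> z))\<^sup>2)))" by (rule nn_integral_add) measurable
  also have "(nnint Z (%z. ennreal ((h (\<pi> z))\<^sup>2))) = ?I" by (rule int) measurable
  finally have "?I + ?I <= ?I + (nnint Z (%z. ennreal ((u z)\<^sup>2)))" by (simp add: mult_2 add.commute)
  with Ifin show ?thesis unfolding h_def[symmetric] by (simp add: ennreal_add_left_cancel_le)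
 qed
 have "(nnint Y (%y. ennreal ((m y)\<^sup>2))) = (nnint Y (%y. liminf (%n. ennreal ((min (m y) (real n))\<^sup>2))))"
 proof (rule nn_integral_cong)
  fix y
  obtain N :: nat where N: "m y <= real N" using real_arch_simple by blast
  have "eventually (%n. ennreal ((min (m y) (real n))\<^sup>2) = ennreal ((m y)\<^sup>2)) sequentially"
   using eventually_ge_at_top[of N] by eventually_elim (use N in \<open>simp add: min_absorb1\<close>)
  then have "(%n. ennreal ((min (m y) (real n))\<^sup>2)) \<longlonglongrightarrow> ennreal ((m y)\<^sup>2)" by (rule tendsto_eventually)
  then show "ennreal ((m y)\<^sup>2) = liminf (%n. ennreal ((min (m y) (real n))\<^sup>2))"
   using lim_imp_Liminf[OF sequentially_bot] by metis
 qed
 also have "... <= liminf (%n. nnint Y (%y. ennreal ((min (m y) (real n))\<^sup>2)))" by (rule nn_integral_liminf) measurable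
 also have "... <= liminf (%n. nnint Z (%z. ennreal ((u z)\<^sup>2)))" by (intro Liminf_mono always_eventually allI bound)
 also have "... < \<infinity>" using fin by (simp add: Liminf_const nn_integral_eq_integral)
 finally have "integrable Y (%y. (m y)\<^sup>2)" by (intro integrableI_bounded) auto
 with m m0 rel show ?thesis by blast
qed

text \<open>The positive part of the real part after rotation by c. The four rotations by
  \<open>fourth_roots\<close> write a complex function as a combination of nonnegative ones, which
  have densities in \<open>ennreal\<close>.\<close>

definition quarter :: "complex => complex => real" where
 "quarter c w = max 0 (Re (c * w))"

lemma quarter_nonneg: "0 <= quarter c w" by (simp add: quarter_def)

lemma quarter_le: "cmod c = 1 ==> quarter c w <= cmod w"
 using complex_Re_le_cmod[of "c * w"] by (simp add: quarter_def norm_mult)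

definition fourth_roots :: "complex set" where "fourth_roots = {1, -1, \<i>, -\<i>}"

lemma quarter_decomp: "w = (\<Sum>c\<in>fourth_roots. cnj c * of_real (quarter c w))"
 by (simp add: fourth_roots_def complex_eq_iff quarter_def max_def)

lemma quarter_measurable [measurable (raw)]:
 assumes [measurable]: "f : BM M" shows "(%z. quarter c (f z)) : BM M"
 unfolding quarter_def by measurable

lemma cmod_quarter_index: "c : fourth_roots ==> cmod c = 1" by (auto simp: fourth_roots_def)

lemma integral_sum_cmult:
 fixes h :: "'i => 'a => complex"
 assumes "!!c. c : C ==> integrable M (h c)"
 shows "(LINT z|M. (\<Sum>c\<in>C. k c * h c z)) = (\<Sum>c\<in>C. k c * (LINT z|M. h c z))"
 using assms by (subst B_integral_sum) auto

text \<open>The conditional expectation is assembled from the densities Q of the four nonnegative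
  parts. They are exported too, because the identities of the joint measure hold for nonnegative
  functions.\<close>

lemma L2_pushdown:
 assumes Z: "prob_space Z" and Y: "prob_space Y" and \<pi> [measurable]: "\<pi> : Z \<rightarrow>\<^sub>M Y" and d: "distr Z Y \<pi> = Y"
  and u: "u : L2 Z"
 obtains Q where "!!c. c : fourth_roots ==> Q c : BM Y" "!!c y. c : fourth_roots ==> 0 <= Q c y"
  "!!c. c : fourth_roots ==> integrable Y (%y. (Q c y)\<^sup>2)"
  "!!c B. c : fourth_roots ==> B : sets Y ==>
   (nnint Z (%z. ennreal (quarter c (u z)) * ind B (\<pi> z))) = (nnint Y (%y. ennreal (Q c y) * ind B y))"
  "(%y. \<Sum>c\<in>fourth_roots. cnj c * of_real (Q c y)) : L2 Y"
  "!!B. B : sets Y ==> (LINT y|Y. ind B y *\<^sub>R (\<Sum>c\<in>fourth_roots. cnj c * of_real (Q c y))) = (LINT z|Z. ind B (\<pi> z) *\<^sub>R u z)"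
proof -
 note um [measurable] = L2_measurable[OF u]
 have uq: "integrable Z (%z. (quarter c (u z))\<^sup>2)" if "c : fourth_roots" for c
 proof (rule B_integrable_bound[OF L2_integrable_sq[OF u]])
  show "AE z in Z. norm ((quarter c (u z))\<^sup>2) <= norm ((cmod (u z))\<^sup>2)"
   using quarter_le[OF cmod_quarter_index[OF that]] quarter_nonneg by (auto intro!: power_mono)
 qed measurable
 have ex: "\<forall>c\<in>fourth_roots. \<exists>m. m : BM Y \<and> (\<forall>y. 0 <= m y) \<and> integrable Y (%y. (m y)\<^sup>2) \<and>
  (\<forall>B\<in>sets Y. (nnint Z (%z. ennreal (quarter c (u z)) * ind B (\<pi> z))) = (nnint Y (%y. ennreal (m y) * ind B y)))"
  by (rule ballI, rule nonneg_pushdown[OF Z Y \<pi> d _ quarter_nonneg uq]) auto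
 from bchoice[OF ex]
 obtain Q where "\<forall>c\<in>fourth_roots. Q c : BM Y \<and> (\<forall>y. 0 <= Q c y) \<and> integrable Y (%y. (Q c y)\<^sup>2) \<and>
  (\<forall>B\<in>sets Y. (nnint Z (%z. ennreal (quarter c (u z)) * ind B (\<pi> z))) = (nnint Y (%y. ennreal (Q c y) * ind B y)))"
  by (elim exE) (rule that)
 then have Q: "!!c. c : fourth_roots ==> Q c : BM Y" "!!c y. c : fourth_roots ==> 0 <= Q c y"
  "!!c. c : fourth_roots ==> integrable Y (%y. (Q c y)\<^sup>2)"
  "!!c B. c : fourth_roots ==> B : sets Y ==>
   (nnint Z (%z. ennreal (quarter c (u z)) * ind B (\<pi> z))) = (nnint Y (%y. ennreal (Q c y) * ind B y))"
  by simp_all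
 have QL: "(%y. of_real (Q c y)) : L2 Y" if "c : fourth_roots" for c
  using Q(1,3)[OF that] by (auto simp: L2_def)
 have uL: "(%z. of_real (quarter c (u z))) : L2 Z" if "c : fourth_roots" for c
  using uq[OF that] by (auto simp: L2_def)
 have eq: "(LINT y|Y. ind B y *\<^sub>R complex_of_real (Q c y)) = (LINT z|Z. ind B (\<pi> z) *\<^sub>R complex_of_real (quarter c (u z)))"
  if B [measurable]: "B : sets Y" and c: "c : fourth_roots" for B c
 proof -
  note Q(1)[OF c, measurable]
  have "(LINT y|Y. Q c y * ind B y) = enn2real (nnint Y (%y. ennreal (Q c y) * ind B y))"
   using Q(2)[OF c] by (subst integral_eq_nn_integral) (auto simp: ennreal_mult ennreal_indicator)
  also have "... = enn2real (nnint Z (%z. ennreal (quarter c (u z)) * ind B (\<pi> z)))" by (simp only: Q(4)[OF c B])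
  also have "... = (LINT z|Z. quarter c (u z) * ind B (\<pi> z))"
   using quarter_nonneg by (subst integral_eq_nn_integral) (auto simp: ennreal_mult ennreal_indicator)
  finally have "complex_of_real (LINT y|Y. Q c y * ind B y) = complex_of_real (LINT z|Z. quarter c (u z) * ind B (\<pi> z))" by simp
  moreover have "(%y. ind B y *\<^sub>R complex_of_real (Q c y)) = (%y. complex_of_real (Q c y * ind B y))"
   "(%z. ind B (\<pi> z) *\<^sub>R complex_of_real (quarter c (u z))) = (%z. complex_of_real (quarter c (u z) * ind B (\<pi> z)))"
   by (auto simp: fun_eq_iff indicator_def)
  ultimately show ?thesis by (simp only: integral_complex_of_real)
 qed
 show thesis
 proof (rule that[OF Q])
  show "(%y. \<Sum>c\<in>fourth_roots. cnj c * of_real (Q c y)) : L2 Y" by (intro L2_sum L2_cmult QL)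
  fix B assume B [measurable]: "B : sets Y"
  have iB: "integrable M (%x. ind B (f x) *\<^sub>R h x)" if "integrable M h" "f : M \<rightarrow>\<^sub>M Y" for M f and h :: "_ => complex"
  proof -
   have "integrable M (%x. ind (f -` B \<inter> space M) x *\<^sub>R h x)"
    using that by (intro integrable_mult_indicator) auto
   then show ?thesis by (rule B_integrable_cong[THEN iffD1, rotated 2]) (auto simp: indicator_def)
  qed
  have "(LINT y|Y. ind B y *\<^sub>R (\<Sum>c\<in>fourth_roots. cnj c * of_real (Q c y))) = (LINT y|Y. (\<Sum>c\<in>fourth_roots. cnj c * (ind B y *\<^sub>R of_real (Q c y))))"
   by (simp only: scaleR_sum_right mult_scaleR_right)
  also have "... = (\<Sum>c\<in>fourth_roots. cnj c * (LINT y|Y. ind B y *\<^sub>R of_real (Q c y)))"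
   by (rule integral_sum_cmult, rule iB[OF L2_integrable[OF Y QL]]) auto
  also have "... = (\<Sum>c\<in>fourth_roots. cnj c * (LINT z|Z. ind B (\<pi> z) *\<^sub>R of_real (quarter c (u z))))"
   by (intro sum.cong refl) (simp only: eq[OF B])
  also have "... = (LINT z|Z. (\<Sum>c\<in>fourth_roots. cnj c * (ind B (\<pi> z) *\<^sub>R of_real (quarter c (u z)))))"
   by (rule integral_sum_cmult[symmetric], rule iB[OF L2_integrable[OF Z uL] \<pi>])
  also have "... = (LINT z|Z. ind B (\<pi> z) *\<^sub>R (\<Sum>c\<in>fourth_roots. cnj c * of_real (quarter c (u z))))"
   by (simp only: scaleR_sum_right mult_scaleR_right)
  finally show "(LINT y|Y. ind B y *\<^sub>R (\<Sum>c\<in>fourth_roots. cnj c * of_real (Q c y))) = (LINT z|Z. ind B (\<pi> z) *\<^sub>R u z)"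
   by (simp only: quarter_decomp[symmetric])
 qed
qed

section \<open>Matrix elements of polymorphisms and of their products\<close>

text \<open>The Mellin transform of p over A x B on the line Re = 1/2. Its real and imaginary parts
  are the tests of \<open>Pol_eqI_char\<close> with weight sqrt t.\<close>

definition pol_char :: "'x set => 'y set => real => ('x \<times> 'y \<times> real) measure => complex" where
 "pol_char A B th p = (LINT z|p. ind A (fst z) *\<^sub>R (ind B (mid z) * half_char th (thd z)))"

lemma pol_char_integrable:
 assumes X: "prob_space X" and Y: "prob_space Y" and p: "p : Pol X Y" and [measurable]: "A : sets X" "B : sets Y"
 shows "integrable p (%z. ind A (fst z) *\<^sub>R (ind B (mid z) * half_char th (thd z)))"
proof (rule B_integrable_bound)
 note sets_Pol[OF p, measurable_cong]
 interpret prob_space p by (rule Pol_prob_space[OF p X])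
 show "integrable p (%z. 1 + thd z)" using Pol_integrable_t[OF p Y] by simp
 show "(%z. ind A (fst z) *\<^sub>R (ind B (mid z) * half_char th (thd z))) : BM p" by measurable
 show "AE z in p. norm (ind A (fst z) *\<^sub>R (ind B (mid z) * half_char th (thd z))) <= norm (1 + thd z)"
  using Pol_AE_pos[OF p] by eventually_elim (auto simp: norm_mult indicator_def intro: sqrt_le_1_plus)
qed

lemma Pol_eqI_pol_char:
 assumes X: "prob_space X" and Y: "prob_space Y" and p: "p : Pol X Y" and p': "p' : Pol X Y"
  and eq: "!!A B th. A : sets X ==> B : sets Y ==> pol_char A B th p = pol_char A B th p'"
 shows "p = p'"
proof (rule Pol_eqI_char[OF X Y p p', of sqrt])
 fix A B th assume AB: "A : sets X" "B : sets Y"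
 have "pol_test A B (%t. sqrt t * cos (th * ln t)) r = Re (pol_char A B th r)" if "r : Pol X Y" for r
  unfolding pol_test_def pol_char_def integral_Re[OF pol_char_integrable[OF X Y that AB], symmetric]
  by (rule B_integral_cong) (auto simp: Re_half_char indicator_def)
 then show "pol_test A B (%t. sqrt t * cos (th * ln t)) p = pol_test A B (%t. sqrt t * cos (th * ln t)) p'"
  using p p' eq[OF AB] by simp
 have "pol_test A B (%t. sqrt t * sin (th * ln t)) r = Im (pol_char A B th r)" if "r : Pol X Y" for r
  unfolding pol_test_def pol_char_def integral_Im[OF pol_char_integrable[OF X Y that AB], symmetric]
  by (rule B_integral_cong) (auto simp: Im_half_char indicator_def)
 then show "pol_test A B (%t. sqrt t * sin (th * ln t)) p = pol_test A B (%t. sqrt t * sin (th * ln t)) p'"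
  using p p' eq[OF AB] by simp
qed (auto intro: sqrt_le_1_plus continuous_intros)

text \<open>The reason for multiplicativity: m is the conditional expectation given y of the part of
  the integrand that belongs to q. Since \<open>half_char\<close> is multiplicative and the factors
  are independent given y, the product p q acts on the indicator of D as p acts on m.\<close>

lemma joint_pol_char:
 fixes X :: "'x measure" and Y :: "'y measure" and W :: "'w measure"
 assumes X: "prob_space X" and Y: "prob_space Y" and W: "prob_space W" and p: "p : Pol X Y" and q: "q : Pol Y W" and R: "is_joint X Y W p q R"
  and A [measurable]: "A : sets X" and D [measurable]: "D : sets W"
 obtains m where "m : L2 Y" "!!B. B : sets Y ==> (LINT y|Y. ind B y *\<^sub>R m y) = pol_char B D th q"
  "pol_char A D th (joint_push X W R) = (LINT z|p. ind A (fst z) *\<^sub>R (m (mid z) * half_char th (thd z)))"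
proof -
 note sp [measurable_cong] = sets_Pol[OF p] and sq [measurable_cong] = sets_Pol[OF q] and sR [measurable_cong] = sets_joint[OF R]
 interpret p: prob_space p by (rule Pol_prob_space[OF p X])
 have q': "prob_space q" by (rule Pol_prob_space[OF q Y])
 define H :: "'w \<times> real => complex" where "H v = ind D (fst v) * half_char th (snd v)" for v
 have Hm [measurable]: "H : BM (W >< rpos)" unfolding H_def by measurable
 have Hle: "cmod (H v) <= sqrt (snd v)" if "0 < snd v" for v using that by (simp add: H_def norm_mult indicator_def)
 have HL: "(%z. H (snd z)) : L2 q"
 proof (rule L2_dominated[OF _ Pol_integrable_t[OF q W]])
  show "AE z in q. (cmod (H (snd z)))\<^sup>2 <= thd z" using Pol_AE_pos[OF q]
  proof eventually_elim
   case (elim z)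
   then have "(cmod (H (snd z)))\<^sup>2 <= (sqrt (thd z))\<^sup>2" by (intro power_mono Hle) auto
   then show ?case using elim by simp
  qed
 qed measurable
 have fq: "fst : q \<rightarrow>\<^sub>M Y" by measurable
 obtain Q where Q: "!!c. c : fourth_roots ==> Q c : BM Y" "!!c y. c : fourth_roots ==> 0 <= Q c y"
  "!!c. c : fourth_roots ==> integrable Y (%y. (Q c y)\<^sup>2)"
  "!!c B. c : fourth_roots ==> B : sets Y ==>
   (nnint q (%z. ennreal (quarter c (H (snd z))) * ind B (fst z))) = (nnint Y (%y. ennreal (Q c y) * ind B y))"
  "(%y. \<Sum>c\<in>fourth_roots. cnj c * of_real (Q c y)) : L2 Y"
  "!!B. B : sets Y ==> (LINT y|Y. ind B y *\<^sub>R (\<Sum>c\<in>fourth_roots. cnj c * of_real (Q c y))) = (LINT z|q. ind B (fst z) *\<^sub>R H (snd z))"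
  by (rule L2_pushdown[OF q' Y fq distr_Pol_fst[OF q] HL], rule that)
 define f :: "'x \<times> 'y \<times> real => complex" where "f z = ind A (fst z) *\<^sub>R half_char th (thd z)" for z
 have fm [measurable]: "f : BM (X >< (Y >< rpos))" unfolding f_def by measurable
 have fle: "cmod (f z) <= sqrt (thd z)" if "0 < thd z" for z using that by (simp add: f_def indicator_def)
 \<comment> \<open>The integrand is bounded by sqrt (t s) <= 1 + t s, and t s is the multiplier of
   the product polymorphism, which is integrable.\<close>
 have Rint: "integrable R (%e. quarter c (H (snd e)) *\<^sub>R f (fst e))" if c: "c : fourth_roots" for c
 proof (rule B_integrable_bound)
  interpret R: prob_space R by (rule prob_space_joint[OF X Y p q R])
  have "integrable (joint_push X W R) (%z. thd z)" by (rule Pol_integrable_t[OF joint_push_Pol[OF X Y p q R] W])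
  then show "integrable R (%e. 1 + thd (fst e) * thd e)"
   unfolding joint_push_def by (subst (asm) integrable_distr_eq) simp_all
  show "AE e in R. norm (quarter c (H (snd e)) *\<^sub>R f (fst e)) <= norm (1 + thd (fst e) * thd e)"
  proof (rule AE_I2)
   fix e assume "e : space R"
   then have pos: "0 < thd (fst e)" "0 < thd e" by (auto simp: space_joint[OF R])
   have "norm (quarter c (H (snd e)) *\<^sub>R f (fst e)) <= sqrt (thd e) * sqrt (thd (fst e))"
    using pos quarter_nonneg order.trans[OF quarter_le[OF cmod_quarter_index[OF c]] Hle[OF pos(2)]] fle[OF pos(1)]
    by (auto intro!: mult_mono)
   also have "... <= 1 + thd (fst e) * thd e"
    using sqrt_le_1_plus[of "thd (fst e) * thd e"] pos by (simp add: real_sqrt_mult mult.commute)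
   finally show "norm (quarter c (H (snd e)) *\<^sub>R f (fst e)) <= norm (1 + thd (fst e) * thd e)" using pos by simp
  qed
 qed measurable
 \<comment> \<open>Here square integrability of Q enters: Q sqrt t <= 1 + t Q^2, and t p projects
   onto Y.\<close>
 have pint: "integrable p (%z. Q c (mid z) *\<^sub>R f z)" if c: "c : fourth_roots" for c
 proof (rule B_integrable_bound)
  note Q(1)[OF c, measurable]
  have "(nnint p (%z. ennreal (thd z) * ennreal ((Q c (mid z))\<^sup>2))) = (nnint Y (%y. ennreal ((Q c y)\<^sup>2)))"
   using Pol_nn_integral_snd[OF p, of "%y. ennreal ((Q c y)\<^sup>2)"] by simp
  also have "... < \<infinity>" using Q(3)[OF c] by (simp add: nn_integral_eq_integral)
  finally have "(nnint p (%z. ennreal (thd z * (Q c (mid z))\<^sup>2))) < \<infinity>" by (simp add: ennreal_mult'')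
  then have "integrable p (%z. thd z * (Q c (mid z))\<^sup>2)"
   by (intro integrableI_nonneg) (auto simp: space_Pol[OF p])
  then show "integrable p (%z. 1 + thd z * (Q c (mid z))\<^sup>2)" by simp
  show "AE z in p. norm (Q c (mid z) *\<^sub>R f z) <= norm (1 + thd z * (Q c (mid z))\<^sup>2)"
   using Pol_AE_pos[OF p]
  proof eventually_elim
   case (elim z)
   let ?y = "Q c (mid z)" and ?t = "thd z"
   have "norm (?y *\<^sub>R f z) <= ?y * sqrt ?t" using Q(2)[OF c] fle[OF elim] by (simp add: mult_left_mono)
   also have "... = sqrt (?y\<^sup>2 * ?t)" using Q(2)[OF c] by (simp add: real_sqrt_mult)
   also have "... <= 1 + ?t * ?y\<^sup>2" using sqrt_le_1_plus[of "?y\<^sup>2 * ?t"] elim by (simp add: mult.commute)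
   finally show ?case using elim by simp
  qed
 qed (use Q(1)[OF c] in measurable)
 have eq: "(LINT e|R. quarter c (H (snd e)) *\<^sub>R f (fst e)) = (LINT z|p. Q c (mid z) *\<^sub>R f z)" if c: "c : fourth_roots" for c
  by (rule joint_integral_fst[OF X Y p q R _ Q(1)[OF c] quarter_nonneg Q(2)[OF c] Q(4)[OF c] fm]) measurable
 show thesis
 proof (rule that[OF Q(5)])
  show "(LINT y|Y. ind B y *\<^sub>R (\<Sum>c\<in>fourth_roots. cnj c * of_real (Q c y))) = pol_char B D th q" if "B : sets Y" for B
   unfolding Q(6)[OF that] by (simp add: pol_char_def H_def)
  have "pol_char A D th (joint_push X W R) = (LINT e|R. H (snd e) * f (fst e))"
   unfolding pol_char_def joint_push_def
  proof (subst integral_distr)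
   show "(LINT e|R. ind A (fst (fst (fst e), mid e, thd (fst e) * thd e)) *\<^sub>R
    (ind D (fst (snd (fst (fst e), mid e, thd (fst e) * thd e))) *
    half_char th (snd (snd (fst (fst e), mid e, thd (fst e) * thd e))))) = (LINT e|R. H (snd e) * f (fst e))"
    by (rule B_integral_cong)
    (auto simp: H_def f_def space_joint[OF R] half_char_mult indicator_def)
  qed measurable
  also have "... = (LINT e|R. (\<Sum>c\<in>fourth_roots. cnj c * (quarter c (H (snd e)) *\<^sub>R f (fst e))))"
  proof (rule B_integral_cong[OF refl])
   fix e
   have "H (snd e) * f (fst e) = (\<Sum>c\<in>fourth_roots. cnj c * of_real (quarter c (H (snd e)))) * f (fst e)" by (simp only: quarter_decomp[symmetric])
   then show "H (snd e) * f (fst e) = (\<Sum>c\<in>fourth_roots. cnj c * (quarter c (H (snd e)) *\<^sub>R f (fst e)))"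
    by (simp add: sum_distrib_right scaleR_conv_of_real mult.assoc)
  qed
  also have "... = (\<Sum>c\<in>fourth_roots. cnj c * (LINT e|R. quarter c (H (snd e)) *\<^sub>R f (fst e)))"
   by (rule integral_sum_cmult[OF Rint])
  also have "... = (\<Sum>c\<in>fourth_roots. cnj c * (LINT z|p. Q c (mid z) *\<^sub>R f z))"
   by (intro sum.cong refl) (simp only: eq)
  also have "... = (LINT z|p. (\<Sum>c\<in>fourth_roots. cnj c * (Q c (mid z) *\<^sub>R f z)))"
   by (rule integral_sum_cmult[OF pint, symmetric])
  also have "... = (LINT z|p. ind A (fst z) *\<^sub>R ((\<Sum>c\<in>fourth_roots. cnj c * of_real (Q c (mid z))) * half_char th (thd z)))"
   by (rule B_integral_cong[OF refl])
    (simp add: f_def sum_distrib_right scaleR_conv_of_real scaleR_sum_right mult_ac sum_distrib_left)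
  finally show "pol_char A D th (joint_push X W R) = ..." .
 qed
qed

section \<open>Fixed vectors of a subgroup and the projection onto them\<close>

text \<open>Only the sets where Re (c k) > 0 are tested, as these will be known to be invariant. The
  values 1, -1, i and -i of c together force k = 0.\<close>

lemma integrable_eq_0_AE:
 fixes k :: "'a => complex"
 assumes k: "integrable M k" and 0: "!!c D. D = {z : space M. 0 < Re (c * k z)} ==> (LINT z|M. ind D z *\<^sub>R k z) = 0"
 shows "AE z in M. k z = 0"
proof -
 have neg: "AE z in M. \<not> 0 < Re (c * k z)" for c
 proof -
  define D where "D = {z : space M. 0 < Re (c * k z)}"
  have km [measurable]: "k : BM M" using k by simp
  have D [measurable]: "D : sets M" unfolding D_def by measurable
  have int: "integrable M (%z. c * (ind D z *\<^sub>R k z))"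
   by (rule integrable_mult_right) (rule integrable_mult_indicator[OF D k])
  have "(LINT z|M. Re (c * (ind D z *\<^sub>R k z))) = Re (c * (LINT z|M. ind D z *\<^sub>R k z))"
   by (subst integral_Re[OF int]) (simp only: integral_mult_right_zero)
  also have "... = 0" by (simp only: 0[OF D_def]) simp
  finally have I: "(LINT z|M. Re (c * (ind D z *\<^sub>R k z))) = 0" .
  have nn: "0 <= Re (c * (ind D z *\<^sub>R k z))" for z
   by (cases "z : D") (simp_all add: D_def del: times_complex.sel)
  have "AE z in M. Re (c * (ind D z *\<^sub>R k z)) = 0"
   using I by (subst (asm) integral_nonneg_eq_0_iff_AE[OF integrable_Re[OF int]]) (use nn in auto)
  then show ?thesis using AE_space by eventually_elim (auto simp: D_def indicator_def split: if_splits)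
 qed
 from neg[of 1] neg[of "-1"] neg[of \<i>] neg[of "-\<i>"] show ?thesis
  by eventually_elim (simp add: complex_eq_iff)
qed

context
 fixes Z :: "'z measure" and B and G :: "('g, 'm) monoid_scheme" and T and \<sigma> :: "'g => 'z => 'z"
  and L :: "'g set" and Y :: "'y measure" and \<pi> :: "'z => 'y" and th :: real
 assumes Z: "prob_space Z" and B: "separating Z B" and G: "topological_group G T" and act: "nonsingular_action G T Z \<sigma>"
  and one: "measure_preserving_transf Z (\<sigma> \<one>\<^bsub>G\<^esub>)"
  and LG: "L \<subseteq> carrier G" and mp: "!!h. h : L ==> measure_preserving_transf Z (\<sigma> h)"
  and quot: "is_quotient Z (invariant_sets Z \<sigma> L) Y \<pi>"
begin

private lemma Yp: "prob_space Y" using quot by (simp add: is_quotient_def lebesgue_prob_spaceD)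
private lemma pim [measurable]: "\<pi> : Z \<rightarrow>\<^sub>M Y" using quot by (simp add: is_quotient_def)
private lemma pid: "distr Z Y \<pi> = Y" using quot by (simp add: is_quotient_def)
private lemma quotD: "A : sets Z ==> A : invariant_sets Z \<sigma> L \<longleftrightarrow> (\<exists>B\<in>sets Y. sym_diff A (\<pi> -` B \<inter> space Z) : null_sets Z)"
 using quot unfolding is_quotient_def by (elim conjE) (erule bspec)
private lemma ns: "h : L ==> nonsingular Z (\<sigma> h)" using action_ns[OF Z B G act one] LG by auto

lemma L2_pullback: "m : L2 Y ==> (%z. m (\<pi> z)) : L2 Z"
 and L2_sq_pullback: "m : L2 Y ==> L2_sq Z (%z. m (\<pi> z)) = L2_sq Y m"
proof -
 assume m: "m : L2 Y"
 note L2_measurable[OF m, measurable]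
 have "integrable (distr Z Y \<pi>) (%y. (cmod (m y))\<^sup>2)" using L2_integrable_sq[OF m] by (simp add: pid)
 then show "(%z. m (\<pi> z)) : L2 Z" unfolding L2_def by (subst (asm) integrable_distr_eq) auto
 have "L2_sq Y m = (LINT y|(distr Z Y \<pi>). (cmod (m y))\<^sup>2)" by (simp add: pid L2_sq_def)
 also have "... = L2_sq Z (%z. m (\<pi> z))" unfolding L2_sq_def by (rule integral_distr) measurable
 finally show "L2_sq Z (%z. m (\<pi> z)) = L2_sq Y m" ..
qed

lemma integral_pullback:
 assumes [measurable]: "D : sets Y" "m : BM Y"
 shows "(LINT z|Z. ind D (\<pi> z) *\<^sub>R (m (\<pi> z) :: complex)) = (LINT y|Y. ind D y *\<^sub>R m y)"
proof -
 have "(LINT y|(distr Z Y \<pi>). ind D y *\<^sub>R m y) = (LINT z|Z. ind D (\<pi> z) *\<^sub>R m (\<pi> z))"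
  by (rule integral_distr) measurable
 then show ?thesis by (simp add: pid)
qed

lemma koopman_measure_preserving: "h : L ==> AE z in Z. koopman Z th (\<sigma> h) f z = f (\<sigma> h z)"
 using measure_preserving_ns_deriv[OF Z ns mp, of h] by (auto elim!: AE_mp simp: koopman_def)

text \<open>Invariance of sets is defined by images. Applying the injective map \<sigma>(h), which
  respects null sets, turns it into a statement about points.\<close>

lemma pullback_set_invariant:
 assumes h: "h : L" and D: "D : sets Y"
 shows "AE z in Z. \<pi> (\<sigma> h z) : D \<longleftrightarrow> \<pi> z : D"
proof -
 let ?A = "\<pi> -` D \<inter> space Z"
 have A: "?A : sets Z" using D by measurable
 have "sym_diff ?A (\<pi> -` D \<inter> space Z) : null_sets Z" by simp
 then have "?A : invariant_sets Z \<sigma> L" using quotD[OF A] D by blast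
 then have N: "sym_diff ?A (\<sigma> h ` ?A) : null_sets Z" using h by (simp add: invariant_sets_def)
 have "AE z in Z. z : ?A \<longleftrightarrow> z : \<sigma> h ` ?A" by (rule AE_I'[OF N]) auto
 from nonsingular_AE[OF Z ns[OF h] this] AE_space show ?thesis
 proof eventually_elim
  case (elim z)
  have "\<sigma> h z : \<sigma> h ` ?A \<longleftrightarrow> z : ?A"
   using nonsingular_vimage_image[OF Z ns[OF h], of ?A] elim(2) by blast
  then show ?case using elim nonsingular_space[OF Z ns[OF h] elim(2)] by auto
 qed
qed

text \<open>Rational levels determine a real number, and they involve only countably many
  exceptional null sets.\<close>

lemma pullback_real_invariant:
 fixes k :: "'y => real"
 assumes h: "h : L" and [measurable]: "k : BM Y"
 shows "AE z in Z. k (\<pi> (\<sigma> h z)) = k (\<pi> z)"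
proof -
 have "AE z in Z. \<forall>q :: rat. \<pi> (\<sigma> h z) : {y : space Y. k y < of_rat q} \<longleftrightarrow> \<pi> z : {y : space Y. k y < of_rat q}"
  by (subst AE_all_countable, intro allI pullback_set_invariant h) measurable
 then show ?thesis using AE_space
 proof eventually_elim
  case (elim z)
  have "\<pi> z : space Y" "\<pi> (\<sigma> h z) : space Y"
   using measurable_space[OF pim] elim(2) nonsingular_space[OF Z ns[OF h] elim(2)] by auto
  with elim(1) have q: "k (\<pi> (\<sigma> h z)) < of_rat q \<longleftrightarrow> k (\<pi> z) < of_rat q" for q by auto
  show ?case
  proof (rule ccontr)
   assume "k (\<pi> (\<sigma> h z)) ~= k (\<pi> z)"
   then consider "k (\<pi> (\<sigma> h z)) < k (\<pi> z)" | "k (\<pi> z) < k (\<pi> (\<sigma> h z))" by linarith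
   then show False
   proof cases
    case 1 then obtain r where "k (\<pi> (\<sigma> h z)) < of_rat r" "of_rat r < k (\<pi> z)" using of_rat_dense by blast
    then show False using q[of r] by simp
   next
    case 2 then obtain r where "k (\<pi> z) < of_rat r" "of_rat r < k (\<pi> (\<sigma> h z))" using of_rat_dense by blast
    then show False using q[of r] by simp
   qed
  qed
 qed
qed

lemma pullback_invariant:
 fixes m :: "'y => complex"
 assumes h: "h : L" and [measurable]: "m : BM Y"
 shows "AE z in Z. m (\<pi> (\<sigma> h z)) = m (\<pi> z)"
proof -
 have "AE z in Z. Re (m (\<pi> (\<sigma> h z))) = Re (m (\<pi> z))" by (rule pullback_real_invariant[OF h, of "%y. Re (m y)"]) measurable
 moreover have "AE z in Z. Im (m (\<pi> (\<sigma> h z))) = Im (m (\<pi> z))" by (rule pullback_real_invariant[OF h, of "%y. Im (m y)"]) measurable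
 ultimately show ?thesis by eventually_elim (simp add: complex_eq_iff)
qed

lemma L2_pushdown_exists:
 assumes u: "u : L2 Z"
 obtains m where "m : L2 Y" "!!D. D : sets Y ==> (LINT y|Y. ind D y *\<^sub>R m y) = (LINT z|Z. ind D (\<pi> z) *\<^sub>R u z)"
 by (rule L2_pushdown[OF Z Yp pim pid u]) (rule that)

text \<open>The difference of an invariant function and its pushdown has zero integral over every pullback,
 hence over every invariant set, in particular over the sets where it is positive.\<close>

lemma invariant_is_pullback:
 assumes f: "f : L2 Z" and inv: "!!h. h : L ==> AE z in Z. f (\<sigma> h z) = f z"
 obtains m where "m : L2 Y" "AE z in Z. f z = m (\<pi> z)"
proof -
 obtain m where m: "m : L2 Y" and mD: "!!D. D : sets Y ==> (LINT y|Y. ind D y *\<^sub>R m y) = (LINT z|Z. ind D (\<pi> z) *\<^sub>R f z)"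
  by (rule L2_pushdown_exists[OF f], rule that)
 note [measurable] = L2_measurable[OF m] L2_measurable[OF f]
 define k where "k z = f z - m (\<pi> z)" for z
 have k: "k : L2 Z" unfolding k_def by (rule L2_diff[OF f L2_pullback[OF m]])
 have km [measurable]: "k : BM Z" by (rule L2_measurable[OF k])
 have ind: "integrable Z (%z. ind D (\<pi> z) *\<^sub>R h z)" if "h : L2 Z" "D : sets Y" for h D
 proof -
  have "integrable Z (%z. ind (\<pi> -` D \<inter> space Z) z *\<^sub>R h z)"
   by (rule integrable_mult_indicator[OF measurable_sets[OF pim that(2)] L2_integrable[OF Z that(1)]])
  then show ?thesis by (rule B_integrable_cong[THEN iffD1, rotated 2]) (auto simp: indicator_def)
 qed
 have 0: "(LINT z|Z. ind D (\<pi> z) *\<^sub>R k z) = 0" if D: "D : sets Y" for D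
  unfolding k_def scaleR_diff_right
  by (subst B_integral_diff[OF ind[OF f D] ind[OF L2_pullback[OF m] D]])
   (simp add: integral_pullback[OF D] mD[OF D])
 have "AE z in Z. k z = 0"
 proof (rule integrable_eq_0_AE[OF L2_integrable[OF Z k]])
  fix c D assume D: "D = {z : space Z. 0 < Re (c * k z)}"
  have Ds [measurable]: "D : sets Z" unfolding D by measurable
  \<comment> \<open>k is invariant outside a null set N, so membership in D can change only over N.
    Points of the symmetric difference therefore lie in the image of N, which is null.\<close>
  have "sym_diff D (\<sigma> h ` D) : null_sets Z" if h: "h : L" for h
  proof -
   have "AE z in Z. \<sigma> h z : D \<longleftrightarrow> z : D"
    using inv[OF h] pullback_invariant[OF h L2_measurable[OF m]] AE_space
    by eventually_elim (use nonsingular_space[OF Z ns[OF h]] in \<open>simp add: D k_def\<close>)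
   then obtain N where N: "N : null_sets Z" "{z : space Z. \<not> (\<sigma> h z : D \<longleftrightarrow> z : D)} \<subseteq> N"
    by (auto simp: eventually_ae_filter)
   have Dsub: "D \<subseteq> space Z" by (auto simp: D)
   have nN: "\<sigma> h ` N : null_sets Z"
    using N(1) sets.sets_into_space[of N Z] by (subst nonsingular_image_null[OF Z ns[OF h]]) auto
   have sub: "sym_diff D (\<sigma> h ` D) \<subseteq> \<sigma> h ` N"
   proof
    fix w assume w: "w : sym_diff D (\<sigma> h ` D)"
    then have "w : space Z" using Dsub nonsingular_space[OF Z ns[OF h]] by auto
    then obtain z where z: "z : space Z" "w = \<sigma> h z"
    using nonsingular_bij[OF Z ns[OF h]] by (auto simp: bij_betw_def)
    have "\<sigma> h z : \<sigma> h ` D \<longleftrightarrow> z : D" using nonsingular_vimage_image[OF Z ns[OF h] Dsub] z(1) by blast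
    with w z N(2) show "w : \<sigma> h ` N" by auto
   qed
   have "\<sigma> h ` D : sets Z" using nonsingular_image_sets[OF Z ns[OF h] Dsub] Ds by simp
   then show ?thesis using Ds by (intro null_sets_subset[OF nN _ sub] sets.Un sets.Diff)
  qed
  then have "D : invariant_sets Z \<sigma> L" using Ds by (simp add: invariant_sets_def)
  then obtain E where E [measurable]: "E : sets Y" and N: "sym_diff D (\<pi> -` E \<inter> space Z) : null_sets Z"
   using quotD[OF Ds] by blast
  have "AE z in Z. z : D \<longleftrightarrow> z : \<pi> -` E \<inter> space Z" by (rule AE_I'[OF N]) auto
  then have "AE z in Z. ind D z *\<^sub>R k z = ind E (\<pi> z) *\<^sub>R k z"
   using AE_space by eventually_elim (auto simp: indicator_def)
  then have "(LINT z|Z. ind D z *\<^sub>R k z) = (LINT z|Z. ind E (\<pi> z) *\<^sub>R k z)"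
   by (intro integral_cong_AE) measurable
  then show "(LINT z|Z. ind D z *\<^sub>R k z) = 0" by (simp only: 0[OF E])
 qed
 then have "AE z in Z. f z = m (\<pi> z)" by eventually_elim (simp add: k_def)
 with m show thesis by (rule that)
qed

abbreviation (input) "HH \<equiv> L2_hilbert Z B"
abbreviation (input) "FF \<equiv> fixed_vectors (L2_hilbert Z B) (koopman_rep Z B \<sigma> th) L"

text \<open>The transformations of L preserve the measure, so their derivative is 1 and the twist by
  th disappears: fixed vectors are the invariant functions.\<close>

lemma fixed_vectors_eq: "FF = (%m. L2_coef Z B (%z. m (\<pi> z))) ` L2 Y"
proof (intro equalityI subsetI)
 fix v assume v: "v : FF"
 then obtain f where f: "f : L2 Z" "v = L2_coef Z B f" by (auto simp: fixed_vectors_def L2_hilbert_carrier[OF Z B])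
 have inv: "AE z in Z. f (\<sigma> h z) = f z" if h: "h : L" for h
 proof -
  have hG: "h : carrier G" using h LG by auto
  have "L2_coef Z B (koopman Z th (\<sigma> h) f) = L2_coef Z B f"
   using v f h by (simp add: fixed_vectors_def koopman_rep_coef[OF Z B G act one hG, symmetric])
  then have "AE z in Z. koopman Z th (\<sigma> h) f z = f z"
   using L2_coef_eq_iff[OF Z B koopman_L2[OF Z ns[OF h]] f(1)] f(1) by simp
  with koopman_measure_preserving[OF h, of f] show ?thesis by eventually_elim simp
 qed
 obtain m where m: "m : L2 Y" "AE z in Z. f z = m (\<pi> z)" by (rule invariant_is_pullback[OF f(1) inv], assumption, rule that)
 then have "v = L2_coef Z B (%z. m (\<pi> z))"
  using f by (simp add: L2_coef_eq_iff[OF Z B f(1) L2_pullback])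
 with m show "v : (%m. L2_coef Z B (%z. m (\<pi> z))) ` L2 Y" by blast
next
 fix v assume "v : (%m. L2_coef Z B (%z. m (\<pi> z))) ` L2 Y"
 then obtain m where m: "m : L2 Y" "v = L2_coef Z B (%z. m (\<pi> z))" by auto
 note mL = L2_pullback[OF m(1)]
 have "koopman_rep Z B \<sigma> th h v = v" if h: "h : L" for h
 proof -
  have hG: "h : carrier G" using h LG by auto
  have "AE z in Z. koopman Z th (\<sigma> h) (%z. m (\<pi> z)) z = m (\<pi> z)"
   using koopman_measure_preserving[OF h, of "%z. m (\<pi> z)"] pullback_invariant[OF h L2_measurable[OF m(1)]]
   by eventually_elim simp
  then show ?thesis
   by (simp add: m(2) koopman_rep_coef[OF Z B G act one hG mL] L2_coef_eq_iff[OF Z B koopman_L2[OF Z ns[OF h] mL] mL])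
 qed
 then show "v : FF" using m mL by (simp add: fixed_vectors_def L2_hilbert_carrier[OF Z B])
qed

lemma pushdown_orthogonal:
 assumes u: "u : L2 Z" and m: "m : L2 Y"
  and mD: "!!D. D : sets Y ==> (LINT y|Y. ind D y *\<^sub>R m y) = (LINT z|Z. ind D (\<pi> z) *\<^sub>R u z)"
  and n: "n : L2 Y"
 shows "L2_ip Z (%z. u z - m (\<pi> z)) (%z. n (\<pi> z)) = 0"
proof -
 note mL = L2_pullback[OF m]
 note k = L2_diff[OF u mL]
 \<comment> \<open>\<open>L2_Cauchy_Schwarz\<close> bounds real parts; quantifying over the factor c
   lets the real part carry the complex statement through the induction.\<close>
 have "\<forall>c. Re (L2_ip Z (%z. c * (u z - m (\<pi> z))) (%z. n (\<pi> z))) = 0"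
  using n
 proof (induction rule: L2_induct[OF Yp, consumes 1, case_names indicator add lim])
  case (indicator D d)
  note [measurable] = L2_measurable[OF m] L2_measurable[OF u] indicator
  have ind: "integrable Z (%z. ind D (\<pi> z) *\<^sub>R h z)" if "h : L2 Z" for h
  proof -
   have "integrable Z (%z. ind (\<pi> -` D \<inter> space Z) z *\<^sub>R h z)"
    by (rule integrable_mult_indicator[OF measurable_sets[OF pim indicator] L2_integrable[OF Z that]])
   then show ?thesis by (rule B_integrable_cong[THEN iffD1, rotated 2]) (auto simp: indicator_def)
  qed
  have "(LINT z|Z. ind D (\<pi> z) *\<^sub>R (u z - m (\<pi> z))) = 0"
   unfolding scaleR_diff_right
   by (subst B_integral_diff[OF ind[OF u] ind[OF mL]]) (simp add: integral_pullback[OF indicator] mD[OF indicator])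
  moreover have "L2_ip Z (%z. u z - m (\<pi> z)) (%z. d * ind D (\<pi> z)) = (LINT z|Z. cnj d * (ind D (\<pi> z) *\<^sub>R (u z - m (\<pi> z))))"
   unfolding L2_ip_def by (rule B_integral_cong) (auto simp: indicator_def)
  ultimately have "L2_ip Z (%z. u z - m (\<pi> z)) (%z. d * ind D (\<pi> z)) = 0" by (simp only: integral_mult_right_zero) simp
  then show ?case by (simp add: L2_ip_cmult)
 next
  case (add n n')
  show ?case
  proof
   fix c
   have "L2_ip Z (%z. c * (u z - m (\<pi> z))) (%z. n (\<pi> z) + n' (\<pi> z)) =
    L2_ip Z (%z. c * (u z - m (\<pi> z))) (%z. n (\<pi> z)) + L2_ip Z (%z. c * (u z - m (\<pi> z))) (%z. n' (\<pi> z))"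
    using L2_ip_add[OF L2_pullback[OF add(1)] L2_pullback[OF add(2)] L2_cmult[OF k, of c]] by (subst (1 2 3) L2_ip_cnj) simp
   then show "Re (L2_ip Z (%z. c * (u z - m (\<pi> z))) (%z. n (\<pi> z) + n' (\<pi> z))) = 0" using add(3,4) by simp
  qed
 next
  case (lim n)
  show ?case
  proof
   fix c
   let ?k = "%z. c * (u z - m (\<pi> z))"
   note ck = L2_cmult[OF k, of c]
   have "\<bar>Re (L2_ip Z ?k (%z. n (\<pi> z)))\<bar> <= 0 + e" if e: "e > 0" for e
   proof -
    define b where "b = L2_sq Z ?k + 1"
    have b: "b > 0" unfolding b_def using L2_sq_nonneg[of Z ?k] by linarith
    have "e\<^sup>2 / b > 0" using b e by simp
    then obtain g where g: "g : L2 Y" "\<forall>c. Re (L2_ip Z (%z. c * (u z - m (\<pi> z))) (%z. g (\<pi> z))) = 0" "L2_sq Y (%y. n y - g y) < e\<^sup>2 / b"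
    using lim(2)[of "e\<^sup>2 / b"] by auto
    have "L2_ip Z ?k (%z. n (\<pi> z) - g (\<pi> z)) = L2_ip Z ?k (%z. n (\<pi> z)) - L2_ip Z ?k (%z. g (\<pi> z))"
    using L2_ip_diff[OF L2_pullback[OF lim(1)] L2_pullback[OF g(1)] ck] by (subst (1 2 3) L2_ip_cnj) simp
    then have "Re (L2_ip Z ?k (%z. n (\<pi> z))) = Re (L2_ip Z ?k (%z. n (\<pi> z) - g (\<pi> z)))" using g(2) by simp
    also have "\<bar>...\<bar> <= sqrt (L2_sq Z ?k) * sqrt (L2_sq Z (%z. n (\<pi> z) - g (\<pi> z)))"
    by (rule L2_Cauchy_Schwarz[OF ck L2_pullback[OF L2_diff[OF lim(1) g(1)]]])
    also have "... <= sqrt b * sqrt (e\<^sup>2 / b)"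
    using g(3) L2_sq_pullback[OF L2_diff[OF lim(1) g(1)]] by (intro mult_mono real_sqrt_le_mono) (auto simp: b_def)
    also have "... = e" using b e by (simp add: real_sqrt_mult[symmetric])
    finally show ?thesis by simp
   qed
   then have "\<bar>Re (L2_ip Z ?k (%z. n (\<pi> z)))\<bar> <= 0" by (rule field_le_epsilon)
   then show "Re (L2_ip Z ?k (%z. n (\<pi> z))) = 0" by simp
  qed
 qed
 from this[THEN spec, of 1] this[THEN spec, of "-\<i>"] show ?thesis
  unfolding L2_ip_cmult by (simp add: complex_eq_iff)
qed

text \<open>The projection onto lifted functions is the conditional expectation. It is unique
  because the difference of two candidates is itself a lift, hence orthogonal to itself.\<close>

lemma orth_proj_pushdown:
 assumes u: "u : L2 Z" and m: "m : L2 Y"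
  and mD: "!!D. D : sets Y ==> (LINT y|Y. ind D y *\<^sub>R m y) = (LINT z|Z. ind D (\<pi> z) *\<^sub>R u z)"
 shows "orth_proj HH FF (L2_coef Z B u) = L2_coef Z B (%z. m (\<pi> z))"
 unfolding orth_proj_def
proof (rule the_equality)
 have ip: "inner_prod HH (L2_coef Z B u \<ominus>\<^bsub>HH\<^esub> L2_coef Z B (%z. m' (\<pi> z))) (L2_coef Z B (%z. n (\<pi> z))) = L2_ip Z (%z. u z - m' (\<pi> z)) (%z. n (\<pi> z))"
  if "m' : L2 Y" "n : L2 Y" for m' n
  using u L2_pullback[OF that(1)] L2_pullback[OF that(2)] by (simp add: L2_hilbert_minus[OF Z B] L2_hilbert_inner[OF Z B] L2_diff)
 show "L2_coef Z B (%z. m (\<pi> z)) : FF \<and> (\<forall>v\<in>FF. inner_prod HH (L2_coef Z B u \<ominus>\<^bsub>HH\<^esub> L2_coef Z B (%z. m (\<pi> z))) v = 0)"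
  unfolding fixed_vectors_eq using m ip[OF m] pushdown_orthogonal[OF u m mD] by auto
 fix w assume w: "w : FF \<and> (\<forall>v\<in>FF. inner_prod HH (L2_coef Z B u \<ominus>\<^bsub>HH\<^esub> w) v = 0)"
 then obtain m' where m': "m' : L2 Y" "w = L2_coef Z B (%z. m' (\<pi> z))" unfolding fixed_vectors_eq by blast
 define n where "n y = m y - m' y" for y
 have n: "n : L2 Y" unfolding n_def by (rule L2_diff[OF m m'(1)])
 note P = L2_pullback
 have "L2_coef Z B (%z. n (\<pi> z)) : FF" unfolding fixed_vectors_eq using n by blast
 then have 0: "L2_ip Z (%z. u z - m' (\<pi> z)) (%z. n (\<pi> z)) = 0" using w ip[OF m'(1) n] m'(2) by simp
 have "L2_ip Z (%z. n (\<pi> z)) (%z. n (\<pi> z)) = L2_ip Z (%z. (u z - m' (\<pi> z)) - (u z - m (\<pi> z))) (%z. n (\<pi> z))"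
  by (simp add: n_def)
 also have "... = 0"
  using 0 pushdown_orthogonal[OF u m mD n] by (subst L2_ip_diff[OF L2_diff[OF u P[OF m'(1)]] L2_diff[OF u P[OF m]] P[OF n]]) simp
 finally have "L2_sq Z (%z. n (\<pi> z)) = 0" by (simp add: L2_ip_self P[OF n])
 then have "AE z in Z. n (\<pi> z) = 0" by (simp add: L2_sq_eq_0 P[OF n])
 then have "AE z in Z. m' (\<pi> z) = m (\<pi> z)" by eventually_elim (simp add: n_def)
 then show "w = L2_coef Z B (%z. m (\<pi> z))" using m'(2) L2_coef_eq_iff[OF Z B P[OF m'(1)] P[OF m]] by simp
qed

text \<open>The way back from operators to measures: integrals over pulled back sets are matrix
  elements of polymorphisms.\<close>

lemma orth_proj_eqD:
 assumes u: "u : L2 Z" and u': "u' : L2 Z" and eq: "orth_proj HH FF (L2_coef Z B u) = orth_proj HH FF (L2_coef Z B u')"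
  and D: "D : sets Y"
 shows "(LINT z|Z. ind D (\<pi> z) *\<^sub>R u z) = (LINT z|Z. ind D (\<pi> z) *\<^sub>R u' z)"
proof -
 obtain m where m: "m : L2 Y" and mD: "!!D. D : sets Y ==> (LINT y|Y. ind D y *\<^sub>R m y) = (LINT z|Z. ind D (\<pi> z) *\<^sub>R u z)"
  by (rule L2_pushdown_exists[OF u], rule that)
 obtain m' where m': "m' : L2 Y" and mD': "!!D. D : sets Y ==> (LINT y|Y. ind D y *\<^sub>R m' y) = (LINT z|Z. ind D (\<pi> z) *\<^sub>R u' z)"
  by (rule L2_pushdown_exists[OF u'], rule that)
 note [measurable] = L2_measurable[OF m] L2_measurable[OF m'] D
 have "L2_coef Z B (%z. m (\<pi> z)) = L2_coef Z B (%z. m' (\<pi> z))"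
  using eq orth_proj_pushdown[OF u m mD] orth_proj_pushdown[OF u' m' mD'] by simp
 then have "AE z in Z. m (\<pi> z) = m' (\<pi> z)" by (simp add: L2_coef_eq_iff[OF Z B L2_pullback[OF m] L2_pullback[OF m']])
 then have "(LINT z|Z. ind D (\<pi> z) *\<^sub>R m (\<pi> z)) = (LINT z|Z. ind D (\<pi> z) *\<^sub>R m' (\<pi> z))"
  by (intro integral_cong_AE) auto
 then show ?thesis by (simp add: integral_pullback[OF D] mD[OF D] mD'[OF D])
qed

end

section \<open>Reduced double cosets and the functor\<close>

lemma reduced_rel_equiv: "equiv (carrier G) (reduced_rel G T L M)"
 by (auto simp: equiv_def refl_on_def sym_def trans_def reduced_rel_def)

lemma reduced_class_rel:
 assumes "a : reduced_double_cosets G T L M" "g : a" "g' : a"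
 shows "(g, g') : reduced_rel G T L M"
 by (rule in_quotient_imp_in_rel[OF reduced_rel_equiv assms(1)[unfolded reduced_double_cosets_def]]) (use assms in simp)

lemma reduced_class_carrier: "a : reduced_double_cosets G T L M ==> g : a ==> g : carrier G"
 using in_quotient_imp_subset[OF reduced_rel_equiv] unfolding reduced_double_cosets_def by blast

lemma reduced_class_nonempty: "a : reduced_double_cosets G T L M ==> \<exists>g. g : a"
 using in_quotient_imp_non_empty[OF reduced_rel_equiv] unfolding reduced_double_cosets_def by blast

lemma reduced_class_rep_hat:
 fixes H :: "(nat => complex) hilbert"
 assumes "a : reduced_double_cosets G T L M" "g : a" "g' : a" "unitary_rep G T H \<rho>"
 shows "rep_hat H \<rho> L M g = rep_hat H \<rho> L M g'"
 using reduced_class_rel[OF assms(1-3)] assms(4) by (simp add: reduced_rel_def)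

lemma on_class_eq:
 assumes "g : a" "!!g'. g' : a ==> f g' = f g"
 shows "on_class f a = f g"
proof -
 have "f ` a = (%_. f g) ` a" by (rule image_cong[OF refl assms(2)])
 also have "... = {f g}" using assms(1) by auto
 finally have "f ` a = {f g}" .
 then show ?thesis by (simp add: on_class_def)
qed

lemma on_class_rep_hat:
 fixes H :: "(nat => complex) hilbert"
 assumes "a : reduced_double_cosets G T L M" "g : a" "unitary_rep G T H \<rho>"
 shows "on_class (rep_hat H \<rho> L M) a = rep_hat H \<rho> L M g"
 by (rule on_class_eq[OF assms(2)]) (rule reduced_class_rep_hat[OF assms(1) _ assms(2,3)])

text \<open>\<open>THE\<close> requires uniqueness: two candidates have the same operators in every
  representation, and that is the definition of being the same reduced double coset.\<close>

lemma coset_product_is_coset_product: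
 assumes "\<exists>c. is_coset_product G T L M N a b c"
 shows "is_coset_product G T L M N a b (coset_product G T L M N a b)"
 unfolding coset_product_def
proof (rule theI')
 show "\<exists>!c. is_coset_product G T L M N a b c"
 proof (rule ex_ex1I[OF assms])
  fix c c' assume c: "is_coset_product G T L M N a b c" and c': "is_coset_product G T L M N a b c'"
  have cs: "c : reduced_double_cosets G T L N" "c' : reduced_double_cosets G T L N" using c c' by (auto simp: is_coset_product_def)
  obtain k k' where k: "k : c" "k' : c'" using reduced_class_nonempty[OF cs(1)] reduced_class_nonempty[OF cs(2)] by auto
  have "rep_hat H \<rho> L N k = rep_hat H \<rho> L N k'" if u: "unitary_rep G T H \<rho>" for H :: "(nat => complex) hilbert" and \<rho>
   using c c' u unfolding is_coset_product_def on_class_rep_hat[OF cs(1) k(1) u, symmetric] on_class_rep_hat[OF cs(2) k(2) u, symmetric]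
   by (elim conjE allE impE) auto
  then have "(k, k') : reduced_rel G T L N"
   using reduced_class_carrier[OF cs(1) k(1)] reduced_class_carrier[OF cs(2) k(2)] by (auto simp: reduced_rel_def)
  then show "c = c'"
   using quotient_eq_iff[OF reduced_rel_equiv, of c G T L N c' k k'] cs k by (simp add: reduced_double_cosets_def)
 qed
qed

theorem theorem3p1:
  fixes G :: "('g, 'm) monoid_scheme" and T :: "'g topology"
    and K :: "'g set" and I :: "'i set" and KK :: "'i \<Rightarrow> 'g set"
    and Z :: "'z measure" and \<sigma> :: "'g \<Rightarrow> 'z \<Rightarrow> 'z"
    and ZZ :: "'i \<Rightarrow> 'y measure" and \<pi> :: "'i \<Rightarrow> 'z \<Rightarrow> 'y"
  assumes "topological_group G T" and "separable_space T"
    and "M_family G T K I KK"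
    and "lebesgue_prob_space Z"
    and "nonsingular_action G T Z \<sigma>"
    and "\<And>h. h \<in> K \<Longrightarrow> measure_preserving_transf Z (\<sigma> h)"
    and "\<And>\<alpha>. \<alpha> \<in> I \<Longrightarrow> is_quotient Z (invariant_sets Z \<sigma> (KK \<alpha>)) (ZZ \<alpha>) (\<pi> \<alpha>)"
  defines "\<S> \<equiv> train_map Z \<sigma> ZZ \<pi>"
  shows "(\<forall>\<alpha>\<in>I. \<forall>\<beta>\<in>I. \<forall>g\<in>carrier G. \<S> \<alpha> \<beta> g \<in> Pol (ZZ \<alpha>) (ZZ \<beta>)) \<and>
    (\<forall>\<alpha>\<in>I. \<forall>\<beta>\<in>I. \<forall>a\<in>reduced_double_cosets G T (KK \<alpha>) (KK \<beta>).
       \<forall>g\<in>a. \<forall>g'\<in>a. \<S> \<alpha> \<beta> g = \<S> \<alpha> \<beta> g') \<and>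
    (\<forall>\<alpha>\<in>I. \<S> \<alpha> \<alpha> \<one>\<^bsub>G\<^esub> = pol_id (ZZ \<alpha>)) \<and>
    (\<forall>\<alpha>\<in>I. \<forall>\<beta>\<in>I. \<forall>\<gamma>\<in>I.
       \<forall>a\<in>reduced_double_cosets G T (KK \<alpha>) (KK \<beta>).
       \<forall>b\<in>reduced_double_cosets G T (KK \<beta>) (KK \<gamma>).
         pol_product (ZZ \<alpha>) (ZZ \<beta>) (ZZ \<gamma>) (on_class (\<S> \<alpha> \<beta>) a) (on_class (\<S> \<beta> \<gamma>) b) =
         on_class (\<S> \<alpha> \<gamma>) (coset_product G T (KK \<alpha>) (KK \<beta>) (KK \<gamma>) a b))"
proof -
 note G = assms(1) and Mf = assms(3) and ZL = assms(4) and act = assms(5) and mpK = assms(6) and quot = assms(7)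
 interpret group G using G by (simp add: topological_group_def)
 have Z: "prob_space Z" by (rule lebesgue_prob_spaceD[OF ZL])
 obtain B where B: "separating Z B" using separating_exists[OF ZL] by blast
 have K: "subgroup K G" and KK: "!!\<alpha>. \<alpha> : I ==> KK \<alpha> \<subseteq> K" using Mf by (auto simp: M_family_def)
 have one: "measure_preserving_transf Z (\<sigma> \<one>\<^bsub>G\<^esub>)" by (rule mpK[OF subgroup.one_closed[OF K]])
 have LG: "KK \<alpha> \<subseteq> carrier G" if "\<alpha> : I" for \<alpha> using KK[OF that] subgroup.subset[OF K] by blast
 have mp: "measure_preserving_transf Z (\<sigma> h)" if "\<alpha> : I" "h : KK \<alpha>" for \<alpha> h using mpK KK that by blast
 have ns: "nonsingular Z (\<sigma> g)" if "g : carrier G" for g by (rule action_ns[OF Z B G act one that])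
 have YL: "lebesgue_prob_space (ZZ \<alpha>)" and pim: "\<pi> \<alpha> : Z \<rightarrow>\<^sub>M ZZ \<alpha>" and pid: "distr Z (ZZ \<alpha>) (\<pi> \<alpha>) = ZZ \<alpha>" if "\<alpha> : I" for \<alpha>
  using quot[OF that] by (simp_all add: is_quotient_def)
 have Y: "prob_space (ZZ \<alpha>)" if "\<alpha> : I" for \<alpha> by (rule lebesgue_prob_spaceD[OF YL[OF that]])
 have S_eq: "\<S> \<alpha> \<beta> g = distr Z (ZZ \<alpha> >< (ZZ \<beta> >< rpos)) (%z. (\<pi> \<alpha> z, \<pi> \<beta> (\<sigma> g z), ns_deriv Z (\<sigma> g) z))"
  and S_Pol: "\<S> \<alpha> \<beta> g : Pol (ZZ \<alpha>) (ZZ \<beta>)" if "\<alpha> : I" "\<beta> : I" "g : carrier G" for \<alpha> \<beta> g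
  unfolding \<S>_def using that
  by (auto intro!: train_map_eq[where \<sigma> = \<sigma> and ZZ = ZZ and \<pi> = \<pi>] ZL ns Y YL pim pid)
 \<comment> \<open>The carrier of H has type \<open>(nat => complex) set\<close>, so for every th
   the representation \<open>\<rho> th\<close> is among those tested by \<open>reduced_rel\<close>
   and \<open>is_coset_product\<close>.\<close>
 define H where "H = L2_hilbert Z B"
 define \<rho> where "\<rho> = koopman_rep Z B \<sigma>"
 have rep: "unitary_rep G T H (\<rho> th)" for th unfolding H_def \<rho>_def by (rule koopman_rep_unitary[OF Z B G act one])
 let ?F = "%th \<alpha>. fixed_vectors H (\<rho> th) (KK \<alpha>)"
 have pull: "(%z. m (\<pi> \<alpha> z)) : L2 Z" "L2_coef Z B (%z. m (\<pi> \<alpha> z)) : ?F th \<alpha>" if "\<alpha> : I" "m : L2 (ZZ \<alpha>)" for m \<alpha> th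
  using L2_pullback[OF Z B G act one LG mp quot, OF that(1) that(1) _ that(1) that(2)]
   fixed_vectors_eq[OF Z B G act one LG mp quot, OF that(1) that(1) _ that(1)] that
  unfolding H_def \<rho>_def by auto
 have ind: "ind D : L2 (ZZ \<alpha>)" if "\<alpha> : I" "D : sets (ZZ \<alpha>)" for \<alpha> D
  using L2_indicator[OF Y[OF that(1)] that(2), of 1] by simp
 have koop: "\<rho> th g (L2_coef Z B f) = L2_coef Z B (koopman Z th (\<sigma> g) f)" "koopman Z th (\<sigma> g) f : L2 Z"
  if "g : carrier G" "f : L2 Z" for th g f
  unfolding \<rho>_def using koopman_rep_coef[OF Z B G act one that] koopman_L2[OF Z ns[OF that(1)] that(2)] by auto
 \<comment> \<open>The dictionary between the polymorphism and the operator: \<S> integrates m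
   against an indicator as T(g) acts on the lift of m.\<close>
 have S_int: "(LINT z|(\<S> \<alpha> \<beta> g). ind A (fst z) *\<^sub>R (m (mid z) * half_char th (thd z))) =
   (LINT z|Z. ind A (\<pi> \<alpha> z) *\<^sub>R koopman Z th (\<sigma> g) (%z. m (\<pi> \<beta> z)) z)"
  if \<alpha>: "\<alpha> : I" and \<beta>: "\<beta> : I" and g: "g : carrier G" and A [measurable]: "A : sets (ZZ \<alpha>)" and m: "m : L2 (ZZ \<beta>)" for A m th \<alpha> \<beta> g
 proof -
  note [measurable] = L2_measurable[OF m] pim[OF \<alpha>] pim[OF \<beta>] nonsingular_measurable[OF Z ns[OF g]] ns_deriv_measurable[OF Z ns[OF g]]
  show ?thesis
   unfolding S_eq[OF \<alpha> \<beta> g] by (subst integral_distr) (simp_all add: koopman_def)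
 qed
 have S_char: "pol_char A D th (\<S> \<alpha> \<beta> g) = (LINT z|Z. ind A (\<pi> \<alpha> z) *\<^sub>R koopman Z th (\<sigma> g) (%z. ind D (\<pi> \<beta> z)) z)"
  if "\<alpha> : I" "\<beta> : I" "g : carrier G" "A : sets (ZZ \<alpha>)" "D : sets (ZZ \<beta>)" for A D th \<alpha> \<beta> g
  unfolding pol_char_def by (rule S_int[OF that(1-4) ind[OF that(2,5)]])
 have proj_eqD: "(LINT z|Z. ind D (\<pi> \<alpha> z) *\<^sub>R u z) = (LINT z|Z. ind D (\<pi> \<alpha> z) *\<^sub>R u' z)"
  if "\<alpha> : I" "u : L2 Z" "u' : L2 Z" "orth_proj H (?F th \<alpha>) (L2_coef Z B u) = orth_proj H (?F th \<alpha>) (L2_coef Z B u')" "D : sets (ZZ \<alpha>)"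
  for \<alpha> u u' D th
  by (rule orth_proj_eqD[OF Z B G act one LG[OF that(1)] mp[OF that(1)] quot[OF that(1)] that(2,3) _ that(5)])
   (use that(4) in \<open>simp_all add: H_def \<rho>_def\<close>)
 have proj_push: "orth_proj H (?F th \<alpha>) (L2_coef Z B u) = L2_coef Z B (%z. m (\<pi> \<alpha> z))"
  if "\<alpha> : I" "u : L2 Z" "m : L2 (ZZ \<alpha>)" "!!D. D : sets (ZZ \<alpha>) ==> (LINT y|(ZZ \<alpha>). ind D y *\<^sub>R m y) = (LINT z|Z. ind D (\<pi> \<alpha> z) *\<^sub>R u z)"
  for \<alpha> u m th
  unfolding H_def \<rho>_def
  by (rule orth_proj_pushdown[OF Z B G act one LG[OF that(1)] mp[OF that(1)] quot[OF that(1)] that(2,3)]) (simp_all add: that(4))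
 \<comment> \<open>Equal compressions act equally on lifted indicators; this yields equal matrix
   elements for all sets and all th, and these determine the polymorphism.\<close>
 have cls: "\<S> \<alpha> \<beta> g = \<S> \<alpha> \<beta> g'"
  if \<alpha>: "\<alpha> : I" and \<beta>: "\<beta> : I" and a: "a : reduced_double_cosets G T (KK \<alpha>) (KK \<beta>)" and ga: "g : a" "g' : a" for \<alpha> \<beta> a g g'
 proof -
  note g = reduced_class_carrier[OF a ga(1)] and g' = reduced_class_carrier[OF a ga(2)]
  show ?thesis
  proof (rule Pol_eqI_pol_char[OF Y[OF \<alpha>] Y[OF \<beta>] S_Pol[OF \<alpha> \<beta> g] S_Pol[OF \<alpha> \<beta> g']])
   fix A D th assume A: "A : sets (ZZ \<alpha>)" and D: "D : sets (ZZ \<beta>)"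
   note f = pull[OF \<beta> ind[OF \<beta> D]]
   have "rep_hat H (\<rho> th) (KK \<alpha>) (KK \<beta>) g (L2_coef Z B (%z. ind D (\<pi> \<beta> z))) = rep_hat H (\<rho> th) (KK \<alpha>) (KK \<beta>) g' (L2_coef Z B (%z. ind D (\<pi> \<beta> z)))"
    using reduced_class_rep_hat[OF a ga rep[unfolded H_def]] by (simp add: H_def)
   then have "orth_proj H (?F th \<alpha>) (L2_coef Z B (koopman Z th (\<sigma> g) (%z. ind D (\<pi> \<beta> z)))) =
    orth_proj H (?F th \<alpha>) (L2_coef Z B (koopman Z th (\<sigma> g') (%z. ind D (\<pi> \<beta> z))))"
    using f(2)[of th] by (simp add: rep_hat_def koop(1)[OF g f(1)] koop(1)[OF g' f(1)])
   from proj_eqD[OF \<alpha> koop(2)[OF g f(1)] koop(2)[OF g' f(1)] this A]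
   show "pol_char A D th (\<S> \<alpha> \<beta> g) = pol_char A D th (\<S> \<alpha> \<beta> g')" by (simp only: S_char[OF \<alpha> \<beta> g A D] S_char[OF \<alpha> \<beta> g' A D])
  qed
 qed
 have S_one: "\<S> \<alpha> \<alpha> \<one>\<^bsub>G\<^esub> = pol_id (ZZ \<alpha>)" if \<alpha>: "\<alpha> : I" for \<alpha>
 proof -
  note [measurable] = pim[OF \<alpha>] nonsingular_measurable[OF Z ns[OF one_closed]] ns_deriv_measurable[OF Z ns[OF one_closed]]
  have "AE z in Z. (\<pi> \<alpha> z, \<pi> \<alpha> (\<sigma> \<one>\<^bsub>G\<^esub> z), ns_deriv Z (\<sigma> \<one>\<^bsub>G\<^esub>) z) = (\<pi> \<alpha> z, \<pi> \<alpha> z, 1)"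
   using action_one[OF Z B G act one] measure_preserving_ns_deriv[OF Z ns[OF one_closed] one] by eventually_elim simp
  then have "\<S> \<alpha> \<alpha> \<one>\<^bsub>G\<^esub> = distr Z (ZZ \<alpha> >< (ZZ \<alpha> >< rpos)) (%z. (\<pi> \<alpha> z, \<pi> \<alpha> z, 1))"
   unfolding S_eq[OF \<alpha> \<alpha> one_closed] by (intro distr_cong_AE) simp_all
  also have "... = distr (distr Z (ZZ \<alpha>) (\<pi> \<alpha>)) (ZZ \<alpha> >< (ZZ \<alpha> >< rpos)) (%x. (x, x, 1))"
   by (subst distr_distr) (simp_all add: comp_def)
  finally show ?thesis by (simp add: pol_id_def pid[OF \<alpha>])
 qed
 have prod: "pol_product (ZZ \<alpha>) (ZZ \<beta>) (ZZ \<gamma>) (on_class (\<S> \<alpha> \<beta>) a) (on_class (\<S> \<beta> \<gamma>) b) =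
    on_class (\<S> \<alpha> \<gamma>) (coset_product G T (KK \<alpha>) (KK \<beta>) (KK \<gamma>) a b)"
  if \<alpha>: "\<alpha> : I" and \<beta>: "\<beta> : I" and \<gamma>: "\<gamma> : I" and a: "a : reduced_double_cosets G T (KK \<alpha>) (KK \<beta>)"
   and b: "b : reduced_double_cosets G T (KK \<beta>) (KK \<gamma>)" for \<alpha> \<beta> \<gamma> a b
 proof -
  define c where "c = coset_product G T (KK \<alpha>) (KK \<beta>) (KK \<gamma>) a b"
  have "\<exists>c. is_coset_product G T (KK \<alpha>) (KK \<beta>) (KK \<gamma>) a b c" using Mf \<alpha> \<beta> \<gamma> a b unfolding M_family_def by (elim conjE) simp
  then have c: "is_coset_product G T (KK \<alpha>) (KK \<beta>) (KK \<gamma>) a b c" unfolding c_def by (rule coset_product_is_coset_product)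
  then have cc: "c : reduced_double_cosets G T (KK \<alpha>) (KK \<gamma>)" by (simp add: is_coset_product_def)
  obtain g h k where ghk: "g : a" "h : b" "k : c"
   using reduced_class_nonempty[OF a] reduced_class_nonempty[OF b] reduced_class_nonempty[OF cc] by auto
  note g = reduced_class_carrier[OF a ghk(1)] and h = reduced_class_carrier[OF b ghk(2)] and k = reduced_class_carrier[OF cc ghk(3)]
  have hat: "compose (?F th \<gamma>) (rep_hat H (\<rho> th) (KK \<alpha>) (KK \<beta>) g) (rep_hat H (\<rho> th) (KK \<beta>) (KK \<gamma>) h) = rep_hat H (\<rho> th) (KK \<alpha>) (KK \<gamma>) k" for th
  proof -
   have "compose (?F th \<gamma>) (on_class (rep_hat H (\<rho> th) (KK \<alpha>) (KK \<beta>)) a) (on_class (rep_hat H (\<rho> th) (KK \<beta>) (KK \<gamma>)) b) =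
    on_class (rep_hat H (\<rho> th) (KK \<alpha>) (KK \<gamma>)) c"
    using c rep[of th] unfolding is_coset_product_def by blast
   then show ?thesis
    by (simp only: on_class_rep_hat[OF a ghk(1) rep] on_class_rep_hat[OF b ghk(2) rep] on_class_rep_hat[OF cc ghk(3) rep])
  qed
  note p = S_Pol[OF \<alpha> \<beta> g] and q = S_Pol[OF \<beta> \<gamma> h]
  define R where "R = (SOME R. is_joint (ZZ \<alpha>) (ZZ \<beta>) (ZZ \<gamma>) (\<S> \<alpha> \<beta> g) (\<S> \<beta> \<gamma> h) R)"
  have R: "is_joint (ZZ \<alpha>) (ZZ \<beta>) (ZZ \<gamma>) (\<S> \<alpha> \<beta> g) (\<S> \<beta> \<gamma> h) R"
   unfolding R_def by (rule some_joint[OF Y[OF \<alpha>] Y[OF \<beta>] YL[OF \<gamma>] p q])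
  have "pol_product (ZZ \<alpha>) (ZZ \<beta>) (ZZ \<gamma>) (\<S> \<alpha> \<beta> g) (\<S> \<beta> \<gamma> h) = joint_push (ZZ \<alpha>) (ZZ \<gamma>) R"
   by (rule pol_product_eq[OF Y[OF \<alpha>] Y[OF \<beta>] YL[OF \<gamma>] p q R])
  also have "... = \<S> \<alpha> \<gamma> k"
  proof (rule Pol_eqI_pol_char[OF Y[OF \<alpha>] Y[OF \<gamma>] joint_push_Pol[OF Y[OF \<alpha>] Y[OF \<beta>] p q R] S_Pol[OF \<alpha> \<gamma> k]])
   fix A D th assume A: "A : sets (ZZ \<alpha>)" and D: "D : sets (ZZ \<gamma>)"
   note f = pull[OF \<gamma> ind[OF \<gamma> D]]
   obtain m where m: "m : L2 (ZZ \<beta>)" and mB: "!!B. B : sets (ZZ \<beta>) ==> (LINT y|(ZZ \<beta>). ind B y *\<^sub>R m y) = pol_char B D th (\<S> \<beta> \<gamma> h)"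
    and mR: "pol_char A D th (joint_push (ZZ \<alpha>) (ZZ \<gamma>) R) = (LINT z|(\<S> \<alpha> \<beta> g). ind A (fst z) *\<^sub>R (m (mid z) * half_char th (thd z)))"
    by (rule joint_pol_char[OF Y[OF \<alpha>] Y[OF \<beta>] Y[OF \<gamma>] p q R A D], rule that)
   note mf = pull[OF \<beta> m]
   \<comment> \<open>The function m is determined by its integrals over sets of
     \<open>ZZ \<beta>\<close>. They are the matrix elements of h, so its lift is the projection of
     T(h) applied to the lifted indicator of D.\<close>
   have push: "orth_proj H (?F th \<beta>) (\<rho> th h (L2_coef Z B (%z. ind D (\<pi> \<gamma> z)))) = L2_coef Z B (%z. m (\<pi> \<beta> z))"
    unfolding koop(1)[OF h f(1)]
    by (rule proj_push[OF \<beta> koop(2)[OF h f(1)] m]) (simp only: mB S_char[OF \<beta> \<gamma> h _ D])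
   \<comment> \<open>\<open>hat\<close> evaluated at the lifted indicator of D: the projection in
     the middle is the one that produced m.\<close>
   have "orth_proj H (?F th \<alpha>) (\<rho> th g (L2_coef Z B (%z. m (\<pi> \<beta> z)))) = orth_proj H (?F th \<alpha>) (\<rho> th k (L2_coef Z B (%z. ind D (\<pi> \<gamma> z))))"
    using fun_cong[OF hat, of th "L2_coef Z B (%z. ind D (\<pi> \<gamma> z))"] f(2)[of th] mf(2)[of th]
    by (simp add: compose_def rep_hat_def push)
   then have "orth_proj H (?F th \<alpha>) (L2_coef Z B (koopman Z th (\<sigma> g) (%z. m (\<pi> \<beta> z)))) =
    orth_proj H (?F th \<alpha>) (L2_coef Z B (koopman Z th (\<sigma> k) (%z. ind D (\<pi> \<gamma> z))))"
    by (simp only: koop(1)[OF g mf(1)] koop(1)[OF k f(1)])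
   from proj_eqD[OF \<alpha> koop(2)[OF g mf(1)] koop(2)[OF k f(1)] this A]
   show "pol_char A D th (joint_push (ZZ \<alpha>) (ZZ \<gamma>) R) = pol_char A D th (\<S> \<alpha> \<gamma> k)"
    by (simp only: mR S_int[OF \<alpha> \<beta> g A m] S_char[OF \<alpha> \<gamma> k A D])
  qed
  finally show ?thesis
   unfolding c_def[symmetric]
   using on_class_eq[OF ghk(1), of "\<S> \<alpha> \<beta>"] cls[OF \<alpha> \<beta> a _ ghk(1)] on_class_eq[OF ghk(2), of "\<S> \<beta> \<gamma>"] cls[OF \<beta> \<gamma> b _ ghk(2)]
    on_class_eq[OF ghk(3), of "\<S> \<alpha> \<gamma>"] cls[OF \<alpha> \<gamma> cc _ ghk(3)] by simp
 qed
 from S_Pol cls S_one prod show ?thesis by (intro conjI ballI)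
qed

end
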